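(* Let $p$ be a rational prime. (1) For $\ell\ne p$ a prime, the restriction map $\mathrm{Val}_p(\mathbb B_\infty(\ell))\to\mathrm{Val}_p(\mathbb B(\ell,p))$ is bijective. (2) The restriction maps from $\mathbb Q^{\rm cycl}_\Delta$ to $\mathbb B_\infty(\ell)$ give a bijection $$\mathrm{Val}_p(\mathbb Q^{\rm cycl}_\Delta)=\prod_{\ell\ne p}\mathrm{Val}_p(\mathbb B_\infty(\ell)).$$ (3) The restriction of $v\in\mathrm{Val}_p(\mathbb Q^{\rm cycl}_\Delta)$ to $\mathbb Q^{{\rm cyc},p}_\Delta$ is unramified and the residue field is isomorphic to $$\bigcup_{n\in I(p)}\mathbb F_{p^n}\subset\bar{\mathbb F}_p,$$ where $I(p)\subset\mathbb N$ denotes the subset of positive integers which are prime to $p$.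
   Context: $\mathbb Q^{\rm cyc}$ is the field generated over $\mathbb Q$ by all roots of unity, with Galois group $\hat{\mathbb Z}^*=\prod_\ell\mathbb Z_\ell^*$ over $\mathbb Q$; $\mathbb Q^{{\rm cyc},p}$ is the subfield generated by the roots of unity of order prime to $p$. For each prime $\ell$ let $\Delta_\ell\subset\mathbb Z_\ell^*$ be the torsion subgroup and $\Delta=\prod_\ell\Delta_\ell\subset\hat{\mathbb Z}^*$. $\mathbb Q^{\rm cycl}_\Delta$ is the subfield of $\mathbb Q^{\rm cyc}$ fixed by $\Delta$ (so $\mathrm{Gal}(\mathbb Q^{\rm cycl}_\Delta:\mathbb Q)\simeq\prod_\ell\mathbb Z_\ell^*/\Delta_\ell\simeq\hat{\mathbb Z}$), and $\mathbb Q^{{\rm cyc},p}_\Delta$ is the subfield of $\mathbb Q^{{\rm cyc},p}$ fixed by $\Delta$, i.e. $\mathbb Q^{{\rm cyc},p}\cap\mathbb Q^{\rm cycl}_\Delta$. For a prime $\ell$, $\mathbb B_\infty(\ell)=\bigcup_k\mathbb B_k(\ell)$ is the $\mathbb Z_\ell$-extension of $\mathbb Q$, where for $\ell$ odd $\mathbb B_k(\ell)$ is the subfield fixed by $\Delta_\ell$ of the extension of $\mathbb Q$ generated by a primitive root of unity of order $\ell^{k+1}$, and for $\ell=2$ the subfield fixed by $\Delta_2=\{\pm1\}$ of the extension generated by a primitive root of unity of order $2^{k+2}$. For primes $p\ne\ell$, $u(p,\ell)=v_\ell(p^{\ell-1}-1)-1$ if $\ell>2$ and $u(p,2)=v_2(p^2-1)-3$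 ($v_\ell$ the $\ell$-adic valuation), and $\mathbb B(\ell,p)=\mathbb B_{u(p,\ell)}(\ell)$, a cyclic extension of $\mathbb Q$ of degree $\ell^{u(p,\ell)}$. For an algebraic extension $E$ of $\mathbb Q$, $\mathrm{Val}_p(E)$ is the set of extensions of the $p$-adic valuation to $E$. *)

theory Defs
  imports
    "HOL-Analysis.Analysis"
    "HOL-Algebra.Algebra"
    "HOL-Algebra.Product_Groups"
    "HOL-Algebra.Algebraic_Closure_Type"
    "HOL-Number_Theory.Residues"
begin

text \<open>All algebraic extensions of the rational numbers are subfields of the complex numbers, represented by their carrier sets.\<close>

abbreviation Cring :: "complex ring" where
  "Cring \<equiv> ring_of_type_algebra"


section \<open>Cyclotomic fields and the action of the profinite units\<close>

definition Q_cyc :: "complex set" where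
  "Q_cyc = generate_field Cring {z. \<exists>n>0. z ^ n = 1}"

definition Q_cyc_prime_to :: "nat \<Rightarrow> complex set" where
  "Q_cyc_prime_to p = generate_field Cring {z. \<exists>n>0. coprime n p \<and> z ^ n = 1}"

definition cyclotomic_field :: "nat \<Rightarrow> complex set" where
  "cyclotomic_field n = generate_field Cring {cis (2 * pi / real n)}"

text \<open>Ring automorphisms fix the rational numbers, so this is the Galois group over them.
  Its members are made extensional so that they are determined by their values on the field.\<close>

definition Gal :: "complex set \<Rightarrow> (complex \<Rightarrow> complex) set" where
  "Gal K = ring_iso (Cring\<lparr>carrier := K\<rparr>) (Cring\<lparr>carrier := K\<rparr>) \<inter> extensional K"

text \<open>The \<open>l\<close>-adic integers as the inverse limit of the rings of integers modulo \<open>l ^ k\<close>,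
  a compatible sequence being given by its least nonnegative representatives.\<close>

definition padic_int_ring :: "nat \<Rightarrow> (nat \<Rightarrow> int) ring" where
  "padic_int_ring l =
    \<lparr>carrier = {a. \<forall>k. a k \<in> {0..<int l ^ k} \<and> a (Suc k) mod int l ^ k = a k},
     monoid.mult = (\<lambda>a b k. (a k * b k) mod int l ^ k),
     one = (\<lambda>k. 1 mod int l ^ k),
     ring.zero = (\<lambda>k. 0),
     ring.add = (\<lambda>a b k. (a k + b k) mod int l ^ k)\<rparr>"

definition padic_units :: "nat \<Rightarrow> (nat \<Rightarrow> int) monoid" where
  "padic_units l = units_of (padic_int_ring l)"

definition primes :: "nat set" where
  "primes = {l. Factorial_Ring.prime l}"

definition Zhat_units :: "(nat \<Rightarrow> nat \<Rightarrow> int) monoid" where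
  "Zhat_units = product_group primes padic_units"

definition Delta_at :: "nat \<Rightarrow> (nat \<Rightarrow> int) set" where
  "Delta_at l = {a \<in> carrier (padic_units l). \<exists>n::nat>0. a [^]\<^bsub>padic_units l\<^esub> n = \<one>\<^bsub>padic_units l\<^esub>}"

definition Delta :: "(nat \<Rightarrow> nat \<Rightarrow> int) set" where
  "Delta = (\<Pi>\<^sub>E l\<in>primes. Delta_at l)"

text \<open>The factor at \<open>l\<close>, regarded as a subgroup of the full product.\<close>

definition Delta_factor :: "nat \<Rightarrow> (nat \<Rightarrow> nat \<Rightarrow> int) set" where
  "Delta_factor l = (\<Pi>\<^sub>E q\<in>primes. if q = l then Delta_at l else {\<one>\<^bsub>padic_units q\<^esub>})"

text \<open>The identification of the profinite units with \<open>Gal Q_cyc\<close>: the unit \<open>a\<close> raises each root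
  of unity of order dividing \<open>l ^ k\<close> to the power \<open>a mod l ^ k\<close>. The roots of unity of prime power
  order generate all roots of unity, so this determines the automorphism.\<close>

definition acts_as :: "(nat \<Rightarrow> nat \<Rightarrow> int) \<Rightarrow> (complex \<Rightarrow> complex) \<Rightarrow> bool" where
  "acts_as a \<sigma> \<longleftrightarrow> a \<in> carrier Zhat_units \<and> \<sigma> \<in> Gal Q_cyc \<and>
    (\<forall>l\<in>primes. \<forall>k z. z ^ (l ^ k) = 1 \<longrightarrow> \<sigma> z = z ^ nat (a l k))"

text \<open>The elements of a subfield \<open>K\<close> of \<open>Q_cyc\<close> that are fixed by \<open>D\<close>.\<close>

definition fixed_subfield :: "complex set \<Rightarrow> (nat \<Rightarrow> nat \<Rightarrow> int) set \<Rightarrow> complex set" where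
  "fixed_subfield K D = {x \<in> K. \<forall>a\<in>D. \<forall>\<sigma>. acts_as a \<sigma> \<longrightarrow> \<sigma> x = x}"

definition Q_cyc_Delta :: "complex set" where
  "Q_cyc_Delta = fixed_subfield Q_cyc Delta"

definition Q_cyc_prime_to_Delta :: "nat \<Rightarrow> complex set" where
  "Q_cyc_prime_to_Delta p = fixed_subfield (Q_cyc_prime_to p) Delta"

definition B_layer :: "nat \<Rightarrow> nat \<Rightarrow> complex set" where
  "B_layer l k =
    fixed_subfield (cyclotomic_field (l ^ (if l = 2 then k + 2 else k + 1))) (Delta_factor l)"

definition B_inf :: "nat \<Rightarrow> complex set" where
  "B_inf l = (\<Union>k. B_layer l k)"

text \<open>For distinct primes \<open>p\<close> and \<open>l\<close> the multiplicities below are at least 1 and at least 3,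
  respectively, so the subtraction of natural numbers is not truncated.\<close>

definition u_level :: "nat \<Rightarrow> nat \<Rightarrow> nat" where
  "u_level p l = (if l = 2 then multiplicity 2 (p ^ 2 - 1) - 3
                  else multiplicity l (p ^ (l - 1) - 1) - 1)"

definition B_fin :: "nat \<Rightarrow> nat \<Rightarrow> complex set" where
  "B_fin l p = B_layer l (u_level p l)"


section \<open>Extensions of the p-adic valuation\<close>

definition padic_valuation :: "nat \<Rightarrow> rat \<Rightarrow> ereal" where
  "padic_valuation p q =
    (if q = 0 then \<infinity>
     else ereal (real (multiplicity (int p) (fst (quotient_of q)))
               - real (multiplicity (int p) (snd (quotient_of q)))))"

definition is_valuation :: "complex set \<Rightarrow> (complex \<Rightarrow> ereal) \<Rightarrow> bool" where
  "is_valuation E v \<longleftrightarrow>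
    (\<forall>x\<in>E. v x \<noteq> -\<infinity> \<and> (v x = \<infinity> \<longleftrightarrow> x = 0)) \<and>
    (\<forall>x\<in>E. \<forall>y\<in>E. v (x * y) = v x + v y \<and> v (x + y) \<ge> min (v x) (v y))"

definition Val :: "nat \<Rightarrow> complex set \<Rightarrow> (complex \<Rightarrow> ereal) set" where
  "Val p E =
    {v \<in> extensional E. is_valuation E v \<and> (\<forall>q::rat. v (of_rat q) = padic_valuation p q)}"

text \<open>Ramification index 1 over the rational numbers. The residue field extension is an algebraic
  extension of the prime field, hence separable, so no separability condition is needed.\<close>

definition unramified :: "nat \<Rightarrow> complex set \<Rightarrow> (complex \<Rightarrow> ereal) \<Rightarrow> bool" where
  "unramified p E v \<longleftrightarrow> v ` (E - {0}) = padic_valuation p ` (UNIV - {0})"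

definition valuation_ring :: "complex set \<Rightarrow> (complex \<Rightarrow> ereal) \<Rightarrow> complex ring" where
  "valuation_ring E v = Cring\<lparr>carrier := {x \<in> E. v x \<ge> 0}\<rparr>"

definition residue_field :: "complex set \<Rightarrow> (complex \<Rightarrow> ereal) \<Rightarrow> complex set ring" where
  "residue_field E v = valuation_ring E v Quot {x \<in> E. v x > 0}"


section \<open>Subfields of an algebraic closure of the prime field\<close>

abbreviation Fp_bar :: "nat \<Rightarrow> ((int list \<times> nat) multiset \<Rightarrow> int) ring" where
  "Fp_bar p \<equiv> field.alg_closure (residue_ring (int p))"

definition I_set :: "nat \<Rightarrow> nat set" where
  "I_set p = {n. n > 0 \<and> coprime n p}"

text \<open>For each \<open>n > 0\<close> there is exactly one subfield with \<open>p ^ n\<close> elements.\<close>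

definition Fp_union :: "nat \<Rightarrow> ((int list \<times> nat) multiset \<Rightarrow> int) ring" where
  "Fp_union p =
    (Fp_bar p)\<lparr>carrier := \<Union>n\<in>I_set p. \<Union>{F. subfield F (Fp_bar p) \<and> card F = p ^ n}\<rparr>"

end

theory Submission
  imports Defs "HOL-Number_Theory.Number_Theory" "HOL-Library.Diagonal_Subsequence"
begin

text \<open>The field generated by the roots of unity is described by its finite levels, the rational spans of
  the roots of unity of order dividing \<open>n\<close>. By the irreducibility of the cyclotomic polynomials,
  each residue \<open>A\<close> prime to \<open>n\<close> gives an automorphism \<open>gal n A\<close> of such a level that raises roots of unity to the
  power \<open>A\<close>, and a profinite unit acts through its residues. The torsion of the \<open>l\<close>-adic
  units has an explicit image modulo \<open>l ^ k\<close> (lemmas \<open>Delta_at_torsion\<close> and \<open>torsion_lifts\<close>), so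
  that membership in the field fixed by \<open>\<Delta>\<close> can be tested at a finite level
  (\<open>Q_cyc_Delta_iff\<close>). Valuations extend from subfields to the cyclotomic field by Chevalley's
  argument (\<open>Val_extends_to_Q_cyc\<close>), so all restriction maps are surjective onto
  the valuations of a subfield.

  Uniqueness statements rest on the fact that the decomposition group of a valuation contains the
  inertia group and the Frobenius automorphism (\<open>gal_invariant\<close>): such automorphisms preserve
  every extension of the \<open>p\<close>-adic valuation. For \<open>l \<noteq> p\<close> the number \<open>u_level p l\<close> is chosen
  such that, modulo torsion, the powers of \<open>p\<close> are dense in the \<open>l\<close>-adic units that act
  trivially on \<open>B_fin l p\<close> (\<open>frobenius_generator\<close>, \<open>powers_exhaust\<close>). So an element of the
  \<open>\<int>\<^sub>l\<close>-extension has a norm in \<open>B_fin l p\<close> whose value is a multiple of its own value, and a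
  valuation is determined by its restriction to \<open>B_fin l p\<close>; this is the first statement.

  For the second statement, surjectivity holds because the valuations of each \<open>\<int>\<^sub>l\<close>-extension are
  conjugate to each other (\<open>valuations_conjugate\<close>), and automorphisms can be prescribed
  independently at all primes \<open>l\<close> (\<open>Val_product_surj\<close>). For injectivity let two valuations of the
  cyclotomic field agree on all \<open>\<int>\<^sub>l\<close>-extensions with \<open>l \<noteq> p\<close>. The prime \<open>p\<close> splits completely in
  \<open>B_fin l p\<close>, so the elements of this field are approximated by the same rational numbers at
  both valuations (\<open>layer_approximable\<close>). Such elements form a ring on which the valuations
  agree. It contains the traces of all roots of unity under the decomposition group, because they
  are products of traces at the individual primes; hence it contains the norm under the decomposition group of
  any element fixed by \<open>\<Delta>\<close> (\<open>eq_on_Q_cyc_Delta\<close>). At the prime \<open>p\<close> itself the extension is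
  totally ramified, and there is no choice.

  For the third statement, \<open>p\<close> is a uniformizer at every level \<open>n\<close> prime to \<open>p\<close>
  (\<open>integral_value\<close>), and the residue of \<open>p\<close> modulo \<open>n\<close> acts on residue classes as the
  Frobenius map (\<open>frobenius_residue\<close>). On the field fixed by \<open>\<Delta>\<close> its order divides \<open>n\<close>, so
  all residue classes have degree prime to \<open>p\<close> over the prime field (\<open>residue_degree\<close>). On the
  other hand, powers of \<open>p\<close> are not torsion, so the \<open>\<int>\<^sub>l\<close>-extension contributes residue classes
  of degree an arbitrarily high power of \<open>l\<close> (\<open>residue_degree_unbounded\<close>). A field with these
  properties embeds into an algebraically closed field of characteristic \<open>p\<close>, and its image is
  the union of the finite subfields of degree prime to \<open>p\<close> (\<open>iso_union_of_finite_subfields\<close>).\<close>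

section \<open>Rational and integral spans of roots of unity\<close>

text \<open>Scalar multiplication by rational numbers and by integers, so that the complex numbers
  become a vector space and a module in which spans of sets of roots of unity can be
  formed.\<close>

definition rat_scale :: "rat \<Rightarrow> complex \<Rightarrow> complex" where
  "rat_scale q x = of_rat q * x"

definition int_scale :: "int \<Rightarrow> complex \<Rightarrow> complex" where
  "int_scale k x = of_int k * x"

interpretation QV: vector_space rat_scale
  by unfold_locales (auto simp: rat_scale_def algebra_simps of_rat_add of_rat_mult)

interpretation ZM: Modules.module int_scale
  by unfold_locales (auto simp: int_scale_def algebra_simps)

abbreviation qspan :: "complex set \<Rightarrow> complex set" where "qspan \<equiv> QV.span"
abbreviation zspan :: "complex set \<Rightarrow> complex set" where "zspan \<equiv> ZM.span"

definition mult_closed :: "complex set \<Rightarrow> bool" where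
  "mult_closed M \<longleftrightarrow> 1 \<in> M \<and> (\<forall>x\<in>M. \<forall>y\<in>M. x * y \<in> M)"

definition mu :: "nat \<Rightarrow> complex set" where
  "mu n = {z. z ^ n = 1}"

definition unity_roots :: "(nat \<Rightarrow> bool) \<Rightarrow> complex set" where
  "unity_roots P = {z. \<exists>n>0. P n \<and> z ^ n = 1}"

lemma mult_closed_mu: "mult_closed (mu n)"
  by (auto simp: mult_closed_def mu_def power_mult_distrib)

lemma mult_closed_unity_roots:
  assumes "P 1" "\<And>m n. P m \<Longrightarrow> P n \<Longrightarrow> P (m * n)"
  shows "mult_closed (unity_roots P)"
  unfolding mult_closed_def
proof (intro conjI ballI)
  show "1 \<in> unity_roots P" using assms(1) by (auto simp: unity_roots_def intro!: exI[of _ 1])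
  fix x y assume "x \<in> unity_roots P" "y \<in> unity_roots P"
  then obtain m n where "m > 0" "P m" "x ^ m = 1" "n > 0" "P n" "y ^ n = 1"
    by (auto simp: unity_roots_def)
  moreover from this have "(x * y) ^ (m * n) = 1"
    by (metis mult.commute power_mult power_mult_distrib power_one mult_1)
  ultimately show "x * y \<in> unity_roots P"
    using assms(2) by (auto simp: unity_roots_def intro!: exI[of _ "m * n"])
qed

lemma finite_mu: "n > 0 \<Longrightarrow> finite (mu n)"
  unfolding mu_def by (rule finite_roots_unity) auto

lemma mu_mono: "m dvd n \<Longrightarrow> mu m \<subseteq> mu n"
  by (auto simp: mu_def dvd_def power_mult)

lemma mu_nonzero: "n > 0 \<Longrightarrow> z \<in> mu n \<Longrightarrow> z \<noteq> 0"
  by (auto simp: mu_def zero_power)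

lemma zspan_subset_qspan: "zspan M \<subseteq> qspan M"
proof
  fix x assume "x \<in> zspan M"
  then show "x \<in> qspan M"
  proof (induction rule: ZM.span_induct_alt)
    case (step c x y)
    have "rat_scale (of_int c) x \<in> qspan M" using step by (intro QV.span_scale QV.span_base)
    moreover have "int_scale c x + y = rat_scale (of_int c) x + y" by (simp add: rat_scale_def int_scale_def)
    ultimately show ?case using step QV.span_add by metis
  qed (rule QV.span_zero)
qed

lemma zspan_of_int_mult: "x \<in> zspan M \<Longrightarrow> of_int k * x \<in> zspan M"
  using ZM.span_scale[of x M k] by (simp add: int_scale_def)

lemma qspan_of_rat_mult: "x \<in> qspan M \<Longrightarrow> of_rat q * x \<in> qspan M"
  using QV.span_scale[of x M q] by (simp add: rat_scale_def)

lemma qspan_of_nat_mult: "x \<in> qspan M \<Longrightarrow> of_nat k * x \<in> qspan M"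
  using qspan_of_rat_mult[of x M "of_nat k"] by simp

lemma zspan_mult:
  assumes "mult_closed M" "x \<in> zspan M" "y \<in> zspan M"
  shows "x * y \<in> zspan M"
  using assms(2)
proof (induction rule: ZM.span_induct_alt)
  case (step c u v)
  have "u * y \<in> zspan M"
    using assms(3)
  proof (induction rule: ZM.span_induct_alt)
    case (step d s t)
    have "u * (int_scale d s + t) = int_scale d (u * s) + u * t"
      by (simp add: int_scale_def algebra_simps)
    moreover have "u * s \<in> M" using assms(1) step(1) \<open>u \<in> M\<close> by (auto simp: mult_closed_def)
    ultimately show ?case using step by (auto intro: ZM.span_add ZM.span_scale ZM.span_base)
  qed (auto intro: ZM.span_zero)
  moreover have "(int_scale c u + v) * y = int_scale c (u * y) + v * y"
    by (simp add: int_scale_def algebra_simps)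
  ultimately show ?case using step by (auto intro: ZM.span_add ZM.span_scale)
qed (auto intro: ZM.span_zero)

text \<open>Only finitely many rational coefficients occur, so they have a common
  denominator.\<close>

lemma qspan_clear_denominators:
  assumes "x \<in> qspan M"
  obtains c :: int where "c > 0" "of_int c * x \<in> zspan M"
proof -
  have "\<exists>c::int. c > 0 \<and> of_int c * x \<in> zspan M"
    using assms
  proof (induction rule: QV.span_induct_alt)
    case base
    show ?case by (rule exI[of _ 1]) (auto intro: ZM.span_zero)
  next
    case (step q u v)
    obtain c where c: "c > 0" "of_int c * v \<in> zspan M" using step by auto
    obtain a b where ab: "quotient_of q = (a, b)" by force
    have b: "b > 0" using quotient_of_denom_pos[OF ab] .
    have q: "complex_of_rat q * of_int b = of_int a"
      using quotient_of_div[OF ab] b by (simp add: of_rat_divide)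
    have "of_int (b * c) * (rat_scale q u + v) = of_int (c * a) * u + of_int b * (of_int c * v)"
      by (simp add: rat_scale_def flip: q) (simp add: algebra_simps)
    moreover have "of_int (c * a) * u + of_int b * (of_int c * v) \<in> zspan M"
      using zspan_of_int_mult[OF c(2)] zspan_of_int_mult[OF ZM.span_base[OF step(1)]] by (intro ZM.span_add)
    ultimately show ?case using b c(1) by (intro exI[of _ "b * c"]) auto
  qed
  then show ?thesis using that by auto
qed

lemma of_int_in_zspan: "mult_closed M \<Longrightarrow> of_int k \<in> zspan M"
  using zspan_of_int_mult[of 1 M k] by (auto simp: mult_closed_def intro: ZM.span_base)

lemma one_in_zspan: "mult_closed M \<Longrightarrow> 1 \<in> zspan M"
  using of_int_in_zspan[of M 1] by simp

lemma of_nat_in_zspan: "mult_closed M \<Longrightarrow> of_nat k \<in> zspan M"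
  using of_int_in_zspan[of M "int k"] by simp

lemma zspan_prod: "mult_closed M \<Longrightarrow> (\<And>i. i \<in> I \<Longrightarrow> f i \<in> zspan M) \<Longrightarrow> prod f I \<in> zspan M"
  by (induction I rule: infinite_finite_induct) (auto intro: one_in_zspan zspan_mult)

lemma of_rat_in_qspan: "mult_closed M \<Longrightarrow> of_rat q \<in> qspan M"
  using qspan_of_rat_mult[of 1 M q] by (auto simp: mult_closed_def intro: QV.span_base)

lemma qspan_mult:
  assumes "mult_closed M" "x \<in> qspan M" "y \<in> qspan M"
  shows "x * y \<in> qspan M"
proof -
  obtain c d :: int where cd: "c > 0" "of_int c * x \<in> zspan M" "d > 0" "of_int d * y \<in> zspan M"
    using assms qspan_clear_denominators by metis
  have "(of_int c * x) * (of_int d * y) \<in> qspan M"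
    using zspan_mult[OF assms(1) cd(2,4)] zspan_subset_qspan by auto
  moreover have "x * y = of_rat (inverse (of_int (c * d))) * ((of_int c * x) * (of_int d * y))"
    using cd by (simp add: of_rat_inverse of_rat_mult) (simp add: field_simps)
  ultimately show ?thesis using qspan_of_rat_mult by metis
qed

lemma qspan_power: "mult_closed M \<Longrightarrow> x \<in> qspan M \<Longrightarrow> x ^ k \<in> qspan M"
  using of_rat_in_qspan[of M 1] by (induction k) (auto intro: qspan_mult)

text \<open>More powers of \<open>x\<close> than there are roots of unity of order dividing
  \<open>n\<close> must be linearly dependent.\<close>

lemma algebraic_of_qspan_mu:
  assumes "n > 0" "x \<in> qspan (mu n)"
  shows "algebraic x"
proof -
  define N where "N = card (mu n)"
  have pw: "x ^ i \<in> qspan (mu n)" for i by (rule qspan_power[OF mult_closed_mu assms(2)])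
  show ?thesis
  proof (cases "inj_on (\<lambda>i. x ^ i) {..N}")
    case False
    then obtain i j where ij: "x ^ i = x ^ j" "i \<noteq> j" by (auto simp: inj_on_def)
    define p :: "complex poly" where "p = Polynomial.monom 1 i - Polynomial.monom 1 j"
    have "Polynomial.coeff p i = 1" using ij by (simp add: p_def)
    then have "p \<noteq> 0" by auto
    moreover have "poly p x = 0" using ij by (simp add: p_def poly_monom)
    moreover have "Polynomial.coeff p k \<in> \<int>" for k by (simp add: p_def)
    ultimately show ?thesis by (auto simp: algebraic_def)
  next
    case True
    have fin: "finite ((\<lambda>i. x ^ i) ` {..N})" by simp
    have "card ((\<lambda>i. x ^ i) ` {..N}) = Suc N" using True by (simp add: card_image)
    moreover have "(\<lambda>i. x ^ i) ` {..N} \<subseteq> qspan (mu n)" using pw by auto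
    ultimately have "QV.dependent ((\<lambda>i. x ^ i) ` {..N})"
      using QV.independent_span_bound[OF finite_mu[OF assms(1)]] N_def by fastforce
    then obtain u where u: "\<exists>v\<in>(\<lambda>i. x ^ i) ` {..N}. u v \<noteq> 0"
      "(\<Sum>v\<in>(\<lambda>i. x ^ i) ` {..N}. rat_scale (u v) v) = 0"
      using QV.dependent_finite[OF fin] by auto
    define p :: "complex poly" where "p = (\<Sum>i\<le>N. Polynomial.monom (of_rat (u (x ^ i))) i)"
    have cf: "Polynomial.coeff p k = (if k \<le> N then of_rat (u (x ^ k)) else 0)" for k
      by (simp add: p_def coeff_sum)
    have "p \<noteq> 0" using u(1) cf by (metis (no_types, lifting) atMost_iff coeff_0 imageE of_rat_eq_0_iff)
    moreover have "poly p x = 0"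
      using u(2) by (simp add: sum.reindex[OF True] p_def poly_sum poly_monom rat_scale_def)
    moreover have "Polynomial.coeff p k \<in> \<rat>" for k by (simp add: cf)
    ultimately show ?thesis by (auto simp: algebraic_altdef)
  qed
qed

text \<open>In an integral equation for \<open>x\<close> the first nonzero coefficient, divided by
  the powers of \<open>x\<close> in front of it, is a multiple of \<open>x\<close>.\<close>

lemma zspan_divides_int:
  assumes "n > 0" "x \<in> zspan (mu n)" "x \<noteq> 0"
  obtains y and c :: int where "y \<in> zspan (mu n)" "c \<noteq> 0" "x * y = of_int c"
proof -
  have ev: "poly p x \<in> zspan (mu n)" if "\<forall>i. Polynomial.coeff p i \<in> \<int>" for p
    using that
  proof (induction p)
    case (pCons a p)
    have "Polynomial.coeff p i \<in> \<int>" for i using pCons.prems[rule_format, of "Suc i"] by simp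
    moreover have "a \<in> \<int>" using pCons.prems[rule_format, of 0] by simp
    ultimately show ?case using pCons(2) assms(2)
      by (auto intro!: ZM.span_add zspan_mult[OF mult_closed_mu] elim!: Ints_cases
          intro: of_int_in_zspan[OF mult_closed_mu])
  qed (auto intro: ZM.span_zero)
  have "\<exists>y c. y \<in> zspan (mu n) \<and> c \<noteq> (0::int) \<and> x * y = of_int c"
    if "\<forall>i. Polynomial.coeff p i \<in> \<int>" "p \<noteq> 0" "poly p x = 0" for p
    using that
  proof (induction p)
    case (pCons a p)
    have int: "\<forall>i. Polynomial.coeff p i \<in> \<int>"
      by (metis coeff_pCons_Suc pCons.prems(1))
    have "a \<in> \<int>" using pCons.prems(1)[rule_format, of 0] by simp
    then obtain c where c: "a = of_int c" by (auto elim: Ints_cases)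
    show ?case
    proof (cases "c = 0")
      case True
      then have "poly p x = 0" "p \<noteq> 0" using pCons.prems c assms(3) by auto
      then show ?thesis using pCons(2) int by blast
    next
      case False
      have "x * (- poly p x) = of_int c" using pCons.prems(3) c by (simp add: add_eq_0_iff)
      then show ?thesis using False ev[OF int] by (blast intro: ZM.span_neg)
    qed
  qed auto
  moreover have "algebraic x"
    using algebraic_of_qspan_mu[OF assms(1)] assms(2) zspan_subset_qspan by auto
  ultimately show ?thesis using that by (force simp: algebraic_def)
qed

definition is_subfield :: "complex set \<Rightarrow> bool" where
  "is_subfield E \<longleftrightarrow> 1 \<in> E \<and> (\<forall>x\<in>E. \<forall>y\<in>E. x + y \<in> E \<and> x * y \<in> E) \<and> (\<forall>x\<in>E. - x \<in> E \<and> inverse x \<in> E)"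

lemma is_subfieldD:
  assumes "is_subfield E"
  shows "1 \<in> E" "x \<in> E \<Longrightarrow> y \<in> E \<Longrightarrow> x + y \<in> E" "x \<in> E \<Longrightarrow> y \<in> E \<Longrightarrow> x * y \<in> E"
    "x \<in> E \<Longrightarrow> - x \<in> E" "x \<in> E \<Longrightarrow> inverse x \<in> E" "0 \<in> E"
    "x \<in> E \<Longrightarrow> y \<in> E \<Longrightarrow> x - y \<in> E" "x \<in> E \<Longrightarrow> y \<in> E \<Longrightarrow> x / y \<in> E" "x \<in> E \<Longrightarrow> x ^ k \<in> E"
    "of_nat k \<in> E" "of_int j \<in> E" "of_rat q \<in> E"
proof -
  note a = assms[unfolded is_subfield_def]
  show 1: "1 \<in> E" using a by auto
  show add: "x + y \<in> E" "x * y \<in> E" if "x \<in> E" "y \<in> E" for x y using a that by auto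
  show neg: "- x \<in> E" "inverse x \<in> E" if "x \<in> E" for x using a that by auto
  show 0: "0 \<in> E" using add(1)[OF 1 neg(1)[OF 1]] by simp
  show "x - y \<in> E" "x / y \<in> E" if "x \<in> E" "y \<in> E" for x y
    using add[OF that(1)] neg[OF that(2)] by (auto simp: divide_inverse diff_conv_add_uminus simp del: add_uminus_conv_diff)
  then have dv: "x / y \<in> E" if "x \<in> E" "y \<in> E" for x y using that by auto
  show "x ^ k \<in> E" if "x \<in> E" using that 1 add by (induction k) auto
  show nat: "of_nat k \<in> E" for k using 0 1 add by (induction k) auto
  show int: "of_int j \<in> E" for j
    using nat[of "nat \<bar>j\<bar>"] neg(1)[of "of_nat (nat \<bar>j\<bar>)"] by (cases "j \<ge> 0") auto
  obtain a b where ab: "quotient_of q = (a, b)" by force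
  show "of_rat q \<in> E" using dv[OF int int, of a b] quotient_of_div[OF ab] by (simp add: of_rat_divide)
qed

lemma is_subfield_sum: "is_subfield E \<Longrightarrow> (\<And>i. i \<in> I \<Longrightarrow> f i \<in> E) \<Longrightarrow> sum f I \<in> E"
  by (induction I rule: infinite_finite_induct) (auto simp: is_subfieldD)

lemma is_subfield_prod: "is_subfield E \<Longrightarrow> (\<And>i. i \<in> I \<Longrightarrow> f i \<in> E) \<Longrightarrow> prod f I \<in> E"
  by (induction I rule: infinite_finite_induct) (auto simp: is_subfieldD)

text \<open>Up to an integer factor, a cofactor of \<open>x\<close> in a nonzero integer is an
  inverse of \<open>x\<close>.\<close>

lemma is_subfield_qspan_mu:
  assumes "n > 0"
  shows "is_subfield (qspan (mu n))"
proof -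
  have "inverse x \<in> qspan (mu n)" if x: "x \<in> qspan (mu n)" for x
  proof (cases "x = 0")
    case True
    then show ?thesis by (auto intro: QV.span_zero)
  next
    case False
    obtain d :: int where d: "d > 0" "of_int d * x \<in> zspan (mu n)"
      using qspan_clear_denominators[OF x] .
    then obtain y and c :: int where y: "y \<in> zspan (mu n)" "c \<noteq> 0" "of_int d * x * y = of_int c"
      using zspan_divides_int[OF assms d(2)] False by auto
    have "inverse x = of_rat (of_int d / of_int c) * y"
      using y d False by (simp add: of_rat_divide field_simps)
    then show ?thesis using y(1) zspan_subset_qspan by (auto intro: qspan_of_rat_mult)
  qed
  then show ?thesis
    using of_rat_in_qspan[OF mult_closed_mu, of 1 n]
    by (auto simp: is_subfield_def intro: QV.span_add QV.span_neg qspan_mult[OF mult_closed_mu])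
qed

lemma qspan_unity_roots_level:
  assumes "P 1" "\<And>m n. P m \<Longrightarrow> P n \<Longrightarrow> P (m * n)" "x \<in> qspan (unity_roots P)"
  shows "\<exists>n>0. P n \<and> x \<in> qspan (mu n)"
  using assms(3)
  proof (induction rule: QV.span_induct_alt)
    case base
    then show ?case using assms(1) by (intro exI[of _ 1]) (auto intro: QV.span_zero)
  next
    case (step c u v)
    then obtain m n where mn: "m > 0" "P m" "v \<in> qspan (mu m)" "n > 0" "P n" "u \<in> mu n"
      by (auto simp: unity_roots_def mu_def)
    have "mu m \<subseteq> mu (m * n)" "mu n \<subseteq> mu (m * n)" by (auto intro!: mu_mono)
    then have "u \<in> qspan (mu (m * n))" "v \<in> qspan (mu (m * n))"
      using mn QV.span_mono by (blast intro: QV.span_base)+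
    then show ?case using mn assms(2) by (intro exI[of _ "m * n"]) (auto intro: QV.span_add QV.span_scale)
qed

lemma qspan_mu_mono: "m dvd n \<Longrightarrow> qspan (mu m) \<subseteq> qspan (mu n)"
  by (intro QV.span_mono mu_mono)

lemma qspan_mu_subset_unity_roots: "n > 0 \<Longrightarrow> P n \<Longrightarrow> qspan (mu n) \<subseteq> qspan (unity_roots P)"
  by (intro QV.span_mono) (auto simp: mu_def unity_roots_def)

lemma is_subfield_qspan_unity_roots:
  assumes "P 1" "\<And>m n. P m \<Longrightarrow> P n \<Longrightarrow> P (m * n)"
  shows "is_subfield (qspan (unity_roots P))"
proof -
  have mc: "mult_closed (unity_roots P)"
    by (rule mult_closed_unity_roots) (fact assms)+
  have "inverse x \<in> qspan (unity_roots P)" if x: "x \<in> qspan (unity_roots P)" for x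
  proof -
    have "\<exists>n>0. P n \<and> x \<in> qspan (mu n)"
      by (rule qspan_unity_roots_level) (fact assms x)+
    then obtain n where n: "n > 0" "P n" "x \<in> qspan (mu n)" by (elim exE conjE)
    show ?thesis
      using is_subfieldD(5)[OF is_subfield_qspan_mu[OF n(1)] n(3)] qspan_mu_subset_unity_roots[of n P, OF n(1,2)]
      by (rule subsetD[rotated])
  qed
  moreover have "1 \<in> qspan (unity_roots P)"
    using mc by (intro QV.span_base) (simp add: mult_closed_def)
  ultimately show ?thesis
    unfolding is_subfield_def by (intro conjI ballI QV.span_add QV.span_neg qspan_mult[OF mc]) assumption+
qed

lemma Cring_simps [simp]:
  "carrier Cring = UNIV" "x \<otimes>\<^bsub>Cring\<^esub> y = x * y" "\<one>\<^bsub>Cring\<^esub> = (1::complex)" "\<zero>\<^bsub>Cring\<^esub> = (0::complex)"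
  "x \<oplus>\<^bsub>Cring\<^esub> y = x + y"
  by (auto simp: ring_of_type_algebra_def)

lemma field_Cring: "field Cring" and cring_Cring: "cring Cring"
  by (rule field_from_type_algebra, rule cring_from_type_algebra)

lemma Cring_uminus [simp]: "\<ominus>\<^bsub>Cring\<^esub> x = - x"
proof -
  have "(- x) \<oplus>\<^bsub>Cring\<^esub> x = \<zero>\<^bsub>Cring\<^esub>" by simp
  from abelian_group.minus_equality[OF _ this] show ?thesis
    using cring_Cring by (simp add: cring_def ring_def)
qed

lemma Cring_inv [simp]: "x \<noteq> 0 \<Longrightarrow> inv\<^bsub>Cring\<^esub> x = inverse x"
proof -
  assume "x \<noteq> 0"
  then have "x \<otimes>\<^bsub>Cring\<^esub> inverse x = \<one>\<^bsub>Cring\<^esub>" by simp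
  from comm_monoid.comm_inv_char[OF _ _ _ this] show "inv\<^bsub>Cring\<^esub> x = inverse x"
    using cring_Cring by (simp add: cring_def)
qed

text \<open>The rational combinations of roots of unity already form a field, so that they exhaust
  the field generated by these roots.\<close>

lemma generate_field_eq_qspan:
  assumes "is_subfield (qspan M)" "G \<subseteq> M" "M \<subseteq> generate_field Cring G"
  shows "generate_field Cring G = qspan M"
proof
  show "generate_field Cring G \<subseteq> qspan M"
  proof
    fix x assume "x \<in> generate_field Cring G"
    then show "x \<in> qspan M"
      using is_subfieldD[OF assms(1)] assms(2)
      by (induction rule: generate_field.induct) (auto intro: QV.span_base)
  qed
  have sf: "is_subfield (generate_field Cring G)"
  proof -
    have 0: "0 \<in> generate_field Cring G" using field.zero_in_generate[OF field_Cring, of G] by simp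
    have "inverse x \<in> generate_field Cring G" if "x \<in> generate_field Cring G" for x
      using generate_field.m_inv[OF that] 0 by (cases "x = 0") auto
    then show ?thesis
      using generate_field.one[of Cring G] generate_field.eng_add[of _ Cring G] generate_field.eng_mult[of _ Cring G]
        generate_field.a_inv[of _ Cring G]
      by (auto simp: is_subfield_def)
  qed
  show "qspan M \<subseteq> generate_field Cring G"
  proof
    fix x assume "x \<in> qspan M"
    then show "x \<in> generate_field Cring G"
      using assms(3) is_subfieldD[OF sf]
      by (induction rule: QV.span_induct_alt) (auto simp: rat_scale_def)
  qed
qed

abbreviation "all_n \<equiv> (\<lambda>n::nat. True)"

lemma Q_cyc_eq: "Q_cyc = qspan (unity_roots all_n)"
  unfolding Q_cyc_def
  by (rule generate_field_eq_qspan[OF is_subfield_qspan_unity_roots])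
     (auto simp: unity_roots_def intro: generate_field.incl)

lemma Q_cyc_prime_to_eq: "Q_cyc_prime_to p = qspan (unity_roots (\<lambda>n. coprime n p))"
  unfolding Q_cyc_prime_to_def
  by (rule generate_field_eq_qspan[OF is_subfield_qspan_unity_roots])
     (auto simp: unity_roots_def intro: generate_field.incl)

lemma mu_eq_powers:
  assumes "n > 0"
  shows "mu n = (\<lambda>k. cis (2 * pi / real n) ^ k) ` {..<n}"
proof -
  have "mu n = (\<lambda>k. cis (2 * pi * real k / real n)) ` {..<n}"
    using Complex.bij_betw_roots_unity[OF assms] by (simp add: bij_betw_def mu_def)
  moreover have "cis (2 * pi / real n) ^ k = cis (2 * pi * real k / real n)" for k
    unfolding Complex.DeMoivre by (rule arg_cong[where f = cis]) simp
  ultimately show ?thesis by simp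
qed

lemma cyclotomic_field_eq:
  assumes "n > 0"
  shows "cyclotomic_field n = qspan (mu n)"
  unfolding cyclotomic_field_def
proof (rule generate_field_eq_qspan[OF is_subfield_qspan_mu[OF assms]])
  have "cis (2 * pi / real n) ^ 1 \<in> mu n"
  proof (cases "n = 1")
    case False
    then have "1 \<in> {..<n}" using assms by auto
    then show ?thesis using mu_eq_powers[OF assms] by blast
  qed (simp add: mu_def)
  then show "{cis (2 * pi / real n)} \<subseteq> mu n" by simp
  have "cis (2 * pi / real n) ^ k \<in> generate_field Cring {cis (2 * pi / real n)}" for k
  proof (induction k)
    case 0
    then show ?case using generate_field.one[of Cring] by simp
  next
    case (Suc k)
    then show ?case using generate_field.eng_mult[OF generate_field.incl Suc, of "cis (2 * pi / real n)"] by simp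
  qed
  then show "mu n \<subseteq> generate_field Cring {cis (2 * pi / real n)}"
    by (auto simp: mu_eq_powers[OF assms])
qed

section \<open>Extensions of the \<open>p\<close>-adic valuation\<close>

lemma padic_valuation_of_int:
  assumes "k \<noteq> 0"
  shows "padic_valuation p (of_int k) = ereal (real (multiplicity (int p) k))"
  using assms by (simp add: padic_valuation_def)

lemma padic_valuation_prime: "Factorial_Ring.prime p \<Longrightarrow> padic_valuation p (of_nat p) = 1"
  using padic_valuation_of_int[of "int p" p] by (auto simp: multiplicity_self one_ereal_def prime_nat_iff)

lemma padic_valuation_diff:
  assumes "quotient_of q = (a, b)" "q \<noteq> 0"
  shows "padic_valuation p q = padic_valuation p (of_int a) - padic_valuation p (of_int b)"
    and "a \<noteq> 0" "b > 0" "q = of_int a / of_int b"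
proof -
  show b: "b > 0" using quotient_of_denom_pos[OF assms(1)] .
  show q: "q = of_int a / of_int b" using quotient_of_div[OF assms(1)] .
  then show a: "a \<noteq> 0" using assms(2) by auto
  show "padic_valuation p q = padic_valuation p (of_int a) - padic_valuation p (of_int b)"
    using a b assms by (simp only: padic_valuation_of_int) (simp add: padic_valuation_def)
qed

locale padic_val =
  fixes p :: nat and E :: "complex set" and v :: "complex \<Rightarrow> ereal"
  assumes prime: "Factorial_Ring.prime p" and subfield: "is_subfield E" and val: "v \<in> Val p E"
begin

lemmas closed = is_subfieldD[OF subfield]

lemma p_pos: "p > 0" using prime by (simp add: prime_gt_0_nat)

lemma valuation: "is_valuation E v" using val by (simp add: Val_def)

lemma v_mult: "x \<in> E \<Longrightarrow> y \<in> E \<Longrightarrow> v (x * y) = v x + v y"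
  using valuation by (auto simp: is_valuation_def)

lemma v_add: "x \<in> E \<Longrightarrow> y \<in> E \<Longrightarrow> min (v x) (v y) \<le> v (x + y)"
  using valuation by (auto simp: is_valuation_def)

lemma v_infinity: "x \<in> E \<Longrightarrow> v x = \<infinity> \<longleftrightarrow> x = 0"
  using valuation by (auto simp: is_valuation_def)

lemma v_zero [simp]: "v 0 = \<infinity>" using v_infinity closed by auto

lemma v_real:
  assumes "x \<in> E" "x \<noteq> 0"
  obtains r where "v x = ereal r"
  using assms valuation by (cases "v x") (auto simp: is_valuation_def)

lemma v_of_rat: "v (of_rat q) = padic_valuation p q"
  using val by (auto simp: Val_def)

lemma v_one [simp]: "v 1 = 0"
  using v_of_rat[of 1] by (simp add: padic_valuation_def zero_ereal_def)

lemma v_prime: "v (of_nat p) = 1"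
  using v_of_rat[of "of_nat p"] padic_valuation_prime[OF prime] by simp

lemma v_of_int: "k \<noteq> 0 \<Longrightarrow> v (of_int k) = ereal (real (multiplicity (int p) k))"
  using v_of_rat[of "of_int k"] padic_valuation_of_int by simp

lemma v_of_int_nonneg: "v (of_int k) \<ge> 0"
  using v_of_int[of k] by (cases "k = 0") auto

lemma v_of_nat_nonneg: "v (of_nat k) \<ge> 0"
  using v_of_int_nonneg[of "int k"] by simp

lemma v_of_int_coprime: "\<not> int p dvd k \<Longrightarrow> v (of_int k) = 0"
  using v_of_int[of k] by (cases "k = 0") (auto simp: not_dvd_imp_multiplicity_0 zero_ereal_def)

lemma v_of_nat_coprime: "\<not> p dvd k \<Longrightarrow> v (of_nat k) = 0"
  using v_of_int_coprime[of "int k"] by simp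

lemma v_minus_one [simp]: "v (-1) = 0"
  using v_of_int[of "-1"] by (simp add: zero_ereal_def)

lemma v_minus: "x \<in> E \<Longrightarrow> v (- x) = v x"
  using v_mult[of "-1" x] closed(1,4) by auto

lemma v_diff: "x \<in> E \<Longrightarrow> y \<in> E \<Longrightarrow> min (v x) (v y) \<le> v (x - y)"
  using v_add[of x "- y"] v_minus closed by auto

lemma v_power: "x \<in> E \<Longrightarrow> v (x ^ k) = ereal (real k) * v x"
proof (induction k)
  case (Suc k)
  then show ?case
    by (cases "x = 0"; cases "v x")
       (use v_infinity[of x] v_mult[of x "x ^ k"] closed(9)[of x] in \<open>auto simp: algebra_simps zero_ereal_def\<close>)
qed (use v_infinity in \<open>auto simp: zero_ereal_def[symmetric]\<close>)

lemma v_power_real: "x \<in> E \<Longrightarrow> v x = ereal r \<Longrightarrow> v (x ^ k) = ereal (real k * r)"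
  using v_power by simp

lemma v_inverse:
  assumes "x \<in> E" "x \<noteq> 0"
  shows "v (inverse x) = - v x"
proof -
  have i: "inverse x \<in> E" "inverse x \<noteq> 0" using assms closed(5) by auto
  obtain r s where rs: "v x = ereal r" "v (inverse x) = ereal s"
    using v_real[OF assms] v_real[OF i] by metis
  have "v (x * inverse x) = ereal (r + s)" using v_mult[OF assms(1) i(1)] rs by simp
  then have "ereal (r + s) = ereal 0" using assms(2) by (simp add: zero_ereal_def)
  then have "s = - r" by simp
  then show ?thesis using rs by simp
qed

lemma v_prime_powi: "v (of_nat p powi j) = ereal (of_int j)" and prime_powi_closed: "of_nat p powi j \<in> E"
proof -
  have "v (of_nat p ^ k) = ereal (real k)" for k
    using v_power[of "of_nat p" k] closed(10)[of p] v_prime by (simp add: one_ereal_def)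
  then show "v (of_nat p powi j) = ereal (of_int j)"
    using v_inverse[OF closed(9)[OF closed(10)[of p]]] p_pos by (auto simp: power_int_def power_inverse)
  show "of_nat p powi j \<in> E" using closed(5,9,10) by (auto simp: power_int_def)
qed

lemma v_prod: "finite I \<Longrightarrow> (\<And>i. i \<in> I \<Longrightarrow> f i \<in> E) \<Longrightarrow> v (prod f I) = (\<Sum>i\<in>I. v (f i))"
  by (induction I rule: finite_induct) (auto simp: v_mult is_subfield_prod[OF subfield])

lemma v_nonneg_add: "x \<in> E \<Longrightarrow> y \<in> E \<Longrightarrow> c \<le> v x \<Longrightarrow> c \<le> v y \<Longrightarrow> c \<le> v (x + y)"
  using v_add[of x y] by (metis min.boundedI order_trans)

lemma v_nonneg_diff: "x \<in> E \<Longrightarrow> y \<in> E \<Longrightarrow> c \<le> v x \<Longrightarrow> c \<le> v y \<Longrightarrow> c \<le> v (x - y)"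
  using v_diff[of x y] by (metis min.boundedI order_trans)

lemma v_pos_add: "x \<in> E \<Longrightarrow> y \<in> E \<Longrightarrow> c < v x \<Longrightarrow> c < v y \<Longrightarrow> c < v (x + y)"
  using v_add[of x y] by (metis min_less_iff_conj order_less_le_trans)

lemma v_pos_diff: "x \<in> E \<Longrightarrow> y \<in> E \<Longrightarrow> c < v x \<Longrightarrow> c < v y \<Longrightarrow> c < v (x - y)"
  using v_diff[of x y] by (metis min_less_iff_conj order_less_le_trans)

lemma v_mult_nonneg: "x \<in> E \<Longrightarrow> y \<in> E \<Longrightarrow> 0 \<le> v x \<Longrightarrow> 0 \<le> v y \<Longrightarrow> 0 \<le> v (x * y)"
  by (simp add: v_mult)

lemma v_mult_pos: "x \<in> E \<Longrightarrow> y \<in> E \<Longrightarrow> 0 < v x \<Longrightarrow> 0 \<le> v y \<Longrightarrow> 0 < v (x * y)"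
  by (simp add: v_mult add_pos_nonneg)

text \<open>If the two values of \<open>x\<close> were different, there would be a rational number
  \<open>a / b\<close> between them, and \<open>x ^ b\<close> divided by \<open>p ^ a\<close>
  would have a positive value at one valuation and a negative value at the other.\<close>

lemma eq_if_ring_subset:
  assumes w: "w \<in> Val p E" and le: "\<And>x. x \<in> E \<Longrightarrow> v x \<ge> 0 \<Longrightarrow> w x \<ge> 0"
  shows "v = w"
proof -
  interpret w: padic_val p E w using prime subfield w by unfold_locales
  have mono: "v x \<le> w x" if x: "x \<in> E" "x \<noteq> 0" for x
  proof (rule ccontr)
    obtain r s where rs: "v x = ereal r" "w x = ereal s" using x v_real w.v_real by metis
    assume "\<not> v x \<le> w x"
    then have "s < r" using rs by simp
    then obtain q where q: "q \<in> \<rat>" "s < q" "q < r" using Rats_dense_in_real by blast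
    then obtain a b where ab: "b > 0" "q = of_int a / of_int b" by (metis Rats_cases')
    define y where "y = x ^ nat b * of_nat p powi (- a)"
    have y: "y \<in> E" using x closed(3,9) prime_powi_closed by (auto simp: y_def)
    have pw: "x ^ nat b \<in> E" using x closed(9) by auto
    have "v y = ereal (of_int b * r - of_int a)" "w y = ereal (of_int b * s - of_int a)"
      using ab(1) by (auto simp: y_def v_mult[OF pw prime_powi_closed] w.v_mult[OF pw prime_powi_closed]
        v_power_real[OF x(1) rs(1)] w.v_power_real[OF x(1) rs(2)] v_prime_powi w.v_prime_powi simp del: power_int_minus)
    moreover have "of_int b * r - of_int a > 0" "of_int b * s - of_int a < 0"
      using q ab by (auto simp: field_simps)
    ultimately show False using le[OF y] by simp
  qed
  show ?thesis
  proof (rule extensionalityI[of _ E])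
    show "v \<in> extensional E" "w \<in> extensional E" using val w by (auto simp: Val_def)
    fix x assume x: "x \<in> E"
    show "v x = w x"
    proof (cases "x = 0")
      case False
      have "v x \<le> w x" "v (inverse x) \<le> w (inverse x)" using mono x False closed(5) by auto
      then show ?thesis using v_inverse[OF x False] w.v_inverse[OF x False] by (simp add: antisym)
    qed simp
  qed
qed

lemma restrict_Val:
  assumes "is_subfield F" "F \<subseteq> E"
  shows "restrict v F \<in> Val p F"
proof -
  have "of_rat q \<in> F" for q using is_subfieldD(12)[OF assms(1)] .
  then show ?thesis
    using assms(2) is_subfieldD(2,3)[OF assms(1)] valuation val
    by (auto simp: Val_def is_valuation_def subset_iff)
qed

end

section \<open>Existence of extensions to the cyclotomic field\<close>

definition is_subring :: "complex set \<Rightarrow> bool" where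
  "is_subring R \<longleftrightarrow> 1 \<in> R \<and> (\<forall>x\<in>R. \<forall>y\<in>R. x + y \<in> R \<and> x * y \<in> R) \<and> (\<forall>x\<in>R. - x \<in> R)"

lemma is_subringD:
  assumes "is_subring R"
  shows "1 \<in> R" "x \<in> R \<Longrightarrow> y \<in> R \<Longrightarrow> x + y \<in> R" "x \<in> R \<Longrightarrow> y \<in> R \<Longrightarrow> x * y \<in> R"
    "x \<in> R \<Longrightarrow> - x \<in> R" "0 \<in> R" "x \<in> R \<Longrightarrow> y \<in> R \<Longrightarrow> x - y \<in> R" "x \<in> R \<Longrightarrow> x ^ k \<in> R" "of_nat k \<in> R"
    "of_int j \<in> R"
proof -
  note a = assms[unfolded is_subring_def]
  show 1: "1 \<in> R" using a by auto
  show add: "x + y \<in> R" "x * y \<in> R" if "x \<in> R" "y \<in> R" for x y using a that by auto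
  show neg: "- x \<in> R" if "x \<in> R" for x using a that by auto
  show 0: "0 \<in> R" using add(1)[OF 1 neg[OF 1]] by simp
  show "x - y \<in> R" if "x \<in> R" "y \<in> R"
    using add(1)[OF that(1) neg[OF that(2)]] by simp
  show "x ^ k \<in> R" if "x \<in> R" using that 1 add by (induction k) auto
  show nat: "of_nat k \<in> R" for k using 0 1 add by (induction k) auto
  show int: "of_int j \<in> R" for j
    using nat[of "nat \<bar>j\<bar>"] neg[of "of_nat (nat \<bar>j\<bar>)"] by (cases "j \<ge> 0") auto
qed

lemma is_subring_sum: "is_subring R \<Longrightarrow> (\<And>i. i \<in> I \<Longrightarrow> f i \<in> R) \<Longrightarrow> sum f I \<in> R"
  by (induction I rule: infinite_finite_induct) (auto simp: is_subringD)

definition adjoin :: "complex set \<Rightarrow> complex \<Rightarrow> complex set" where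
  "adjoin R x = {poly f x | f. \<forall>i. Polynomial.coeff f i \<in> R}"

lemma is_subring_adjoin:
  assumes "is_subring R"
  shows "is_subring (adjoin R x)" "R \<subseteq> adjoin R x" "x \<in> adjoin R x"
proof -
  note R = is_subringD[OF assms]
  have mult: "\<forall>i. Polynomial.coeff (f * g) i \<in> R" if "\<forall>i. Polynomial.coeff f i \<in> R" "\<forall>i. Polynomial.coeff g i \<in> R" for f g
    using that R(3) by (auto simp: coeff_mult intro!: is_subring_sum[OF assms])
  show "is_subring (adjoin R x)"
    unfolding is_subring_def
  proof (intro conjI ballI)
    show "1 \<in> adjoin R x" unfolding adjoin_def using R by (auto intro!: exI[of _ 1])
    fix y assume "y \<in> adjoin R x"
    then obtain f where f: "y = poly f x" "\<forall>i. Polynomial.coeff f i \<in> R" by (auto simp: adjoin_def)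
    show "- y \<in> adjoin R x" unfolding adjoin_def using f R by (auto intro!: exI[of _ "-f"])
    fix z assume "z \<in> adjoin R x"
    then obtain g where g: "z = poly g x" "\<forall>i. Polynomial.coeff g i \<in> R" by (auto simp: adjoin_def)
    show "y + z \<in> adjoin R x" unfolding adjoin_def using f g R by (auto intro!: exI[of _ "f + g"])
    show "y * z \<in> adjoin R x" unfolding adjoin_def using f g mult by (auto intro!: exI[of _ "f * g"])
  qed
  show "R \<subseteq> adjoin R x" unfolding adjoin_def
    using R by (auto intro!: exI[of _ "[:_:]"] simp: coeff_pCons split: nat.splits)
  show "x \<in> adjoin R x" unfolding adjoin_def
    using R by (auto intro!: exI[of _ "[:0, 1:]"] simp: coeff_pCons split: nat.splits)
qed

lemma adjoin_subset:
  assumes "is_subring K" "R \<subseteq> K" "x \<in> K"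
  shows "adjoin R x \<subseteq> K"
  using assms(2,3) is_subringD(3,7)[OF assms(1)]
  by (auto simp: adjoin_def poly_altdef subset_iff intro!: is_subring_sum[OF assms(1)])

lemma is_subfield_imp_subring: "is_subfield K \<Longrightarrow> is_subring K"
  by (auto simp: is_subfield_def is_subring_def)

text \<open>Chevalley's construction of valuations: a subring that is maximal among those not
  containing \<open>1 / p\<close> is a valuation ring.\<close>

locale maximal_ring =
  fixes p :: nat and K R :: "complex set"
  assumes prime: "Factorial_Ring.prime p" and K: "is_subfield K"
    and R: "is_subring R" "R \<subseteq> K" "inverse (of_nat p) \<notin> R"
    and maximal: "\<And>S. is_subring S \<Longrightarrow> R \<subseteq> S \<Longrightarrow> S \<subseteq> K \<Longrightarrow> inverse (of_nat p) \<notin> S \<Longrightarrow> S = R"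
begin

lemmas Rc = is_subringD[OF R(1)]
lemmas Kc = is_subfieldD[OF K]

lemma p_nonzero: "(of_nat p :: complex) \<noteq> 0" using prime by auto

lemma adjoin_contains_inverse:
  assumes "x \<in> K" "x \<notin> R"
  obtains f where "\<And>i. Polynomial.coeff f i \<in> R" "inverse (of_nat p) = poly f x"
proof -
  have "inverse (of_nat p) \<in> adjoin R x"
  proof (rule ccontr)
    assume "inverse (of_nat p) \<notin> adjoin R x"
    then have "adjoin R x = R"
      using is_subring_adjoin[OF R(1), of x] adjoin_subset[OF is_subfield_imp_subring[OF K] R(2) assms(1)]
      by (intro maximal) auto
    then show False using is_subring_adjoin(3)[OF R(1), of x] assms(2) by auto
  qed
  then show ?thesis using that by (auto simp: adjoin_def)
qed

text \<open>Let \<open>u = 1 - p b\<close>. If \<open>1 / u\<close> were outside of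
  \<open>R\<close>, then maximality would make \<open>1 / p\<close> a polynomial in \<open>1 /
  u\<close> with coefficients in \<open>R\<close>. Multiplied by a power of \<open>u\<close>,
  which is again congruent to 1 modulo \<open>p\<close>, it would show that \<open>1 / p\<close>
  lies in \<open>R\<close>.\<close>

lemma unit:
  assumes "b \<in> R"
  shows "inverse (1 - of_nat p * b) \<in> R"
proof (rule ccontr)
  define u where "u = 1 - of_nat p * b"
  assume "inverse (1 - of_nat p * b) \<notin> R"
  moreover have "u \<in> R" using assms Rc by (auto simp: u_def)
  ultimately obtain f where f: "\<And>i. Polynomial.coeff f i \<in> R" "inverse (of_nat p) = poly f (inverse u)"
    using adjoin_contains_inverse[of "inverse u"] R(2) Kc(5) by (auto simp: u_def)
  have u0: "u \<noteq> 0"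
  proof
    assume "u = 0"
    then have "b = inverse (of_nat p)" using p_nonzero by (auto simp: u_def field_simps)
    then show False using R(3) assms by auto
  qed
  have pw: "\<exists>c\<in>R. u ^ k = 1 - of_nat p * c" for k
  proof (induction k)
    case (Suc k)
    then obtain c where "c \<in> R" "u ^ k = 1 - of_nat p * c" by auto
    then have "u ^ Suc k = u * (1 - of_nat p * c)" by simp
    also have "\<dots> = 1 - of_nat p * (b + c - of_nat p * b * c)"
      by (simp add: u_def algebra_simps)
    finally have "u ^ Suc k = 1 - of_nat p * (b + c - of_nat p * b * c)" .
    moreover have "b + c - of_nat p * b * c \<in> R" using assms \<open>c \<in> R\<close> Rc by auto
    ultimately show ?case by blast
  qed (use Rc in \<open>auto intro!: bexI[of _ 0]\<close>)
  define n where "n = Polynomial.degree f"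
  obtain c where c: "c \<in> R" "u ^ n = 1 - of_nat p * c" using pw by blast
  have "u ^ n * inverse (of_nat p) = (\<Sum>i\<le>n. Polynomial.coeff f i * (inverse u ^ i * u ^ n))"
    unfolding f(2) by (simp add: poly_altdef n_def sum_distrib_left algebra_simps)
  also have "\<dots> = (\<Sum>i\<le>n. Polynomial.coeff f i * u ^ (n - i))"
  proof (rule sum.cong)
    fix i assume "i \<in> {..n}"
    then have "u ^ n = u ^ i * u ^ (n - i)" by (simp flip: power_add)
    then show "Polynomial.coeff f i * (inverse u ^ i * u ^ n) = Polynomial.coeff f i * u ^ (n - i)"
      using u0 by (simp add: power_inverse)
  qed simp
  also have "\<dots> \<in> R" using f \<open>u \<in> R\<close> Rc by (intro is_subring_sum[OF R(1)]) auto
  finally have "u ^ n * inverse (of_nat p) + c \<in> R" using c(1) Rc by auto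
  also have "u ^ n * inverse (of_nat p) + c = inverse (of_nat p)"
    using p_nonzero by (simp add: c(2) field_simps)
  finally show False using R(3) by simp
qed

text \<open>A relation expresses \<open>1 / p\<close> as a polynomial in \<open>x\<close>. By
  maximality this is possible for every element outside of the ring.\<close>

definition relation :: "complex \<Rightarrow> nat \<Rightarrow> bool" where
  "relation x n \<longleftrightarrow> (\<exists>a. (\<forall>i. a i \<in> R) \<and> 1 = (\<Sum>i\<le>n. of_nat p * a i * x ^ i))"

lemma ex_relation:
  assumes "x \<in> K" "x \<notin> R"
  obtains n where "relation x n"
proof -
  obtain f where f: "\<And>i. Polynomial.coeff f i \<in> R" "inverse (of_nat p) = poly f x"
    using adjoin_contains_inverse[OF assms] by blast
  have "1 = of_nat p * poly f x" using f(2) p_nonzero by (simp add: field_simps)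
  then have "relation x (Polynomial.degree f)"
    unfolding relation_def poly_altdef sum_distrib_left mult.assoc using f(1) by blast
  then show ?thesis using that by blast
qed

text \<open>In a relation for \<open>inverse x\<close> of degree \<open>m\<close> the constant
  term can be absorbed, because \<open>1 - p b 0\<close> is a unit. What remains expresses
  \<open>x ^ m\<close> by lower powers of \<open>x\<close>, and this removes the leading term of
  the relation for \<open>x\<close>.\<close>

lemma relation_reduce:
  assumes x: "x \<noteq> 0" and n: "relation x n" and m: "relation (inverse x) m" "m \<le> n"
  shows "\<exists>k<n. relation x k"
proof -
  obtain a where a: "\<And>i. a i \<in> R" "1 = (\<Sum>i\<le>n. of_nat p * a i * x ^ i)"
    using n by (auto simp: relation_def)
  obtain b where b: "\<And>i. b i \<in> R" "1 = (\<Sum>i\<le>m. of_nat p * b i * inverse x ^ i)"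
    using m by (auto simp: relation_def)
  define u where "u = inverse (1 - of_nat p * b 0)"
  have u: "u \<in> R" using unit b by (auto simp: u_def)
  have u0: "1 - of_nat p * b 0 \<noteq> 0"
  proof
    assume "1 - of_nat p * b 0 = 0"
    then have "b 0 = inverse (of_nat p)" using p_nonzero by (auto simp: field_simps)
    then show False using R(3) b(1)[of 0] by auto
  qed
  have "m \<noteq> 0" using b(2) u0 by (intro notI) simp
  then obtain m' where m': "m = Suc m'" by (cases m) auto
  define c where "c i = u * (of_nat p * b (m - i))" for i
  have c: "c i \<in> R" for i using u b Rc by (auto simp: c_def)
  have "1 - of_nat p * b 0 = (\<Sum>i<m. of_nat p * b (Suc i) * inverse x ^ Suc i)"
    using b(2) by (simp add: sum.atMost_shift algebra_simps)
  also have "\<dots> = (\<Sum>i<m. of_nat p * b (m - i) * inverse x ^ (m - i))"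
    using sum.nat_diff_reindex[of "\<lambda>i. of_nat p * b (Suc i) * inverse x ^ Suc i" m]
    by (intro trans[OF sym[OF sum.nat_diff_reindex] sum.cong]) (auto simp: Suc_diff_Suc simp del: power_Suc)
  finally have *: "1 - of_nat p * b 0 = (\<Sum>i<m. of_nat p * b (m - i) * inverse x ^ (m - i))" .
  have "x ^ m = x ^ m * u * (1 - of_nat p * b 0)" using u0 by (simp add: u_def)
  also have "\<dots> = (\<Sum>i<m. c i * (x ^ m * inverse x ^ (m - i)))"
    unfolding * by (simp add: sum_distrib_left c_def algebra_simps)
  also have "\<dots> = (\<Sum>i<m. c i * x ^ i)"
  proof (rule sum.cong)
    fix i assume "i \<in> {..<m}"
    then have "x ^ m = x ^ i * x ^ (m - i)" by (simp flip: power_add)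
    then show "c i * (x ^ m * inverse x ^ (m - i)) = c i * x ^ i"
      using x by (simp add: power_inverse)
  qed simp
  finally have xm: "x ^ m = (\<Sum>i<m. c i * x ^ i)" .
  define d where "d i = a i + (if n - m \<le> i then a n * c (i - (n - m)) else 0)" for i
  have d: "d i \<in> R" for i using a c Rc by (auto simp: d_def)
  have "x ^ n = x ^ (n - m) * x ^ m" using m by (simp flip: power_add)
  also have "\<dots> = (\<Sum>i<m. c i * x ^ (i + (n - m)))"
    unfolding xm by (simp add: sum_distrib_left power_add algebra_simps)
  also have "\<dots> = (\<Sum>i=n-m..<n. c (i - (n - m)) * x ^ i)"
    using m sum.shift_bounds_nat_ivl[of "\<lambda>i. c (i - (n - m)) * x ^ i" 0 "n - m" m]
    by (simp add: lessThan_atLeast0)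
  also have "\<dots> = (\<Sum>i<n. if n - m \<le> i then c (i - (n - m)) * x ^ i else 0)"
    by (rule sum.mono_neutral_cong_left) auto
  finally have xn: "x ^ n = (\<Sum>i<n. if n - m \<le> i then c (i - (n - m)) * x ^ i else 0)" .
  have "1 = (\<Sum>i<n. of_nat p * a i * x ^ i) + of_nat p * a n * x ^ n"
    using a(2) by (simp flip: lessThan_Suc_atMost)
  also have "\<dots> = (\<Sum>i<n. of_nat p * d i * x ^ i)"
    unfolding xn sum_distrib_left sum.distrib[symmetric] d_def
    by (intro sum.cong) (auto simp: algebra_simps)
  also have "{..<n} = {..n - 1}" using m m' by auto
  finally have "relation x (n - 1)" unfolding relation_def using d by blast
  then show ?thesis using m m' by (intro exI[of _ "n - 1"]) auto
qed

text \<open>If both elements were outside of the ring, the longer of two shortest relations could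
  be shortened.\<close>

lemma valuation_ring:
  assumes "x \<in> K" "x \<noteq> 0"
  shows "x \<in> R \<or> inverse x \<in> R"
proof (rule ccontr)
  assume *: "\<not> ?thesis"
  define n m where "n = (LEAST n. relation x n)" and "m = (LEAST n. relation (inverse x) n)"
  have n: "relation x n" unfolding n_def using ex_relation[of x] assms * by (metis LeastI)
  have m: "relation (inverse x) m" unfolding m_def using ex_relation[of "inverse x"] assms Kc(5) * by (metis LeastI)
  show False
  proof (cases "m \<le> n")
    case True
    then show ?thesis using relation_reduce[OF assms(2) n m] not_less_Least n_def by blast
  next
    case False
    then show ?thesis using relation_reduce[of "inverse x" m n] assms n m not_less_Least m_def by auto
  qed
qed

text \<open>A rational number \<open>j / s\<close> belongs to this set if \<open>x ^ s\<close> is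
  divisible by \<open>p ^ j\<close> in \<open>R\<close>, that is, if the value of
  \<open>x\<close>, normalized to be 1 at \<open>p\<close>, is at least \<open>j / s\<close>. So
  the set is the lower half of a cut.\<close>

definition exponents :: "complex \<Rightarrow> real set" where
  "exponents x = {of_int j / real s | j s. s > 0 \<and> x ^ s * of_nat p powi (- j) \<in> R}"

definition ord :: "complex \<Rightarrow> real" where
  "ord x = Sup (exponents x)"

lemma powi_nonpos: "of_nat p powi (- j) \<in> R \<Longrightarrow> j \<le> 0"
proof (rule ccontr)
  assume *: "of_nat p powi (- j) \<in> R" "\<not> j \<le> 0"
  have "of_nat p ^ nat (j - 1) * (of_nat p powi (- j) :: complex) = of_nat p powi (j - 1) * of_nat p powi (- j)"
    using * by (simp add: power_int_def)
  also have "\<dots> = inverse (of_nat p)"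
    using power_int_add[of "of_nat p :: complex" "j - 1" "- j"] p_nonzero by simp
  finally show False using * R(3) Rc(3,7,8) by metis
qed

lemma exponents_add:
  assumes "a \<in> exponents x" "b \<in> exponents y"
  shows "a + b \<in> exponents (x * y)"
proof -
  obtain j s where a: "a = of_int j / real s" "s > 0" "x ^ s * of_nat p powi (- j) \<in> R"
    using assms(1) by (auto simp: exponents_def)
  obtain i t where b: "b = of_int i / real t" "t > 0" "y ^ t * of_nat p powi (- i) \<in> R"
    using assms(2) by (auto simp: exponents_def)
  have "(x ^ s * of_nat p powi (- j)) ^ t * (y ^ t * of_nat p powi (- i)) ^ s \<in> R"
    using a b Rc by auto
  also have "(x ^ s * of_nat p powi (- j)) ^ t * (y ^ t * of_nat p powi (- i)) ^ s
      = (x * y) ^ (s * t) * (of_nat p powi (- j * int t) * of_nat p powi (- i * int s))"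
    by (simp add: power_mult_distrib power_int_power' mult_ac del: power_int_minus flip: power_mult)
  also have "of_nat p powi (- j * int t) * of_nat p powi (- i * int s) = (of_nat p powi (- (j * int t + i * int s)) :: complex)"
    using p_nonzero by (simp flip: power_int_add)
  finally have "(x * y) ^ (s * t) * of_nat p powi (- (j * int t + i * int s)) \<in> R" .
  moreover have "a + b = of_int (j * int t + i * int s) / real (s * t)"
    using a b by (simp add: field_simps)
  ultimately show ?thesis using a(2) b(2) unfolding exponents_def
    by (intro CollectI exI[of _ "j * int t + i * int s"] exI[of _ "s * t"]) simp
qed

lemma exponents_one: "a \<in> exponents 1 \<Longrightarrow> a \<le> 0"
  using powi_nonpos by (auto simp: exponents_def divide_nonpos_pos)

lemma exponents_inverse: "x \<noteq> 0 \<Longrightarrow> a \<in> exponents x \<Longrightarrow> b \<in> exponents (inverse x) \<Longrightarrow> a \<le> - b"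
  using exponents_add[of a x b "inverse x"] exponents_one by fastforce

lemma exponents_ring:
  assumes "x \<in> R"
  shows "0 \<in> exponents x"
proof -
  have "0 = of_int 0 / real 1" "x ^ 1 * of_nat p powi (- 0) \<in> R" using assms by auto
  then show ?thesis unfolding exponents_def by (metis (mono_tags, lifting) mem_Collect_eq zero_less_one)
qed

text \<open>The valuation ring contains \<open>x ^ s / p ^ j\<close> or its inverse.\<close>

lemma exponents_cut:
  assumes "x \<in> K" "x \<noteq> 0" "q \<in> \<rat>"
  shows "q \<in> exponents x \<or> - q \<in> exponents (inverse x)"
proof -
  obtain j b where jb: "b > 0" "q = of_int j / of_int b" using assms(3) by (metis Rats_cases')
  define s where "s = nat b"
  define y where "y = x ^ s * of_nat p powi (- j)"
  have "y \<in> K" "y \<noteq> 0"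
    using assms p_nonzero Kc(3,5,9,10) by (auto simp: y_def power_int_def)
  then have "y \<in> R \<or> inverse y \<in> R" by (rule valuation_ring)
  moreover have "inverse y = inverse x ^ s * of_nat p powi (- (- j))"
    by (simp add: y_def power_int_minus power_inverse)
  moreover have "q = of_int j / real s" "- q = of_int (- j) / real s" "s > 0"
    using jb by (auto simp: s_def)
  ultimately show ?thesis unfolding exponents_def y_def by (metis (mono_tags, lifting) mem_Collect_eq)
qed

end

text \<open>For the cyclotomic field the valuation has rank one, with real values: each element
  is, up to a nonzero integer, an integral combination of roots of unity, which are units, so that
  its value is bounded in terms of \<open>p\<close>. The integers prime to \<open>p\<close> have
  to be units for the valuation to extend the \<open>p\<close>-adic one.\<close>

locale maximal_cyc_ring = maximal_ring p Q_cyc R for p R +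
  assumes localized: "\<And>k. \<not> int p dvd k \<Longrightarrow> inverse (of_int k) \<in> R"
begin

lemma roots_of_unity_in_ring: "unity_roots all_n \<subseteq> R"
proof
  fix z assume "z \<in> unity_roots all_n"
  then obtain n where n: "n > 0" "z ^ n = 1" by (auto simp: unity_roots_def)
  then have z: "z \<noteq> 0" "z \<in> Q_cyc"
    by (auto simp: zero_power Q_cyc_eq unity_roots_def intro!: QV.span_base)
  from valuation_ring[OF z(2,1)] show "z \<in> R"
  proof
    assume "inverse z \<in> R"
    then have "inverse z ^ (n - 1) \<in> R" by (rule Rc)
    also have "inverse z ^ (n - 1) = z"
    proof -
      have "z ^ (n - 1) * z = 1" using n by (metis power_minus_mult)
      then show ?thesis by (metis inverse_unique power_inverse mult.commute)
    qed
    finally show ?thesis .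
  qed
qed

lemma zspan_in_ring: "x \<in> zspan (unity_roots all_n) \<Longrightarrow> x \<in> R"
  by (induction rule: ZM.span_induct_alt)
     (use Rc roots_of_unity_in_ring in \<open>auto simp: int_scale_def subset_iff\<close>)

text \<open>An integral combination of roots of unity has a nonnegative value, and an integer has
  a finite one.\<close>

lemma exponents_nonempty:
  assumes "x \<in> Q_cyc"
  shows "exponents x \<noteq> {}"
proof -
  obtain c :: int where c: "c > 0" "of_int c * x \<in> zspan (unity_roots all_n)"
    using qspan_clear_denominators assms unfolding Q_cyc_eq by metis
  obtain m d where md: "c = int p ^ m * d" "\<not> int p dvd d"
    using multiplicity_decompose'[of c "int p"] c prime
    by (metis less_irrefl not_prime_unit prime_int_nat_transfer prime_nat_int_transfer)
  have "inverse (of_int d) * (of_int c * x) \<in> R"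
    using localized[OF md(2)] zspan_in_ring[OF c(2)] Rc by auto
  also have "inverse (of_int d) * (of_int c * x) = x ^ 1 * of_nat p powi (- (- int m))"
    using md by (auto simp: field_simps)
  finally show ?thesis unfolding exponents_def by (metis (mono_tags, lifting) empty_iff mem_Collect_eq zero_less_one)
qed

lemma inverse_nonzero: "x \<in> Q_cyc \<Longrightarrow> x \<noteq> 0 \<Longrightarrow> inverse x \<in> Q_cyc \<and> inverse x \<noteq> 0"
  using Kc(5) by auto

lemma exponents_bdd:
  assumes "x \<in> Q_cyc" "x \<noteq> 0"
  shows "bdd_above (exponents x)"
proof -
  obtain b where "b \<in> exponents (inverse x)"
    using exponents_nonempty inverse_nonzero[OF assms] by blast
  then show ?thesis using exponents_inverse[OF assms(2)] by (auto intro!: bdd_aboveI[of _ "- b"])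
qed

text \<open>A rational number strictly between the two sides would be missing from both halves of
  the cut.\<close>

lemma ord_inverse:
  assumes "x \<in> Q_cyc" "x \<noteq> 0"
  shows "ord (inverse x) = - ord x"
proof (rule antisym)
  have ne: "exponents x \<noteq> {}" "exponents (inverse x) \<noteq> {}"
    using exponents_nonempty assms inverse_nonzero by auto
  have bdd: "bdd_above (exponents x)" "bdd_above (exponents (inverse x))"
    using exponents_bdd assms inverse_nonzero by auto
  have "b \<le> - ord x" if "b \<in> exponents (inverse x)" for b
  proof -
    have "ord x \<le> - b" unfolding ord_def
      using exponents_inverse[OF assms(2) _ that] by (intro cSup_least ne) auto
    then show ?thesis by simp
  qed
  then show "ord (inverse x) \<le> - ord x" unfolding ord_def[of "inverse x"] by (intro cSup_least ne) auto
  show "- ord x \<le> ord (inverse x)"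
  proof (rule ccontr)
    assume "\<not> - ord x \<le> ord (inverse x)"
    then have "ord x < - ord (inverse x)" by simp
    then obtain q where q: "q \<in> \<rat>" "ord x < q" "q < - ord (inverse x)" using Rats_dense_in_real by blast
    from exponents_cut[OF assms q(1)] show False
    proof
      assume "q \<in> exponents x"
      then show False using cSup_upper[OF _ bdd(1)] q unfolding ord_def by force
    next
      assume "- q \<in> exponents (inverse x)"
      then show False using cSup_upper[OF _ bdd(2)] q unfolding ord_def by force
    qed
  qed
qed

lemma ord_mult_ge:
  assumes "x \<in> Q_cyc" "x \<noteq> 0" "y \<in> Q_cyc" "y \<noteq> 0"
  shows "ord x + ord y \<le> ord (x * y)"
proof -
  have bdd: "bdd_above (exponents (x * y))"
    using exponents_bdd assms Kc(3) by auto
  have "a + b \<le> ord (x * y)" if "a \<in> exponents x" "b \<in> exponents y" for a b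
    unfolding ord_def using cSup_upper[OF exponents_add[OF that] bdd] .
  then have "a \<le> ord (x * y) - b" if "a \<in> exponents x" "b \<in> exponents y" for a b
    using that by (simp add: le_diff_eq)
  then have "ord x \<le> ord (x * y) - b" if "b \<in> exponents y" for b
    unfolding ord_def[of x] using exponents_nonempty[OF assms(1)] that by (intro cSup_least) auto
  then have "b \<le> ord (x * y) - ord x" if "b \<in> exponents y" for b
    using that by (metis diff_le_eq le_diff_eq add.commute)
  then have "ord y \<le> ord (x * y) - ord x"
    unfolding ord_def[of y] using exponents_nonempty[OF assms(3)] by (intro cSup_least) auto
  then show ?thesis by simp
qed

lemma ord_mult:
  assumes "x \<in> Q_cyc" "x \<noteq> 0" "y \<in> Q_cyc" "y \<noteq> 0"
  shows "ord (x * y) = ord x + ord y"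
proof (rule antisym)
  have "ord (inverse x) + ord (inverse y) \<le> ord (inverse x * inverse y)"
    using assms inverse_nonzero by (intro ord_mult_ge) auto
  also have "inverse x * inverse y = inverse (x * y)" by simp
  finally show "ord (x * y) \<le> ord x + ord y"
    using assms Kc(3) by (simp add: ord_inverse del: inverse_mult_distrib)
qed (rule ord_mult_ge[OF assms])

lemma ord_ring: "x \<in> R \<Longrightarrow> x \<noteq> 0 \<Longrightarrow> ord x \<ge> 0"
  unfolding ord_def by (rule cSup_upper) (use exponents_ring exponents_bdd R(2) in auto)

lemma ord_add:
  assumes "x \<in> Q_cyc" "x \<noteq> 0" "y \<in> Q_cyc" "y \<noteq> 0" "x + y \<noteq> 0"
  shows "min (ord x) (ord y) \<le> ord (x + y)"
proof -
  have *: "ord x \<le> ord (x + y)"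
    if "x \<in> Q_cyc" "x \<noteq> 0" "y \<in> Q_cyc" "x + y \<noteq> 0" "y / x \<in> R" for x y
  proof -
    have e: "x + y = x * (1 + y / x)" using that by (simp add: field_simps)
    have "1 + y / x \<in> R" "1 + y / x \<noteq> 0" using that Rc e by auto
    then show ?thesis unfolding e using that R(2) ord_mult[of x "1 + y / x"] ord_ring by auto
  qed
  have "y / x \<in> Q_cyc" "y / x \<noteq> 0" using assms Kc(8) by auto
  then have "y / x \<in> R \<or> x / y \<in> R" using valuation_ring[of "y / x"] by simp
  then show ?thesis using *[of x y] *[of y x] assms by (auto simp: add.commute)
qed

lemma ord_prime: "ord (of_nat p) = 1"
proof -
  have "of_nat p ^ 1 * (of_nat p :: complex) powi (- 1) \<in> R" using p_nonzero Rc by simp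
  then have "1 \<in> exponents (of_nat p)" unfolding exponents_def
    by (auto intro!: exI[of _ "1::int"] exI[of _ "1::nat"])
  moreover have "a \<le> 1" if mem: "a \<in> exponents (of_nat p)" for a
  proof -
    obtain j s where a: "a = of_int j / real s" "s > 0" "of_nat p ^ s * (of_nat p :: complex) powi (- j) \<in> R"
      using mem by (auto simp: exponents_def)
    have "of_nat p ^ s * (of_nat p :: complex) powi (- j) = of_nat p powi (- (j - int s))"
      using p_nonzero by (simp add: power_int_add power_int_minus power_int_diff field_simps)
    then have "of_nat p powi (- (j - int s)) \<in> R" using a(3) by simp
    then have "j - int s \<le> 0" by (rule powi_nonpos)
    then have "real_of_int j \<le> real s" by linarith
    then show ?thesis using a(1,2) by simp
  qed
  ultimately show ?thesis unfolding ord_def by (intro cSup_eq_maximum) auto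
qed

lemma ord_one: "ord 1 = 0"
  using ord_mult[of 1 1] Kc(1) by simp

lemma ord_int:
  assumes "k \<noteq> 0"
  shows "ord (of_int k) = real (multiplicity (int p) k)"
proof -
  obtain d where d: "k = int p ^ multiplicity (int p) k * d" "\<not> int p dvd d"
    using multiplicity_decompose'[of k "int p"] assms prime
    by (metis not_prime_unit prime_int_nat_transfer prime_nat_int_transfer)
  then have d0: "d \<noteq> 0" using assms by auto
  have "ord (of_int d) \<ge> 0" "ord (inverse (of_int d)) \<ge> 0"
    using localized[OF d(2)] d0 Rc(9) by (auto intro!: ord_ring)
  then have od: "ord (of_int d) = 0" using ord_inverse[of "of_int d"] d0 Kc(11) by simp
  have op: "ord (of_nat p ^ m) = real m" for m
  proof (induction m)
    case (Suc m)
    then show ?case using ord_mult[of "of_nat p" "of_nat p ^ m"] p_nonzero Kc(9,10) by (simp add: ord_prime)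
  qed (simp add: ord_one)
  have "(of_int k :: complex) = of_nat p ^ multiplicity (int p) k * of_int d"
    by (subst d(1)) simp
  also have "ord \<dots> = real (multiplicity (int p) k)"
    using ord_mult[of "of_nat p ^ multiplicity (int p) k" "of_int d"] p_nonzero d0 Kc(9,10,11) od op by simp
  finally show ?thesis .
qed

definition val :: "complex \<Rightarrow> ereal" where
  "val = (\<lambda>x\<in>Q_cyc. if x = 0 then \<infinity> else ereal (ord x))"

lemma val_in_Val: "val \<in> Val p Q_cyc" and val_ring: "x \<in> R \<Longrightarrow> val x \<ge> 0"
proof -
  have rat: "val (of_rat q) = padic_valuation p q" for q
  proof (cases "q = 0")
    case True
    then show ?thesis using Kc(6) by (simp add: val_def padic_valuation_def)
  next
    case False
    obtain a b where ab: "quotient_of q = (a, b)" by force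
    note d = padic_valuation_diff(1)[OF ab False, of p] padic_valuation_diff(2-4)[OF ab False]
    have i: "(of_int b :: complex) \<in> Q_cyc" "(of_int b :: complex) \<noteq> 0" using d Kc by auto
    have "(of_rat q :: complex) = of_int a * inverse (of_int b)"
      unfolding d(4) by (simp add: of_rat_divide) (simp add: divide_inverse)
    then have "ord (of_rat q) = real (multiplicity (int p) a) - real (multiplicity (int p) b)"
      using d ord_mult[of "of_int a" "inverse (of_int b)"] Kc(11) inverse_nonzero[OF i] ord_inverse[OF i] ord_int[of a] ord_int[of b]
      by simp
    then show ?thesis
      using False d(2,3) Kc(12) by (simp add: val_def d(1) padic_valuation_of_int)
  qed
  have add: "min (val x) (val y) \<le> val (x + y)" if "x \<in> Q_cyc" "y \<in> Q_cyc" for x y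
    using that ord_add[of x y] Kc(2)[OF that] by (auto simp: val_def min_def split: if_splits)
  have mult: "val (x * y) = val x + val y" if "x \<in> Q_cyc" "y \<in> Q_cyc" for x y
    using that ord_mult[of x y] Kc(3)[OF that] by (auto simp: val_def)
  show "val \<in> Val p Q_cyc"
    unfolding Val_def is_valuation_def
  proof (intro CollectI IntI conjI ballI allI)
    show "val \<in> extensional Q_cyc" by (simp add: val_def)
  qed (use rat add mult in \<open>auto simp: val_def\<close>)
  show "x \<in> R \<Longrightarrow> val x \<ge> 0" using ord_ring R(2) by (auto simp: val_def)
qed

end

lemma is_subfield_Q_cyc: "is_subfield Q_cyc"
  unfolding Q_cyc_eq by (rule is_subfield_qspan_unity_roots) auto

text \<open>Zorn's lemma provides a maximal subring containing \<open>S\<close>.\<close>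

lemma subring_dominated_by_valuation:
  assumes prime: "Factorial_Ring.prime p" and S: "is_subring S" "S \<subseteq> Q_cyc" "inverse (of_nat p) \<notin> S"
    and loc: "\<And>k. \<not> int p dvd k \<Longrightarrow> inverse (of_int k) \<in> S"
  obtains v where "v \<in> Val p Q_cyc" "\<And>x. x \<in> S \<Longrightarrow> v x \<ge> 0"
proof -
  define A where "A = {R. is_subring R \<and> S \<subseteq> R \<and> R \<subseteq> Q_cyc \<and> inverse (of_nat p) \<notin> R}"
  have "\<exists>m\<in>A. \<forall>x\<in>A. m \<subseteq> x \<longrightarrow> x = m"
  proof (rule subset_Zorn_nonempty)
    show "A \<noteq> {}" using S by (auto simp: A_def)
    fix C assume C: "C \<noteq> {}" "subset.chain A C"
    have CA: "C \<subseteq> A" using C by (auto simp: subset.chain_def)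
    have "is_subring (\<Union>C)"
      unfolding is_subring_def
    proof (intro conjI ballI)
      show "1 \<in> \<Union>C" using C CA by (auto simp: A_def is_subring_def)
      fix x assume x: "x \<in> \<Union>C"
      then show "- x \<in> \<Union>C" using CA by (auto simp: A_def is_subring_def subset_iff) blast
      fix y assume "y \<in> \<Union>C"
      then obtain T U where XY: "T \<in> C" "U \<in> C" "x \<in> T" "y \<in> U" using x by auto
      then have "T \<subseteq> U \<or> U \<subseteq> T" using C(2) unfolding subset.chain_def by auto
      then obtain Z where "Z \<in> C" "x \<in> Z" "y \<in> Z" using XY by auto
      moreover from this have "is_subring Z" using CA by (auto simp: A_def)
      ultimately show "x + y \<in> \<Union>C" "x * y \<in> \<Union>C" by (auto simp: is_subring_def)
    qed
    then show "\<Union>C \<in> A" using C CA by (auto simp: A_def)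
  qed
  then obtain R where R: "R \<in> A" "\<And>T. T \<in> A \<Longrightarrow> R \<subseteq> T \<Longrightarrow> T = R" by blast
  have SR: "S \<subseteq> R" using R(1) by (auto simp: A_def)
  interpret maximal_cyc_ring p R
  proof
    show "is_subring R" "R \<subseteq> Q_cyc" "inverse (of_nat p) \<notin> R" using R(1) by (auto simp: A_def)
    show "\<And>k. \<not> int p dvd k \<Longrightarrow> inverse (of_int k) \<in> R" using R(1) loc by (auto simp: A_def)
    fix T assume T: "is_subring T" "R \<subseteq> T" "T \<subseteq> Q_cyc" "inverse (of_nat p) \<notin> T"
    then have "T \<in> A" using R(1) by (auto simp: A_def)
    then show "T = R" using R(2) T(2) by blast
  qed (use prime is_subfield_Q_cyc in auto)
  show ?thesis using that[OF val_in_Val val_ring[OF subsetD[OF SR]]] .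
qed

text \<open>The starting point is the ring of rational numbers whose denominator is prime to
  \<open>p\<close>.\<close>

lemma Val_Q_cyc_nonempty:
  assumes "Factorial_Ring.prime p"
  obtains v where "v \<in> Val p Q_cyc"
proof -
  define S where "S = {of_int a / of_int b :: complex | a b. \<not> int p dvd b}"
  have p: "Factorial_Ring.prime (int p)" using assms by simp
  have mem: "of_int a / of_int b \<in> S" if "\<not> int p dvd b" for a b using that by (auto simp: S_def)
  have "is_subring S"
    unfolding is_subring_def
  proof (intro conjI ballI)
    show "1 \<in> S" using mem[of 1 1] p not_prime_unit[of "int p"] by (metis div_by_1 of_int_1)
    fix x assume "x \<in> S"
    then obtain a b where ab: "x = of_int a / of_int b" "\<not> int p dvd b" by (auto simp: S_def)
    then show "- x \<in> S" using mem[of b "- a"] by simp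
    fix y assume "y \<in> S"
    then obtain c d where cd: "y = of_int c / of_int d" "\<not> int p dvd d" by (auto simp: S_def)
    have bd: "\<not> int p dvd b * d" using ab cd p by (simp add: prime_dvd_mult_iff)
    have nz: "b \<noteq> 0" "d \<noteq> 0" using ab cd by auto
    show "x + y \<in> S" using mem[OF bd, of "a * d + c * b"] nz ab cd by (simp add: add_frac_eq)
    show "x * y \<in> S" using mem[OF bd, of "a * c"] ab cd by simp
  qed
  moreover have "S \<subseteq> Q_cyc" using is_subfieldD(8,11)[OF is_subfield_Q_cyc] by (auto simp: S_def)
  moreover have "inverse (of_nat p) \<notin> S"
  proof
    assume "inverse (of_nat p) \<in> S"
    then obtain a b where ab: "inverse (of_nat p) = (of_int a / of_int b :: complex)" "\<not> int p dvd b" by (auto simp: S_def)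
    then have "b \<noteq> 0" by auto
    then have "(of_int b :: complex) = of_int (int p * a)" using ab assms by (simp add: field_simps)
    then show False using ab(2) of_int_eq_iff by (metis dvd_triv_left)
  qed
  moreover have "inverse (of_int k) \<in> S" if "\<not> int p dvd k" for k
    using mem[OF that, of 1] by (simp add: inverse_eq_divide)
  ultimately show ?thesis using subring_dominated_by_valuation[OF assms] that by metis
qed

text \<open>Some valuation \<open>w\<close> is nonnegative on the ring of \<open>v\<close>. As
  both restrict to the \<open>p\<close>-adic valuation, the restriction of \<open>w\<close> cannot
  differ from \<open>v\<close>.\<close>

theorem Val_extends_to_Q_cyc:
  assumes "Factorial_Ring.prime p" "is_subfield E" "E \<subseteq> Q_cyc" "v \<in> Val p E"
  obtains w where "w \<in> Val p Q_cyc" "restrict w E = v"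
proof -
  interpret v: padic_val p E v using assms by unfold_locales
  define S where "S = {x \<in> E. v x \<ge> 0}"
  have "is_subring S"
    using v.closed by (auto simp: is_subring_def S_def v.v_minus intro: v.v_nonneg_add v.v_mult_nonneg)
  moreover have "inverse (of_nat p) \<notin> S"
    using v.v_prime_powi[of "-1"] by (auto simp: S_def power_int_minus)
  moreover have "inverse (of_int k) \<in> S" if "\<not> int p dvd k" for k
  proof -
    have "k \<noteq> 0" using that by auto
    then show ?thesis
      using v.v_inverse[of "of_int k"] v.closed v.v_of_int_coprime[OF that] by (auto simp: S_def)
  qed
  ultimately obtain w where w: "w \<in> Val p Q_cyc" "\<And>x. x \<in> S \<Longrightarrow> w x \<ge> 0"
    using subring_dominated_by_valuation[OF assms(1), of S] assms(3) by (auto simp: S_def)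
  interpret w: padic_val p Q_cyc w using assms(1) w(1) is_subfield_Q_cyc by unfold_locales
  have "v = restrict w E"
    by (rule v.eq_if_ring_subset[OF w.restrict_Val[OF assms(2,3)]]) (use w(2) in \<open>auto simp: S_def\<close>)
  then show ?thesis using that w(1) by blast
qed

lemma restrict_Val_surj:
  assumes "Factorial_Ring.prime p" "is_subfield E" "is_subfield F" "E \<subseteq> F" "F \<subseteq> Q_cyc" "v \<in> Val p E"
  shows "\<exists>w\<in>Val p F. restrict w E = v"
proof -
  obtain w where w: "w \<in> Val p Q_cyc" "restrict w E = v"
    using Val_extends_to_Q_cyc[OF assms(1,2) _ assms(6)] assms(4,5) by auto
  interpret w: padic_val p Q_cyc w using assms(1) w(1) is_subfield_Q_cyc by unfold_locales
  have "restrict w F \<in> Val p F" by (rule w.restrict_Val[OF assms(3,5)])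
  moreover have "restrict (restrict w F) E = v" using assms(4) w(2) by (auto simp: Int_absorb1)
  ultimately show ?thesis by blast
qed

section \<open>Congruences in a ring of complex numbers\<close>

text \<open>Congruence modulo the principal ideal of \<open>R\<close> generated by
  \<open>d\<close>.\<close>

definition ring_cong :: "complex set \<Rightarrow> complex \<Rightarrow> complex \<Rightarrow> complex \<Rightarrow> bool" where
  "ring_cong R d x y \<longleftrightarrow> (\<exists>r\<in>R. x - y = d * r)"

lemma is_subring_zspan: "mult_closed M \<Longrightarrow> is_subring (zspan M)"
  by (auto simp: is_subring_def intro: one_in_zspan zspan_mult ZM.span_add ZM.span_neg)

lemma zspan_mu_subring: "is_subring (zspan (mu n))"
  by (rule is_subring_zspan[OF mult_closed_mu])

context
  fixes R :: "complex set" assumes R: "is_subring R"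
begin

lemma ring_cong_refl: "ring_cong R d x x"
  using is_subringD(5)[OF R] by (auto simp: ring_cong_def)

lemma ring_cong_sym:
  assumes "ring_cong R d x y"
  shows "ring_cong R d y x"
proof -
  obtain r where "r \<in> R" "x - y = d * r" using assms by (auto simp: ring_cong_def)
  then have "- r \<in> R" "y - x = d * (- r)" using is_subringD(4)[OF R] by (auto simp: algebra_simps)
  then show ?thesis unfolding ring_cong_def by blast
qed

lemma ring_cong_trans:
  assumes "ring_cong R d x y" "ring_cong R d y z"
  shows "ring_cong R d x z"
proof -
  obtain r s where "r \<in> R" "x - y = d * r" "s \<in> R" "y - z = d * s" using assms by (auto simp: ring_cong_def)
  then have "r + s \<in> R" "x - z = d * (r + s)" using is_subringD(2)[OF R] by (auto simp: algebra_simps)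
  then show ?thesis by (auto simp: ring_cong_def)
qed

lemma ring_cong_add:
  assumes "ring_cong R d x y" "ring_cong R d u v"
  shows "ring_cong R d (x + u) (y + v)"
proof -
  obtain r s where "r \<in> R" "x - y = d * r" "s \<in> R" "u - v = d * s" using assms by (auto simp: ring_cong_def)
  then have "r + s \<in> R" "(x + u) - (y + v) = d * (r + s)" using is_subringD(2)[OF R] by (auto simp: algebra_simps)
  then show ?thesis unfolding ring_cong_def by blast
qed

lemma ring_cong_mult:
  assumes "ring_cong R d x y" "ring_cong R d u v" "x \<in> R" "v \<in> R"
  shows "ring_cong R d (x * u) (y * v)"
proof -
  obtain r s where rs: "r \<in> R" "x - y = d * r" "s \<in> R" "u - v = d * s" using assms by (auto simp: ring_cong_def)
  then have "x * s + r * v \<in> R" using assms(3,4) is_subringD(2,3)[OF R] by auto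
  moreover have "x * u - y * v = x * (u - v) + (x - y) * v" by (simp add: algebra_simps)
  then have "x * u - y * v = d * (x * s + r * v)" by (simp add: rs algebra_simps)
  ultimately show ?thesis unfolding ring_cong_def by blast
qed

lemma ring_cong_power:
  assumes "ring_cong R d x y" "x \<in> R" "y \<in> R"
  shows "ring_cong R d (x ^ k) (y ^ k)"
  by (induction k) (auto intro!: ring_cong_refl ring_cong_mult assms is_subringD[OF R])

lemma ring_cong_modulus:
  assumes "ring_cong R e x y" "e = d * c" "c \<in> R"
  shows "ring_cong R d x y"
  using assms is_subringD(3)[OF R] by (auto simp: ring_cong_def mult.assoc)

text \<open>The middle binomial coefficients are divisible by \<open>q\<close>.\<close>

lemma frobenius_add:
  assumes "Factorial_Ring.prime q" "x \<in> R" "y \<in> R"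
  shows "ring_cong R (of_nat q) ((x + y) ^ q) (x ^ q + y ^ q)"
proof -
  note Rc = is_subringD[OF R]
  have q: "q > 0" using assms(1) by (simp add: prime_gt_0_nat)
  have dv: "\<exists>c. q choose k = q * c" if "k \<in> {1..<q}" for k
    using dvd_choose_prime[of k q] that assms(1) by (auto simp: dvd_def)
  then obtain c where c: "\<And>k. k \<in> {1..<q} \<Longrightarrow> q choose k = q * c k" by metis
  define r where "r = (\<Sum>k\<in>{1..<q}. of_nat (c k) * x ^ k * y ^ (q - k))"
  have "(x + y) ^ q = (\<Sum>k\<le>q. of_nat (q choose k) * x ^ k * y ^ (q - k))"
    by (rule binomial_ring)
  also have "{..q} = insert 0 (insert q {1..<q})" using q by auto
  also have "(\<Sum>k\<in>insert 0 (insert q {1..<q}). of_nat (q choose k) * x ^ k * y ^ (q - k))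
      = y ^ q + x ^ q + (\<Sum>k\<in>{1..<q}. of_nat (q choose k) * x ^ k * y ^ (q - k))"
    using q by (simp add: add.assoc)
  also have "(\<Sum>k\<in>{1..<q}. of_nat (q choose k) * x ^ k * y ^ (q - k)) = of_nat q * r"
    unfolding r_def sum_distrib_left by (rule sum.cong) (auto simp: c)
  finally have "(x + y) ^ q - (x ^ q + y ^ q) = of_nat q * r" by simp
  moreover have "r \<in> R" unfolding r_def using assms Rc by (intro is_subring_sum[OF R]) auto
  ultimately show ?thesis unfolding ring_cong_def by blast
qed

lemma frobenius_power_add:
  assumes "Factorial_Ring.prime q" "x \<in> R" "y \<in> R"
  shows "ring_cong R (of_nat q) ((x + y) ^ (q ^ i)) (x ^ (q ^ i) + y ^ (q ^ i))"
proof (induction i)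
  case (Suc i)
  note Rc = is_subringD[OF R]
  have "ring_cong R (of_nat q) (((x + y) ^ (q ^ i)) ^ q) ((x ^ (q ^ i) + y ^ (q ^ i)) ^ q)"
    using Suc assms Rc by (intro ring_cong_power) auto
  moreover have "ring_cong R (of_nat q) ((x ^ (q ^ i) + y ^ (q ^ i)) ^ q) ((x ^ (q ^ i)) ^ q + (y ^ (q ^ i)) ^ q)"
    using assms Rc by (intro frobenius_add) auto
  ultimately have "ring_cong R (of_nat q) (((x + y) ^ (q ^ i)) ^ q) ((x ^ (q ^ i)) ^ q + (y ^ (q ^ i)) ^ q)"
    by (rule ring_cong_trans)
  then show ?case by (simp add: mult.commute[of q] flip: power_mult)
qed (simp add: ring_cong_refl)

end

lemma frobenius_int:
  assumes "is_subring R" "Factorial_Ring.prime q"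
  shows "ring_cong R (of_nat q) (of_int a ^ (q ^ i)) (of_int a)"
proof -
  note Rc = is_subringD[OF assms(1)]
  have nat: "ring_cong R (of_nat q) (of_nat k ^ (q ^ i)) (of_nat k)" for k
  proof (induction k)
    case 0
    then show ?case using assms(2) by (simp add: ring_cong_refl[OF assms(1)] zero_power prime_gt_0_nat)
  next
    case (Suc k)
    have "ring_cong R (of_nat q) ((of_nat k + 1) ^ (q ^ i)) (of_nat k ^ (q ^ i) + 1 ^ (q ^ i))"
      using assms Rc by (intro frobenius_power_add) auto
    moreover have "ring_cong R (of_nat q) (of_nat k ^ (q ^ i) + 1 ^ (q ^ i)) (of_nat k + 1)"
      by (intro ring_cong_add[OF assms(1)] Suc) (simp add: ring_cong_refl[OF assms(1)])
    ultimately have "ring_cong R (of_nat q) ((of_nat k + 1) ^ (q ^ i)) (of_nat k + 1)"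
      by (rule ring_cong_trans[OF assms(1)])
    then show ?case by (simp add: add.commute)
  qed
  define k where "k = nat (a mod int q)"
  have q: "q > 0" using assms(2) by (simp add: prime_gt_0_nat)
  have "a = int k + int q * (a div int q)" using q by (simp add: k_def)
  then have "(of_int a :: complex) = of_int (int k + int q * (a div int q))" by (rule arg_cong)
  then have "(of_int a :: complex) - of_nat k = of_nat q * of_int (a div int q)" by simp
  then have ak: "ring_cong R (of_nat q) (of_int a) (of_nat k)"
    unfolding ring_cong_def by (rule bexI) (rule Rc)
  have "ring_cong R (of_nat q) (of_int a ^ (q ^ i)) (of_nat k ^ (q ^ i))"
    using Rc by (intro ring_cong_power[OF assms(1) ak]) auto
  from ring_cong_trans[OF assms(1) ring_cong_trans[OF assms(1) this nat] ring_cong_sym[OF assms(1) ak]]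
  show ?thesis .
qed

section \<open>Galois action on cyclotomic fields\<close>

text \<open>A valuation on the field of roots of unity of order dividing \<open>n\<close>. The
  cyclotomic integers are integral combinations of these roots, which is why they have nonnegative
  values.\<close>

locale level_val = padic_val p "qspan (mu n)" v for p n v +
  assumes n: "n > 0"
begin

lemma zspan_closed: "x \<in> zspan (mu n) \<Longrightarrow> x \<in> qspan (mu n)"
  using zspan_subset_qspan by auto

lemma v_root:
  assumes "z \<in> mu n"
  shows "v z = 0"
proof -
  have z: "z \<in> qspan (mu n)" using assms by (rule QV.span_base)
  obtain r where r: "v z = ereal r" using v_real[OF z mu_nonzero[OF n assms]] .
  have "v (z ^ n) = ereal (real n * r)" using v_power_real[OF z r] .
  then have "ereal (real n * r) = ereal 0" using assms by (simp add: mu_def zero_ereal_def)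
  then show "v z = 0" using n r by (simp add: zero_ereal_def)
qed

lemma v_zspan:
  assumes "x \<in> zspan (mu n)"
  shows "v x \<ge> 0"
proof -
  have "x \<in> qspan (mu n) \<and> v x \<ge> 0"
    using assms
  proof (induction rule: ZM.span_induct_alt)
    case (step c z y)
    have z: "z \<in> qspan (mu n)" using step(1) by (rule QV.span_base)
    have "0 \<le> v (of_int c * z)" "of_int c * z \<in> qspan (mu n)"
      using v_root[OF step(1)] closed(3,11) z v_of_int_nonneg by (auto intro: v_mult_nonneg)
    then show ?case using step closed(2) unfolding int_scale_def by (auto intro: v_nonneg_add)
  qed (use closed(6) in auto)
  then show ?thesis ..
qed

end

lemma Q_cyc_level:
  assumes "x \<in> Q_cyc"
  obtains n where "n > 0" "x \<in> qspan (mu n)"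
  using qspan_unity_roots_level[of all_n x] assms unfolding Q_cyc_eq by blast

lemma qspan_mu_Q_cyc: "n > 0 \<Longrightarrow> qspan (mu n) \<subseteq> Q_cyc"
  unfolding Q_cyc_eq by (rule qspan_mu_subset_unity_roots) auto

text \<open>A multiple of \<open>x\<close> is a nonzero integer \<open>c\<close>. If a prime
  divides \<open>x\<close>, an extension of the valuation of this prime shows that it divides
  \<open>c\<close> among the integers.\<close>

lemma finite_prime_divisors_zspan:
  assumes "n > 0" "x \<in> zspan (mu n)" "x \<noteq> 0"
  shows "finite {q. Factorial_Ring.prime q \<and> ring_cong (zspan (mu n)) (of_nat q) x 0}"
proof -
  obtain y and c :: int where y: "y \<in> zspan (mu n)" "c \<noteq> 0" "x * y = of_int c"
    using zspan_divides_int[OF assms] .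
  have "int q dvd c" if q: "Factorial_Ring.prime q" and x0: "ring_cong (zspan (mu n)) (of_nat q) x 0" for q
  proof (rule ccontr)
    assume nd: "\<not> int q dvd c"
    obtain r where r: "r \<in> zspan (mu n)" "x = of_nat q * r"
      using x0 by (auto simp: ring_cong_def)
    obtain u where u: "u \<in> Val q Q_cyc" using Val_Q_cyc_nonempty[OF q] .
    interpret u: padic_val q Q_cyc u using q u is_subfield_Q_cyc by unfold_locales
    define w where "w = restrict u (qspan (mu n))"
    note S = is_subfield_qspan_mu[OF assms(1)]
    have w: "w \<in> Val q (qspan (mu n))" unfolding w_def by (rule u.restrict_Val[OF S qspan_mu_Q_cyc[OF assms(1)]])
    interpret w: level_val q n w using q w S assms(1) by unfold_locales
    have ry: "r * y \<in> zspan (mu n)" using zspan_mult[OF mult_closed_mu r(1) y(1)] .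
    have "of_int c = of_nat q * (r * y)" using y(3) r(2) by (simp add: mult.assoc)
    then have "w (of_int c) = 1 + w (r * y)"
      using w.v_mult[of "of_nat q" "r * y"] w.closed(10) w.zspan_closed[OF ry] w.v_prime by simp
    then have "w (of_int c) > 0" using w.v_zspan[OF ry] by (cases "w (r * y)") auto
    then show False using w.v_of_int_coprime[OF nd] by simp
  qed
  then have "{q. Factorial_Ring.prime q \<and> ring_cong (zspan (mu n)) (of_nat q) x 0} \<subseteq> nat ` {d. d dvd c \<and> d > 0}"
    by (auto intro!: image_eqI[of _ nat "int _"] simp: prime_gt_0_nat)
  moreover have "finite {d. d dvd c \<and> d > 0}"
  proof (rule finite_subset)
    show "{d. d dvd c \<and> d > 0} \<subseteq> {1..\<bar>c\<bar>}" using y(2) dvd_imp_le_int[of c] by force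
  qed simp
  ultimately show ?thesis using finite_subset by blast
qed

definition int_poly :: "complex poly \<Rightarrow> bool" where
  "int_poly f \<longleftrightarrow> (\<forall>i. Polynomial.coeff f i \<in> \<int>)"

definition rat_poly :: "complex poly \<Rightarrow> bool" where
  "rat_poly f \<longleftrightarrow> (\<forall>i. Polynomial.coeff f i \<in> \<rat>)"

lemma int_poly_pCons: "int_poly (pCons a f) \<longleftrightarrow> a \<in> \<int> \<and> int_poly f"
  by (auto simp: int_poly_def coeff_pCons split: nat.splits)

lemma rat_poly_pCons: "rat_poly (pCons a f) \<longleftrightarrow> a \<in> \<rat> \<and> rat_poly f"
  by (auto simp: rat_poly_def coeff_pCons split: nat.splits)

lemma rat_poly_mult: "rat_poly f \<Longrightarrow> rat_poly g \<Longrightarrow> rat_poly (f * g)"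
  by (auto simp: rat_poly_def coeff_mult intro!: Rats_sum)

lemma mu_power:
  assumes "z \<in> mu n"
  shows "z ^ k \<in> mu n"
proof -
  have "(z ^ k) ^ n = (z ^ n) ^ k" by (simp add: mult.commute flip: power_mult)
  then show ?thesis using assms by (simp add: mu_def)
qed

lemma poly_in_zspan:
  assumes "z \<in> mu n" "int_poly f"
  shows "poly f z \<in> zspan (mu n)"
  using assms(2)
proof (induction f)
  case 0
  then show ?case by (auto intro: ZM.span_zero)
next
  case (pCons a f)
  then obtain k where "a = of_int k" by (auto simp: int_poly_pCons elim: Ints_cases)
  then show ?case
    using pCons ZM.span_base[OF assms(1)]
    by (auto simp: int_poly_pCons intro!: ZM.span_add of_int_in_zspan zspan_mult mult_closed_mu)
qed

text \<open>Modulo \<open>q\<close> the map \<open>x \<mapsto> x ^ q\<close> is additive and fixes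
  the integers.\<close>

lemma poly_frobenius:
  assumes "z \<in> mu n" "int_poly f" "Factorial_Ring.prime q"
  shows "ring_cong (zspan (mu n)) (of_nat q) (poly f (z ^ q)) (poly f z ^ q)"
  using assms(2)
proof (induction f)
  case 0
  then show ?case using assms(3) by (simp add: zero_power prime_gt_0_nat ring_cong_refl[OF zspan_mu_subring])
next
  case (pCons a f)
  let ?R = "zspan (mu n)"
  note R = zspan_mu_subring[of n]
  obtain k where k: "a = of_int k" using pCons.prems by (auto simp: int_poly_pCons elim: Ints_cases)
  have f: "int_poly f" using pCons.prems by (simp add: int_poly_pCons)
  have z: "z \<in> ?R" using assms(1) by (rule ZM.span_base)
  have fz: "poly f z \<in> ?R" by (rule poly_in_zspan[OF assms(1) f])
  have "ring_cong ?R (of_nat q) (z ^ q * poly f (z ^ q)) (z ^ q * poly f z ^ q)"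
    using pCons.IH[OF f] is_subringD(7)[OF R] z fz
    by (intro ring_cong_mult[OF R ring_cong_refl[OF R]]) auto
  moreover have "ring_cong ?R (of_nat q) a (a ^ q)"
    using ring_cong_sym[OF R frobenius_int[OF R assms(3), of k 1]] k by simp
  ultimately have "ring_cong ?R (of_nat q) (a + z ^ q * poly f (z ^ q)) (a ^ q + z ^ q * poly f z ^ q)"
    by (intro ring_cong_add[OF R])
  moreover have "ring_cong ?R (of_nat q) (a ^ q + (z * poly f z) ^ q) ((a + z * poly f z) ^ q)"
  proof -
    have "a \<in> ?R" unfolding k by (rule is_subringD(9)[OF R])
    from ring_cong_sym[OF R frobenius_add[OF R assms(3) this is_subringD(3)[OF R z fz]]] show ?thesis .
  qed
  ultimately have "ring_cong ?R (of_nat q) (a + z ^ q * poly f (z ^ q)) ((a + z * poly f z) ^ q)"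
    unfolding power_mult_distrib by (rule ring_cong_trans[OF R])
  then show ?case by simp
qed

text \<open>This is Dedekind's proof of the irreducibility of the cyclotomic polynomials. If
  \<open>y\<close> is a root of \<open>f\<close>, then the value at \<open>y ^ q\<close> is
  divisible by the prime \<open>q\<close>, and therefore vanishes for all but finitely many
  \<open>q\<close>. The exponent \<open>A\<close> can be changed modulo \<open>n\<close> in such a
  way that no exceptional prime divides it.\<close>

theorem integral_relation_conjugate:
  assumes "n > 0" "coprime A n" "int_poly f" "z \<in> mu n" "poly f z = 0"
  shows "poly f (z ^ A) = 0"
proof -
  define bad where "bad = (\<Union>y\<in>{y \<in> mu n. poly f y \<noteq> 0}.
    {q. Factorial_Ring.prime q \<and> ring_cong (zspan (mu n)) (of_nat q) (poly f y) 0})"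
  have fin: "finite bad"
    unfolding bad_def
    using finite_mu[OF assms(1)] finite_prime_divisors_zspan[OF assms(1) poly_in_zspan[OF _ assms(3)]]
    by (intro finite_UN_I) auto
  note pw = mu_power[of _ n]
  have step: "poly f (y ^ q) = 0" if y: "y \<in> mu n" "poly f y = 0" and q: "Factorial_Ring.prime q" "q \<notin> bad" for y q
  proof (rule ccontr)
    assume "poly f (y ^ q) \<noteq> 0"
    moreover have "ring_cong (zspan (mu n)) (of_nat q) (poly f (y ^ q)) 0"
      using poly_frobenius[OF y(1) assms(3) q(1)] y(2) q(1) by (simp add: zero_power prime_gt_0_nat)
    ultimately show False using q pw[OF y(1), of q] by (auto simp: bad_def)
  qed
  have all: "poly f (y ^ B) = 0" if "y \<in> mu n" "poly f y = 0" "B > 0" "\<And>q. Factorial_Ring.prime q \<Longrightarrow> q dvd B \<Longrightarrow> q \<notin> bad" for y B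
    using that
  proof (induction B arbitrary: y rule: prime_divisors_induct)
    case (factor q B)
    have "B > 0" using factor.prems(3) by (cases B) auto
    have "poly f ((y ^ q) ^ B) = 0"
    proof (rule factor.IH)
      show "y ^ q \<in> mu n" using pw factor by auto
      show "poly f (y ^ q) = 0" using step[OF factor.prems(1,2) factor.hyps] factor.prems(4)[OF factor.hyps] by auto
    qed (use factor \<open>B > 0\<close> in auto)
    then show ?case by (simp add: power_mult)
  qed auto
  \<comment> \<open>An exceptional prime divides exactly one of \<open>A\<close> and \<open>n *
    t\<close>, hence not their sum.\<close>
  define t where "t = \<Prod>{q \<in> bad. \<not> q dvd A}"
  have primes: "Factorial_Ring.prime q" if "q \<in> bad" for q using that by (auto simp: bad_def)
  have tpos: "t > 0" unfolding t_def using primes by (auto intro!: prod_pos simp: prime_gt_0_nat)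
  have tdvd: "q dvd t \<longleftrightarrow> \<not> q dvd A" if qbad: "q \<in> bad" for q
  proof
    assume "q dvd t"
    then obtain r where r: "r \<in> bad" "\<not> r dvd A" "q dvd r"
      unfolding t_def using prime_dvd_prod_iff[of "{q \<in> bad. \<not> q dvd A}" q "\<lambda>x. x"] fin primes[OF qbad] by auto
    then have "q = r" using primes qbad by (simp add: primes_dvd_imp_eq)
    then show "\<not> q dvd A" using r by simp
  next
    assume "\<not> q dvd A"
    then show "q dvd t" unfolding t_def using fin qbad by (intro dvd_prodI[of _ _ "\<lambda>x. x", simplified]) auto
  qed
  define B where "B = A + n * t"
  have "q \<notin> bad" if q: "Factorial_Ring.prime q" "q dvd B" for q
  proof
    assume "q \<in> bad"
    show False
    proof (cases "q dvd A")
      case True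
      then have "q dvd n * t" using q(2) by (simp add: B_def dvd_add_right_iff)
      moreover have "\<not> q dvd n" using True assms(2) q(1) by (metis coprime_common_divisor not_prime_unit)
      ultimately have "q dvd t" using q(1) by (simp add: prime_dvd_mult_iff)
      then show False using tdvd[OF \<open>q \<in> bad\<close>] True by simp
    next
      case False
      then have "q dvd n * t" using tdvd[OF \<open>q \<in> bad\<close>] by simp
      then have "q dvd A" using q(2) by (simp add: B_def dvd_add_left_iff)
      then show False using False by simp
    qed
  qed
  then have "poly f (z ^ B) = 0" using all[OF assms(4,5)] assms(1) tpos by (simp add: B_def)
  moreover have "z ^ B = z ^ A" using assms(4) by (simp add: B_def mu_def power_add power_mult)
  ultimately show ?thesis by simp
qed

lemma rat_poly_clear:
  assumes "rat_poly f"
  obtains d :: int where "d > 0" "int_poly (Polynomial.smult (of_int d) f)"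
proof -
  have "\<exists>d::int. d > 0 \<and> int_poly (Polynomial.smult (of_int d) f)"
    using assms
  proof (induction f)
    case 0
    then show ?case by (auto simp: int_poly_def intro: exI[of _ 1])
  next
    case (pCons a f)
    then obtain d :: int where d: "d > 0" "int_poly (Polynomial.smult (of_int d) f)" by (auto simp: rat_poly_pCons)
    have "a \<in> \<rat>" using pCons.prems by (simp add: rat_poly_pCons)
    then obtain r where r: "a = of_rat r" by (auto elim: Rats_cases)
    obtain i j where ij: "quotient_of r = (i, j)" by force
    have j: "j > 0" using quotient_of_denom_pos[OF ij] .
    have "a * of_int j = of_int i" using quotient_of_div[OF ij] j by (simp add: r of_rat_divide)
    then have "of_int (d * j) * a = of_int (d * i)" by (simp add: mult_ac)
    moreover have "Polynomial.smult (of_int (d * j)) f = Polynomial.smult (of_int j) (Polynomial.smult (of_int d) f)"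
      by (simp add: mult.commute)
    ultimately have "Polynomial.smult (of_int (d * j)) (pCons a f)
        = pCons (of_int (d * i)) (Polynomial.smult (of_int j) (Polynomial.smult (of_int d) f))"
      by (simp only: smult_pCons)
    moreover have "int_poly (Polynomial.smult (of_int j) (Polynomial.smult (of_int d) f))"
      using d(2) unfolding int_poly_def coeff_smult[of "of_int j"] by (intro allI Ints_mult Ints_of_int) auto
    ultimately have "int_poly (Polynomial.smult (of_int (d * j)) (pCons a f))"
      by (simp only: int_poly_pCons Ints_of_int)
    then show ?case using mult_pos_pos[OF d(1) j] by blast
  qed
  then show ?thesis using that by auto
qed

lemma rational_relation_conjugate:
  assumes "n > 0" "coprime A n" "rat_poly f" "z \<in> mu n" "poly f z = 0"
  shows "poly f (z ^ A) = 0"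
proof -
  obtain d :: int where d: "d > 0" "int_poly (Polynomial.smult (of_int d) f)" using rat_poly_clear[OF assms(3)] .
  then show ?thesis using integral_relation_conjugate[OF assms(1,2) d(2) assms(4)] assms(5) by simp
qed

definition zeta :: "nat \<Rightarrow> complex" where
  "zeta n = cis (2 * pi / real n)"

lemma mu_eq_zeta_powers: "n > 0 \<Longrightarrow> mu n = (\<lambda>k. zeta n ^ k) ` {..<n}"
  unfolding zeta_def by (rule mu_eq_powers)

lemma zeta_power_eq_iff:
  assumes "n > 0"
  shows "zeta n ^ i = zeta n ^ j \<longleftrightarrow> [i = j] (mod n)"
proof -
  have "zeta n ^ i = exp (2 * of_real pi * \<i> * of_nat i / of_nat n)" for i
  proof -
    have "zeta n ^ i = cis (real i * (2 * pi / real n))" by (simp add: zeta_def Complex.DeMoivre)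
    then show ?thesis by (simp add: cis_conv_exp mult_ac)
  qed
  then show ?thesis using complex_root_unity_eq[of n i j] assms by (simp add: cong_def)
qed

lemma zeta_in_mu: "n > 0 \<Longrightarrow> zeta n \<in> mu n"
  using zeta_power_eq_iff[of n n 0] by (simp add: mu_def cong_def)

lemma zeta_level: "n > 0 \<Longrightarrow> m > 0 \<Longrightarrow> zeta (n * m) ^ m = zeta n"
  unfolding zeta_def Complex.DeMoivre by (rule arg_cong[where f = cis]) simp

lemma mu_power_cong:
  assumes "z \<in> mu n" "[i = j] (mod n)"
  shows "z ^ i = z ^ j"
proof -
  have "z ^ i = z ^ (i mod n)" for i
    using assms(1) power_add[of z "n * (i div n)" "i mod n"] by (simp add: mu_def power_mult)
  then show ?thesis using assms(2) by (metis cong_def)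
qed

lemma qspan_mu_eq_polys:
  assumes "n > 0" "x \<in> qspan (mu n)"
  obtains f where "rat_poly f" "x = poly f (zeta n)"
proof -
  have "\<exists>f. rat_poly f \<and> x = poly f (zeta n)"
    using assms(2)
  proof (induction rule: QV.span_induct_alt)
    case base
    then show ?case by (intro exI[of _ 0]) (simp add: rat_poly_def)
  next
    case (step c z y)
    obtain f where f: "rat_poly f" "y = poly f (zeta n)" using step by auto
    obtain k where k: "z = zeta n ^ k" using step(1) mu_eq_zeta_powers[OF assms(1)] by auto
    have "rat_poly (Polynomial.monom (of_rat c) k + f)"
      using f by (auto simp: rat_poly_def)
    then show ?case using f k by (intro exI[of _ "Polynomial.monom (of_rat c) k + f"]) (simp add: poly_monom rat_scale_def)
  qed
  then show ?thesis using that by auto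
qed

lemma poly_in_qspan:
  assumes "z \<in> mu n" "rat_poly f"
  shows "poly f z \<in> qspan (mu n)"
  using assms(2)
proof (induction f)
  case 0
  then show ?case by (auto intro: QV.span_zero)
next
  case (pCons a f)
  then obtain k where "a = of_rat k" by (auto simp: rat_poly_pCons elim: Rats_cases)
  then show ?case
    using pCons QV.span_base[OF assms(1)]
    by (auto simp: rat_poly_pCons intro!: QV.span_add of_rat_in_qspan qspan_mult mult_closed_mu)
qed

text \<open>The automorphism that raises roots of unity to the power \<open>A\<close>. An element
  is expressed as a polynomial in a primitive root, and by the irreducibility of the cyclotomic
  polynomial the choice of this polynomial does not matter.\<close>

definition gal :: "nat \<Rightarrow> nat \<Rightarrow> complex \<Rightarrow> complex" where
  "gal n A x = poly (SOME f. rat_poly f \<and> x = poly f (zeta n)) (zeta n ^ A)"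

context
  fixes n A :: nat
  assumes n: "n > 0" and A: "coprime A n"
begin

lemma gal_poly:
  assumes "rat_poly f"
  shows "gal n A (poly f (zeta n)) = poly f (zeta n ^ A)"
proof -
  define g where "g = (SOME g. rat_poly g \<and> poly f (zeta n) = poly g (zeta n))"
  have g: "rat_poly g \<and> poly f (zeta n) = poly g (zeta n)"
    unfolding g_def by (rule someI[of _ f]) (use assms in auto)
  have "rat_poly (g - f)" using g assms by (auto simp: rat_poly_def)
  then have "poly (g - f) (zeta n ^ A) = 0"
    by (rule rational_relation_conjugate[OF n A _ zeta_in_mu[OF n]]) (use g in simp)
  then show ?thesis by (simp add: gal_def g_def)
qed

lemma gal_add:
  assumes "x \<in> qspan (mu n)" "y \<in> qspan (mu n)"
  shows "gal n A (x + y) = gal n A x + gal n A y"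
proof -
  obtain f g where fg: "rat_poly f" "x = poly f (zeta n)" "rat_poly g" "y = poly g (zeta n)"
    using assms qspan_mu_eq_polys[OF n] by metis
  moreover have "rat_poly (f + g)" using fg by (auto simp: rat_poly_def)
  ultimately show ?thesis using gal_poly[of "f + g"] gal_poly[of f] gal_poly[of g] by simp
qed

lemma gal_mult:
  assumes "x \<in> qspan (mu n)" "y \<in> qspan (mu n)"
  shows "gal n A (x * y) = gal n A x * gal n A y"
proof -
  obtain f g where fg: "rat_poly f" "x = poly f (zeta n)" "rat_poly g" "y = poly g (zeta n)"
    using assms qspan_mu_eq_polys[OF n] by metis
  then show ?thesis using gal_poly[of "f * g"] gal_poly[of f] gal_poly[of g] rat_poly_mult by simp
qed

lemma gal_of_rat [simp]: "gal n A (of_rat q) = of_rat q"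
  using gal_poly[of "[:of_rat q:]"] by (simp add: rat_poly_pCons) (simp add: rat_poly_def)

lemma gal_root: 
  assumes "z \<in> mu n"
  shows "gal n A z = z ^ A"
proof -
  obtain k where k: "z = zeta n ^ k" using assms mu_eq_zeta_powers[OF n] by auto
  have "rat_poly (Polynomial.monom 1 k)" by (simp add: rat_poly_def)
  then show ?thesis using gal_poly[of "Polynomial.monom 1 k"]
    by (simp add: k poly_monom mult.commute flip: power_mult)
qed

lemma gal_one [simp]: "gal n A 1 = 1" and gal_zero [simp]: "gal n A 0 = 0"
  using gal_of_rat[of 1] gal_of_rat[of 0] by simp_all

lemma gal_of_nat [simp]: "gal n A (of_nat k) = of_nat k"
  using gal_of_rat[of "of_nat k"] by simp

lemma gal_rat_scale: "x \<in> qspan (mu n) \<Longrightarrow> gal n A (of_rat q * x) = of_rat q * gal n A x"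
  using gal_mult[OF of_rat_in_qspan[OF mult_closed_mu]] by simp

lemma gal_uminus: "x \<in> qspan (mu n) \<Longrightarrow> gal n A (- x) = - gal n A x"
  using gal_rat_scale[of x "-1"] by simp

lemma gal_diff: "x \<in> qspan (mu n) \<Longrightarrow> y \<in> qspan (mu n) \<Longrightarrow> gal n A (x - y) = gal n A x - gal n A y"
  using gal_add[of x "- y"] gal_uminus QV.span_neg[of y "mu n"] by simp

lemma gal_closed: "x \<in> qspan (mu n) \<Longrightarrow> gal n A x \<in> qspan (mu n)"
  using qspan_mu_eq_polys[OF n, of x] gal_poly poly_in_qspan[OF mu_power[OF zeta_in_mu[OF n]]] by metis

lemma gal_sum: "(\<And>i. i \<in> I \<Longrightarrow> f i \<in> qspan (mu n)) \<Longrightarrow> gal n A (sum f I) = (\<Sum>i\<in>I. gal n A (f i))"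
  by (induction I rule: infinite_finite_induct)
     (auto simp: gal_add is_subfield_sum[OF is_subfield_qspan_mu[OF n]])

lemma gal_prod: "(\<And>i. i \<in> I \<Longrightarrow> f i \<in> qspan (mu n)) \<Longrightarrow> gal n A (prod f I) = (\<Prod>i\<in>I. gal n A (f i))"
  by (induction I rule: infinite_finite_induct)
     (auto simp: gal_mult is_subfield_prod[OF is_subfield_qspan_mu[OF n]])

lemma gal_power: "x \<in> qspan (mu n) \<Longrightarrow> gal n A (x ^ k) = gal n A x ^ k"
  by (induction k) (auto simp: gal_mult is_subfieldD(9)[OF is_subfield_qspan_mu[OF n]])

lemma gal_zspan_closed:
  assumes "x \<in> zspan (mu n)"
  shows "gal n A x \<in> zspan (mu n)"
proof -
  have "x \<in> qspan (mu n) \<and> gal n A x \<in> zspan (mu n)"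
    using assms
  proof (induction rule: ZM.span_induct_alt)
    case base
    then show ?case by (simp add: ZM.span_zero QV.span_zero)
  next
    case (step c z y)
    have z: "z \<in> qspan (mu n)" using step(1) by (rule QV.span_base)
    have cz: "of_rat (of_int c) * z \<in> qspan (mu n)" using z by (rule qspan_of_rat_mult)
    have eq: "int_scale c z + y = of_rat (of_int c) * z + y" by (simp add: int_scale_def)
    have "gal n A (int_scale c z + y) = int_scale c (z ^ A) + gal n A y"
      unfolding eq using step cz z by (simp only: gal_add gal_rat_scale gal_root) (simp add: int_scale_def)
    moreover have "int_scale c (z ^ A) + gal n A y \<in> zspan (mu n)"
      using step by (intro ZM.span_add[OF ZM.span_scale[OF ZM.span_base[OF mu_power[OF step(1)]]]]) blast
    moreover have "int_scale c z + y \<in> qspan (mu n)"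
      unfolding eq using step cz by (intro QV.span_add) blast+
    ultimately show ?case by simp
  qed
  then show ?thesis ..
qed

lemma gal_nonzero:
  assumes "x \<in> qspan (mu n)" "x \<noteq> 0"
  shows "gal n A x \<noteq> 0"
proof
  assume "gal n A x = 0"
  then have "gal n A (x * inverse x) = 0"
    using gal_mult[OF assms(1) is_subfieldD(5)[OF is_subfield_qspan_mu[OF n] assms(1)]] by simp
  then show False using assms(2) by simp
qed

end

text \<open>Additive and rational homogeneous maps are determined by their values on
  generators.\<close>

lemma qspan_map_eqI:
  assumes "x \<in> qspan M"
    and "\<And>x y. x \<in> qspan M \<Longrightarrow> y \<in> qspan M \<Longrightarrow> f (x + y) = f x + f y"
    and "\<And>x q. x \<in> qspan M \<Longrightarrow> f (of_rat q * x) = of_rat q * f x"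
    and "\<And>x y. x \<in> qspan M \<Longrightarrow> y \<in> qspan M \<Longrightarrow> g (x + y) = g x + g y"
    and "\<And>x q. x \<in> qspan M \<Longrightarrow> g (of_rat q * x) = of_rat q * g x"
    and "\<And>z. z \<in> M \<Longrightarrow> f z = g z"
  shows "f x = g x"
proof -
  have "x \<in> qspan M \<and> f x = g x"
    using assms(1)
  proof (induction rule: QV.span_induct_alt)
    case base
    show ?case using assms(3)[OF QV.span_zero, of 0] assms(5)[OF QV.span_zero, of 0] by (simp add: QV.span_zero)
  next
    case (step c z y)
    have z: "z \<in> qspan M" using step(1) by (rule QV.span_base)
    have cz: "of_rat c * z \<in> qspan M" using z by (rule qspan_of_rat_mult)
    have y: "y \<in> qspan M" "f y = g y" using step by auto
    have "f (of_rat c * z + y) = g (of_rat c * z + y)"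
      using assms(2)[OF cz y(1)] assms(3)[OF z] assms(4)[OF cz y(1)] assms(5)[OF z] assms(6)[OF step(1)] y(2) by simp
    moreover have "of_rat c * z + y \<in> qspan M" using cz y(1) by (rule QV.span_add)
    ultimately show ?case unfolding rat_scale_def by blast
  qed
  then show ?thesis ..
qed

lemma gal_compose:
  assumes "n > 0" "coprime A n" "coprime B n" "x \<in> qspan (mu n)"
  shows "gal n A (gal n B x) = gal n (A * B) x"
proof (rule qspan_map_eqI[OF assms(4)])
  have AB: "coprime (A * B) n" using assms by simp
  show "gal n A (gal n B z) = gal n (A * B) z" if "z \<in> mu n" for z
    using gal_root[OF assms(1,2) mu_power[OF that]] gal_root[OF assms(1,3) that] gal_root[OF assms(1) AB that]
    by (simp add: mult.commute flip: power_mult)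
qed (use assms gal_add gal_rat_scale gal_closed in auto)

lemma gal_level:
  assumes "m > 0" "n > 0" "coprime A n" "coprime B m" "[A = B] (mod m)" "m dvd n" "x \<in> qspan (mu m)"
  shows "gal n A x = gal m B x"
proof (rule qspan_map_eqI[OF assms(7)])
  have sub: "qspan (mu m) \<subseteq> qspan (mu n)" by (rule qspan_mu_mono[OF assms(6)])
  then show "gal n A (x + y) = gal n A x + gal n A y" if "x \<in> qspan (mu m)" "y \<in> qspan (mu m)" for x y
    using gal_add[OF assms(2,3)] that by auto
  show "gal n A (of_rat q * x) = of_rat q * gal n A x" if "x \<in> qspan (mu m)" for x q
    using gal_rat_scale[OF assms(2,3)] that sub by auto
  show "gal n A z = gal m B z" if "z \<in> mu m" for z
    using gal_root[OF assms(2,3)] gal_root[OF assms(1,4)] that mu_mono[OF assms(6)] mu_power_cong[OF that assms(5)] by auto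
qed (use assms gal_add gal_rat_scale in auto)

lemma gal_cong:
  assumes "n > 0" "coprime A n" "[A = B] (mod n)" "x \<in> qspan (mu n)"
  shows "gal n A x = gal n B x"
proof -
  have "coprime B n" using cong_imp_coprime[OF assms(3)] assms(2) by simp
  then show ?thesis using gal_level[of n n A B x] assms by auto
qed

lemma gal_1:
  assumes "n > 0" "x \<in> qspan (mu n)"
  shows "gal n 1 x = x"
  by (rule qspan_map_eqI[OF assms(2)]) (use assms gal_add gal_rat_scale gal_root in auto)

section \<open>The profinite units as the Galois group\<close>

lemma cong_of_prime_powers:
  fixes A B n :: nat
  assumes "n > 0" "\<And>l. Factorial_Ring.prime l \<Longrightarrow> l dvd n \<Longrightarrow> [A = B] (mod l ^ multiplicity l n)"
  shows "[A = B] (mod n)"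
proof -
  define d where "d = nat \<bar>int A - int B\<bar>"
  have eq: "[A = B] (mod m) \<longleftrightarrow> m dvd d" for m
    unfolding d_def by (rule cong_altdef_nat')
  have "n dvd d"
  proof (cases "d = 0")
    case False
    show ?thesis
    proof (rule multiplicity_le_imp_dvd)
      fix l :: nat assume l: "Factorial_Ring.prime l"
      show "multiplicity l n \<le> multiplicity l d"
      proof (cases "l dvd n")
        case True
        then have "l ^ multiplicity l n dvd d" using assms(2)[OF l] eq by simp
        then show ?thesis using False l by (intro multiplicity_geI) (auto simp: prime_elem_not_unit)
      qed (simp add: not_dvd_imp_multiplicity_0)
    qed (use assms in auto)
  qed simp
  then show ?thesis using eq by simp
qed

lemma coprime_primesI:
  fixes A n :: nat
  assumes "\<And>l. Factorial_Ring.prime l \<Longrightarrow> l dvd n \<Longrightarrow> \<not> l dvd A"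
  shows "coprime A n"
proof (rule ccontr)
  assume "\<not> coprime A n"
  then have "gcd A n \<noteq> 1" using coprime_iff_gcd_eq_1[of A n] by blast
  then obtain l where "Factorial_Ring.prime l" "l dvd gcd A n" using prime_factor_nat by blast
  then show False using assms by auto
qed

lemma multiplicity_prime_pos:
  fixes l n :: nat
  assumes "Factorial_Ring.prime l" "n > 0" "l dvd n"
  shows "multiplicity l n > 0"
proof -
  have "l ^ 1 dvd n" using assms(3) by simp
  moreover have "\<not> is_unit l" using assms(1) not_prime_unit by blast
  ultimately have "multiplicity l n \<ge> 1" using assms(2) by (intro multiplicity_geI) auto
  then show ?thesis by linarith
qed

lemma padic_carrier_iff:
  "a \<in> carrier (padic_int_ring l) \<longleftrightarrow> (\<forall>k. a k \<in> {0..<int l ^ k} \<and> a (Suc k) mod int l ^ k = a k)"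
  by (simp add: padic_int_ring_def)

lemma padic_compat:
  assumes "a \<in> carrier (padic_int_ring l)" "j \<le> k"
  shows "a k mod int l ^ j = a j"
  using assms(2)
proof (induction k rule: dec_induct)
  case base
  then show ?case using assms(1) by (auto simp: padic_carrier_iff)
next
  case (step k)
  have "a (Suc k) mod int l ^ j = (a (Suc k) mod int l ^ k) mod int l ^ j"
    using step(1) by (simp add: mod_mod_cancel le_imp_power_dvd)
  then show ?case using step(3) assms(1) by (simp add: padic_carrier_iff)
qed

text \<open>The inverses modulo the powers of \<open>l\<close> are unique and hence compatible
  with each other.\<close>

lemma padic_units_iff:
  assumes "Factorial_Ring.prime l"
  shows "a \<in> carrier (padic_units l) \<longleftrightarrow> a \<in> carrier (padic_int_ring l) \<and> \<not> int l dvd a 1"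
proof
  assume "a \<in> carrier (padic_units l)"
  then obtain b where b: "a \<in> carrier (padic_int_ring l)"
    "a \<otimes>\<^bsub>padic_int_ring l\<^esub> b = \<one>\<^bsub>padic_int_ring l\<^esub>"
    by (auto simp: padic_units_def units_of_def Units_def)
  have "(a 1 * b 1) mod int l ^ 1 = 1 mod int l ^ 1"
    using fun_cong[OF b(2), of 1] by (simp add: padic_int_ring_def)
  then have *: "(a 1 * b 1) mod int l = 1" using assms prime_gt_1_nat[OF assms] by simp
  have "\<not> int l dvd a 1"
  proof
    assume "int l dvd a 1"
    then have "int l dvd a 1 * b 1" by (rule dvd_mult2)
    then show False using * by simp
  qed
  then show "a \<in> carrier (padic_int_ring l) \<and> \<not> int l dvd a 1" using b by simp
next
  assume a: "a \<in> carrier (padic_int_ring l) \<and> \<not> int l dvd a 1"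
  have l1: "int l > 1" using prime_gt_1_nat[OF assms] by simp
  have cop: "coprime (a k) (int l ^ k)" for k
  proof (cases k)
    case (Suc j)
    have "a k mod int l ^ 1 = a 1" using padic_compat[of a l 1 k] a Suc by simp
    then have "\<not> int l dvd a k" using a by (metis dvd_mod_iff dvd_refl power_one_right)
    then have "coprime (int l) (a k)" using assms by (intro prime_imp_coprime) auto
    then show ?thesis by (simp add: coprime_commute)
  qed simp
  have ex: "\<exists>x. x \<in> {0..<int l ^ k} \<and> [a k * x = 1] (mod int l ^ k)" for k
  proof -
    obtain x where x: "[a k * x = 1] (mod int l ^ k)" using cong_solve_coprime_int[OF cop[of k]] by blast
    have "[a k * (x mod int l ^ k) = 1] (mod int l ^ k)"
      using x by (simp add: cong_def mod_mult_right_eq)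
    then show ?thesis using l1 by (intro exI[of _ "x mod int l ^ k"]) auto
  qed
  then obtain b where b: "\<And>k. b k \<in> {0..<int l ^ k}" "\<And>k. [a k * b k = 1] (mod int l ^ k)" by metis
  have "b (Suc k) mod int l ^ k = b k" for k
  proof -
    have "[a (Suc k) * b (Suc k) = 1] (mod int l ^ k)"
      using b(2)[of "Suc k"] by (rule cong_dvd_modulus) (simp add: le_imp_power_dvd)
    moreover have ak: "[a (Suc k) = a k] (mod int l ^ k)" using a by (simp add: padic_carrier_iff cong_def)
    ultimately have "[a k * b (Suc k) = 1] (mod int l ^ k)"
      using cong_trans[OF cong_sym[OF cong_scalar_right[OF ak]]] by blast
    then have "[a k * b (Suc k) = a k * b k] (mod int l ^ k)" using b(2)[of k] cong_sym cong_trans by blast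
    then have "[b (Suc k) = b k] (mod int l ^ k)" using cong_mult_lcancel[OF cop[of k]] by blast
    then show ?thesis using b(1)[of k] by (simp add: cong_def)
  qed
  then have "b \<in> carrier (padic_int_ring l)" using b by (simp add: padic_carrier_iff)
  moreover have "a \<otimes>\<^bsub>padic_int_ring l\<^esub> b = \<one>\<^bsub>padic_int_ring l\<^esub>" "b \<otimes>\<^bsub>padic_int_ring l\<^esub> a = \<one>\<^bsub>padic_int_ring l\<^esub>"
    using b(2) by (auto simp: padic_int_ring_def cong_def mult.commute)
  ultimately show "a \<in> carrier (padic_units l)"
    using a by (auto simp: padic_units_def units_of_def Units_def)
qed

lemma padic_unitI:
  assumes "Factorial_Ring.prime l" "\<And>k. [c (Suc k) = c k] (mod int l ^ k)" "\<not> int l dvd c 1"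
  shows "(\<lambda>k. c k mod int l ^ k) \<in> carrier (padic_units l)"
proof -
  have l1: "int l > 1" using prime_gt_1_nat[OF assms(1)] by simp
  have "(c (Suc k) mod int l ^ Suc k) mod int l ^ k = c k mod int l ^ k" for k
    using assms(2)[of k] by (simp add: mod_mod_cancel cong_def)
  then show ?thesis using assms(1,3) l1 by (simp add: padic_units_iff padic_carrier_iff dvd_mod_iff)
qed

lemma padic_units_one: "Factorial_Ring.prime l \<Longrightarrow> \<one>\<^bsub>padic_units l\<^esub> = (\<lambda>k. 1 mod int l ^ k)"
  by (simp add: padic_units_def units_of_def padic_int_ring_def)

lemma padic_units_one_closed:
  assumes "Factorial_Ring.prime l"
  shows "\<one>\<^bsub>padic_units l\<^esub> \<in> carrier (padic_units l)"
  using padic_unitI[OF assms, of "\<lambda>k. 1"] prime_gt_1_nat[OF assms] by (simp add: padic_units_one[OF assms])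

lemma padic_units_pow:
  "(a [^]\<^bsub>padic_units l\<^esub> n) k mod int l ^ k = (a k) ^ n mod int l ^ k"
proof (induction n)
  case 0
  then show ?case by (simp add: nat_pow_def padic_units_def units_of_def padic_int_ring_def)
next
  case (Suc n)
  have "a [^]\<^bsub>padic_units l\<^esub> Suc n = (\<lambda>k. ((a [^]\<^bsub>padic_units l\<^esub> n) k * a k) mod int l ^ k)"
    by (simp add: nat_pow_def padic_units_def units_of_def padic_int_ring_def)
  then have "(a [^]\<^bsub>padic_units l\<^esub> Suc n) k mod int l ^ k = ((a [^]\<^bsub>padic_units l\<^esub> n) k mod int l ^ k * a k) mod int l ^ k"
    by (simp add: mod_mult_left_eq)
  then show ?case unfolding Suc by (simp add: mod_mult_left_eq mod_mult_right_eq mult.commute)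
qed

lemma Delta_at_iff:
  assumes "Factorial_Ring.prime l"
  shows "a \<in> Delta_at l \<longleftrightarrow> a \<in> carrier (padic_units l) \<and> (\<exists>n>0. \<forall>k. [a k ^ n = 1] (mod int l ^ k))"
proof -
  have red: "b k mod int l ^ k = b k" if "b = c [^]\<^bsub>padic_units l\<^esub> (n::nat)" for b c n k
    unfolding that by (cases n) (simp_all add: nat_pow_def padic_units_def units_of_def padic_int_ring_def)
  have "a [^]\<^bsub>padic_units l\<^esub> n = \<one>\<^bsub>padic_units l\<^esub> \<longleftrightarrow> (\<forall>k. [a k ^ n = 1] (mod int l ^ k))" for n :: nat
    using padic_units_pow[of l a n] red[OF refl]
    by (auto simp: padic_units_one[OF assms] cong_def fun_eq_iff)
  then show ?thesis by (auto simp: Delta_at_def)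
qed

text \<open>The residue of \<open>A\<close> modulo \<open>n\<close> is the image of the profinite
  unit \<open>a\<close>, by the Chinese remainder theorem.\<close>

definition matches :: "(nat \<Rightarrow> nat \<Rightarrow> int) \<Rightarrow> nat \<Rightarrow> nat \<Rightarrow> bool" where
  "matches a n A \<longleftrightarrow>
    (\<forall>l. Factorial_Ring.prime l \<and> l dvd n \<longrightarrow> [A = nat (a l (multiplicity l n))] (mod l ^ multiplicity l n))"

lemma Zhat_unit:
  assumes "a \<in> carrier Zhat_units" "Factorial_Ring.prime l"
  shows "a l \<in> carrier (padic_int_ring l)" "\<not> int l dvd a l 1" "a l k \<ge> 0"
    "j \<le> k \<Longrightarrow> [nat (a l k) = nat (a l j)] (mod l ^ j)" "k > 0 \<Longrightarrow> \<not> l dvd nat (a l k)"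
proof -
  have "a l \<in> carrier (padic_units l)" using assms by (auto simp: Zhat_units_def primes_def)
  then show a: "a l \<in> carrier (padic_int_ring l)" "\<not> int l dvd a l 1" using padic_units_iff[OF assms(2)] by auto
  have pos: "a l k \<ge> 0" for k using a(1) by (auto simp: padic_carrier_iff)
  then show "a l k \<ge> 0" .
  have cong: "[nat (a l k) = nat (a l j)] (mod l ^ j)" if "j \<le> k" for j k
  proof -
    have "[a l k = a l j] (mod int l ^ j)"
      using padic_compat[OF a(1) that] by (simp add: cong_def) (metis mod_mod_trivial)
    then have "[int (nat (a l k)) = int (nat (a l j))] (mod int (l ^ j))" using pos by simp
    then show ?thesis unfolding cong_int_iff .
  qed
  then show "[nat (a l k) = nat (a l j)] (mod l ^ j)" if "j \<le> k" using that by blast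
  show "\<not> l dvd nat (a l k)" if "k > 0"
  proof -
    have "[nat (a l k) = nat (a l 1)] (mod l)" using cong[of 1 k] that by simp
    moreover have "\<not> l dvd nat (a l 1)" using a(2) pos[of 1] by (metis int_dvd_int_iff int_nat_eq)
    ultimately show ?thesis using cong_dvd_iff by blast
  qed
qed

lemma matches_exists:
  assumes "a \<in> carrier Zhat_units" "n > 0"
  obtains A where "matches a n A"
proof -
  have "\<exists>A. \<forall>l\<in>prime_factors n. [A = nat (a l (multiplicity l n))] (mod l ^ multiplicity l n)"
    by (rule chinese_remainder_nat) (auto intro!: primes_coprime)
  then show ?thesis using that assms(2) by (auto simp: matches_def prime_factors_dvd)
qed

lemma matches_coprime:
  assumes "a \<in> carrier Zhat_units" "n > 0" "matches a n A"
  shows "coprime A n"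
proof (rule coprime_primesI)
  fix l assume l: "Factorial_Ring.prime l" "l dvd n"
  define k where "k = multiplicity l n"
  have k: "k > 0" using multiplicity_prime_pos l assms(2) by (simp add: k_def)
  have "[A = nat (a l k)] (mod l ^ k)" using assms(3) l by (simp add: matches_def k_def)
  then have "[A = nat (a l k)] (mod l)" using k by (elim cong_dvd_modulus_nat) simp
  then show "\<not> l dvd A" using Zhat_unit(5)[OF assms(1) l(1) k] cong_dvd_iff by blast
qed

lemma matches_dvd:
  assumes "a \<in> carrier Zhat_units" "n > 0" "matches a n A" "m dvd n"
  shows "matches a m A"
  unfolding matches_def
proof (intro allI impI)
  fix l assume l: "Factorial_Ring.prime l \<and> l dvd m"
  have le: "multiplicity l m \<le> multiplicity l n" using assms(2,4) by (intro dvd_imp_multiplicity_le) auto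
  have "[A = nat (a l (multiplicity l n))] (mod l ^ multiplicity l n)"
    using assms(3,4) l dvd_trans unfolding matches_def by blast
  then have "[A = nat (a l (multiplicity l n))] (mod l ^ multiplicity l m)"
    by (rule cong_dvd_modulus_nat) (simp add: le le_imp_power_dvd)
  then show "[A = nat (a l (multiplicity l m))] (mod l ^ multiplicity l m)"
    using Zhat_unit(4)[OF assms(1) _ le] l cong_trans by blast
qed

lemma matches_unique:
  assumes "n > 0" "matches a n A" "matches a n B"
  shows "[A = B] (mod n)"
proof (rule cong_of_prime_powers[OF assms(1)])
  fix l assume "Factorial_Ring.prime l" "l dvd n"
  then show "[A = B] (mod l ^ multiplicity l n)"
    using assms(2,3) cong_trans[OF _ cong_sym] unfolding matches_def by blast
qed

lemma Gal_Q_cyc: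
  assumes "\<sigma> \<in> Gal Q_cyc"
  shows "x \<in> Q_cyc \<Longrightarrow> \<sigma> x \<in> Q_cyc" "x \<in> Q_cyc \<Longrightarrow> y \<in> Q_cyc \<Longrightarrow> \<sigma> (x + y) = \<sigma> x + \<sigma> y"
    "x \<in> Q_cyc \<Longrightarrow> y \<in> Q_cyc \<Longrightarrow> \<sigma> (x * y) = \<sigma> x * \<sigma> y" "\<sigma> 1 = 1" "\<sigma> (of_rat q) = of_rat q"
    "x \<in> Q_cyc \<Longrightarrow> \<sigma> (of_rat q * x) = of_rat q * \<sigma> x" "x \<in> Q_cyc \<Longrightarrow> x \<noteq> 0 \<Longrightarrow> \<sigma> x \<noteq> 0"
    "x \<in> Q_cyc \<Longrightarrow> \<sigma> (x ^ k) = \<sigma> x ^ k" "\<sigma> 0 = 0"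
proof -
  note Kc = is_subfieldD[OF is_subfield_Q_cyc]
  have h: "\<sigma> \<in> ring_hom (Cring\<lparr>carrier := Q_cyc\<rparr>) (Cring\<lparr>carrier := Q_cyc\<rparr>)" using assms by (simp add: Gal_def ring_iso_def)
  show c: "\<sigma> x \<in> Q_cyc" if "x \<in> Q_cyc" for x using ring_hom_closed[OF h] that by simp
  show add: "\<sigma> (x + y) = \<sigma> x + \<sigma> y" if "x \<in> Q_cyc" "y \<in> Q_cyc" for x y using ring_hom_add[OF h] that by simp
  show mult: "\<sigma> (x * y) = \<sigma> x * \<sigma> y" if "x \<in> Q_cyc" "y \<in> Q_cyc" for x y using ring_hom_mult[OF h] that by simp
  show one: "\<sigma> 1 = 1" using ring_hom_one[OF h] by simp
  show 0: "\<sigma> 0 = 0" using add[of 0 0] Kc by simp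
  have nat: "\<sigma> (of_nat k) = of_nat k" for k
    by (induction k) (use Kc in \<open>simp_all add: 0 one add\<close>)
  have neg: "\<sigma> (- x) = - \<sigma> x" if "x \<in> Q_cyc" for x 
  proof -
    have "\<sigma> x + \<sigma> (- x) = 0" using add[OF that Kc(4)[OF that]] 0 by simp
    then show ?thesis by (simp add: add_eq_0_iff)
  qed
  have int: "\<sigma> (of_int k) = of_int k" for k
    by (cases k rule: int_cases2) (simp_all add: nat neg Kc(10))
  show rat: "\<sigma> (of_rat q) = of_rat q" for q
  proof -
    obtain a b where ab: "quotient_of q = (a, b)" by force
    have b: "b > 0" using quotient_of_denom_pos[OF ab] .
    have "of_rat q * of_int b = (of_int a :: complex)"
      using quotient_of_div[OF ab] b by (simp add: of_rat_divide)
    then have "\<sigma> (of_rat q) * of_int b = of_int a" using mult[OF Kc(12) Kc(11), of q b] int by simp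
    then show ?thesis using \<open>of_rat q * of_int b = (of_int a :: complex)\<close> b
      by (metis mult_right_cancel of_int_eq_0_iff less_irrefl)
  qed
  show "\<sigma> (of_rat q * x) = of_rat q * \<sigma> x" if "x \<in> Q_cyc" using mult[OF Kc(12) that] rat by simp
  show "\<sigma> x \<noteq> 0" if "x \<in> Q_cyc" "x \<noteq> 0"
    using mult[of x "inverse x"] that Kc(5)[OF that(1)] one by auto
  show "\<sigma> (x ^ k) = \<sigma> x ^ k" if "x \<in> Q_cyc" for k
    using that Kc by (induction k) (simp_all add: one mult)
qed

text \<open>The automorphism raises a primitive root of unity to some power, and the exponent is
  determined by the action on the roots of prime power order.\<close>

lemma acts_as_gal:
  assumes "acts_as a \<sigma>" "n > 0" "matches a n A" "x \<in> qspan (mu n)"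
  shows "\<sigma> x = gal n A x"
proof -
  have a: "a \<in> carrier Zhat_units" and s: "\<sigma> \<in> Gal Q_cyc" using assms(1) by (auto simp: acts_as_def)
  have act: "\<sigma> z = z ^ nat (a l k)" if "Factorial_Ring.prime l" "z ^ (l ^ k) = 1" for l k z
    using assms(1) that by (auto simp: acts_as_def primes_def)
  have A: "coprime A n" using matches_coprime[OF a assms(2,3)] .
  have sub: "qspan (mu n) \<subseteq> Q_cyc" using qspan_mu_Q_cyc[OF assms(2)] .
  have zq: "zeta n \<in> Q_cyc" using sub QV.span_base[OF zeta_in_mu[OF assms(2)]] by auto
  have "\<sigma> (zeta n) ^ n = 1"
    using Gal_Q_cyc(8)[OF s zq, of n] zeta_in_mu[OF assms(2)] Gal_Q_cyc(4)[OF s] by (simp add: mu_def)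
  then obtain B where B: "\<sigma> (zeta n) = zeta n ^ B"
    using mu_eq_zeta_powers[OF assms(2)] by (auto simp: mu_def)
  have "[A = B] (mod n)"
  proof (rule cong_of_prime_powers[OF assms(2)])
    fix l assume l: "Factorial_Ring.prime l" "l dvd n"
    define q where "q = l ^ multiplicity l n"
    define m where "m = n div q"
    have "q dvd n" by (simp add: q_def multiplicity_dvd)
    then have nq: "n = q * m" by (simp add: m_def)
    have pos: "q > 0" "m > 0" using assms(2) nq by auto
    have zm: "zeta n ^ m = zeta q" unfolding nq by (rule zeta_level[OF pos])
    have "\<sigma> (zeta q) = zeta q ^ B"
      using Gal_Q_cyc(8)[OF s zq, of m] by (simp add: B mult.commute flip: zm power_mult)
    moreover have "\<sigma> (zeta q) = zeta q ^ nat (a l (multiplicity l n))"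
      using zeta_in_mu[OF pos(1)] by (intro act l) (simp add: mu_def q_def)
    ultimately have "[B = nat (a l (multiplicity l n))] (mod q)"
      using zeta_power_eq_iff[OF pos(1)] cong_sym by metis
    moreover have "[A = nat (a l (multiplicity l n))] (mod q)" using assms(3) l by (simp add: matches_def q_def)
    ultimately show "[A = B] (mod l ^ multiplicity l n)" unfolding q_def by (metis cong_sym cong_trans)
  qed
  then have zA: "zeta n ^ A = zeta n ^ B" by (rule mu_power_cong[OF zeta_in_mu[OF assms(2)]])
  show ?thesis
  proof (rule qspan_map_eqI[OF assms(4)])
    fix z assume "z \<in> mu n"
    then obtain k where k: "z = zeta n ^ k" using mu_eq_zeta_powers[OF assms(2)] by auto
    have "\<sigma> z = (zeta n ^ A) ^ k" using Gal_Q_cyc(8)[OF s zq] B zA by (simp add: k)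
    then show "\<sigma> z = gal n A z" using gal_root[OF assms(2) A \<open>z \<in> mu n\<close>] by (simp add: k mult.commute flip: power_mult)
  qed (use subsetD[OF sub] Gal_Q_cyc(2,6)[OF s] gal_add[OF assms(2) A] gal_rat_scale[OF assms(2) A] in auto)
qed

text \<open>Each element lies in the span of the roots of unity of some order \<open>n\<close>, on
  which the image of \<open>a\<close> modulo \<open>n\<close> acts; the results for different
  \<open>n\<close> agree.\<close>

definition automorphism :: "(nat \<Rightarrow> nat \<Rightarrow> int) \<Rightarrow> complex \<Rightarrow> complex" where
  "automorphism a = (\<lambda>x\<in>Q_cyc. let (n, A) = (SOME (n, A). n > 0 \<and> x \<in> qspan (mu n) \<and> matches a n A) in gal n A x)"

lemma automorphism_eq_gal:
  assumes a: "a \<in> carrier Zhat_units" and n: "n > 0" "matches a n A" "x \<in> qspan (mu n)"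
  shows "automorphism a x = gal n A x"
proof -
  define P where "P = (\<lambda>(n, A). n > 0 \<and> x \<in> qspan (mu n) \<and> matches a n A)"
  obtain m B where mB: "Eps P = (m, B)" by force
  have "P (n, A)" using n by (simp add: P_def)
  then have "P (m, B)" using someI[of P] mB by metis
  then have m: "m > 0" "x \<in> qspan (mu m)" "matches a m B" by (auto simp: P_def)
  have "m * n > 0" using m n by simp
  then obtain C where C: "matches a (m * n) C" using matches_exists[OF a] by blast
  have cop: "coprime C (m * n)" using matches_coprime[OF a \<open>m * n > 0\<close> C] .
  have "gal (m * n) C x = gal k D x" if "k \<in> {m, n}" "matches a k D" "x \<in> qspan (mu k)" for k D
  proof (rule gal_level)
    show k: "k > 0" "k dvd m * n" using that m n by auto
    show "[C = D] (mod k)" using matches_unique[OF k(1) matches_dvd[OF a \<open>m * n > 0\<close> C k(2)] that(2)] .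
    show "coprime D k" using matches_coprime[OF a k(1) that(2)] .
  qed (use that cop \<open>m * n > 0\<close> in auto)
  then have "gal m B x = gal n A x" using m n by (metis insertCI)
  moreover have "x \<in> Q_cyc" using n qspan_mu_Q_cyc by auto
  ultimately show ?thesis using mB by (simp add: automorphism_def P_def)
qed

lemma acts_as_automorphism:
  assumes a: "a \<in> carrier Zhat_units"
  shows "acts_as a (automorphism a)"
proof -
  have lev: "\<exists>n A. n > 0 \<and> matches a n A \<and> coprime A n \<and> x \<in> qspan (mu n) \<and> y \<in> qspan (mu n)" if xy: "x \<in> Q_cyc" "y \<in> Q_cyc" for x y
  proof -
    obtain m n where mn: "m > 0" "x \<in> qspan (mu m)" "n > 0" "y \<in> qspan (mu n)"
      using Q_cyc_level xy by metis
    then have pos: "m * n > 0" by simp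
    obtain A where A: "matches a (m * n) A" using matches_exists[OF a pos] .
    moreover have "x \<in> qspan (mu (m * n))" "y \<in> qspan (mu (m * n))"
      using mn qspan_mu_mono[of m "m * n"] qspan_mu_mono[of n "m * n"] by auto
    ultimately show ?thesis using matches_coprime[OF a pos A] pos by blast
  qed
  have hom: "automorphism a x \<in> Q_cyc \<and> automorphism a (x + y) = automorphism a x + automorphism a y \<and>
     automorphism a (x * y) = automorphism a x * automorphism a y \<and> (\<exists>u\<in>Q_cyc. automorphism a u = x) \<and>
     (automorphism a x = automorphism a y \<longrightarrow> x = y)" if xy: "x \<in> Q_cyc" "y \<in> Q_cyc" for x y
  proof -
    obtain n A where n: "n > 0" "matches a n A" "coprime A n" "x \<in> qspan (mu n)" "y \<in> qspan (mu n)"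
      using lev[OF xy] by blast
    note F = is_subfieldD[OF is_subfield_qspan_mu[OF n(1)]]
    note eq = automorphism_eq_gal[OF a n(1,2)]
    obtain B where B: "[A * B = 1] (mod n)" using cong_solve_coprime_nat[OF n(3)] by auto
    have copB: "coprime B n"
      by (metis B cong_imp_coprime cong_sym coprime_1_left coprime_mult_left_iff)
    have "gal n A (gal n B x) = x"
      using gal_compose[OF n(1,3) copB n(4)] gal_cong[OF n(1) _ B n(4)] gal_1[OF n(1,4)] n(3) copB by simp
    moreover have gB: "gal n B x \<in> qspan (mu n)" by (rule gal_closed[OF n(1) copB n(4)])
    ultimately have "\<exists>u\<in>Q_cyc. automorphism a u = x"
      using eq[OF gB] qspan_mu_Q_cyc[OF n(1)] by auto
    moreover have "x = y" if e: "automorphism a x = automorphism a y"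
    proof -
      have "gal n A (x - y) = 0" using e eq n gal_diff[OF n(1,3)] by simp
      then show ?thesis using gal_nonzero[OF n(1,3), of "x - y"] F(7)[OF n(4,5)] by auto
    qed
    moreover have "automorphism a x \<in> Q_cyc"
      using eq[OF n(4)] gal_closed[OF n(1,3,4)] qspan_mu_Q_cyc[OF n(1)] by auto
    moreover have "automorphism a (x + y) = automorphism a x + automorphism a y"
      using eq[OF F(2)[OF n(4,5)]] eq[OF n(4)] eq[OF n(5)] gal_add[OF n(1,3,4,5)] by simp
    moreover have "automorphism a (x * y) = automorphism a x * automorphism a y"
      using eq[OF F(3)[OF n(4,5)]] eq[OF n(4)] eq[OF n(5)] gal_mult[OF n(1,3,4,5)] by simp
    ultimately show ?thesis by blast
  qed
  have root: "automorphism a z = z ^ nat (a l k)" if l: "Factorial_Ring.prime l" and z: "z ^ (l ^ k) = 1" for l k z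
  proof -
    have pos: "l ^ k > 0" using l by (simp add: prime_gt_0_nat)
    have m: "matches a (l ^ k) (nat (a l k))"
      unfolding matches_def
    proof (intro allI impI)
      fix q assume q: "Factorial_Ring.prime q \<and> q dvd l ^ k"
      then have "q = l" using l by (meson prime_dvd_power primes_dvd_imp_eq)
      then show "[nat (a l k) = nat (a q (multiplicity q (l ^ k)))] (mod q ^ multiplicity q (l ^ k))"
        using l by (simp add: multiplicity_prime_power)
    qed
    have "z \<in> mu (l ^ k)" using z by (simp add: mu_def)
    then show ?thesis
      using automorphism_eq_gal[OF a pos m QV.span_base] gal_root[OF pos matches_coprime[OF a pos m]] by simp
  qed
  have "automorphism a \<in> ring_iso (Cring\<lparr>carrier := Q_cyc\<rparr>) (Cring\<lparr>carrier := Q_cyc\<rparr>)"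
    unfolding ring_iso_def ring_hom_def bij_betw_def inj_on_def
  proof (intro CollectI conjI ballI)
    show "automorphism a \<in> carrier (Cring\<lparr>carrier := Q_cyc\<rparr>) \<rightarrow> carrier (Cring\<lparr>carrier := Q_cyc\<rparr>)"
      using hom by auto
    have "automorphism a 1 = 1 ^ nat (a 2 0)" by (rule root) auto
    then show "automorphism a \<one>\<^bsub>Cring\<lparr>carrier := Q_cyc\<rparr>\<^esub> = \<one>\<^bsub>Cring\<lparr>carrier := Q_cyc\<rparr>\<^esub>" by simp
    show "automorphism a ` carrier (Cring\<lparr>carrier := Q_cyc\<rparr>) = carrier (Cring\<lparr>carrier := Q_cyc\<rparr>)"
      using hom by (auto simp: image_iff)
  qed (use hom in auto)
  moreover have "automorphism a \<in> extensional Q_cyc" by (simp add: automorphism_def)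
  ultimately show ?thesis using a root by (auto simp: acts_as_def Gal_def primes_def)
qed

text \<open>This replaces the automorphisms of the infinite extension by residues.\<close>

lemma fixed_subfield_level:
  assumes "D \<subseteq> carrier Zhat_units" "n > 0" "x \<in> qspan (mu n)"
  shows "x \<in> fixed_subfield K D \<longleftrightarrow> x \<in> K \<and> (\<forall>a\<in>D. \<forall>A. matches a n A \<longrightarrow> gal n A x = x)"
proof -
  have "(\<forall>\<sigma>. acts_as a \<sigma> \<longrightarrow> \<sigma> x = x) \<longleftrightarrow> (\<forall>A. matches a n A \<longrightarrow> gal n A x = x)" if "a \<in> D" for a
  proof -
    have a: "a \<in> carrier Zhat_units" using assms(1) that by auto
    obtain A where A: "matches a n A" using matches_exists[OF a assms(2)] .
    show ?thesis using acts_as_gal[OF _ assms(2) _ assms(3)] acts_as_automorphism[OF a] A by metis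
  qed
  then show ?thesis by (auto simp: fixed_subfield_def)
qed

section \<open>Torsion in the units of the \<open>l\<close>-adic integers\<close>

text \<open>This is the domain on which the \<open>l\<close>-adic logarithm preserves distances;
  for \<open>l = 2\<close> it is smaller than the set of all units congruent to 1 modulo
  \<open>l\<close>.\<close>

definition close_to_one :: "nat \<Rightarrow> int \<Rightarrow> bool" where
  "close_to_one l g \<longleftrightarrow> (if l = 2 then 4 dvd g - 1 else int l dvd g - 1)"

definition geometric :: "int \<Rightarrow> nat \<Rightarrow> int" where
  "geometric g m = (\<Sum>i<m. g ^ i)"

lemma geometric_mult: "(g - 1) * geometric g m = g ^ m - 1"
  unfolding geometric_def by (simp add: power_diff_1_eq)

lemma geometric_product: "geometric g (q * m) = geometric g q * geometric (g ^ q) m"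
proof (induction m)
  case (Suc m)
  have "geometric g (q * Suc m) = (\<Sum>i<q * m. g ^ i) + (\<Sum>i=q * m..<q * m + q. g ^ i)"
    unfolding geometric_def by (simp add: lessThan_atLeast0 sum.atLeastLessThan_concat add.commute)
  also have "(\<Sum>i=q * m..<q * m + q. g ^ i) = (\<Sum>i<q. g ^ (i + q * m))"
    using sum.shift_bounds_nat_ivl[of "\<lambda>i. g ^ i" 0 "q * m" q] by (simp add: lessThan_atLeast0 add.commute)
  also have "\<dots> = geometric g q * (g ^ q) ^ m"
    by (simp add: geometric_def sum_distrib_right power_add power_mult)
  finally show ?case using Suc by (simp add: geometric_def algebra_simps)
qed (simp add: geometric_def)

lemma close_to_one_dvd:
  assumes "close_to_one l g"
  shows "int l dvd g - 1"
proof (cases "l = 2")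
  case True
  then have "4 dvd g - 1" using assms by (simp add: close_to_one_def)
  then have "2 dvd g - 1" by (rule dvd_trans[rotated]) simp
  then show ?thesis using True by simp
qed (use assms in \<open>simp add: close_to_one_def\<close>)

lemma close_to_one_power: "close_to_one l g \<Longrightarrow> close_to_one l (g ^ m)"
  unfolding close_to_one_def geometric_mult[symmetric] by (simp split: if_splits)

text \<open>Modulo \<open>l\<^sup>2\<close> the sum of \<open>(1 + l h) ^ i\<close> is \<open>l +
  l h l (l - 1) / 2\<close>, which is \<open>l\<close> for odd \<open>l\<close>. For \<open>l =
  2\<close> the sum is \<open>1 + g\<close>, so that \<open>g\<close> has to be 1 modulo
  4.\<close>

lemma geometric_prime_same:
  assumes "Factorial_Ring.prime l" "close_to_one l g"
  obtains c where "geometric g l = int l * c" "\<not> int l dvd c"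
proof (cases "l = 2")
  case True
  then obtain c where c: "g = 1 + 4 * c" using assms(2) by (auto simp: close_to_one_def dvd_def algebra_simps)
  have "geometric g l = int l * (1 + 2 * c)" using True by (simp add: geometric_def c numeral_2_eq_2)
  moreover have "\<not> int l dvd 1 + 2 * c" using True by simp
  ultimately show ?thesis using that by blast
next
  case False
  obtain h where h: "g = 1 + int l * h"
    using close_to_one_dvd[OF assms(2)] by (auto simp: dvd_def algebra_simps)
  have "odd l" using assms(1) False prime_odd_nat prime_ge_2_nat[OF assms(1)] by force
  then obtain r where r: "l = 2 * r + 1" by (auto elim: oddE)
  have "[g ^ i = 1 + int i * (int l * h)] (mod (int l)\<^sup>2)" for i
  proof (induction i)
    case (Suc i)
    have "[g ^ i * g = (1 + int i * (int l * h)) * g] (mod (int l)\<^sup>2)"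
      using Suc by (rule cong_scalar_right)
    also have "(1 + int i * (int l * h)) * g = 1 + int (Suc i) * (int l * h) + (int l)\<^sup>2 * (int i * h\<^sup>2)"
      by (simp add: h algebra_simps power2_eq_square)
    also have "[\<dots> = 1 + int (Suc i) * (int l * h)] (mod (int l)\<^sup>2)"
      by (simp add: cong_iff_dvd_diff)
    finally show ?case by (simp add: mult.commute)
  qed simp
  then have "[geometric g l = (\<Sum>i<l. 1 + int i * (int l * h))] (mod (int l)\<^sup>2)"
    unfolding geometric_def by (intro cong_sum)
  also have "(\<Sum>i<l. 1 + int i * (int l * h)) = int l + (\<Sum>i<l. int i) * (int l * h)"
    by (simp add: sum.distrib sum_distrib_right)
  also have "(\<Sum>i<l. int i) = int l * int r"
  proof -
    have "2 * (\<Sum>i<l. int i) = int l * (int l - 1)"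
      by (induction l) (simp_all add: algebra_simps)
    then show ?thesis by (simp add: r)
  qed
  also have "[int l + int l * int r * (int l * h) = int l] (mod (int l)\<^sup>2)"
    by (simp add: cong_iff_dvd_diff power2_eq_square)
  finally obtain k where k: "geometric g l = int l + (int l)\<^sup>2 * k"
    by (auto simp: cong_iff_dvd_diff dvd_def algebra_simps)
  have "geometric g l = int l * (1 + int l * k)" by (simp add: k algebra_simps power2_eq_square)
  moreover have "\<not> int l dvd 1 + int l * k"
  proof
    assume "int l dvd 1 + int l * k"
    then have "int l dvd 1" by (simp add: dvd_add_left_iff)
    then show False using prime_gt_1_nat[OF assms(1)] by simp
  qed
  ultimately show ?thesis using that by blast
qed

lemma geometric_prime_other:
  assumes "Factorial_Ring.prime l" "Factorial_Ring.prime q" "q \<noteq> l" "close_to_one l g"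
  shows "\<not> int l dvd geometric g q"
proof -
  have "[g = 1] (mod int l)" using close_to_one_dvd[OF assms(4)] by (simp add: cong_iff_dvd_diff)
  then have "[geometric g q = (\<Sum>i<q. 1 ^ i)] (mod int l)"
    unfolding geometric_def by (intro cong_sum cong_pow)
  then have "[geometric g q = int q] (mod int l)" by simp
  from cong_dvd_iff[OF this] have "int l dvd geometric g q \<longleftrightarrow> l dvd q" by simp
  then show ?thesis using primes_dvd_imp_eq[OF assms(1,2)] assms(3) by auto
qed

text \<open>Both sides are multiplicative under the composition of \<open>m\<close> from prime
  factors. A factor different from \<open>l\<close> contributes a unit, and a factor
  \<open>l\<close> contributes \<open>l\<close>.\<close>

lemma geometric_decompose:
  assumes "Factorial_Ring.prime l" "m > 0" "close_to_one l g"
  shows "\<exists>c. geometric g m = int l ^ multiplicity l m * c \<and> \<not> int l dvd c"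
  using assms(2,3)
proof (induction m arbitrary: g rule: prime_divisors_induct)
  case (unit m)
  then show ?case using prime_gt_1_nat[OF assms(1)] by (auto simp: geometric_def)
next
  case (factor q m)
  have m: "m > 0" using factor.prems by (cases m) auto
  obtain c where c: "geometric (g ^ q) m = int l ^ multiplicity l m * c" "\<not> int l dvd c"
    using factor.IH[OF m close_to_one_power[OF factor.prems(2)]] by blast
  have pl: "Factorial_Ring.prime (int l)" using assms(1) by simp
  have mul: "multiplicity l (q * m) = multiplicity l q + multiplicity l m"
    using assms(1) m factor.hyps by (intro prime_elem_multiplicity_mult_distrib) (auto intro: prime_imp_prime_elem)
  show ?case
  proof (cases "q = l")
    case True
    obtain d where d: "geometric g l = int l * d" "\<not> int l dvd d"
      using geometric_prime_same[OF assms(1) factor.prems(2)] .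
    have "multiplicity l q = 1" using True assms(1) by (simp add: multiplicity_self prime_gt_0_nat not_prime_unit)
    then have "geometric g (q * m) = int l ^ multiplicity l (q * m) * (d * c)"
      using c d True mul by (simp add: geometric_product power_add)
    moreover have "\<not> int l dvd d * c" using c d pl by (simp add: prime_dvd_mult_iff)
    ultimately show ?thesis by blast
  next
    case False
    have "multiplicity l q = 0" using False assms(1) factor.hyps
      by (intro not_dvd_imp_multiplicity_0) (metis primes_dvd_imp_eq)
    then have "geometric g (q * m) = int l ^ multiplicity l (q * m) * (geometric g q * c)"
      using c by (simp add: geometric_product mul)
    moreover have "\<not> int l dvd geometric g q * c"
      using c pl geometric_prime_other[OF assms(1) factor.hyps False factor.prems(2)] by (simp add: prime_dvd_mult_iff)
    ultimately show ?thesis by blast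
  qed
qed auto

text \<open>The quotient of \<open>g ^ m - 1\<close> by \<open>g - 1\<close> is the geometric sum,
  whose valuation is that of \<open>m\<close>.\<close>

lemma power_minus_one_dvd_iff:
  assumes "Factorial_Ring.prime l" "m > 0" "close_to_one l g"
  shows "int l ^ (multiplicity l m + j) dvd g ^ m - 1 \<longleftrightarrow> int l ^ j dvd g - 1"
proof -
  obtain c where c: "geometric g m = int l ^ multiplicity l m * c" "\<not> int l dvd c"
    using geometric_decompose[OF assms] by blast
  have l0: "int l \<noteq> 0" using assms(1) by auto
  have cop: "coprime (int l ^ j) c" using c(2) assms(1) by (simp add: prime_imp_coprime)
  have "int l ^ (multiplicity l m + j) dvd g ^ m - 1 \<longleftrightarrow> int l ^ multiplicity l m * int l ^ j dvd int l ^ multiplicity l m * ((g - 1) * c)"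
    unfolding geometric_mult[symmetric] c(1) by (simp add: power_add mult_ac)
  also have "\<dots> \<longleftrightarrow> int l ^ j dvd (g - 1) * c" using l0 by simp
  also have "\<dots> \<longleftrightarrow> int l ^ j dvd g - 1" using cop by (simp add: coprime_dvd_mult_left_iff)
  finally show ?thesis .
qed

text \<open>The image modulo \<open>l ^ k\<close> of the torsion of the \<open>l\<close>-adic
  units, which consists of 1 and -1 for \<open>l = 2\<close> and of the roots of unity of order
  dividing \<open>l - 1\<close> otherwise.\<close>

definition torsion :: "nat \<Rightarrow> nat \<Rightarrow> nat \<Rightarrow> bool" where
  "torsion l k A \<longleftrightarrow> (if l = 2 then [A = 1] (mod 2 ^ k) \<or> [A + 1 = 0] (mod 2 ^ k) else [A ^ (l - 1) = 1] (mod l ^ k))"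

text \<open>Raising to the power \<open>n\<close> loses only finitely many \<open>l\<close>-adic
  digits near 1, so that an element of finite order there has all digits equal to those of
  1.\<close>

lemma torsion_near_one_trivial:
  assumes "Factorial_Ring.prime l" "n > 0"
    and "\<And>j k. j \<le> k \<Longrightarrow> [b k = b j] (mod int l ^ j)" "\<And>k. k \<ge> 2 \<Longrightarrow> close_to_one l (b k)"
    and "\<And>k. [b k ^ n = 1] (mod int l ^ k)"
  shows "[b k = 1] (mod int l ^ k)"
proof -
  define J where "J = multiplicity l n + (k + 2)"
  have "int l ^ (multiplicity l n + (k + 2)) dvd b J ^ n - 1"
    using assms(5)[of J] by (simp add: cong_iff_dvd_diff J_def)
  then have "int l ^ (k + 2) dvd b J - 1"
    by (rule iffD1[OF power_minus_one_dvd_iff[OF assms(1,2) assms(4)[of J]], rotated]) (simp add: J_def)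
  then have "int l ^ k dvd b J - 1" using power_le_dvd[of "int l" "k + 2"] by simp
  then have "[b J = 1] (mod int l ^ k)" by (simp add: cong_iff_dvd_diff)
  moreover have "[b J = b k] (mod int l ^ k)" by (rule assms(3)) (simp add: J_def)
  ultimately show ?thesis using cong_sym cong_trans by blast
qed

lemma padic_units_cong:
  assumes "Factorial_Ring.prime l" "a \<in> carrier (padic_units l)" "j \<le> k"
  shows "[a k = a j] (mod int l ^ j)"
  using padic_compat[of a l j k] assms by (simp add: padic_units_iff cong_def) (metis mod_mod_trivial)

text \<open>The power with exponent \<open>l - 1\<close>, or the product with a sign for \<open>l
  = 2\<close>, moves a unit close to 1, where there is no torsion.\<close>

lemma Delta_at_torsion:
  assumes l: "Factorial_Ring.prime l" and a: "a \<in> Delta_at l" and A: "[int A = a k] (mod int l ^ k)"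
  shows "torsion l k A"
proof -
  obtain n where n: "n > 0" "\<And>k. [a k ^ n = 1] (mod int l ^ k)" and au: "a \<in> carrier (padic_units l)"
    using a Delta_at_iff[OF l] by auto
  note comp = padic_units_cong[OF l au]
  have nd: "\<not> int l dvd a 1" using padic_units_iff[OF l] au by auto
  show ?thesis
  proof (cases "l = 2")
    case False
    have "[a k ^ (l - 1) = 1] (mod int l ^ k)"
    proof (rule torsion_near_one_trivial[OF l n(1), where b = "\<lambda>k. a k ^ (l - 1)"])
      show "[(a k ^ (l - 1)) ^ n = 1] (mod int l ^ k)" for k
        using cong_pow[OF n(2)[of k], of "l - 1"] by (simp add: mult.commute flip: power_mult)
      fix k :: nat assume k: "k \<ge> 2"
      have "[a k = a 1] (mod int l)" using comp[of 1 k] k by simp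
      then have nk: "\<not> int l dvd a k" using nd cong_dvd_iff by blast
      define c where "c = nat (a k mod int l)"
      have lp: "l > 0" using prime_gt_0_nat[OF l] .
      have ck: "int c = a k mod int l" using lp by (simp add: c_def)
      have "\<not> l dvd c" using nk unfolding int_dvd_int_iff[symmetric] ck by (simp add: dvd_mod_iff)
      then have "[c ^ (l - 1) = 1] (mod l)" using fermat_theorem[OF l] by simp
      then have "[int c ^ (l - 1) = 1] (mod int l)" by (metis cong_int_iff of_nat_1 of_nat_power)
      moreover have "[int c ^ (l - 1) = a k ^ (l - 1)] (mod int l)" by (rule cong_pow) (simp add: ck cong_def)
      ultimately have "[a k ^ (l - 1) = 1] (mod int l)" using cong_sym cong_trans by blast
      then show "close_to_one l (a k ^ (l - 1))" using False by (simp add: close_to_one_def cong_iff_dvd_diff)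
    qed (use comp in \<open>auto intro: cong_pow\<close>)
    moreover have "[int A ^ (l - 1) = a k ^ (l - 1)] (mod int l ^ k)" using A by (rule cong_pow)
    ultimately have "[int (A ^ (l - 1)) = int 1] (mod int (l ^ k))" using cong_trans by simp blast
    then have "[A ^ (l - 1) = 1] (mod l ^ k)" unfolding cong_int_iff .
    then show ?thesis using False by (simp add: torsion_def)
  next
    case True
    have odd: "odd (a 2)"
    proof -
      have "[a 2 = a 1] (mod int l)" using comp[of 1 2] by simp
      then show ?thesis using nd cong_dvd_iff True by fastforce
    qed
    then have "a 2 mod 4 = 1 \<or> a 2 mod 4 = 3" by presburger
    then have "4 dvd 1 * a 2 - 1 \<or> 4 dvd (-1) * a 2 - 1" by presburger
    then have "\<exists>s\<in>{1, -1}. 4 dvd s * a 2 - 1" by blast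
    then obtain s :: int where s: "s \<in> {1, -1}" "4 dvd s * a 2 - 1" by blast
    have "[s * a k = 1] (mod int l ^ k)"
    proof (rule torsion_near_one_trivial[OF l, where b = "\<lambda>k. s * a k" and n = "2 * n"])
      show "[(s * a k) ^ (2 * n) = 1] (mod int l ^ k)" for k
      proof -
        have "(s * a k) ^ (2 * n) = ((s * a k) ^ 2) ^ n" by (rule power_mult)
        also have "(s * a k) ^ 2 = a k ^ 2" using s(1) by (auto simp: power2_eq_square)
        also have "(a k ^ 2) ^ n = (a k ^ n) ^ 2" by (metis power_mult mult.commute)
        finally have "(s * a k) ^ (2 * n) = (a k ^ n) ^ 2" .
        then show ?thesis using cong_pow[OF n(2)[of k], of 2] by simp
      qed
      fix k :: nat assume k: "k \<ge> 2"
      have "[s * a k = s * a 2] (mod int l ^ 2)" using comp[OF k] by (rule cong_scalar_left)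
      moreover have "[s * a 2 = 1] (mod int l ^ 2)" using s(2) True by (simp add: cong_iff_dvd_diff)
      ultimately have "[s * a k = 1] (mod int l ^ 2)" by (rule cong_trans)
      then show "close_to_one l (s * a k)" using True by (simp add: close_to_one_def cong_iff_dvd_diff)
    qed (use comp n in \<open>auto intro: cong_scalar_left\<close>)
    moreover have "[s * int A = s * a k] (mod int l ^ k)" using A by (rule cong_scalar_left)
    ultimately have "[s * int A = 1] (mod int l ^ k)" using cong_trans by blast
    then have "[int A = 1] (mod int l ^ k) \<or> [int A + 1 = 0] (mod int l ^ k)"
      using s(1) by (auto simp: cong_iff_dvd_diff) (metis dvd_minus_iff minus_add_distrib uminus_add_conv_diff add.commute minus_diff_eq diff_minus_eq_add)
    then have "[int A = int 1] (mod int (l ^ k)) \<or> [int (A + 1) = int 0] (mod int (l ^ k))" by (simp add: add.commute)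
    then show ?thesis unfolding cong_int_iff using True by (simp add: torsion_def)
  qed
qed

text \<open>For odd \<open>l\<close> the lift is the Teichmueller representative, the limit of the
  powers \<open>A ^ (l ^ j)\<close>.\<close>

lemma torsion_lifts:
  assumes l: "Factorial_Ring.prime l" and A: "torsion l k A"
  shows "\<exists>a\<in>Delta_at l. [int A = a k] (mod int l ^ k)"
proof (cases "k = 0")
  case True
  have "\<one>\<^bsub>padic_units l\<^esub> \<in> Delta_at l"
    using padic_units_one_closed[OF l] padic_units_one[OF l]
    by (auto simp: Delta_at_iff[OF l] cong_def intro!: exI[of _ 1])
  then show ?thesis using True by auto
next
  case False
  have l1: "l > 1" using prime_gt_1_nat[OF l] .
  have unit: "(\<lambda>j. c mod int l ^ j) \<in> Delta_at l" if c: "c \<in> {1, -1}" for c :: int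
  proof -
    have "(\<lambda>j. c mod int l ^ j) \<in> carrier (padic_units l)"
      using c l1 by (intro padic_unitI[OF l]) auto
    moreover have "[(c mod int l ^ j) ^ 2 = 1] (mod int l ^ j)" for j
      using c by (auto simp: cong_def power_mod)
    ultimately show ?thesis unfolding Delta_at_iff[OF l] by (auto intro!: exI[of _ 2])
  qed
  show ?thesis
  proof (cases "l = 2")
    case True
    then consider "[A = 1] (mod l ^ k)" | "[A + 1 = 0] (mod l ^ k)" using A by (auto simp: torsion_def)
    then show ?thesis
    proof cases
      case 1
      then have "[int A = int 1] (mod int (l ^ k))" unfolding cong_int_iff .
      then show ?thesis using unit[of 1] by (intro bexI[of _ "\<lambda>j. 1 mod int l ^ j"]) (auto simp: cong_def)
    next
      case 2
      then have "[int (A + 1) = int 0] (mod int (l ^ k))" unfolding cong_int_iff .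
      then have "[int A = -1] (mod int l ^ k)" by (simp add: cong_iff_dvd_diff add.commute)
      then show ?thesis using unit[of "-1"] by (intro bexI[of _ "\<lambda>j. (-1) mod int l ^ j"]) (auto simp: cong_def)
    qed
  next
    case 2: False
    have pw: "[A ^ (l - 1) = 1] (mod l ^ k)" using A 2 by (simp add: torsion_def)
    then have "[A ^ (l - 1) = 1] (mod l)" using False by (elim cong_dvd_modulus_nat) simp
    then have nd: "\<not> l dvd A"
      using l1 by (metis cong_dvd_iff dvd_power_iff_le dvd_trans dvd_refl dvd_power nat_dvd_1_iff_1 zero_less_diff less_irrefl)
    have base: "[int A ^ (l ^ Suc j) = int A ^ (l ^ j)] (mod int l ^ Suc j)" for j
    proof (induction j)
      case 0
      have "[A ^ (l - 1) * A = 1 * A] (mod l)" using fermat_theorem[OF l nd] by (rule cong_scalar_right)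
      then have "[A ^ l = A] (mod l)" using l1 by (metis mult_1 power_minus_mult zero_less_one order_less_trans)
      then show ?case by (metis cong_int_iff of_nat_power power_0 power_one_right One_nat_def)
    next
      case (Suc j)
      define x y where "x = int A ^ (l ^ Suc j)" and "y = int A ^ (l ^ j)"
      obtain t where t: "x = y + int l ^ Suc j * t"
        using Suc unfolding x_def y_def by (metis cong_iff_lin cong_sym)
      have "[x ^ l = y ^ l] (mod int l ^ Suc (Suc j))"
      proof -
        have "x ^ l - y ^ l = (x - y) * (\<Sum>i<l. y ^ (l - Suc i) * x ^ i)" by (rule power_diff_sumr2)
        moreover have "int l dvd (\<Sum>i<l. y ^ (l - Suc i) * x ^ i)"
        proof -
          have xy: "[x = y] (mod int l)" by (simp add: t cong_iff_dvd_diff)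
          have "[(\<Sum>i<l. y ^ (l - Suc i) * x ^ i) = (\<Sum>i<l. y ^ (l - Suc i) * y ^ i)] (mod int l)"
            by (intro cong_sum cong_scalar_left cong_pow xy)
          also have "(\<Sum>i<l. y ^ (l - Suc i) * y ^ i) = (\<Sum>i<l. y ^ (l - 1))"
            by (intro sum.cong refl) (simp flip: power_add)
          finally show ?thesis by (simp add: cong_dvd_iff)
        qed
        ultimately have "int l ^ Suc j * int l dvd x ^ l - y ^ l" unfolding t by (auto intro: mult_dvd_mono)
        then show ?thesis by (simp add: cong_iff_dvd_diff mult.commute)
      qed
      then show ?case by (simp add: x_def y_def mult.commute flip: power_mult)
    qed
    define a where "a = (\<lambda>j. (int A ^ (l ^ j)) mod int l ^ j)"
    have "a \<in> carrier (padic_units l)"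
      unfolding a_def
    proof (rule padic_unitI[OF l])
      show "[int A ^ l ^ Suc k = int A ^ l ^ k] (mod int l ^ k)" for k
        using base[of k] by (rule cong_dvd_modulus) simp
      show "\<not> int l dvd int A ^ l ^ 1" using nd l
        by (metis int_dvd_int_iff of_nat_power prime_dvd_power)
    qed
    moreover have "[a j ^ (l - 1) = 1] (mod int l ^ j)" for j
    proof -
      have "[int A ^ (l ^ j * (l - 1)) = 1] (mod int l ^ j)"
      proof (cases j)
        case (Suc i)
        have "coprime (int l ^ j) (int A ^ (l ^ i))" using nd l by (simp add: prime_imp_coprime)
        moreover have "[int A ^ (l ^ i) * int A ^ (l ^ i * (l - 1)) = int A ^ (l ^ i) * 1] (mod int l ^ j)"
        proof -
          have "l ^ Suc i = l ^ i + l ^ i * (l - 1)" using l1 by (simp add: algebra_simps)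
          then show ?thesis using base[of i] Suc by (simp flip: power_add)
        qed
        ultimately have "[int A ^ (l ^ i * (l - 1)) = 1] (mod int l ^ j)"
          using cong_mult_lcancel by (metis coprime_commute)
        from cong_pow[OF this, of l] show ?thesis by (simp add: Suc mult_ac flip: power_mult)
      qed simp
      moreover have "[a j ^ (l - 1) = (int A ^ (l ^ j)) ^ (l - 1)] (mod int l ^ j)"
        unfolding a_def by (intro cong_pow) (simp add: cong_def)
      ultimately show ?thesis using cong_trans by (simp add: power_mult) blast
    qed
    ultimately have "a \<in> Delta_at l" unfolding Delta_at_iff[OF l] using l1 by (auto intro!: exI[of _ "l - 1"])
    moreover have "[int A = a k] (mod int l ^ k)"
    proof -
      have "[int A ^ l = int A] (mod int l ^ k)"
      proof -
        have "[A ^ (l - 1) * A = 1 * A] (mod l ^ k)" using pw by (rule cong_scalar_right)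
        then have "[A ^ l = A] (mod l ^ k)" using l1 by (metis mult_1 power_minus_mult zero_less_one order_less_trans)
        then show ?thesis by (metis cong_int_iff of_nat_power)
      qed
      then have "[int A ^ (l ^ j) = int A] (mod int l ^ k)" for j
      proof (induction j)
        case (Suc j)
        have "[(int A ^ (l ^ j)) ^ l = int A ^ l] (mod int l ^ k)" using Suc by (intro cong_pow) auto
        then show ?case using Suc.prems cong_trans by (simp add: mult.commute flip: power_mult) blast
      qed simp
      then show ?thesis unfolding a_def by (simp add: cong_def)
    qed
    ultimately show ?thesis by blast
  qed
qed

section \<open>The fixed fields of the torsion subgroup\<close>

text \<open>The image of \<open>\<Delta>\<close> modulo \<open>n\<close>, by the Chinese remainder
  theorem.\<close>

definition torsion_residue :: "nat \<Rightarrow> nat \<Rightarrow> bool" where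
  "torsion_residue n A \<longleftrightarrow> (\<forall>l. Factorial_Ring.prime l \<and> l dvd n \<longrightarrow> torsion l (multiplicity l n) A)"

lemma torsion_one [simp]: "torsion l k (Suc 0)"
  by (simp add: torsion_def)

lemma torsion_cong:
  assumes "[A = B] (mod l ^ k)" "torsion l k A"
  shows "torsion l k B"
proof (cases "l = 2")
  case True
  then show ?thesis using assms cong_trans[OF cong_sym[OF assms(1)], of 1] cong_trans[OF cong_add[OF cong_sym[OF assms(1)] cong_refl[of 1]], of 0]
    by (auto simp: torsion_def)
next
  case False
  then show ?thesis using assms cong_trans[OF cong_sym[OF cong_pow[OF assms(1)]], of "l - 1" 1] by (auto simp: torsion_def)
qed

lemma torsion_mult:
  assumes "torsion l k A" "torsion l k B"
  shows "torsion l k (A * B)"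
proof (cases "l = 2")
  case False
  then show ?thesis using assms cong_mult[of "A ^ (l - 1)" 1 "l ^ k" "B ^ (l - 1)" 1] by (auto simp: torsion_def power_mult_distrib)
next
  case True
  have iff: "torsion l k C \<longleftrightarrow> [int C = 1] (mod 2 ^ k) \<or> [int C = -1] (mod 2 ^ k)" for C
    using True cong_int_iff[of C 1 "2 ^ k"] cong_int_iff[of "C + 1" 0 "2 ^ k"]
    by (auto simp: torsion_def cong_iff_dvd_diff add.commute)
  show ?thesis
    using assms cong_mult[of "int A" 1 "2 ^ k" "int B" 1] cong_mult[of "int A" "-1" "2 ^ k" "int B" 1]
      cong_mult[of "int A" 1 "2 ^ k" "int B" "-1"] cong_mult[of "int A" "-1" "2 ^ k" "int B" "-1"]
    unfolding iff by auto
qed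

lemma torsion_le:
  assumes "torsion l k A" "j \<le> k"
  shows "torsion l j A"
proof -
  have "l ^ j dvd l ^ k" using assms(2) by (rule le_imp_power_dvd)
  then show ?thesis using assms(1) cong_dvd_modulus_nat unfolding torsion_def by (auto split: if_splits)
qed

lemma torsion_coprime:
  assumes "Factorial_Ring.prime l" "torsion l k A"
  shows "coprime A (l ^ k)"
proof (cases "k = 0")
  case False
  have "torsion l 1 A" using torsion_le[OF assms(2), of 1] False by simp
  then have "\<not> l dvd A"
  proof (cases "l = 2")
    case True
    then have "A mod 2 = 1 \<or> (A + 1) mod 2 = 0" using \<open>torsion l 1 A\<close> by (simp add: torsion_def cong_def)
    then show ?thesis using True by presburger
  next
    case False
    then have "l dvd A ^ (l - 1) \<longleftrightarrow> l dvd 1"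
      using \<open>torsion l 1 A\<close> by (intro cong_dvd_iff) (simp add: torsion_def)
    moreover have "l dvd A ^ (l - 1)" if "l dvd A"
      using that prime_gt_1_nat[OF assms(1)] by (simp add: dvd_power_iff[symmetric] dvd_trans[OF that dvd_power])
    ultimately show ?thesis using prime_gt_1_nat[OF assms(1)] by auto
  qed
  then have "coprime l A" using assms(1) by (rule prime_imp_coprime[rotated])
  then show ?thesis by (simp add: coprime_commute)
qed simp

lemma torsion_residue_coprime:
  assumes "n > 0" "torsion_residue n A"
  shows "coprime A n"
proof (rule coprime_primesI)
  fix l assume l: "Factorial_Ring.prime l" "l dvd n"
  have "coprime A (l ^ multiplicity l n)"
    using assms(2) l by (intro torsion_coprime) (auto simp: torsion_residue_def)
  then have "coprime A l" using multiplicity_prime_pos[OF l(1) assms(1) l(2)] by simp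
  then show "\<not> l dvd A" using l(1) by (metis coprime_common_divisor dvd_refl not_prime_unit)
qed

lemma Delta_carrier: "Delta \<subseteq> carrier Zhat_units"
  by (auto simp: Delta_def Zhat_units_def Delta_at_def)

lemma Delta_factor_carrier: "Delta_factor l \<subseteq> carrier Zhat_units"
proof
  fix a assume a: "a \<in> Delta_factor l"
  have "a q \<in> carrier (padic_units q)" if "q \<in> primes" for q
    using PiE_mem[OF a[unfolded Delta_factor_def] that] padic_units_one_closed that
    by (auto simp: Delta_at_def primes_def split: if_splits)
  then show "a \<in> carrier Zhat_units" using a by (auto simp: Delta_factor_def Zhat_units_def PiE_iff)
qed

lemma ex_Delta_match:
  assumes "torsion_residue n A" "n > 0"
  shows "\<exists>a\<in>Delta. matches a n A"
proof -
  have "\<exists>b. b \<in> Delta_at l \<and> (l dvd n \<longrightarrow> [int A = b (multiplicity l n)] (mod int l ^ multiplicity l n))"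
    if l: "Factorial_Ring.prime l" for l
  proof (cases "l dvd n")
    case True
    then show ?thesis using torsion_lifts[OF l, of "multiplicity l n" A] assms(1) l by (auto simp: torsion_residue_def)
  next
    case False
    then show ?thesis using torsion_lifts[OF l torsion_one] by blast
  qed
  then obtain b where b: "\<And>l. Factorial_Ring.prime l \<Longrightarrow> b l \<in> Delta_at l"
    "\<And>l. Factorial_Ring.prime l \<Longrightarrow> l dvd n \<Longrightarrow> [int A = b l (multiplicity l n)] (mod int l ^ multiplicity l n)"
    by metis
  define a where "a = restrict b primes"
  have a: "a \<in> Delta" using b(1) by (auto simp: a_def Delta_def primes_def)
  have "matches a n A"
    unfolding matches_def
  proof (intro allI impI)
    fix l assume l: "Factorial_Ring.prime l \<and> l dvd n"
    have eq: "a l = b l" using l by (simp add: a_def primes_def)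
    have "a l (multiplicity l n) \<ge> 0" using Zhat_unit(3)[of a l] a Delta_carrier l by auto
    then have "[int A = int (nat (a l (multiplicity l n)))] (mod int (l ^ multiplicity l n))"
      using b(2)[of l] l eq by simp
    then show "[A = nat (a l (multiplicity l n))] (mod l ^ multiplicity l n)" unfolding cong_int_iff .
  qed
  then show ?thesis using a by blast
qed

lemma matches_torsion:
  assumes "a \<in> carrier Zhat_units" "matches a n A" "\<And>l. Factorial_Ring.prime l \<Longrightarrow> l dvd n \<Longrightarrow> a l \<in> Delta_at l"
  shows "torsion_residue n A"
  unfolding torsion_residue_def
proof (intro allI impI)
  fix l assume l: "Factorial_Ring.prime l \<and> l dvd n"
  have "[A = nat (a l (multiplicity l n))] (mod l ^ multiplicity l n)" using assms(2) l by (auto simp: matches_def)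
  then have "[int A = a l (multiplicity l n)] (mod int l ^ multiplicity l n)"
    unfolding cong_int_iff[symmetric] using Zhat_unit(3)[OF assms(1), of l] l by simp
  then show "torsion l (multiplicity l n) A" using Delta_at_torsion assms(3) l by blast
qed

text \<open>Every torsion residue modulo \<open>n\<close> is the image of an element of
  \<open>\<Delta>\<close>, and conversely.\<close>

lemma Q_cyc_Delta_iff:
  assumes "n > 0" "x \<in> qspan (mu n)"
  shows "x \<in> Q_cyc_Delta \<longleftrightarrow> (\<forall>A. torsion_residue n A \<longrightarrow> gal n A x = x)"
proof -
  have "x \<in> Q_cyc" using assms qspan_mu_Q_cyc by auto
  then have "x \<in> Q_cyc_Delta \<longleftrightarrow> (\<forall>a\<in>Delta. \<forall>A. matches a n A \<longrightarrow> gal n A x = x)"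
    unfolding Q_cyc_Delta_def using fixed_subfield_level[OF Delta_carrier assms] by simp
  also have "\<dots> \<longleftrightarrow> (\<forall>A. torsion_residue n A \<longrightarrow> gal n A x = x)"
  proof -
    have "torsion_residue n A" if "a \<in> Delta" "matches a n A" for a A
      using that Delta_carrier by (intro matches_torsion[of a]) (auto simp: Delta_def primes_def)
    then show ?thesis using ex_Delta_match[OF _ assms(1)] by blast
  qed
  finally show ?thesis .
qed

text \<open>The exponent of the roots of unity from which the \<open>k\<close>-th layer is cut
  out.\<close>

definition top_level :: "nat \<Rightarrow> nat \<Rightarrow> nat" where
  "top_level l k = (if l = 2 then k + 2 else k + 1)"

text \<open>On roots of unity of \<open>l\<close>-power order the factor of
  \<open>\<Delta>\<close> at \<open>l\<close> acts like all of \<open>\<Delta>\<close>.\<close>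

lemma B_layer_eq:
  assumes l: "Factorial_Ring.prime l"
  shows "B_layer l k = qspan (mu (l ^ top_level l k)) \<inter> Q_cyc_Delta"
proof -
  define N where "N = l ^ top_level l k"
  have N: "N > 0" using l by (simp add: N_def prime_gt_0_nat)
  have B: "B_layer l k = fixed_subfield (qspan (mu N)) (Delta_factor l)"
    using cyclotomic_field_eq[OF N] by (simp add: B_layer_def N_def top_level_def)
  have "x \<in> B_layer l k \<longleftrightarrow> x \<in> Q_cyc_Delta" if x: "x \<in> qspan (mu N)" for x
  proof -
    have "x \<in> B_layer l k \<longleftrightarrow> (\<forall>a\<in>Delta_factor l. \<forall>A. matches a N A \<longrightarrow> gal N A x = x)"
      unfolding B using fixed_subfield_level[OF Delta_factor_carrier N x] x by simp
    also have "\<dots> \<longleftrightarrow> (\<forall>A. torsion_residue N A \<longrightarrow> gal N A x = x)"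
    proof -
      have ql: "q = l" if "Factorial_Ring.prime q" "q dvd N" for q
        using that l unfolding N_def by (meson prime_dvd_power primes_dvd_imp_eq)
      have 1: "torsion_residue N A" if a: "a \<in> Delta_factor l" "matches a N A" for a A
      proof -
        have "a l \<in> Delta_at l"
          using PiE_mem[OF a(1)[unfolded Delta_factor_def], of l] l by (simp add: primes_def)
        then show ?thesis using ql by (intro matches_torsion[OF subsetD[OF Delta_factor_carrier a(1)] a(2)]) blast
      qed
      have 2: "\<exists>a\<in>Delta_factor l. matches a N A" if A: "torsion_residue N A" for A
      proof -
        obtain a where a: "a \<in> Delta" "matches a N A" using ex_Delta_match[OF A N] by blast
        define b where "b = (\<lambda>q\<in>primes. if q = l then a l else \<one>\<^bsub>padic_units q\<^esub>)"
        have "b \<in> Delta_factor l" using a l by (auto simp: b_def Delta_factor_def Delta_def primes_def)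
        moreover have "matches b N A" using a(2) ql l by (auto simp: matches_def b_def primes_def)
        ultimately show ?thesis by blast
      qed
      show ?thesis using 1 2 by blast
    qed
    also have "\<dots> \<longleftrightarrow> x \<in> Q_cyc_Delta" by (rule Q_cyc_Delta_iff[OF N x, symmetric])
    finally show ?thesis .
  qed
  moreover have "B_layer l k \<subseteq> qspan (mu N)" unfolding B by (auto simp: fixed_subfield_def)
  ultimately show ?thesis unfolding N_def by blast
qed

lemma is_subfield_fixed:
  assumes "is_subfield K" "K \<subseteq> Q_cyc"
  shows "is_subfield (fixed_subfield K D)"
proof -
  note Kc = is_subfieldD[OF assms(1)]
  have "\<sigma> (- x) = - x" "\<sigma> (inverse x) = inverse x"
    if "acts_as a \<sigma>" "x \<in> K" "\<sigma> x = x" for a \<sigma> x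
  proof -
    have s: "\<sigma> \<in> Gal Q_cyc" and x: "x \<in> Q_cyc" using that assms(2) by (auto simp: acts_as_def)
    show "\<sigma> (- x) = - x" using Gal_Q_cyc(6)[OF s x, of "-1"] that(3) by simp
    show "\<sigma> (inverse x) = inverse x"
    proof (cases "x = 0")
      case False
      have "\<sigma> (x * inverse x) = \<sigma> x * \<sigma> (inverse x)"
        using Gal_Q_cyc(3)[OF s x] Kc(5)[OF that(2)] assms(2) by auto
      then have "x * \<sigma> (inverse x) = 1" using False Gal_Q_cyc(4)[OF s] that(3) by simp
      then show ?thesis by (metis inverse_unique)
    qed (use that(3) in simp)
  qed
  moreover have "\<sigma> (x + y) = x + y" "\<sigma> (x * y) = x * y"
    if "acts_as a \<sigma>" "x \<in> K" "y \<in> K" "\<sigma> x = x" "\<sigma> y = y" for a \<sigma> x y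
  proof -
    have s: "\<sigma> \<in> Gal Q_cyc" and x: "x \<in> Q_cyc" "y \<in> Q_cyc" using that assms(2) by (auto simp: acts_as_def)
    show "\<sigma> (x + y) = x + y" "\<sigma> (x * y) = x * y" using Gal_Q_cyc(2,3)[OF s x] that by auto
  qed
  moreover have "\<sigma> 1 = 1" if "acts_as a \<sigma>" for a \<sigma>
    using Gal_Q_cyc(4) that by (auto simp: acts_as_def)
  ultimately show ?thesis
    unfolding is_subfield_def fixed_subfield_def using Kc(1-5) by auto
qed

lemma is_subfield_Q_cyc_Delta: "is_subfield Q_cyc_Delta"
  unfolding Q_cyc_Delta_def by (rule is_subfield_fixed[OF is_subfield_Q_cyc]) simp

lemma Q_cyc_Delta_subset: "Q_cyc_Delta \<subseteq> Q_cyc"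
  by (auto simp: Q_cyc_Delta_def fixed_subfield_def)

lemma is_subfield_Int: "is_subfield E \<Longrightarrow> is_subfield F \<Longrightarrow> is_subfield (E \<inter> F)"
  by (auto simp: is_subfield_def)

text \<open>The same fields as the layers of the \<open>\<int>\<^sub>l\<close>-extension, but
  counted by the exponent of the root of unity, so that the shift at the beginning
  disappears.\<close>

definition layer :: "nat \<Rightarrow> nat \<Rightarrow> complex set" where
  "layer l k = qspan (mu (l ^ k)) \<inter> Q_cyc_Delta"

lemma layer_mono: "j \<le> k \<Longrightarrow> layer l j \<subseteq> layer l k"
  using qspan_mu_mono[OF le_imp_power_dvd, of j k l] by (auto simp: layer_def)

lemma is_subfield_layer: "Factorial_Ring.prime l \<Longrightarrow> is_subfield (layer l k)"
  unfolding layer_def by (intro is_subfield_Int is_subfield_qspan_mu is_subfield_Q_cyc_Delta) (simp add: prime_gt_0_nat)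

lemma B_inf_eq:
  assumes "Factorial_Ring.prime l"
  shows "B_inf l = (\<Union>k. layer l k)"
proof -
  have "B_inf l = (\<Union>k. layer l (top_level l k))"
    using B_layer_eq[OF assms] by (simp add: B_inf_def layer_def)
  also have "\<dots> = (\<Union>k. layer l k)"
  proof -
    have "layer l k \<subseteq> layer l (top_level l k)" for k by (rule layer_mono) (simp add: top_level_def)
    then show ?thesis by blast
  qed
  finally show ?thesis .
qed

lemma is_subfield_B_inf:
  assumes "Factorial_Ring.prime l"
  shows "is_subfield (B_inf l)"
proof -
  have both: "\<exists>k. x \<in> layer l k \<and> y \<in> layer l k" if xy: "x \<in> B_inf l" "y \<in> B_inf l" for x y
  proof -
    obtain i j where "x \<in> layer l i" "y \<in> layer l j" using xy B_inf_eq[OF assms] by auto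
    then have "x \<in> layer l (max i j)" "y \<in> layer l (max i j)"
      using layer_mono[of i "max i j" l] layer_mono[of j "max i j" l] by auto
    then show ?thesis by blast
  qed
  have sub: "layer l k \<subseteq> B_inf l" for k using B_inf_eq[OF assms] by auto
  note F = is_subfieldD[OF is_subfield_layer[OF assms]]
  show ?thesis
    unfolding is_subfield_def
  proof (intro conjI ballI)
    show "1 \<in> B_inf l" using F(1)[of 0] sub by auto
    fix x assume x: "x \<in> B_inf l"
    obtain k where "x \<in> layer l k" using both[OF x x] by auto
    then show "- x \<in> B_inf l" "inverse x \<in> B_inf l" using F(4,5) sub by blast+
    fix y assume y: "y \<in> B_inf l"
    obtain k where "x \<in> layer l k" "y \<in> layer l k" using both[OF x y] by auto
    then show "x + y \<in> B_inf l" "x * y \<in> B_inf l" using F(2,3) sub by blast+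
  qed
qed

lemma B_inf_subset: "Factorial_Ring.prime l \<Longrightarrow> B_inf l \<subseteq> Q_cyc_Delta"
  using B_inf_eq by (auto simp: layer_def)

lemma torsion_residue_prime_power:
  assumes "Factorial_Ring.prime l"
  shows "torsion_residue (l ^ k) A \<longleftrightarrow> torsion l k A"
proof (cases "k = 0")
  case True
  then show ?thesis by (auto simp: torsion_residue_def torsion_def)
next
  case False
  have "q = l" if "Factorial_Ring.prime q" "q dvd l ^ k" for q
    using that assms by (meson prime_dvd_power primes_dvd_imp_eq)
  moreover have "l dvd l ^ k" using False by (simp add: dvd_power)
  ultimately have "torsion_residue (l ^ k) A \<longleftrightarrow> torsion l (multiplicity l (l ^ k)) A"
    unfolding torsion_residue_def using assms by blast
  then show ?thesis using assms by (simp add: multiplicity_prime_power)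
qed

lemma layer_iff:
  assumes "Factorial_Ring.prime l" "x \<in> qspan (mu (l ^ k))"
  shows "x \<in> layer l k \<longleftrightarrow> (\<forall>A. torsion l k A \<longrightarrow> gal (l ^ k) A x = x)"
  using Q_cyc_Delta_iff[of "l ^ k" x] assms torsion_residue_prime_power[OF assms(1)]
  by (auto simp: layer_def prime_gt_0_nat)

section \<open>Averages and norms over groups of residues\<close>

text \<open>The average of the conjugates of \<open>x\<close> under \<open>H\<close> is
  \<open>x\<close> itself, and a combination of the traces of roots of unity.\<close>

lemma average_subspace:
  assumes n: "n > 0" and H: "finite H" "H \<noteq> {}" "\<And>A. A \<in> H \<Longrightarrow> coprime A n"
    and S: "QV.subspace S" "\<And>z. z \<in> mu n \<Longrightarrow> (\<Sum>A\<in>H. z ^ A) \<in> S"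
    and x: "x \<in> qspan (mu n)" "\<And>A. A \<in> H \<Longrightarrow> gal n A x = x"
  shows "x \<in> S"
proof -
  have "x \<in> qspan (mu n) \<and> (\<Sum>A\<in>H. gal n A x) \<in> S"
    using x(1)
  proof (induction rule: QV.span_induct_alt)
    case base
    then show ?case using n H(3) QV.subspace_0[OF S(1)] by (simp add: QV.span_zero)
  next
    case (step c z y)
    have z: "z \<in> qspan (mu n)" using step(1) by (rule QV.span_base)
    have cz: "of_rat c * z \<in> qspan (mu n)" using z by (rule qspan_of_rat_mult)
    have y: "y \<in> qspan (mu n)" "(\<Sum>A\<in>H. gal n A y) \<in> S" using step by auto
    have "(\<Sum>A\<in>H. gal n A (of_rat c * z + y)) = (\<Sum>A\<in>H. of_rat c * z ^ A + gal n A y)"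
      using gal_add[OF n H(3) cz y(1)] gal_rat_scale[OF n H(3) z] gal_root[OF n H(3) step(1)]
      by (intro sum.cong) auto
    also have "\<dots> = rat_scale c (\<Sum>A\<in>H. z ^ A) + (\<Sum>A\<in>H. gal n A y)"
      by (simp add: sum.distrib sum_distrib_left rat_scale_def)
    also have "\<dots> \<in> S"
      by (intro QV.subspace_add[OF S(1)] QV.subspace_scale[OF S(1)] S(2) step(1) y(2))
    finally show ?case using QV.span_add[OF cz y(1)] unfolding rat_scale_def by blast
  qed
  moreover have "(\<Sum>A\<in>H. gal n A x) = of_nat (card H) * x" using x(2) by simp
  ultimately have "rat_scale (inverse (of_nat (card H))) (of_nat (card H) * x) \<in> S"
    using QV.subspace_scale[OF S(1)] by metis
  moreover have "card H \<noteq> 0" using H by simp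
  then have "rat_scale (inverse (of_nat (card H))) (of_nat (card H) * x) = x"
    unfolding rat_scale_def of_rat_inverse of_rat_of_nat_eq by simp
  ultimately show ?thesis by metis
qed

text \<open>A subgroup of the unit group modulo \<open>n\<close>, given by the least
  representatives; \<open>1 mod n\<close> covers the case \<open>n = 1\<close>. The product of the
  conjugates of an element under such a group is a norm, and the sum is a trace.\<close>

definition residue_group :: "nat \<Rightarrow> nat set \<Rightarrow> bool" where
  "residue_group n H \<longleftrightarrow> H \<subseteq> {..<n} \<and> 1 mod n \<in> H \<and> (\<forall>A\<in>H. coprime A n) \<and> (\<forall>A\<in>H. \<forall>B\<in>H. A * B mod n \<in> H)"

lemma residue_group_bij:
  assumes "n > 0" "residue_group n H" "B mod n \<in> H"
  shows "bij_betw (\<lambda>A. B * A mod n) H H"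
proof -
  have fin: "finite H" using assms(2) finite_subset unfolding residue_group_def by blast
  have "coprime (B mod n) n" using assms(2,3) by (auto simp: residue_group_def)
  then have cop: "coprime B n" using coprime_mod_left_iff[of n B] assms(1) by simp
  have inj: "inj_on (\<lambda>A. B * A mod n) H"
  proof (rule inj_onI)
    fix A A' assume A: "A \<in> H" "A' \<in> H" and "B * A mod n = B * A' mod n"
    then have "[A = A'] (mod n)" using cong_mult_lcancel_nat[OF cop] by (simp add: cong_def)
    moreover have "A < n" "A' < n" using A assms(2) by (auto simp: residue_group_def)
    ultimately show "A = A'" by (simp add: cong_def)
  qed
  have "B * A mod n \<in> H" if "A \<in> H" for A
  proof -
    have "(B mod n) * A mod n \<in> H" using assms(2,3) that by (auto simp: residue_group_def)
    then show ?thesis by (simp add: mod_mult_left_eq)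
  qed
  then show ?thesis using endo_inj_surj[OF fin _ inj] inj by (auto simp: bij_betw_def)
qed

lemma residue_group_finite: "residue_group n H \<Longrightarrow> finite H \<and> H \<noteq> {}"
  unfolding residue_group_def using finite_subset by blast

lemma
  assumes n: "n > 0" and H: "residue_group n H" and B: "B mod n \<in> H" and x: "x \<in> qspan (mu n)"
  shows gal_norm: "gal n B (\<Prod>A\<in>H. gal n A x) = (\<Prod>A\<in>H. gal n A x)"
    and gal_trace: "gal n B (\<Sum>A\<in>H. gal n A x) = (\<Sum>A\<in>H. gal n A x)"
proof -
  have cop: "coprime A n" if "A \<in> H" for A using H that by (auto simp: residue_group_def)
  have copB: "coprime B n" using cop[OF B] n by simp
  have c: "gal n A x \<in> qspan (mu n)" if "A \<in> H" for A using gal_closed[OF n cop[OF that] x] .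
  have eq: "gal n B (gal n A x) = gal n (B * A mod n) x" if "A \<in> H" for A
    using gal_compose[OF n copB cop[OF that] x] gal_cong[OF n _ _ x, of "B * A" "B * A mod n"] copB cop[OF that]
    by (simp add: cong_def)
  have "gal n B (\<Prod>A\<in>H. gal n A x) = (\<Prod>A\<in>H. gal n (B * A mod n) x)"
    using gal_prod[OF n copB, of H] c eq by (simp cong: prod.cong)
  also have "\<dots> = (\<Prod>A\<in>H. gal n A x)" by (rule prod.reindex_bij_betw[OF residue_group_bij[OF n H B]])
  finally show "gal n B (\<Prod>A\<in>H. gal n A x) = (\<Prod>A\<in>H. gal n A x)" .
  have "gal n B (\<Sum>A\<in>H. gal n A x) = (\<Sum>A\<in>H. gal n (B * A mod n) x)"
    using gal_sum[OF n copB, of H] c eq by (simp cong: sum.cong)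
  also have "\<dots> = (\<Sum>A\<in>H. gal n A x)" by (rule sum.reindex_bij_betw[OF residue_group_bij[OF n H B]])
  finally show "gal n B (\<Sum>A\<in>H. gal n A x) = (\<Sum>A\<in>H. gal n A x)" .
qed

lemma sum_powers_root_of_unity:
  assumes "w ^ m = (1::complex)" "w \<noteq> 1"
  shows "(\<Sum>i<m. w ^ i) = 0"
  using geometric_sum[OF assms(2), of m] assms(1) by simp

text \<open>The sum of the conjugates of a root of unity of prime power order is the difference of
  two sums over full groups of residues.\<close>

lemma trace_prime_power_rational:
  assumes l: "Factorial_Ring.prime l" and z: "z \<in> mu (l ^ k)"
  shows "(\<Sum>A\<in>{A. A < l ^ k \<and> coprime A (l ^ k)}. z ^ A) \<in> \<rat>"
proof (cases k)
  case 0
  have "{A. A < l ^ k \<and> coprime A (l ^ k)} = {0}" using 0 by auto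
  then show ?thesis by simp
next
  case (Suc j)
  have l0: "l > 0" using l by (simp add: prime_gt_0_nat)
  have full: "(\<Sum>i<m. w ^ i) \<in> \<rat>" if "w ^ m = 1" for w :: complex and m
    using sum_powers_root_of_unity[OF that] by (cases "w = 1") auto
  have "{A. A < l ^ k \<and> coprime A (l ^ k)} = {..<l ^ k} - (\<lambda>i. l * i) ` {..<l ^ j}"
  proof -
    have "coprime A (l ^ k) \<longleftrightarrow> \<not> l dvd A" for A
      using Suc l prime_imp_coprime[OF l, of A] coprime_commute[of A l] coprime_common_divisor[of A l l]
      by (auto simp: not_prime_unit)
    then show ?thesis using l0 by (auto simp: Suc dvd_def)
  qed
  moreover have "(\<lambda>i. l * i) ` {..<l ^ j} \<subseteq> {..<l ^ k}" using l0 by (auto simp: Suc)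
  ultimately have "(\<Sum>A\<in>{A. A < l ^ k \<and> coprime A (l ^ k)}. z ^ A)
      = (\<Sum>A<l ^ k. z ^ A) - (\<Sum>A\<in>(\<lambda>i. l * i) ` {..<l ^ j}. z ^ A)"
    by (simp add: sum_diff)
  also have "(\<Sum>A\<in>(\<lambda>i. l * i) ` {..<l ^ j}. z ^ A) = (\<Sum>i<l ^ j. (z ^ l) ^ i)"
    using l0 by (subst sum.reindex) (auto simp: inj_on_def power_mult)
  also have "(\<Sum>A<l ^ k. z ^ A) - (\<Sum>i<l ^ j. (z ^ l) ^ i) \<in> \<rat>"
    using z Suc by (intro Rats_diff full) (auto simp: mu_def power_mult)
  finally show ?thesis .
qed

lemma residue_group_units:
  assumes "n > 0"
  shows "residue_group n {A. A < n \<and> coprime A n}"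
proof -
  have "coprime (1 mod n) n" "\<And>A B. coprime A n \<Longrightarrow> coprime B n \<Longrightarrow> coprime (A * B mod n) n"
    using assms coprime_mod_left_iff[of n] by auto
  then show ?thesis using assms by (auto simp: residue_group_def)
qed

lemma fixed_by_units_rational:
  assumes l: "Factorial_Ring.prime l" and x: "x \<in> qspan (mu (l ^ k))"
    and fixed: "\<And>A. coprime A (l ^ k) \<Longrightarrow> gal (l ^ k) A x = x"
  shows "x \<in> \<rat>"
proof (rule average_subspace[of "l ^ k" "{A. A < l ^ k \<and> coprime A (l ^ k)}"])
  show "l ^ k > 0" using l by (simp add: prime_gt_0_nat)
  then show "{A. A < l ^ k \<and> coprime A (l ^ k)} \<noteq> {}"
    using residue_group_finite[OF residue_group_units] by blast
  show "QV.subspace \<rat>" by (auto simp: QV.subspace_def rat_scale_def)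
qed (use x fixed trace_prime_power_rational[OF l] in auto)

section \<open>The decomposition field at a prime different from the residue characteristic\<close>

text \<open>The decomposition field of \<open>p\<close> in the
  \<open>\<int>\<^sub>l\<close>-extension consists of elements of the field of roots of unity of
  order \<open>l ^ split_level p l\<close>.\<close>

definition split_level :: "nat \<Rightarrow> nat \<Rightarrow> nat" where
  "split_level p l = top_level l (u_level p l)"

lemma B_fin_eq: "Factorial_Ring.prime l \<Longrightarrow> B_fin l p = layer l (split_level p l)"
  by (simp add: B_fin_def B_layer_eq layer_def split_level_def)

lemma nat_power_dvd_iff:
  fixes l n :: nat
  assumes "Factorial_Ring.prime l" "n > 0"
  shows "l ^ j dvd n \<longleftrightarrow> j \<le> multiplicity l n"
proof -
  have "\<not> is_unit l" using assms(1) not_prime_unit by blast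
  then show ?thesis using assms(2) multiplicity_dvd'[of j l n] multiplicity_geI[of n l j] by blast
qed

text \<open>Up to torsion, \<open>p\<close> is congruent to 1 modulo \<open>l ^ split_level p
  l\<close> but not modulo a higher power. The element \<open>g\<close> is \<open>p ^ (l -
  1)\<close> for odd \<open>l\<close>, and \<open>p\<close> or \<open>- p\<close> for \<open>l =
  2\<close>; in the latter case the definition of \<open>u_level\<close> by \<open>p\<^sup>2 - 1 =
  (g - 1) (g + 1)\<close> counts one factor 2 of \<open>g + 1\<close>.\<close>

lemma frobenius_generator:
  assumes p: "Factorial_Ring.prime p" and l: "Factorial_Ring.prime l" and pl: "p \<noteq> l"
  obtains g i where "close_to_one l g" "\<And>j. int l ^ j dvd g - 1 \<longleftrightarrow> j \<le> split_level p l"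
    "\<And>k. \<exists>A. torsion l k A \<and> [g = int (p ^ i * A)] (mod int l ^ k)"
    "torsion l (split_level p l) p"
proof -
  define s where "s = split_level p l"
  have p1: "p > 1" using prime_gt_1_nat[OF p] .
  have nd: "\<not> l dvd p" using primes_dvd_imp_eq[OF l p] pl by auto
  show ?thesis
  proof (cases "l = 2")
    case False
    define m where "m = p ^ (l - 1) - 1"
    have l1: "l > 1" using prime_gt_1_nat[OF l] .
    have m: "m > 0" using one_less_power[OF p1, of "l - 1"] l1 by (simp add: m_def)
    have pm: "p ^ (l - 1) = m + 1" using p1 by (simp add: m_def)
    have im: "int p ^ (l - 1) - 1 = int m" using arg_cong[OF pm, of int] by simp
    have "[p ^ (l - 1) = 1] (mod l)" by (rule fermat_theorem[OF l nd])
    then have "l dvd m" using p1 by (simp add: m_def cong_altdef_nat)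
    then have "multiplicity l m \<ge> 1" using nat_power_dvd_iff[OF l m, of 1] by simp
    then have s: "s = multiplicity l m" using False by (simp add: s_def split_level_def top_level_def u_level_def m_def)
    have iff: "int l ^ j dvd int p ^ (l - 1) - 1 \<longleftrightarrow> j \<le> s" for j
      unfolding im s nat_power_dvd_iff[OF l m, symmetric] by (metis int_dvd_int_iff of_nat_power)
    show ?thesis
    proof (rule that[of "int p ^ (l - 1)" "l - 1"])
      show "close_to_one l (int p ^ (l - 1))"
        using False iff[of 1] \<open>multiplicity l m \<ge> 1\<close> s by (simp add: close_to_one_def)
      show "\<exists>A. torsion l k A \<and> [int p ^ (l - 1) = int (p ^ (l - 1) * A)] (mod int l ^ k)" for k
        by (intro exI[of _ 1]) (simp add: torsion_one)
      have "[int p ^ (l - 1) = 1] (mod int l ^ s)" using iff[of s] by (simp add: cong_iff_dvd_diff)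
      then have "[int (p ^ (l - 1)) = int 1] (mod int (l ^ s))" by simp
      then show "torsion l (split_level p l) p" unfolding cong_int_iff using False by (simp add: torsion_def s_def)
    qed (use iff s_def in auto)
  next
    case True
    have "odd p" using nd True by simp
    then have "int p mod 4 = 1 \<or> int p mod 4 = 3" by presburger
    then have "4 dvd 1 * int p - 1 \<or> 4 dvd (-1) * int p - 1" by presburger
    then obtain e :: int where e: "e \<in> {1, -1}" "4 dvd e * int p - 1" by blast
    define g where "g = e * int p"
    define m where "m = p ^ 2 - 1"
    have m: "m > 0" using one_less_power[OF p1, of 2] by (simp add: m_def)
    have im: "int m = (g - 1) * (g + 1)"
    proof -
      have "int m = int p ^ 2 - 1" using p1 by (simp add: m_def of_nat_diff)
      then show ?thesis using e(1) by (auto simp: g_def power2_eq_square algebra_simps)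
    qed
    obtain c where c: "g = 1 + 4 * c" using e(2) by (auto simp: g_def dvd_def algebra_simps)
    have iff0: "2 ^ (j + 1) dvd m \<longleftrightarrow> 2 ^ j dvd g - 1" for j
    proof -
      have "2 ^ (j + 1) dvd m \<longleftrightarrow> (2::int) ^ (j + 1) dvd int m" by (metis int_dvd_int_iff of_nat_numeral of_nat_power)
      also have "int m = 2 * ((g - 1) * (1 + 2 * c))" by (simp add: im c algebra_simps)
      also have "(2::int) ^ (j + 1) dvd 2 * ((g - 1) * (1 + 2 * c)) \<longleftrightarrow> 2 ^ j dvd (g - 1) * (1 + 2 * c)" by simp
      also have "\<dots> \<longleftrightarrow> 2 ^ j dvd g - 1" by (intro coprime_dvd_mult_left_iff) simp
      finally show ?thesis .
    qed
    have "2 ^ (2 + 1) dvd m" unfolding iff0 by (simp add: c)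
    then have m3: "multiplicity 2 m \<ge> 3" using nat_power_dvd_iff[of 2 m 3] m by simp
    have s: "s + 1 = multiplicity 2 m" using m3 True by (simp add: s_def split_level_def top_level_def u_level_def m_def)
    have iff: "2 ^ j dvd g - 1 \<longleftrightarrow> j \<le> s" for j
    proof -
      have "2 ^ (j + 1) dvd m \<longleftrightarrow> j + 1 \<le> s + 1"
        unfolding s by (rule nat_power_dvd_iff[OF two_is_prime_nat m])
      then show ?thesis using iff0[of j] by simp
    qed
    have tor: "\<exists>A. torsion l k A \<and> [g = int (p ^ 1 * A)] (mod int l ^ k)" for k
    proof (cases "e = 1")
      case True
      then show ?thesis by (intro exI[of _ 1]) (simp add: torsion_one g_def)
    next
      case False
      have "torsion l k (2 ^ k - 1)" using \<open>l = 2\<close> by (simp add: torsion_def cong_def)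
      moreover have "[g = int (p ^ 1 * (2 ^ k - 1))] (mod int l ^ k)"
        using False e(1) \<open>l = 2\<close> by (simp add: g_def cong_iff_dvd_diff of_nat_diff algebra_simps)
      ultimately show ?thesis by blast
    qed
    show ?thesis
    proof (rule that[OF _ _ tor])
      show "close_to_one l g" using True e(2) by (simp add: close_to_one_def g_def)
      have "(2::int) ^ s dvd e * int p - 1" using iff[of s] by (simp add: g_def)
      then have "[int p = 1] (mod 2 ^ s) \<or> [int p + 1 = 0] (mod 2 ^ s)"
        using e(1) by (auto simp: cong_iff_dvd_diff) (metis dvd_minus_iff minus_diff_eq diff_minus_eq_add add.commute)
      then have "[int p = int 1] (mod int (2 ^ s)) \<or> [int (p + 1) = int 0] (mod int (2 ^ s))" by (simp add: add.commute)
      then show "torsion l (split_level p l) p" unfolding cong_int_iff using True by (simp add: torsion_def s_def)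
    qed (use iff s_def True in auto)
  qed
qed

lemma gal_power_fixed:
  assumes "n > 0" "coprime A n" "x \<in> qspan (mu n)" "gal n A x = x"
  shows "gal n (A ^ i) x = x"
proof (induction i)
  case (Suc i)
  have "gal n A (gal n (A ^ i) x) = gal n (A * A ^ i) x"
    using assms by (intro gal_compose) auto
  then show ?case using Suc assms(4) by simp
qed (use gal_1 assms in simp)

text \<open>The powers of \<open>g\<close> with exponent less than \<open>l ^ (k - s)\<close> are
  distinct modulo \<open>l ^ k\<close>, because taking a power moves \<open>g\<close> towards 1
  only by the valuation of the exponent. There are as many of them as residues congruent to 1
  modulo \<open>l ^ s\<close>.\<close>

lemma powers_exhaust:
  assumes l: "Factorial_Ring.prime l" and g: "close_to_one l g" "\<And>j. int l ^ j dvd g - 1 \<longleftrightarrow> j \<le> s"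
    and k: "s < k" and j: "j < l ^ (k - s)"
  shows "\<exists>i. [g ^ i = int (1 + l ^ s * j)] (mod int l ^ k)"
proof -
  define M where "M = l ^ (k - s)"
  have l1: "l > 1" using prime_gt_1_nat[OF l] .
  have s1: "s \<ge> 1" using g(2)[of 1] close_to_one_dvd[OF g(1)] by simp
  have kM: "l ^ k = l ^ s * M" using k by (simp add: M_def flip: power_add)
  define f where "f i = g ^ i mod int l ^ k" for i
  define C where "C = (\<lambda>j. int (1 + l ^ s * j)) ` {..<M}"
  have inj: "inj_on f {..<M}"
  proof -
    have "False" if ij: "i < j" "j < M" "f i = f j" for i j
    proof -
      have "[g ^ i * g ^ (j - i) = g ^ i * 1] (mod int l ^ k)"
        using ij by (simp add: f_def cong_def flip: power_add)
      moreover have "coprime g (int l)"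
      proof -
        have "coprime (1 + (g - 1)) (int l)" using close_to_one_dvd[OF g(1)]
          by (metis add.commute coprime_1_left coprime_add_one_left coprime_imp_coprime dvd_refl dvd_trans)
        then show ?thesis by simp
      qed
      ultimately have "[g ^ (j - i) = 1] (mod int l ^ k)"
      proof -
        assume c: "[g ^ i * g ^ (j - i) = g ^ i * 1] (mod int l ^ k)" and "coprime g (int l)"
        then have "coprime (g ^ i) (int l ^ k)" by simp
        from iffD1[OF cong_mult_lcancel[OF this] c] show ?thesis .
      qed
      then have d: "int l ^ k dvd g ^ (j - i) - 1" by (simp add: cong_iff_dvd_diff)
      define t where "t = multiplicity l (j - i)"
      have "k - s \<le> t"
      proof (rule ccontr)
        assume *: "\<not> k - s \<le> t"
        then have "int l ^ (t + (k - t)) dvd g ^ (j - i) - 1" using d by simp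
        then have "int l ^ (k - t) dvd g - 1"
          unfolding t_def using power_minus_one_dvd_iff[OF l _ g(1), of "j - i"] ij by simp
        then show False using g(2) * by simp
      qed
      then have "M dvd j - i" unfolding M_def using nat_power_dvd_iff[OF l, of "j - i"] ij by (simp add: t_def)
      then show False using ij dvd_imp_le[of M "j - i"] by auto
    qed
    then show ?thesis by (intro inj_onI) (metis lessThan_iff linorder_neqE_nat)
  qed
  have "f i \<in> C" for i
  proof -
    define r where "r = nat (f i)"
    have lk: "int l ^ k > 0" using l1 by simp
    then have fi: "f i = int r" "f i < int l ^ k" by (auto simp: r_def f_def)
    have "[f i = g ^ i] (mod int l ^ s)"
      unfolding f_def using k by (simp add: cong_def mod_mod_cancel le_imp_power_dvd)
    moreover have "[g ^ i = 1 ^ i] (mod int l ^ s)"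
      using g(2)[of s] by (intro cong_pow) (simp add: cong_iff_dvd_diff)
    ultimately have "[f i = 1] (mod int l ^ s)" using cong_trans by fastforce
    then have "[r = 1] (mod l ^ s)" by (metis cong_int_iff fi(1) of_nat_1 of_nat_power)
    moreover have "l ^ s > 1" using one_less_power[OF l1, of s] s1 by simp
    ultimately obtain t where t: "r = 1 + l ^ s * t"
      by (metis cong_def mod_less mult.commute mod_div_mult_eq add.commute)
    have "r < l ^ k" using fi by (metis of_nat_less_iff of_nat_power)
    then have "l ^ s * t < l ^ s * M" using t kM by linarith
    then have "t < M" using mult_less_cancel1 by blast
    then show ?thesis using t fi(1) by (auto simp: C_def)
  qed
  then have "f ` {..<M} \<subseteq> C" by auto
  moreover have "card C = M" unfolding C_def using l1 by (subst card_image) (auto simp: inj_on_def)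
  moreover have "card (f ` {..<M}) = M" using inj by (simp add: card_image)
  ultimately have "f ` {..<M} = C" by (intro card_subset_eq) (auto simp: C_def)
  moreover have "int (1 + l ^ s * j) \<in> C" using j by (auto simp: C_def M_def)
  ultimately obtain i where "f i = int (1 + l ^ s * j)" by (metis imageE)
  then have "[g ^ i = int (1 + l ^ s * j)] (mod int l ^ k)" unfolding f_def by (metis cong_def mod_mod_trivial)
  then show ?thesis by blast
qed

text \<open>The Frobenius automorphism and torsion generate a group that contains all
  automorphisms trivial on roots of unity of order \<open>l ^ s\<close>. The trace of a root of
  unity under the latter is zero unless the order of the root divides \<open>l ^
  s\<close>.\<close>

lemma frobenius_fixed_in_split_layer:
  assumes p: "Factorial_Ring.prime p" and l: "Factorial_Ring.prime l" and pl: "p \<noteq> l"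
    and x: "x \<in> layer l k" "gal (l ^ k) p x = x"
  shows "x \<in> layer l (split_level p l)"
proof (cases "k \<le> split_level p l")
  case True
  then show ?thesis using x(1) layer_mono by blast
next
  case False
  define s where "s = split_level p l"
  define M where "M = l ^ (k - s)"
  have sk: "s < k" using False by (simp add: s_def)
  have l0: "l > 0" using prime_gt_0_nat[OF l] .
  have kM: "l ^ k = l ^ s * M" using sk by (simp add: M_def flip: power_add)
  have N: "l ^ k > 0" using l0 by simp
  have xq: "x \<in> qspan (mu (l ^ k))" using x(1) by (simp add: layer_def)
  have copp: "coprime p (l ^ k)" using primes_coprime[OF p l pl] by simp
  obtain g i where g: "close_to_one l g" "\<And>j. int l ^ j dvd g - 1 \<longleftrightarrow> j \<le> s"
    "\<exists>A. torsion l k A \<and> [g = int (p ^ i * A)] (mod int l ^ k)"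
    using frobenius_generator[OF p l pl] unfolding s_def by metis
  obtain A where A: "torsion l k A" "[g = int (p ^ i * A)] (mod int l ^ k)" using g(3) by blast
  have copA: "coprime A (l ^ k)" by (rule torsion_coprime[OF l A(1)])
  define B where "B = p ^ i * A"
  have copi: "coprime (p ^ i) (l ^ k)" using copp by auto
  have copB: "coprime B (l ^ k)" using copA copi unfolding B_def by (metis coprime_mult_left_iff)
  have "gal (l ^ k) B x = x"
  proof -
    have "gal (l ^ k) A x = x" using x(1) layer_iff[OF l xq] A(1) by blast
    moreover have "gal (l ^ k) (p ^ i) x = x" by (rule gal_power_fixed[OF N copp xq x(2)])
    ultimately show ?thesis using gal_compose[OF N copi copA xq] by (simp add: B_def)
  qed
  then have Bj: "gal (l ^ k) (B ^ j) x = x" for j by (rule gal_power_fixed[OF N copB xq])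
  have fixed: "coprime (1 + l ^ s * j) (l ^ k) \<and> gal (l ^ k) (1 + l ^ s * j) x = x" if jM: "j < M" for j
  proof -
    obtain t where t: "[g ^ t = int (1 + l ^ s * j)] (mod int l ^ k)"
      using powers_exhaust[OF l g(1,2) sk] jM unfolding M_def by blast
    have "[g ^ t = int (B ^ t)] (mod int l ^ k)" using cong_pow[OF A(2)] by (simp add: B_def)
    then have "[int (B ^ t) = int (1 + l ^ s * j)] (mod int (l ^ k))" using t cong_trans cong_sym by (metis of_nat_power)
    then have c: "[B ^ t = 1 + l ^ s * j] (mod l ^ k)" unfolding cong_int_iff .
    have cB: "coprime (B ^ t) (l ^ k)" using copB by auto
    show ?thesis using cong_imp_coprime[OF c cB] gal_cong[OF N cB c xq] Bj[of t] by argo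
  qed
  have "x \<in> qspan (mu (l ^ s))"
  proof (rule average_subspace[OF N, of "(\<lambda>j. 1 + l ^ s * j) ` {..<M}"])
    show "(\<lambda>j. 1 + l ^ s * j) ` {..<M} \<noteq> {}" using l0 by (auto simp: M_def lessThan_empty_iff)
    show "QV.subspace (qspan (mu (l ^ s)))" by simp
    fix z assume z: "z \<in> mu (l ^ k)"
    define w where "w = z ^ (l ^ s)"
    have wM: "w ^ M = 1" using z kM by (simp add: w_def mu_def flip: power_mult)
    have "(\<Sum>A\<in>(\<lambda>j. 1 + l ^ s * j) ` {..<M}. z ^ A) = (\<Sum>j<M. z * w ^ j)"
      using l0 by (subst sum.reindex) (auto simp: inj_on_def w_def power_mult)
    also have "\<dots> = z * (\<Sum>j<M. w ^ j)" by (simp add: sum_distrib_left)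
    also have "\<dots> \<in> qspan (mu (l ^ s))"
    proof (cases "w = 1")
      case True
      then have "z \<in> qspan (mu (l ^ s))" by (intro QV.span_base) (simp add: mu_def w_def)
      then show ?thesis using True qspan_of_nat_mult[of z "mu (l ^ s)" M] by (simp add: mult.commute)
    next
      case False
      then show ?thesis using sum_powers_root_of_unity[OF wM] QV.span_zero by simp
    qed
    finally show "(\<Sum>A\<in>(\<lambda>j. 1 + l ^ s * j) ` {..<M}. z ^ A) \<in> qspan (mu (l ^ s))" .
  qed (use xq fixed in auto)
  then show ?thesis using x(1) by (simp add: layer_def s_def)
qed

section \<open>Valuations on cyclotomic fields and the Frobenius automorphism\<close>

lemma mu_split:
  assumes "coprime a b" "z \<in> mu (a * b)"
  obtains x y where "x \<in> mu a" "y \<in> mu b" "z = x * y"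
proof -
  obtain e where e: "[e = 1] (mod a)" "[e = 0] (mod b)" using binary_chinese_remainder_nat[OF assms(1)] by blast
  obtain f where f: "[f = 0] (mod a)" "[f = 1] (mod b)" using binary_chinese_remainder_nat[OF assms(1)] by blast
  have "[e + f = 1] (mod a)" "[e + f = 1] (mod b)"
    using cong_add[OF e(1) f(1)] cong_add[OF e(2) f(2)] by simp_all
  then have "[e + f = 1] (mod a * b)" using coprime_cong_mult_nat assms(1) by blast
  then have "z ^ (e + f) = z ^ 1" by (rule mu_power_cong[OF assms(2)])
  then have "z = z ^ e * z ^ f" by (simp add: power_add)
  moreover have "z ^ e \<in> mu a"
  proof -
    obtain t where "e = b * t" using e(2) by (auto simp: cong_0_iff)
    then have "(z ^ e) ^ a = (z ^ (a * b)) ^ t" by (simp add: mult_ac flip: power_mult)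
    then show ?thesis using assms(2) by (simp add: mu_def)
  qed
  moreover have "z ^ f \<in> mu b"
  proof -
    obtain t where "f = a * t" using f(1) by (auto simp: cong_0_iff)
    then have "(z ^ f) ^ b = (z ^ (a * b)) ^ t" by (simp add: mult_ac flip: power_mult)
    then show ?thesis using assms(2) by (simp add: mu_def)
  qed
  ultimately show ?thesis using that by blast
qed

text \<open>Modulo a divisor \<open>c\<close> of \<open>p\<close> for which the roots of unity of
  \<open>p\<close>-power order are congruent to 1, an automorphism that is a power of
  \<open>p\<close> on the other roots acts as a power of the Frobenius map.\<close>

lemma gal_cong_frobenius:
  assumes p: "Factorial_Ring.prime p" and n: "n > 0" "n = p ^ a * m" "coprime m p"
    and c: "of_nat p = c * d" "d \<in> zspan (mu n)" "c \<in> zspan (mu n)"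
    and roots: "\<And>z. z \<in> mu (p ^ a) \<Longrightarrow> ring_cong (zspan (mu n)) c z 1"
    and A: "coprime A n" "[A = p ^ i] (mod m)" and x: "x \<in> zspan (mu n)"
  shows "ring_cong (zspan (mu n)) c (gal n A x) (x ^ (p ^ i))"
proof -
  let ?R = "zspan (mu n)"
  note R = zspan_mu_subring[of n]
  note Rc = is_subringD[OF R]
  have p0: "p ^ i > 0" using p by (simp add: prime_gt_0_nat)
  have modp: "ring_cong ?R c x y" if "ring_cong ?R (of_nat p) x y" for x y
    using ring_cong_modulus[OF R that c(1,2)] .
  have root: "ring_cong ?R c (z ^ A) (z ^ (p ^ i))" if z: "z \<in> mu n" for z
  proof -
    have "coprime (p ^ a) m" using n(3) coprime_commute by auto
    then obtain z1 z0 where z10: "z1 \<in> mu (p ^ a)" "z0 \<in> mu m" "z = z1 * z0"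
      using mu_split z n(2) by blast
    have zz: "z1 \<in> ?R" "z0 \<in> ?R"
      using z10 mu_mono[of "p ^ a" n] mu_mono[of m n] n(2) by (auto intro!: ZM.span_base)
    have k: "ring_cong ?R c (z1 ^ k) 1" for k
      using ring_cong_power[OF R roots[OF z10(1)] zz(1) Rc(1), of k] by simp
    have "ring_cong ?R c (z1 ^ A) (z1 ^ (p ^ i))"
      using ring_cong_trans[OF R k ring_cong_sym[OF R k]] .
    then have "ring_cong ?R c (z1 ^ A * z0 ^ A) (z1 ^ (p ^ i) * z0 ^ A)"
      using zz Rc by (intro ring_cong_mult[OF R _ ring_cong_refl[OF R]]) auto
    moreover have "z0 ^ A = z0 ^ (p ^ i)" using mu_power_cong[OF z10(2) A(2)] .
    ultimately show ?thesis by (simp add: z10(3) power_mult_distrib)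
  qed
  have "x \<in> ?R \<and> ring_cong ?R c (gal n A x) (x ^ (p ^ i))"
    using x
  proof (induction rule: ZM.span_induct_alt)
    case base
    then show ?case using n(1) A(1) p0 Rc(5) by (simp add: ring_cong_refl[OF R] zero_power)
  next
    case (step k z y)
    have z: "z \<in> ?R" using step(1) by (rule ZM.span_base)
    have y: "y \<in> ?R" "ring_cong ?R c (gal n A y) (y ^ (p ^ i))" using step by auto
    have kz: "of_int k * z \<in> ?R" using z by (rule zspan_of_int_mult)
    have yq: "y \<in> qspan (mu n)" and zq: "z \<in> qspan (mu n)" using y(1) z zspan_subset_qspan by auto
    have g: "gal n A (of_int k * z + y) = of_int k * z ^ A + gal n A y"
      using gal_add[OF n(1) A(1) _ yq, of "of_int k * z"] gal_rat_scale[OF n(1) A(1) zq, of "of_int k"]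
        gal_root[OF n(1) A(1) step(1)] kz zspan_subset_qspan[of "mu n"] by auto
    have 1: "ring_cong ?R c (of_int k * z ^ A) ((of_int k * z) ^ (p ^ i))"
      unfolding power_mult_distrib
      by (rule ring_cong_mult[OF R modp[OF ring_cong_sym[OF R frobenius_int[OF R p]]] root[OF step(1)] Rc(9) Rc(7)[OF z]])
    have 2: "ring_cong ?R c ((of_int k * z) ^ (p ^ i) + y ^ (p ^ i)) ((of_int k * z + y) ^ (p ^ i))"
      by (rule modp[OF ring_cong_sym[OF R frobenius_power_add[OF R p kz y(1)]]])
    have "ring_cong ?R c (gal n A (of_int k * z + y)) ((of_int k * z + y) ^ (p ^ i))"
      unfolding g by (rule ring_cong_trans[OF R ring_cong_add[OF R 1 y(2)] 2])
    moreover have "int_scale k z + y = of_int k * z + y" by (simp add: int_scale_def)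
    ultimately show ?case using Rc(2)[OF kz y(1)] by simp
  qed
  then show ?thesis ..
qed

context level_val
begin

lemma v_one_minus:
  assumes "x \<in> qspan (mu n)" "v x > 0"
  shows "v (1 - x) = 0"
proof (rule antisym)
  show "0 \<le> v (1 - x)" using assms closed(1) by (intro v_nonneg_diff) auto
  show "v (1 - x) \<le> 0"
  proof (rule ccontr)
    assume "\<not> v (1 - x) \<le> 0"
    then have "0 < v ((1 - x) + x)" using assms closed by (intro v_pos_add) auto
    then show False by simp
  qed
qed

lemma v_power_pos: "x \<in> qspan (mu n) \<Longrightarrow> v x > 0 \<Longrightarrow> k > 0 \<Longrightarrow> v (x ^ k) > 0"
  by (cases "v x") (auto simp: v_power)

lemma v_power_zero: "x \<in> qspan (mu n) \<Longrightarrow> v x = 0 \<Longrightarrow> v (x ^ k) = 0"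
  by (simp add: v_power)

lemma ring_cong_pos:
  assumes "ring_cong (zspan (mu n)) c x y" "c \<in> zspan (mu n)" "v c > 0"
  shows "v (x - y) > 0"
proof -
  obtain r where r: "r \<in> zspan (mu n)" "x - y = c * r" using assms(1) by (auto simp: ring_cong_def)
  show ?thesis unfolding r(2) using assms r zspan_closed v_zspan by (intro v_mult_pos) auto
qed

text \<open>If \<open>x\<close> is congruent to \<open>x ^ q\<close> modulo \<open>c\<close>, then \<open>1 - x ^ (q - 1)\<close> is a unit at \<open>v\<close> that
  multiplies a non-unit \<open>x\<close> into the ideal of \<open>c\<close>.\<close>

lemma unit_multiplier:
  assumes q: "q \<ge> 2" and fr: "ring_cong (zspan (mu n)) c x (x ^ q)" and x: "x \<in> zspan (mu n)"
  defines "e \<equiv> 1 - x ^ (q - 1)"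
  shows "e \<in> zspan (mu n)" "\<exists>y\<in>zspan (mu n). e * x = c * y" "v x > 0 \<Longrightarrow> v e = 0"
proof -
  note Rc = is_subringD[OF zspan_mu_subring[of n]]
  show "e \<in> zspan (mu n)" unfolding e_def using x Rc by auto
  have "x * x ^ (q - 1) = x ^ q" using q by (cases q) auto
  then have "e * x = x - x ^ q" by (simp add: e_def algebra_simps)
  then show "\<exists>y\<in>zspan (mu n). e * x = c * y" using fr by (auto simp: ring_cong_def)
  show "v x > 0 \<Longrightarrow> v e = 0" unfolding e_def using q x zspan_closed closed(9) by (intro v_one_minus v_power_pos) auto
qed

text \<open>A valuation is determined by its centre on the ring of cyclotomic integers. If
  \<open>x\<close> is not in the centre, then \<open>1 - x ^ (q - 1)\<close> is, so that units are
  recognized. A non-unit can be divided by \<open>c\<close> up to a unit, which reduces its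
  value.\<close>

lemma eq_if_centre_subset:
  assumes w: "w \<in> Val p (qspan (mu n))" and q: "q \<ge> 2"
    and c: "c \<in> zspan (mu n)" "c \<noteq> 0" "v c > 0" "w c = v c"
    and fr: "\<And>x. x \<in> zspan (mu n) \<Longrightarrow> ring_cong (zspan (mu n)) c x (x ^ q)"
    and sub: "\<And>x. x \<in> zspan (mu n) \<Longrightarrow> v x > 0 \<Longrightarrow> w x > 0"
    and x: "x \<in> qspan (mu n)"
  shows "v x = w x"
proof -
  interpret w: level_val p n w using prime subfield w n by unfold_locales
  note Rc = is_subringD[OF zspan_mu_subring[of n]]
  have unit: "w x = 0" if x: "x \<in> zspan (mu n)" "v x = 0" for x
  proof -
    obtain y where y: "y \<in> zspan (mu n)" "(1 - x ^ (q - 1)) * x = c * y"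
      using unit_multiplier(2)[OF q fr[OF x(1)] x(1)] by blast
    have e: "1 - x ^ (q - 1) \<in> zspan (mu n)" using x Rc by auto
    have "v ((1 - x ^ (q - 1)) * x) > 0"
      unfolding y(2) using c y zspan_closed v_zspan by (intro v_mult_pos) auto
    then have "v (1 - x ^ (q - 1)) > 0" using v_mult[OF zspan_closed[OF e] zspan_closed[OF x(1)]] x(2) by simp
    then have "w (1 - x ^ (q - 1)) > 0" by (rule sub[OF e])
    then have "\<not> w x > 0" using w.unit_multiplier(3)[OF q fr[OF x(1)] x(1)] by auto
    then show ?thesis using w.v_zspan[OF x(1)] by simp
  qed
  obtain r where r: "v c = ereal r" using v_real[OF zspan_closed[OF c(1)] c(2)] .
  have r0: "r > 0" using r c(3) by simp
  have main: "v x = w x" if "x \<in> zspan (mu n)" "x \<noteq> 0" "v x < ereal (real k * r)" for k x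
    using that
  proof (induction k arbitrary: x)
    case 0
    then show ?case using v_zspan[of x] by (simp add: zero_ereal_def[symmetric])
  next
    case (Suc k)
    show ?case
    proof (cases "v x > 0")
      case False
      then show ?thesis using unit[OF Suc.prems(1)] v_zspan[OF Suc.prems(1)] by simp
    next
      case True
      define e where "e = 1 - x ^ (q - 1)"
      obtain y where y: "y \<in> zspan (mu n)" "e * x = c * y"
        using unit_multiplier(2)[OF q fr[OF Suc.prems(1)] Suc.prems(1)] unfolding e_def by blast
      have e: "e \<in> zspan (mu n)" "v e = 0" "w e = 0"
        using unit_multiplier(1,3)[OF q fr[OF Suc.prems(1)] Suc.prems(1)] True
          w.unit_multiplier(3)[OF q fr[OF Suc.prems(1)] Suc.prems(1)] sub[OF Suc.prems(1) True] by (auto simp: e_def)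
      have "e \<noteq> 0" using e(2) by auto
      then have y0: "y \<noteq> 0" using y(2) Suc.prems(2) c(2) by auto
      have vx: "v x = v c + v y"
        using v_mult[OF zspan_closed[OF e(1)] zspan_closed[OF Suc.prems(1)]]
          v_mult[OF zspan_closed[OF c(1)] zspan_closed[OF y(1)]] e y(2) by simp
      have wx: "w x = w c + w y"
        using w.v_mult[OF zspan_closed[OF e(1)] zspan_closed[OF Suc.prems(1)]]
          w.v_mult[OF zspan_closed[OF c(1)] zspan_closed[OF y(1)]] e y(2) by simp
      obtain t where t: "v y = ereal t" using v_real[OF zspan_closed[OF y(1)] y0] .
      have "v y < ereal (real k * r)"
        using Suc.prems(3) unfolding vx r t by (simp add: algebra_simps)
      then have "v y = w y" using Suc.IH y(1) y0 by blast
      then show ?thesis using vx wx c(4) by simp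
    qed
  qed
  have zs: "v x = w x" if xz: "x \<in> zspan (mu n)" for x
  proof (cases "x = 0")
    case False
    obtain t where t: "v x = ereal t" using v_real[OF zspan_closed[OF xz] False] .
    obtain k where "t / r < real k" using reals_Archimedean2 by blast
    then have "t < real k * r" using r0 by (simp add: field_simps)
    then show ?thesis using main[OF xz False, of k] t by simp
  qed simp
  obtain d :: int where d: "d > 0" "of_int d * x \<in> zspan (mu n)" using qspan_clear_denominators[OF x] .
  have "v (of_int d) + v x = w (of_int d) + w x"
    using zs[OF d(2)] v_mult[OF closed(11) x] w.v_mult[OF closed(11) x] by simp
  moreover have "v (of_int d) = w (of_int d)" "\<bar>v (of_int d)\<bar> \<noteq> \<infinity>"
    using v_of_int[of d] w.v_of_int[of d] d(1) by auto
  ultimately show ?thesis by (cases "v (of_int d)"; cases "v x"; cases "w x") auto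
qed

lemma gal_Val:
  assumes "coprime A n"
  shows "restrict (\<lambda>x. v (gal n A x)) (qspan (mu n)) \<in> Val p (qspan (mu n))"
proof -
  have "v (gal n A x) = \<infinity> \<longleftrightarrow> x = 0" if "x \<in> qspan (mu n)" for x
    using v_infinity[OF gal_closed[OF n assms that]] gal_nonzero[OF n assms that] gal_zero[OF n assms] by auto
  moreover have "v (gal n A x) \<noteq> - \<infinity>" if "x \<in> qspan (mu n)" for x
    using valuation gal_closed[OF n assms that] by (auto simp: is_valuation_def)
  moreover have "v (gal n A (x * y)) = v (gal n A x) + v (gal n A y)"
    "min (v (gal n A x)) (v (gal n A y)) \<le> v (gal n A (x + y))" if "x \<in> qspan (mu n)" "y \<in> qspan (mu n)" for x y
    using that gal_add[OF n assms] gal_mult[OF n assms] v_add v_mult gal_closed[OF n assms] by auto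
  ultimately show ?thesis
    using closed(2,3,12) gal_of_rat[OF n assms] v_of_rat
    by (auto simp: Val_def is_valuation_def)
qed

end

text \<open>The element is \<open>1 - zeta (p ^ a)\<close>, or \<open>p\<close> itself in the
  unramified case. It divides \<open>p\<close>, a power of it is divisible by \<open>p\<close>,
  and it is associated to its conjugates; so it has the same positive value at any two conjugate
  valuations.\<close>

lemma uniformizer:
  assumes p: "Factorial_Ring.prime p" and n: "n > 0" "n = p ^ a * m"
  defines "c \<equiv> (if a = 0 then of_nat p else 1 - zeta (p ^ a))"
  shows "c \<in> zspan (mu n)" "c \<noteq> 0" "\<exists>d\<in>zspan (mu n). of_nat p = c * d"
    "\<And>z. z \<in> mu (p ^ a) \<Longrightarrow> ring_cong (zspan (mu n)) c z 1"
    "\<And>A. coprime A n \<Longrightarrow> ring_cong (zspan (mu n)) c (gal n A c) 0 \<and> ring_cong (zspan (mu n)) (gal n A c) c 0"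
    "ring_cong (zspan (mu n)) (of_nat p) (c ^ (p ^ a)) 0"
proof -
  let ?R = "zspan (mu n)"
  note R = zspan_mu_subring[of n]
  note Rc = is_subringD[OF R]
  have p0: "p > 0" using p by (simp add: prime_gt_0_nat)
  have "c \<in> ?R \<and> c \<noteq> 0 \<and> (\<exists>d\<in>?R. of_nat p = c * d) \<and> (\<forall>z\<in>mu (p ^ a). ring_cong ?R c z 1) \<and>
    (\<forall>A. coprime A n \<longrightarrow> ring_cong ?R c (gal n A c) 0 \<and> ring_cong ?R (gal n A c) c 0) \<and>
    ring_cong ?R (of_nat p) (c ^ (p ^ a)) 0"
  proof (cases "a = 0")
    case True
    then have "c = of_nat p" by (simp add: c_def)
    then show ?thesis using True Rc(1,8) p0 gal_of_nat[OF n(1)] ring_cong_refl[OF R, of "of_nat p" 1]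
      by (auto simp: mu_def ring_cong_def intro!: bexI[of _ 1])
  next
    case False
    define N z where "N = p ^ a" and "z = zeta N"
    have N: "N > 1" "N dvd n" using one_less_power[OF prime_gt_1_nat[OF p], of a] False n(2) by (simp_all add: N_def)
    then have N0: "N > 0" by simp
    have c: "c = 1 - z" using False by (simp add: c_def z_def N_def)
    have zN: "z \<in> mu N" using zeta_in_mu[of N] N by (simp add: z_def)
    then have zmu: "z \<in> mu n" using mu_mono[OF N(2)] by auto
    then have z: "z \<in> ?R" by (rule ZM.span_base)
    have quot: "\<exists>d\<in>?R. 1 - y ^ k = (1 - y) * d" if "y \<in> ?R" for y k
    proof -
      have "1 - y ^ k = (1 - y) * (\<Sum>i<k. y ^ i)" by (rule one_diff_power_eq)
      moreover have "(\<Sum>i<k. y ^ i) \<in> ?R" using that Rc by (intro is_subring_sum[OF R]) auto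
      ultimately show ?thesis by blast
    qed
    have 1: "c \<in> ?R" using z Rc by (auto simp: c)
    have 2: "c \<noteq> 0"
    proof
      assume "c = 0"
      then have "zeta N ^ 1 = zeta N ^ 0" by (simp add: c z_def)
      then show False using zeta_power_eq_iff[of N 1 0] N by (simp add: cong_def)
    qed
    have 3: "\<exists>d\<in>?R. of_nat p = c * d"
    proof -
      define w where "w = z ^ (p ^ (a - 1))"
      have pa: "p ^ a = p ^ (a - 1) * p" using False by (metis mult.commute power_eq_if)
      have w1: "w ^ p = 1" using zN by (simp add: w_def mu_def N_def pa flip: power_mult)
      have "w \<noteq> 1"
      proof
        assume "w = 1"
        then have "zeta N ^ (p ^ (a - 1)) = zeta N ^ 0" by (simp add: w_def z_def)
        then have "[p ^ (a - 1) = 0] (mod N)" using zeta_power_eq_iff[OF N0, of "p ^ (a - 1)" 0] by blast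
        then have "N dvd p ^ (a - 1)" by (simp add: cong_0_iff)
        moreover have "p ^ (a - 1) < N" using False prime_gt_1_nat[OF p] by (simp add: N_def)
        ultimately show False using p0 by (auto dest: dvd_imp_le)
      qed
      then have "(\<Sum>j<p. w ^ j) = 0" using sum_powers_root_of_unity[OF w1] by simp
      then have "of_nat p = (\<Sum>j<p. 1 - w ^ j)" by (simp add: sum_subtractf)
      also have "\<dots> = (\<Sum>j<p. 1 - z ^ (p ^ (a - 1) * j))" by (simp add: w_def power_mult)
      finally have pe: "of_nat p = (\<Sum>j<p. 1 - z ^ (p ^ (a - 1) * j))" .
      obtain d where d: "\<And>k. d k \<in> ?R" "\<And>k. 1 - z ^ k = c * d k" using quot[OF z] unfolding c by metis
      have "of_nat p = c * (\<Sum>j<p. d (p ^ (a - 1) * j))" unfolding pe d(2) by (simp add: sum_distrib_left)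
      then show ?thesis using is_subring_sum[OF R d(1)] by blast
    qed
    have 4: "ring_cong ?R c y 1" if y: "y \<in> mu (p ^ a)" for y
    proof -
      have "y \<in> mu N" using y by (simp add: N_def)
      then obtain k where k: "y = z ^ k" using mu_eq_zeta_powers[OF N0] by (auto simp: z_def)
      obtain d where "d \<in> ?R" "1 - z ^ k = c * d" using quot[OF z] unfolding c by blast
      then have "ring_cong ?R c 1 y" unfolding ring_cong_def k by blast
      then show ?thesis by (rule ring_cong_sym[OF R])
    qed
    have 5: "ring_cong ?R c (gal n A c) 0 \<and> ring_cong ?R (gal n A c) c 0" if A: "coprime A n" for A
    proof -
      have g: "gal n A c = 1 - z ^ A"
        using gal_diff[OF n(1) A, of 1 z] gal_one[OF n(1) A] gal_root[OF n(1) A zmu] QV.span_base[OF zmu]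
          of_rat_in_qspan[OF mult_closed_mu, of 1 n] by (simp add: c)
      have "coprime A N" using A N(2) by (metis coprime_common_divisor_nat coprime_divisors dvd_refl)
      then obtain B where B: "[A * B = 1] (mod N)" using cong_solve_coprime_nat[of A N] by auto
      have "(z ^ A) ^ B = z" using mu_power_cong[OF zN B] by (simp add: power_mult)
      moreover have "z ^ A \<in> ?R" using z Rc by auto
      ultimately obtain d where d: "d \<in> ?R" "1 - z = (1 - z ^ A) * d" using quot[of "z ^ A" B] by auto
      obtain d' where d': "d' \<in> ?R" "1 - z ^ A = (1 - z) * d'" using quot[OF z] by blast
      have "gal n A c - 0 = c * d'" unfolding g using d'(2) c by simp
      moreover have "c - 0 = gal n A c * d" unfolding g using d(2) c by simp
      ultimately show ?thesis unfolding ring_cong_def using d(1) d'(1) by blast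
    qed
    have 6: "ring_cong ?R (of_nat p) (c ^ (p ^ a)) 0"
    proof -
      have "ring_cong ?R (of_nat p) ((c + z) ^ (p ^ a)) (c ^ (p ^ a) + z ^ (p ^ a))"
        by (rule frobenius_power_add[OF R p 1 z])
      then have "ring_cong ?R (of_nat p) 1 (c ^ (p ^ a) + 1)" using zN by (simp add: c mu_def N_def)
      from ring_cong_sym[OF R this] show ?thesis by (simp add: ring_cong_def)
    qed
    show ?thesis using 1 2 3 4 5 6 by blast
  qed
  then show "c \<in> ?R" "c \<noteq> 0" "\<exists>d\<in>?R. of_nat p = c * d" "\<And>z. z \<in> mu (p ^ a) \<Longrightarrow> ring_cong ?R c z 1"
    "\<And>A. coprime A n \<Longrightarrow> ring_cong ?R c (gal n A c) 0 \<and> ring_cong ?R (gal n A c) c 0"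
    "ring_cong ?R (of_nat p) (c ^ (p ^ a)) 0" by blast+
qed

context level_val
begin

lemma decompose_level:
  obtains a m where "n = p ^ a * m" "coprime m p" "m > 0"
proof -
  obtain m where m: "n = p ^ multiplicity p n * m" "\<not> p dvd m"
    using multiplicity_decompose'[of n p] n prime not_prime_unit by blast
  have "coprime m p" using prime_imp_coprime[OF prime m(2)] by (simp add: coprime_commute)
  moreover have "m > 0" using m(1) n by (cases "m = 0") auto
  ultimately show ?thesis using that m(1) by blast
qed

lemma frobenius_power:
  assumes "coprime m p" "m > 0"
  obtains f where "p ^ f \<ge> 2" "[1 = p ^ f] (mod m)"
proof (rule that[of "totient m"])
  have "totient m > 0" using assms(2) by simp
  then show "p ^ totient m \<ge> 2" using prime_gt_1_nat[OF prime] one_less_power[of p "totient m"] by linarith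
  show "[1 = p ^ totient m] (mod m)" using euler_theorem[of p m] assms(1) by (simp add: coprime_commute cong_sym)
qed

text \<open>The decomposition group contains the inertia group and the Frobenius automorphisms:
  such an automorphism acts modulo \<open>c\<close> as a power of the Frobenius map, which
  preserves the centre of the valuation.\<close>

theorem gal_invariant:
  assumes nm: "n = p ^ a * m" "coprime m p" and A: "coprime A n" "[A = p ^ i] (mod m)" and x: "x \<in> qspan (mu n)"
  shows "v (gal n A x) = v x"
proof -
  let ?R = "zspan (mu n)"
  define c where "c = (if a = 0 then of_nat p else 1 - zeta (p ^ a))"
  note u = uniformizer[OF prime n nm(1), folded c_def]
  have m0: "m > 0" using n nm(1) by (cases "m = 0") auto
  obtain d where d: "d \<in> ?R" "of_nat p = c * d" using u(3) by blast
  note fr = gal_cong_frobenius[OF prime n nm(1,2) d(2,1) u(1) u(4)]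
  obtain f where f: "p ^ f \<ge> 2" "[1 = p ^ f] (mod m)" using frobenius_power[OF nm(2) m0] .
  have frob: "ring_cong ?R c x (x ^ (p ^ f))" if "x \<in> ?R" for x
    using fr[OF _ _ f(2) that] gal_1[OF n zspan_closed[OF that]] by simp
  have cpos: "v c > 0"
  proof (rule ccontr)
    assume "\<not> v c > 0"
    then have "v c = 0" using v_zspan[OF u(1)] by simp
    then have "v (c ^ (p ^ a)) = 0" using v_power_zero zspan_closed[OF u(1)] by blast
    moreover have "v (c ^ (p ^ a) - 0) > 0"
      using of_nat_in_zspan[OF mult_closed_mu] v_prime by (intro ring_cong_pos[OF u(6)]) auto
    ultimately show False by simp
  qed
  define w where "w = restrict (\<lambda>x. v (gal n A x)) (qspan (mu n))"
  have w: "w \<in> Val p (qspan (mu n))" unfolding w_def by (rule gal_Val[OF A(1)])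
  have gc: "gal n A c \<in> ?R" by (rule gal_zspan_closed[OF n A(1) u(1)])
  have wc: "w c = v c"
  proof -
    obtain r s where rs: "r \<in> ?R" "gal n A c = c * r" "s \<in> ?R" "c = gal n A c * s"
      using u(5)[OF A(1)] unfolding ring_cong_def by auto
    have "v c \<le> v (gal n A c)"
      using v_mult[OF zspan_closed[OF u(1)] zspan_closed[OF rs(1)]] rs(2) v_zspan[OF rs(1)] by (simp add: add_increasing2)
    moreover have "v (gal n A c) \<le> v c"
      using v_mult[OF zspan_closed[OF gc] zspan_closed[OF rs(3)]] rs(4)[symmetric] v_zspan[OF rs(3)] by (simp add: add_increasing2)
    ultimately show ?thesis using zspan_closed[OF u(1)] by (simp add: w_def)
  qed
  have "v x = w x"
  proof (rule eq_if_centre_subset[OF w f(1) u(1,2) cpos wc frob])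
    show "x \<in> qspan (mu n)" by (rule x)
    fix y assume y: "y \<in> ?R" "v y > 0"
    have "v (gal n A y - y ^ (p ^ i)) > 0" by (rule ring_cong_pos[OF fr[OF _ A y(1)] u(1) cpos])
    moreover have "v (y ^ (p ^ i)) > 0" using y zspan_closed prime by (intro v_power_pos) (auto simp: prime_gt_0_nat)
    ultimately have "v ((gal n A y - y ^ (p ^ i)) + y ^ (p ^ i)) > 0"
      using y zspan_closed[OF y(1)] closed(7,9) gal_closed[OF n A(1)] by (intro v_pos_add) auto
    then show "w y > 0" using zspan_closed[OF y(1)] by (simp add: w_def)
  qed
  then show ?thesis using x by (simp add: w_def)
qed

end

locale unramified_level = level_val +
  assumes coprime_level: "coprime n p"
begin

lemma frobenius_mod_p:
  assumes "coprime A n" "[A = p ^ i] (mod n)" "x \<in> zspan (mu n)"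
  shows "ring_cong (zspan (mu n)) (of_nat p) (gal n A x) (x ^ (p ^ i))"
proof (rule gal_cong_frobenius[OF prime n _ coprime_level, where a = 0 and d = 1])
  show "ring_cong (zspan (mu n)) (of_nat p) z 1" if "z \<in> mu (p ^ 0)" for z
    using that ring_cong_refl[OF zspan_mu_subring] by (simp add: mu_def)
qed (use assms one_in_zspan[OF mult_closed_mu] of_nat_in_zspan[OF mult_closed_mu] in auto)

lemma p_in_ring: "of_nat p \<in> zspan (mu n)"
  by (rule of_nat_in_zspan[OF mult_closed_mu])

lemma power_mod_p:
  obtains f where "p ^ f \<ge> 2" "\<And>x. x \<in> zspan (mu n) \<Longrightarrow> ring_cong (zspan (mu n)) (of_nat p) x (x ^ (p ^ f))"
proof -
  obtain f where f: "p ^ f \<ge> 2" "[1 = p ^ f] (mod n)" using frobenius_power[OF coprime_level n] .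
  have "ring_cong (zspan (mu n)) (of_nat p) x (x ^ (p ^ f))" if "x \<in> zspan (mu n)" for x
    using frobenius_mod_p[OF _ f(2) that] gal_1[OF n zspan_closed[OF that]] by simp
  then show ?thesis using that f(1) by blast
qed

lemma gal_frobenius_invariant:
  assumes "coprime A n" "[A = p ^ i] (mod n)" "x \<in> qspan (mu n)"
  shows "v (gal n A x) = v x"
  using gal_invariant[of 0 n A i x] assms coprime_level by simp

text \<open>Since \<open>p\<close> does not divide \<open>n\<close>, it is a uniformizer: a
  non-unit can be divided by \<open>p\<close> after multiplication with a unit.\<close>

lemma unit_decomposition:
  assumes x: "x \<in> qspan (mu n)" "x \<noteq> 0"
  obtains e y j where "e \<in> zspan (mu n)" "y \<in> zspan (mu n)" "v e = 0" "v y = 0" "e * x = of_nat p powi j * y"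
proof -
  let ?R = "zspan (mu n)"
  note Rc = is_subringD[OF zspan_mu_subring[of n]]
  obtain f where f: "p ^ f \<ge> 2" "\<And>x. x \<in> ?R \<Longrightarrow> ring_cong ?R (of_nat p) x (x ^ (p ^ f))"
    using power_mod_p by blast
  have p0: "(of_nat p :: complex) \<noteq> 0" using prime by auto
  have main: "\<exists>e y j. e \<in> ?R \<and> y \<in> ?R \<and> v e = 0 \<and> v y = 0 \<and> e * x = of_nat p ^ j * y"
    if "x \<in> ?R" "x \<noteq> 0" "v x < ereal (real k)" for k x
    using that
  proof (induction k arbitrary: x)
    case 0
    then show ?case using v_zspan[of x] by (simp add: zero_ereal_def[symmetric])
  next
    case (Suc k)
    show ?case
    proof (cases "v x > 0")
      case False
      then have "v x = 0" using v_zspan[OF Suc.prems(1)] by simp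
      then show ?thesis using Suc.prems Rc(1) by (intro exI[of _ 1] exI[of _ x] exI[of _ 0]) auto
    next
      case True
      define e where "e = 1 - x ^ (p ^ f - 1)"
      note um = unit_multiplier[OF f(1) f(2)[OF Suc.prems(1)] Suc.prems(1), folded e_def]
      obtain y where y: "y \<in> ?R" "e * x = of_nat p * y" using um(2) by blast
      have e0: "v e = 0" using um(3) True by simp
      then have "e \<noteq> 0" by auto
      then have y0: "y \<noteq> 0" using y(2) Suc.prems(2) p0 by auto
      obtain t where t: "v y = ereal t" using v_real[OF zspan_closed[OF y(1)] y0] .
      have "v x = 1 + v y"
        using v_mult[OF zspan_closed[OF um(1)] zspan_closed[OF Suc.prems(1)]]
          v_mult[OF closed(10) zspan_closed[OF y(1)], of p] v_prime e0 y(2) by simp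
      then have "v y < ereal (real k)" using Suc.prems(3) t by (simp add: one_ereal_def)
      then obtain e' y' j where *: "e' \<in> ?R" "y' \<in> ?R" "v e' = 0" "v y' = 0" "e' * y = of_nat p ^ j * y'"
        using Suc.IH[OF y(1) y0] by blast
      have "v (e' * e) = 0" using v_mult[OF zspan_closed[OF *(1)] zspan_closed[OF um(1)]] *(3) e0 by simp
      moreover have "(e' * e) * x = of_nat p ^ Suc j * y'"
        using *(5) y(2) by (simp add: algebra_simps)
      ultimately show ?thesis using * Rc(3)[OF *(1) um(1)] by blast
    qed
  qed
  obtain d :: int where d: "d > 0" "of_int d * x \<in> ?R" using qspan_clear_denominators[OF x(1)] .
  obtain t where t: "v (of_int d * x) = ereal t" using v_real[OF zspan_closed[OF d(2)]] d x(2) by auto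
  obtain k where "t < real k" using reals_Archimedean2 by blast
  then have "v (of_int d * x) < ereal (real k)" using t by simp
  then obtain e y j where ey: "e \<in> ?R" "y \<in> ?R" "v e = 0" "v y = 0" "e * (of_int d * x) = of_nat p ^ j * y"
    using main[OF d(2)] d(1) x(2) by fastforce
  obtain m d' where d': "d = int p ^ m * d'" "\<not> int p dvd d'"
    using multiplicity_decompose'[of d "int p"] d(1) prime not_prime_unit
    by (metis less_irrefl prime_int_nat_transfer prime_nat_int_transfer)
  have "v (e * of_int d') = 0" using v_mult[OF zspan_closed[OF ey(1)] closed(11)] ey(3) v_of_int_coprime[OF d'(2)] by simp
  moreover have "(e * of_int d') * x = of_nat p powi (int j - int m) * y"
  proof -
    have "of_nat p ^ m * ((e * of_int d') * x) = of_nat p ^ j * y" using ey(5) d'(1) by (simp add: mult_ac)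
    then show ?thesis using p0 by (simp add: power_int_diff field_simps)
  qed
  moreover have "e * of_int d' \<in> ?R" using ey(1) Rc by auto
  ultimately show ?thesis using that ey by blast
qed

lemma integral_value:
  assumes "x \<in> qspan (mu n)" "x \<noteq> 0"
  obtains j :: int where "v x = ereal (of_int j)"
proof -
  obtain e y j where ey: "e \<in> zspan (mu n)" "y \<in> zspan (mu n)" "v e = 0" "v y = 0" "e * x = of_nat p powi j * y"
    using unit_decomposition[OF assms] .
  have "v (e * x) = v (of_nat p powi j) + v y" unfolding ey(5) by (rule v_mult[OF prime_powi_closed zspan_closed[OF ey(2)]])
  then have "v x = ereal (of_int j)" using v_mult[OF zspan_closed[OF ey(1)] assms(1)] ey v_prime_powi by simp
  then show ?thesis using that by blast
qed

text \<open>For cyclotomic integers this is a congruence modulo \<open>p\<close>. In general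
  \<open>e x\<close> is a cyclotomic integer for some unit \<open>e\<close> among them, and the
  congruences for \<open>e x\<close> and \<open>e\<close> imply that for \<open>x\<close>.\<close>

lemma frobenius_residue:
  assumes A: "coprime A n" "[A = p ^ i] (mod n)" and x: "x \<in> qspan (mu n)" "v x \<ge> 0"
  shows "v (gal n A x - x ^ (p ^ i)) > 0"
proof (cases "x = 0")
  case True
  then show ?thesis using gal_zero[OF n A(1)] prime by (simp add: zero_power prime_gt_0_nat)
next
  case False
  let ?R = "zspan (mu n)"
  note Rc = is_subringD[OF zspan_mu_subring[of n]]
  define q where "q = p ^ i"
  obtain e y j where ey: "e \<in> ?R" "y \<in> ?R" "v e = 0" "v y = 0" "e * x = of_nat p powi j * y"
    using unit_decomposition[OF x(1) False] .
  have "v (e * x) = v (of_nat p powi j) + v y" unfolding ey(5) by (rule v_mult[OF prime_powi_closed zspan_closed[OF ey(2)]])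
  then have "v x = ereal (of_int j)" using v_mult[OF zspan_closed[OF ey(1)] x(1)] ey v_prime_powi by simp
  then have j: "j \<ge> 0" using x(2) by simp
  have exR: "e * x \<in> ?R" unfolding ey(5) using j ey(2) Rc by (auto simp: power_int_def)
  have pos: "v (gal n A u - u ^ q) > 0" if "u \<in> ?R" for u
    using ring_cong_pos[OF frobenius_mod_p[OF A that] p_in_ring] v_prime by (simp add: q_def)
  have cl: "gal n A x \<in> qspan (mu n)" "gal n A e \<in> qspan (mu n)" "e ^ q \<in> qspan (mu n)" "x ^ q \<in> qspan (mu n)"
    "e \<in> qspan (mu n)" "gal n A (e * x) \<in> qspan (mu n)" "(e * x) ^ q \<in> qspan (mu n)"
    using zspan_closed[OF ey(1)] zspan_closed[OF exR] x(1) gal_closed[OF n A(1)] closed(9) by auto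
  have "e ^ q * (gal n A x - x ^ q) = (gal n A (e * x) - (e * x) ^ q) - (gal n A e - e ^ q) * gal n A x"
    using gal_mult[OF n A(1) cl(5) x(1)] by (simp add: power_mult_distrib algebra_simps)
  moreover have "v ((gal n A (e * x) - (e * x) ^ q) - (gal n A e - e ^ q) * gal n A x) > 0"
  proof (rule v_pos_diff[OF closed(7)[OF cl(6,7)] closed(3)[OF closed(7)[OF cl(2,3)] cl(1)] pos[OF exR]])
    show "v ((gal n A e - e ^ q) * gal n A x) > 0"
      using gal_frobenius_invariant[OF A x(1)] x(2)
      by (intro v_mult_pos[OF closed(7)[OF cl(2,3)] cl(1) pos[OF ey(1)]]) simp
  qed
  ultimately have "v (e ^ q * (gal n A x - x ^ q)) > 0" by simp
  moreover have "v (e ^ q) = 0" using v_power_zero[OF cl(5) ey(3)] .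
  ultimately show ?thesis using v_mult[OF cl(3) closed(7)[OF cl(1,4)]] by (simp add: q_def)
qed

end

section \<open>Valuations of the \<open>\<int>\<^sub>l\<close>-extension\<close>

lemma level_restrict:
  assumes "Factorial_Ring.prime p" "w \<in> Val p Q_cyc" "n > 0"
  shows "level_val p n (restrict w (qspan (mu n)))"
proof -
  interpret padic_val p Q_cyc w using assms is_subfield_Q_cyc by unfold_locales
  show ?thesis
    using restrict_Val[OF is_subfield_qspan_mu[OF assms(3)] qspan_mu_Q_cyc[OF assms(3)]] assms is_subfield_qspan_mu[OF assms(3)]
    by unfold_locales
qed

lemma unramified_restrict:
  assumes "Factorial_Ring.prime p" "w \<in> Val p Q_cyc" "n > 0" "coprime n p"
  shows "unramified_level p n (restrict w (qspan (mu n)))"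
  using level_restrict[OF assms(1-3)] assms(4) by (simp add: unramified_level_def unramified_level_axioms_def)

lemma Val_gal_invariant:
  assumes p: "Factorial_Ring.prime p" and w: "w \<in> Val p Q_cyc" and n: "n > 0" "n = p ^ a * m" "coprime m p"
    and A: "coprime A n" "[A = p ^ i] (mod m)" and x: "x \<in> qspan (mu n)"
  shows "w (gal n A x) = w x"
proof -
  interpret w: level_val p n "restrict w (qspan (mu n))" by (rule level_restrict[OF p w n(1)])
  show ?thesis using w.gal_invariant[OF n(2,3) A x] x gal_closed[OF n(1) A(1) x] by simp
qed

lemma gal_commute:
  assumes "n > 0" "coprime A n" "coprime B n" "x \<in> qspan (mu n)"
  shows "gal n A (gal n B x) = gal n B (gal n A x)"
  using gal_compose[OF assms] gal_compose[OF assms(1,3,2,4)] by (simp add: mult.commute)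

lemma gal_Q_cyc_Delta:
  assumes "n > 0" "coprime A n" "x \<in> qspan (mu n)" "x \<in> Q_cyc_Delta"
  shows "gal n A x \<in> Q_cyc_Delta"
proof -
  have "gal n B (gal n A x) = gal n A x" if "torsion_residue n B" for B
    using gal_commute[OF assms(1,2) torsion_residue_coprime[OF assms(1) that] assms(3)]
      Q_cyc_Delta_iff[OF assms(1,3)] assms(4) that by auto
  then show ?thesis using Q_cyc_Delta_iff[OF assms(1) gal_closed[OF assms(1-3)]] by blast
qed

text \<open>The norm of \<open>x\<close> for the group generated by the Frobenius automorphism
  lies in the layer on which the valuations agree. Its value is that of \<open>x\<close>
  multiplied by the number of factors, as the Frobenius automorphism preserves every
  valuation.\<close>

lemma Val_eq_on_layer:
  assumes p: "Factorial_Ring.prime p" and l: "Factorial_Ring.prime l" and pl: "p \<noteq> l"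
    and v: "v \<in> Val p Q_cyc" and w: "w \<in> Val p Q_cyc"
    and eq: "\<And>y. y \<in> layer l (split_level p l) \<Longrightarrow> v y = w y" and x: "x \<in> layer l k"
  shows "v x = w x"
proof (cases "x = 0")
  case True
  then show ?thesis using eq[of 0] is_subfieldD(6)[OF is_subfield_layer[OF l]] by simp
next
  case False
  define N where "N = l ^ k"
  have N: "N > 0" using l by (simp add: N_def prime_gt_0_nat)
  have copp: "coprime p N" using primes_coprime[OF p l pl] by (simp add: N_def)
  have xN: "x \<in> qspan (mu N)" "x \<in> Q_cyc_Delta" using x by (auto simp: layer_def N_def)
  define r where "r = totient N"
  have r: "r > 0" using N by (simp add: r_def)
  define f where "f i = gal N (p ^ i) x" for i
  have copi: "coprime (p ^ i) N" for i using copp by simp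
  have f: "f i \<in> qspan (mu N)" "f i \<noteq> 0" "f i \<in> Q_cyc_Delta" for i
    using gal_closed[OF N copi xN(1)] gal_nonzero[OF N copi xN(1) False] gal_Q_cyc_Delta[OF N copi xN] by (auto simp: f_def)
  have step: "gal N p (f i) = f (Suc i)" for i
    using gal_compose[OF N copp copi xN(1)] by (simp add: f_def)
  have "[p ^ r = p ^ 0] (mod N)" using euler_theorem[OF copp] by (simp add: r_def)
  then have fr: "f r = f 0" unfolding f_def by (rule gal_cong[OF N copi _ xN(1)])
  define y where "y = (\<Prod>i<r. f i)"
  have "f 0 * (\<Prod>i<r. f (Suc i)) = (\<Prod>i<Suc r. f i)" by (rule prod.lessThan_Suc_shift[symmetric])
  also have "\<dots> = f 0 * (\<Prod>i<r. f i)" using fr by (simp add: mult.commute)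
  finally have shift: "(\<Prod>i<r. f (Suc i)) = y" using f(2) by (simp add: y_def)
  have "gal N p y = (\<Prod>i<r. gal N p (f i))" unfolding y_def by (rule gal_prod[OF N copp f(1)])
  then have "gal N p y = y" using shift step by simp
  moreover have "y \<in> layer l k"
    using f(1,3) is_subfield_prod[OF is_subfield_layer[OF l], of "{..<r}" f k] by (auto simp: y_def layer_def N_def)
  ultimately have "y \<in> layer l (split_level p l)"
    using frobenius_fixed_in_split_layer[OF p l pl] by (simp add: N_def)
  then have vw: "v y = w y" by (rule eq)
  have norm_value: "u y = ereal (real r * t)" if u: "u \<in> Val p Q_cyc" and t: "u x = ereal t" for u t
  proof -
    interpret u: padic_val p Q_cyc u using p u is_subfield_Q_cyc by unfold_locales
    have "coprime N p" using copp by (simp add: coprime_commute)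
    then have "u (f i) = ereal t" for i
      using Val_gal_invariant[OF p u N _ _ copi _ xN(1), of 0 N i i] t by (simp add: f_def)
    moreover have "u y = (\<Sum>i<r. u (f i))"
      unfolding y_def using f(1) qspan_mu_Q_cyc[OF N] by (intro u.v_prod) auto
    ultimately show ?thesis by simp
  qed
  have xQ: "x \<in> Q_cyc" using xN(1) qspan_mu_Q_cyc[OF N] by auto
  interpret v: padic_val p Q_cyc v using p v is_subfield_Q_cyc by unfold_locales
  interpret w: padic_val p Q_cyc w using p w is_subfield_Q_cyc by unfold_locales
  obtain s where s: "v x = ereal s" using v.v_real[OF xQ False] .
  obtain t where t: "w x = ereal t" using w.v_real[OF xQ False] .
  show ?thesis using norm_value[OF v s] norm_value[OF w t] vw r s t by simp
qed

lemma is_subfield_B_fin: "Factorial_Ring.prime l \<Longrightarrow> is_subfield (B_fin l p)"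
  by (simp add: B_fin_eq is_subfield_layer)

lemma B_fin_subset: "Factorial_Ring.prime l \<Longrightarrow> B_fin l p \<subseteq> B_inf l"
  by (auto simp: B_fin_eq B_inf_eq)

text \<open>Valuations extend, so that the restriction map is surjective. It is injective because
  the Frobenius automorphism topologically generates the Galois group of the extension, so that
  only one valuation lies above.\<close>

theorem bij_restrict_B_fin:
  assumes p: "Factorial_Ring.prime p" and l: "Factorial_Ring.prime l" and pl: "p \<noteq> l"
  shows "bij_betw (\<lambda>v. restrict v (B_fin l p)) (Val p (B_inf l)) (Val p (B_fin l p))"
proof -
  note Fin = is_subfield_B_fin[OF l, of p] and Inf = is_subfield_B_inf[OF l]
  have InfQ: "B_inf l \<subseteq> Q_cyc" using B_inf_subset[OF l] Q_cyc_Delta_subset by auto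
  have "inj_on (\<lambda>v. restrict v (B_fin l p)) (Val p (B_inf l))"
  proof (rule inj_onI)
    fix v v' assume v: "v \<in> Val p (B_inf l)" "v' \<in> Val p (B_inf l)" and eq: "restrict v (B_fin l p) = restrict v' (B_fin l p)"
    obtain w where w: "w \<in> Val p Q_cyc" "restrict w (B_inf l) = v" using Val_extends_to_Q_cyc[OF p Inf InfQ v(1)] .
    obtain w' where w': "w' \<in> Val p Q_cyc" "restrict w' (B_inf l) = v'" using Val_extends_to_Q_cyc[OF p Inf InfQ v(2)] .
    have "w y = w' y" if "y \<in> layer l (split_level p l)" for y
    proof -
      have y: "y \<in> B_fin l p" "y \<in> B_inf l" using that B_fin_eq[OF l] B_fin_subset[OF l, of p] by auto
      have "v y = v' y" using fun_cong[OF eq, of y] y(1) by simp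
      then show ?thesis using y(2) w(2) w'(2) by (metis restrict_apply')
    qed
    then have "w x = w' x" if "x \<in> B_inf l" for x
      using Val_eq_on_layer[OF p l pl w(1) w'(1)] that B_inf_eq[OF l] by auto
    then show "v = v'" unfolding w(2)[symmetric] w'(2)[symmetric] by (intro restrict_ext)
  qed
  moreover have "restrict v (B_fin l p) \<in> Val p (B_fin l p)" if v: "v \<in> Val p (B_inf l)" for v
  proof -
    interpret padic_val p "B_inf l" v using p Inf v by unfold_locales
    show ?thesis by (rule restrict_Val[OF Fin B_fin_subset[OF l]])
  qed
  moreover have "v \<in> (\<lambda>v. restrict v (B_fin l p)) ` Val p (B_inf l)" if "v \<in> Val p (B_fin l p)" for v
    using restrict_Val_surj[OF p Fin Inf B_fin_subset[OF l] InfQ that] by auto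
  ultimately show ?thesis unfolding bij_betw_def by blast
qed

section \<open>Transitivity of the Galois action on valuations\<close>

text \<open>Suppose that the centre of \<open>w\<close> is not contained in that of any conjugate
  of \<open>v\<close>. For each \<open>A\<close> there is a witness \<open>y A\<close>, and the
  product of the elements \<open>1 - y A ^ (q - 1)\<close> is a unit at \<open>w\<close> congruent
  to 1 but a non-unit at all conjugates of \<open>v\<close>. The norm of its difference
  \<open>x\<close> from 1 is a rational number with a positive value at \<open>w\<close> and the
  value 0 at \<open>v\<close>, which is impossible.\<close>

theorem valuations_conjugate:
  assumes p: "Factorial_Ring.prime p" and l: "Factorial_Ring.prime l" and pl: "p \<noteq> l" and n_def: "n = l ^ s"
    and v: "v \<in> Val p (qspan (mu n))" and w: "w \<in> Val p (qspan (mu n))"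
  obtains A where "coprime A n" "\<And>x. x \<in> qspan (mu n) \<Longrightarrow> w x = v (gal n A x)"
proof -
  have n: "n > 0" using l by (simp add: n_def prime_gt_0_nat)
  have cop: "coprime n p" using primes_coprime[OF l p] pl by (simp add: n_def)
  interpret v: unramified_level p n v using p v n cop is_subfield_qspan_mu[OF n] by unfold_locales
  interpret w: unramified_level p n w using p w n cop is_subfield_qspan_mu[OF n] by unfold_locales
  let ?R = "zspan (mu n)"
  note Rc = is_subringD[OF zspan_mu_subring[of n]]
  obtain f where f: "p ^ f \<ge> 2" "\<And>x. x \<in> ?R \<Longrightarrow> ring_cong ?R (of_nat p) x (x ^ (p ^ f))"
    using v.power_mod_p by blast
  define q where "q = p ^ f"
  define H where "H = {A. A < n \<and> coprime A n}"
  have H: "residue_group n H" unfolding H_def by (rule residue_group_units[OF n])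
  have Hfin: "finite H" and H1: "1 mod n \<in> H" using residue_group_finite[OF H] H by (auto simp: residue_group_def)
  have copH: "coprime A n" if "A \<in> H" for A using that by (simp add: H_def)
  have "\<exists>A\<in>H. \<forall>y\<in>?R. w y > 0 \<longrightarrow> v (gal n A y) > 0"
  proof (rule ccontr)
    assume "\<not> ?thesis"
    then obtain y where y: "\<And>A. A \<in> H \<Longrightarrow> y A \<in> ?R" "\<And>A. A \<in> H \<Longrightarrow> w (y A) > 0" "\<And>A. A \<in> H \<Longrightarrow> \<not> v (gal n A (y A)) > 0"
      by metis
    define e where "e A = 1 - y A ^ (q - 1)" for A
    have eR: "e A \<in> ?R" if "A \<in> H" for A using y(1)[OF that] Rc by (simp add: e_def)
    define x where "x = 1 - (\<Prod>A\<in>H. e A)"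
    have prodR: "(\<Prod>A\<in>H. e A) \<in> ?R" by (rule zspan_prod[OF mult_closed_mu eR])
    have xR: "x \<in> ?R" using prodR Rc by (simp add: x_def)
    have xq: "x \<in> qspan (mu n)" by (rule v.zspan_closed[OF xR])
    have q1: "q - 1 > 0" using f(1) by (simp add: q_def)
    \<comment> \<open>Every factor is congruent to 1 modulo the centre of
      \<open>w\<close>.\<close>
    have wx: "w x > 0"
    proof -
      have "w (1 - (\<Prod>A\<in>J. e A)) > 0 \<and> (\<Prod>A\<in>J. e A) \<in> ?R" if "finite J" "J \<subseteq> H" for J
        using that
      proof (induction J rule: finite_induct)
        case empty
        then show ?case using Rc(1) by simp
      next
        case (insert B J)
        have B: "B \<in> H" using insert by auto
        have IH: "w (1 - (\<Prod>A\<in>J. e A)) > 0" "(\<Prod>A\<in>J. e A) \<in> ?R" using insert by auto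
        have cl: "y B ^ (q - 1) \<in> qspan (mu n)" "(\<Prod>A\<in>J. e A) \<in> qspan (mu n)"
          using w.zspan_closed[OF y(1)[OF B]] w.closed(9) w.zspan_closed[OF IH(2)] by auto
        have "w (y B ^ (q - 1) * (\<Prod>A\<in>J. e A)) > 0"
          using w.v_power_pos[OF w.zspan_closed[OF y(1)[OF B]] y(2)[OF B] q1] w.v_zspan[OF IH(2)]
          by (intro w.v_mult_pos cl) auto
        then have "w ((1 - (\<Prod>A\<in>J. e A)) + y B ^ (q - 1) * (\<Prod>A\<in>J. e A)) > 0"
          using IH(1) cl w.closed by (intro w.v_pos_add) auto
        also have "(1 - (\<Prod>A\<in>J. e A)) + y B ^ (q - 1) * (\<Prod>A\<in>J. e A) = 1 - (\<Prod>A\<in>insert B J. e A)"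
          using insert(1,2) by (simp add: e_def algebra_simps)
        finally show ?case using insert(1,2) Rc(3)[OF eR[OF B] IH(2)] by simp
      qed
      then show ?thesis unfolding x_def using Hfin by blast
    qed
    \<comment> \<open>The factor belonging to \<open>B\<close> becomes a non-unit under the
      automorphism \<open>B\<close>.\<close>
    have vx: "v (gal n B x) = 0" if B: "B \<in> H" for B
    proof -
      note gB = copH[OF B]
      define u where "u = gal n B (y B)"
      have uR: "u \<in> ?R" unfolding u_def by (rule gal_zspan_closed[OF n gB y(1)[OF B]])
      have u0: "v u = 0" using y(3)[OF B] v.v_zspan[OF uR] by (simp add: u_def)
      have rest: "(\<Prod>A\<in>H - {B}. gal n B (e A)) \<in> ?R"
        using eR by (intro zspan_prod[OF mult_closed_mu] gal_zspan_closed[OF n gB]) auto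
      have yq: "y B \<in> qspan (mu n)" "y B ^ (q - 1) \<in> qspan (mu n)"
        using v.zspan_closed[OF y(1)[OF B]] v.closed(9) by auto
      have ge: "gal n B (e B) = 1 - u ^ (q - 1)"
        unfolding e_def u_def using gal_diff[OF n gB v.closed(1) yq(2)] gal_power[OF n gB yq(1)] gal_one[OF n gB] by simp
      have eRB: "1 - u ^ (q - 1) \<in> ?R" using uR Rc by auto
      obtain t where t: "t \<in> ?R" "(1 - u ^ (q - 1)) * u = of_nat p * t"
        using v.unit_multiplier(2)[OF f(1) f(2)[OF uR] uR] unfolding q_def by blast
      have "v ((1 - u ^ (q - 1)) * u) > 0"
        unfolding t(2) using v.v_prime v.v_zspan[OF t(1)] by (intro v.v_mult_pos v.closed(10) v.zspan_closed[OF t(1)]) auto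
      then have "v (1 - u ^ (q - 1)) > 0"
        using v.v_mult[OF v.zspan_closed[OF eRB] v.zspan_closed[OF uR]] u0 by simp
      then have "v ((1 - u ^ (q - 1)) * (\<Prod>A\<in>H - {B}. gal n B (e A))) > 0"
        by (intro v.v_mult_pos v.zspan_closed[OF eRB] v.zspan_closed[OF rest] v.v_zspan[OF rest])
      also have "(1 - u ^ (q - 1)) * (\<Prod>A\<in>H - {B}. gal n B (e A)) = gal n B (\<Prod>A\<in>H. e A)"
        using gal_prod[OF n gB, of H e] v.zspan_closed[OF eR] prod.remove[OF Hfin B, of "\<lambda>A. gal n B (e A)"] ge by simp
      finally have pos: "v (gal n B (\<Prod>A\<in>H. e A)) > 0" .
      have "gal n B x = 1 - gal n B (\<Prod>A\<in>H. e A)"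
        unfolding x_def using gal_diff[OF n gB v.closed(1) v.zspan_closed[OF prodR]] gal_one[OF n gB] by simp
      then show ?thesis using v.v_one_minus[OF gal_closed[OF n gB v.zspan_closed[OF prodR]] pos] by simp
    qed
    define N where "N = (\<Prod>B\<in>H. gal n B x)"
    have clx: "gal n B x \<in> qspan (mu n)" if "B \<in> H" for B by (rule gal_closed[OF n copH[OF that] xq])
    have Nq: "N \<in> qspan (mu n)" unfolding N_def by (rule is_subfield_prod[OF v.subfield clx])
    have "gal n B N = N" if "coprime B n" for B
    proof -
      have "B mod n \<in> H" using that n coprime_mod_left_iff[of n B] by (auto simp: H_def)
      then show ?thesis unfolding N_def by (rule gal_norm[OF n H _ xq])
    qed
    then have "N \<in> \<rat>" using fixed_by_units_rational[OF l, of N s] Nq by (simp add: n_def)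
    then obtain r where "N = of_rat r" by (auto elim: Rats_cases)
    then have "v N = w N" using v.v_of_rat w.v_of_rat by simp
    moreover have "v N = 0" unfolding N_def using v.v_prod[OF Hfin clx] vx by simp
    moreover have "w N > 0"
    proof -
      have g1: "gal n (1 mod n) x = x"
        using gal_cong[OF n copH[OF H1] _ xq, of 1] gal_1[OF n xq] by (simp add: cong_def)
      have rest: "(\<Prod>B\<in>H - {1 mod n}. gal n B x) \<in> ?R"
        using copH xR by (intro zspan_prod[OF mult_closed_mu] gal_zspan_closed[OF n]) auto
      have "N = x * (\<Prod>B\<in>H - {1 mod n}. gal n B x)"
        unfolding N_def using prod.remove[OF Hfin H1, of "\<lambda>B. gal n B x"] g1 by simp
      then show ?thesis using w.v_mult_pos[OF xq w.zspan_closed[OF rest] wx w.v_zspan[OF rest]] by simp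
    qed
    ultimately show False by simp
  qed
  then obtain A where A: "A \<in> H" "\<And>y. y \<in> ?R \<Longrightarrow> w y > 0 \<Longrightarrow> v (gal n A y) > 0" by blast
  define u where "u = restrict (\<lambda>x. v (gal n A x)) (qspan (mu n))"
  have "w x = u x" if x: "x \<in> qspan (mu n)" for x
  proof (rule w.eq_if_centre_subset[where q = "p ^ f" and c = "of_nat p"])
    show "u \<in> Val p (qspan (mu n))" unfolding u_def by (rule v.gal_Val[OF copH[OF A(1)]])
    show "u (of_nat p) = w (of_nat p)"
      using v.v_prime w.v_prime v.closed(10) gal_of_nat[OF n copH[OF A(1)]] by (simp add: u_def)
    show "u y > 0" if "y \<in> ?R" "w y > 0" for y using A(2)[OF that] v.zspan_closed[OF that(1)] by (simp add: u_def)
  qed (use f v.p_in_ring w.v_prime p x in auto)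
  then show ?thesis using that[OF copH[OF A(1)]] by (simp add: u_def)
qed

section \<open>Valuations of the compositum: existence\<close>

lemma automorphism_Val:
  assumes p: "Factorial_Ring.prime p" and w: "w \<in> Val p Q_cyc" and a: "a \<in> carrier Zhat_units"
  shows "restrict (\<lambda>x. w (automorphism a x)) Q_cyc \<in> Val p Q_cyc"
proof -
  interpret w: padic_val p Q_cyc w using p w is_subfield_Q_cyc by unfold_locales
  have s: "automorphism a \<in> Gal Q_cyc" using acts_as_automorphism[OF a] by (simp add: acts_as_def)
  note G = Gal_Q_cyc[OF s]
  have "w (automorphism a x) = \<infinity> \<longleftrightarrow> x = 0" if "x \<in> Q_cyc" for x
    using w.v_infinity[OF G(1)[OF that]] G(7)[OF that] G(9) by auto
  moreover have "w (automorphism a x) \<noteq> - \<infinity>" if "x \<in> Q_cyc" for x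
    using w.valuation G(1)[OF that] by (auto simp: is_valuation_def)
  ultimately show ?thesis
    using G w.closed(2,3,12) w.v_add w.v_mult w.v_of_rat by (auto simp: Val_def is_valuation_def)
qed

lemma split_level_pos: "split_level p l > 0"
  by (simp add: split_level_def top_level_def)

text \<open>The restriction to a layer determines a valuation of the
  \<open>\<int>\<^sub>l\<close>-extension, and on this layer the given valuation is a conjugate of
  a fixed valuation \<open>w0\<close> by some residue. As a profinite unit is an arbitrary family
  of \<open>l\<close>-adic units, one automorphism of the cyclotomic field realizes all of these
  residues at the same time.\<close>

lemma Val_product_surj:
  assumes p: "Factorial_Ring.prime p" and f: "f \<in> (\<Pi>\<^sub>E l\<in>primes - {p}. Val p (B_inf l))"
  shows "\<exists>v\<in>Val p Q_cyc_Delta. \<forall>l\<in>primes - {p}. restrict v (B_inf l) = f l"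
proof -
  obtain w0 where w0: "w0 \<in> Val p Q_cyc" using Val_Q_cyc_nonempty[OF p] .
  have "\<exists>u A. u \<in> Val p Q_cyc \<and> restrict u (B_inf l) = f l \<and> coprime A (l ^ split_level p l) \<and>
      (\<forall>x\<in>qspan (mu (l ^ split_level p l)). u x = w0 (gal (l ^ split_level p l) A x))" if lp: "l \<in> primes - {p}" for l
  proof -
    have l: "Factorial_Ring.prime l" "p \<noteq> l" using lp by (auto simp: primes_def)
    define n where "n = l ^ split_level p l"
    have n: "n > 0" using l by (simp add: n_def prime_gt_0_nat)
    have InfQ: "B_inf l \<subseteq> Q_cyc" using B_inf_subset[OF l(1)] Q_cyc_Delta_subset by auto
    have "f l \<in> Val p (B_inf l)" using f lp by auto
    then obtain u where u: "u \<in> Val p Q_cyc" "restrict u (B_inf l) = f l"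
      using Val_extends_to_Q_cyc[OF p is_subfield_B_inf[OF l(1)] InfQ] by blast
    interpret u: level_val p n "restrict u (qspan (mu n))" by (rule level_restrict[OF p u(1) n])
    interpret w0: level_val p n "restrict w0 (qspan (mu n))" by (rule level_restrict[OF p w0 n])
    obtain A where A: "coprime A n"
      "\<And>x. x \<in> qspan (mu n) \<Longrightarrow> restrict u (qspan (mu n)) x = restrict w0 (qspan (mu n)) (gal n A x)"
      using valuations_conjugate[OF p l n_def w0.val u.val] by blast
    then have "u x = w0 (gal n A x)" if "x \<in> qspan (mu n)" for x
      using that gal_closed[OF n A(1) that] by (metis restrict_apply')
    then show ?thesis using u A(1) unfolding n_def by blast
  qed
  then obtain u A where uA: "\<And>l. l \<in> primes - {p} \<Longrightarrow> u l \<in> Val p Q_cyc"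
    "\<And>l. l \<in> primes - {p} \<Longrightarrow> restrict (u l) (B_inf l) = f l"
    "\<And>l. l \<in> primes - {p} \<Longrightarrow> coprime (A l) (l ^ split_level p l)"
    "\<And>l x. l \<in> primes - {p} \<Longrightarrow> x \<in> qspan (mu (l ^ split_level p l)) \<Longrightarrow> u l x = w0 (gal (l ^ split_level p l) (A l) x)"
    by metis
  \<comment> \<open>The integer \<open>A l\<close>, regarded as an \<open>l\<close>-adic unit; the
    component at \<open>p\<close> is arbitrary.\<close>
  define c where "c l = (if l = p then 1 else int (A l))" for l
  define a where "a = (\<lambda>l\<in>primes. \<lambda>k. c l mod int l ^ k)"
  have a: "a \<in> carrier Zhat_units"
  proof -
    have "(\<lambda>k. c l mod int l ^ k) \<in> carrier (padic_units l)" if l: "l \<in> primes" for l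
    proof (rule padic_unitI)
      show l': "Factorial_Ring.prime l" using l by (simp add: primes_def)
      show "\<not> int l dvd c l"
      proof (cases "l = p")
        case True
        then show ?thesis using prime_gt_1_nat[OF l'] by (simp add: c_def)
      next
        case False
        have "coprime (A l) l" using uA(3)[of l] l False split_level_pos[of p l] by simp
        then show ?thesis using False l' by (metis c_def coprime_common_divisor dvd_refl int_dvd_int_iff not_prime_unit)
      qed
    qed simp
    then show ?thesis by (simp add: a_def Zhat_units_def)
  qed
  define w where "w = restrict (\<lambda>x. w0 (automorphism a x)) Q_cyc"
  have w: "w \<in> Val p Q_cyc" unfolding w_def by (rule automorphism_Val[OF p w0 a])
  have agree: "w x = u l x" if l: "l \<in> primes - {p}" and x: "x \<in> layer l (split_level p l)" for l x
  proof -
    have l': "Factorial_Ring.prime l" using l by (simp add: primes_def)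
    define n where "n = l ^ split_level p l"
    have n: "n > 0" using l' by (simp add: n_def prime_gt_0_nat)
    have xn: "x \<in> qspan (mu n)" using x by (simp add: layer_def n_def)
    have "matches a n (A l)"
      unfolding matches_def
    proof (intro allI impI)
      fix q assume q: "Factorial_Ring.prime q \<and> q dvd n"
      then have "q = l" using l' unfolding n_def by (meson prime_dvd_power primes_dvd_imp_eq)
      moreover have "nat (int (A l) mod int l ^ multiplicity l n) = A l mod l ^ multiplicity l n"
        by (metis nat_int of_nat_mod of_nat_power)
      ultimately show "[A l = nat (a q (multiplicity q n))] (mod q ^ multiplicity q n)"
        using l by (simp add: a_def c_def primes_def cong_def)
    qed
    then have "automorphism a x = gal n (A l) x" using automorphism_eq_gal[OF a n _ xn] by blast
    then show ?thesis using uA(4)[OF l, of x] xn qspan_mu_Q_cyc[OF n] by (auto simp: w_def n_def)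
  qed
  interpret w: padic_val p Q_cyc w using p w is_subfield_Q_cyc by unfold_locales
  have "restrict w Q_cyc_Delta \<in> Val p Q_cyc_Delta"
    by (rule w.restrict_Val[OF is_subfield_Q_cyc_Delta Q_cyc_Delta_subset])
  moreover have "restrict (restrict w Q_cyc_Delta) (B_inf l) = f l" if l: "l \<in> primes - {p}" for l
  proof -
    have l': "Factorial_Ring.prime l" "p \<noteq> l" using l by (auto simp: primes_def)
    have "w x = u l x" if "x \<in> B_inf l" for x
      using Val_eq_on_layer[OF p l' w uA(1)[OF l] agree[OF l]] that B_inf_eq[OF l'(1)] by auto
    then have "restrict w (B_inf l) = restrict (u l) (B_inf l)" by (intro restrict_ext)
    then show ?thesis using uA(2)[OF l] B_inf_subset[OF l'(1)] by (simp add: Int_absorb1)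
  qed
  ultimately show ?thesis by blast
qed

section \<open>Elements approximated by rational numbers\<close>

lemma int_poly_mult: "int_poly f \<Longrightarrow> int_poly g \<Longrightarrow> int_poly (f * g)"
  by (auto simp: int_poly_def coeff_mult intro!: Ints_sum)

lemma int_poly_0 [simp]: "int_poly 0" and int_poly_1 [simp]: "int_poly 1"
  by (auto simp: int_poly_def coeff_pCons one_pCons split: nat.splits)

lemma poly_Ints: "int_poly f \<Longrightarrow> c \<in> \<int> \<Longrightarrow> poly f c \<in> \<int>"
  by (induction f) (auto simp: int_poly_pCons)

lemma int_poly_synthetic_div: "int_poly f \<Longrightarrow> c \<in> \<int> \<Longrightarrow> int_poly (synthetic_div f c)"
  by (induction f) (auto simp: int_poly_pCons poly_Ints)

text \<open>The integers \<open>0, \<dots>, p - 1\<close> are roots modulo \<open>p\<close> of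
  \<open>x ^ p - x\<close>, and can be split off one after the other.\<close>

lemma power_minus_self_product:
  assumes p: "Factorial_Ring.prime p"
  obtains h where "int_poly h" "\<And>x. x ^ p - x = (\<Prod>c<p. x - of_nat c) + of_nat p * poly h x"
proof -
  define F :: "complex poly" where "F = Polynomial.monom 1 p - Polynomial.monom 1 1"
  define P :: "nat \<Rightarrow> complex poly" where "P k = (\<Prod>c<k. [:- of_nat c, 1:])" for k
  have p1: "p > 1" using prime_gt_1_nat[OF p] .
  have P: "int_poly (P k)" for k
  proof (induction k)
    case (Suc k)
    have "int_poly [:- of_nat k, 1:]" by (simp add: int_poly_pCons)
    moreover have "P (Suc k) = P k * [:- of_nat k, 1:]" by (simp add: P_def)
    ultimately show ?case using int_poly_mult[OF Suc] by metis
  qed (simp add: P_def)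
  have evF: "poly F x = x ^ p - x" for x by (simp add: F_def poly_monom)
  have "\<exists>g h. int_poly g \<and> int_poly h \<and> Polynomial.degree g \<le> p - k \<and> Polynomial.coeff g (p - k) = 1 \<and>
      F = P k * g + Polynomial.smult (of_nat p) h" if "k \<le> p" for k
    using that
  proof (induction k)
    case 0
    have "int_poly F" by (auto simp: F_def int_poly_def)
    moreover have "Polynomial.degree F \<le> p"
      unfolding F_def using p1 by (intro degree_diff_le) (auto intro: order_trans[OF degree_monom_le])
    moreover have "Polynomial.coeff F p = 1" using p1 by (simp add: F_def)
    ultimately show ?case by (intro exI[of _ F] exI[of _ 0]) (auto simp: P_def int_poly_def)
  next
    case (Suc k)
    obtain g h where gh: "int_poly g" "int_poly h" "Polynomial.degree g \<le> p - k" "Polynomial.coeff g (p - k) = 1"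
      "F = P k * g + Polynomial.smult (of_nat p) h" using Suc by auto
    define r g' where "r = poly g (of_nat k)" and "g' = synthetic_div g (of_nat k)"
    have g: "g = [:- of_nat k, 1:] * g' + [:r:]"
      unfolding r_def g'_def by (rule synthetic_div_correct'[symmetric])
    have g': "int_poly g'" unfolding g'_def by (rule int_poly_synthetic_div[OF gh(1)]) simp
    have dg': "Polynomial.degree g' \<le> p - Suc k" using gh(3) by (simp add: g'_def degree_synthetic_div)
    have pk: "p - k = Suc (p - Suc k)" using Suc.prems by simp
    have "Polynomial.coeff g' (p - k) = 0" using dg' pk by (intro coeff_eq_0) simp
    then have cg': "Polynomial.coeff g' (p - Suc k) = 1"
      using gh(4) unfolding g pk by simp
    obtain r0 where r0: "r = of_int r0" using poly_Ints[OF gh(1), of "of_nat k"] by (auto simp: r_def elim: Ints_cases)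
    obtain h0 where h0: "poly h (of_nat k) = of_int h0" using poly_Ints[OF gh(2), of "of_nat k"] by (auto elim: Ints_cases)
    have Pk: "poly (P j) (of_nat k) = of_int (\<Prod>c<j. int k - int c)" for j
      by (simp add: P_def poly_prod)
    have "(of_int (int k ^ p - int k) :: complex) = of_int ((\<Prod>c<k. int k - int c) * r0 + int p * h0)"
      using arg_cong[OF gh(5), of "\<lambda>f. poly f (of_nat k)"] by (simp add: evF Pk h0 r0[symmetric] r_def)
    then have eq: "int k ^ p - int k = (\<Prod>c<k. int k - int c) * r0 + int p * h0" by (simp only: of_int_eq_iff)
    have "int p dvd int k ^ p - int k"
    proof -
      have "[k ^ p = k] (mod p)"
      proof (cases "p dvd k")
        case True
        then have "p dvd k ^ p" using p1 by (metis dvd_power dvd_trans less_imp_Suc_add zero_less_Suc dvd_power_same power_one_right dvd_refl le_imp_power_dvd less_imp_le)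
        then show ?thesis using True by (simp add: cong_def)
      next
        case False
        have "[k ^ (p - 1) * k = 1 * k] (mod p)" by (intro cong_scalar_right fermat_theorem[OF p False])
        then show ?thesis using p1 by (metis mult_1 power_minus_mult zero_less_one order_less_trans)
      qed
      then have "[int (k ^ p) = int k] (mod int p)" unfolding cong_int_iff .
      then show ?thesis by (simp add: cong_iff_dvd_diff)
    qed
    then have "int p dvd (\<Prod>c<k. int k - int c) * r0" unfolding eq by (simp add: dvd_add_left_iff)
    moreover have "\<not> int p dvd (\<Prod>c<k. int k - int c)"
    proof
      assume "int p dvd (\<Prod>c<k. int k - int c)"
      then obtain c where "c < k" "int p dvd int k - int c"
        using p prime_dvd_prod_iff[of "{..<k}" "int p" "\<lambda>c. int k - int c"] by auto
      then show False using zdvd_imp_le[of "int p" "int k - int c"] Suc.prems by simp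
    qed
    ultimately have "int p dvd r0" using p by (simp add: prime_dvd_mult_iff)
    then obtain t where t: "r0 = int p * t" by (auto simp: dvd_def)
    have PS: "P (Suc k) = P k * [:- of_nat k, 1:]" by (simp add: P_def)
    have "F = P (Suc k) * g' + Polynomial.smult (of_nat p) (h + Polynomial.smult (of_int t) (P k))"
      unfolding gh(5) by (subst g) (simp add: PS r0 t algebra_simps smult_add_right)
    moreover have "int_poly (h + Polynomial.smult (of_int t) (P k))"
      using P[of k] gh(2) by (auto simp: int_poly_def)
    ultimately show ?case using g' dg' cg' by blast
  qed
  from this[of p] obtain g h where gh: "int_poly h" "Polynomial.degree g \<le> 0" "Polynomial.coeff g 0 = 1"
    "F = P p * g + Polynomial.smult (of_nat p) h" by auto
  have "g = 1" using gh(2,3) by (metis degree_0_id one_pCons le_zero_eq degree_eq_zeroE coeff_pCons_0)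
  then have "x ^ p - x = (\<Prod>c<p. x - of_nat c) + of_nat p * poly h x" for x
    using arg_cong[OF gh(4), of "\<lambda>f. poly f x"] by (simp add: evF P_def poly_prod)
  then show ?thesis using that gh(1) by blast
qed

context padic_val
begin

lemma v_poly_nonneg:
  assumes "int_poly f" "x \<in> E" "v x \<ge> 0"
  shows "v (poly f x) \<ge> 0" "poly f x \<in> E"
proof -
  have "v (poly f x) \<ge> 0 \<and> poly f x \<in> E"
    using assms(1)
  proof (induction f)
    case (pCons a f)
    obtain c where c: "a = of_int c" using pCons.prems by (auto simp: int_poly_pCons elim: Ints_cases)
    have f: "v (poly f x) \<ge> 0" "poly f x \<in> E" using pCons by (auto simp: int_poly_pCons)
    then have "x * poly f x \<in> E" "v (x * poly f x) \<ge> 0" using assms closed by (auto intro: v_mult_nonneg)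
    then show ?case using v_of_int_nonneg[of c] closed by (auto simp: c intro: v_nonneg_add)
  qed (use closed in auto)
  then show "v (poly f x) \<ge> 0" "poly f x \<in> E" by auto
qed

text \<open>The residue field contains no roots of \<open>x ^ p - x\<close> apart from the classes
  of integers.\<close>

lemma residue_in_prime_field:
  assumes "x \<in> E" "v x \<ge> 0" "v (x ^ p - x) > 0"
  obtains c :: nat where "v (x - of_nat c) > 0"
proof -
  obtain h where h: "int_poly h" "x ^ p - x = (\<Prod>c<p. x - of_nat c) + of_nat p * poly h x"
    using power_minus_self_product[OF prime] by metis
  note hx = v_poly_nonneg[OF h(1) assms(1,2)]
  have cl: "x - of_nat c \<in> E" for c using assms closed by auto
  have "v (of_nat p * poly h x) > 0" using hx closed v_prime by (intro v_mult_pos) auto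
  then have "v ((x ^ p - x) - of_nat p * poly h x) > 0"
    by (rule v_pos_diff[OF closed(7)[OF closed(9)[OF assms(1)] assms(1)] closed(3)[OF closed(10) hx(2)] assms(3)])
  then have "v (\<Prod>c<p. x - of_nat c) > 0" unfolding h(2) by simp
  then have "(\<Sum>c<p. v (x - of_nat c)) > 0" using v_prod[of "{..<p}" "\<lambda>c. x - of_nat c"] cl by simp
  then have "\<exists>c<p. v (x - of_nat c) > 0"
    by (metis (no_types, lifting) lessThan_iff not_le sum_nonpos)
  then show ?thesis using that by blast
qed

lemma v_eq_if_close:
  assumes "x \<in> E" "y \<in> E" "v x < v (x - y)"
  shows "v y = v x"
proof (rule antisym)
  have d: "x - y \<in> E" using assms closed by auto
  have "min (v x) (v (x - y)) \<le> v (x - (x - y))" by (rule v_diff[OF assms(1) d])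
  then show "v x \<le> v y" using assms(3) by (simp add: min_def split: if_splits)
  show "v y \<le> v x"
  proof (rule ccontr)
    assume "\<not> v y \<le> v x"
    then have "v x < v ((x - y) + y)" using assms d by (intro v_pos_add) auto
    then show False by simp
  qed
qed

lemma v_lower_bound:
  assumes "x \<in> E"
  obtains k :: nat where "- ereal (real k) \<le> v x"
proof (cases "x = 0")
  case False
  obtain r where r: "v x = ereal r" using v_real[OF assms False] .
  obtain k where "- r < real k" using reals_Archimedean2 by blast
  then show ?thesis using that[of k] r by simp
qed (use that[of 0] in simp)

end

text \<open>The elements at which both valuations are limits of the same rational numbers. They
  form a ring containing the rational numbers, and the valuations agree on them.\<close>

definition approximable :: "(complex \<Rightarrow> ereal) \<Rightarrow> (complex \<Rightarrow> ereal) \<Rightarrow> complex set" where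
  "approximable v w = {x \<in> Q_cyc. \<forall>k::nat. \<exists>c::rat. ereal (real k) \<le> v (x - of_rat c) \<and> ereal (real k) \<le> w (x - of_rat c)}"

locale two_valuations = v: padic_val p Q_cyc v + w: padic_val p Q_cyc w for p v w
begin

lemma approximable_rat: "of_rat q \<in> approximable v w"
  using v.closed by (auto simp: approximable_def intro!: exI[of _ q])

lemma approximable_add:
  assumes "x \<in> approximable v w" "y \<in> approximable v w"
  shows "x + y \<in> approximable v w"
proof -
  have Q: "x \<in> Q_cyc" "y \<in> Q_cyc" using assms by (auto simp: approximable_def)
  have "\<exists>c. ereal (real k) \<le> v (x + y - of_rat c) \<and> ereal (real k) \<le> w (x + y - of_rat c)" for k :: nat
  proof -
    obtain c where c: "ereal (real k) \<le> v (x - of_rat c)" "ereal (real k) \<le> w (x - of_rat c)"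
      using assms(1) unfolding approximable_def by blast
    obtain d where d: "ereal (real k) \<le> v (y - of_rat d)" "ereal (real k) \<le> w (y - of_rat d)"
      using assms(2) unfolding approximable_def by blast
    have eq: "x + y - of_rat (c + d) = (x - of_rat c) + (y - of_rat d)" by (simp add: of_rat_add)
    have cl: "x - of_rat c \<in> Q_cyc" "y - of_rat d \<in> Q_cyc" using Q v.closed by auto
    show ?thesis
      by (rule exI[of _ "c + d"]) (use v.v_nonneg_add[OF cl c(1) d(1)] w.v_nonneg_add[OF cl c(2) d(2)] in \<open>simp only: eq\<close>)
  qed
  then show ?thesis using Q v.closed(2) by (simp add: approximable_def)
qed

lemma approximable_mult:
  assumes "x \<in> approximable v w" "y \<in> approximable v w"
  shows "x * y \<in> approximable v w"
proof -
  have Q: "x \<in> Q_cyc" "y \<in> Q_cyc" using assms by (auto simp: approximable_def)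
  have bound: "\<exists>M::nat. - ereal (real M) \<le> v z \<and> - ereal (real M) \<le> w z" if z: "z \<in> Q_cyc" for z
  proof -
    obtain a b :: nat where ab: "- ereal (real a) \<le> v z" "- ereal (real b) \<le> w z"
      using v.v_lower_bound[OF z] w.v_lower_bound[OF z] by metis
    have "- ereal (real (max a b)) \<le> - ereal (real a)" "- ereal (real (max a b)) \<le> - ereal (real b)" by auto
    then show ?thesis using ab order_trans by blast
  qed
  have "\<exists>c. ereal (real k) \<le> v (x * y - of_rat c) \<and> ereal (real k) \<le> w (x * y - of_rat c)" for k :: nat
  proof -
    obtain M :: nat where M: "- ereal (real M) \<le> v y" "- ereal (real M) \<le> w y" using bound[OF Q(2)] by blast
    obtain c where c: "ereal (real (k + M)) \<le> v (x - of_rat c)" "ereal (real (k + M)) \<le> w (x - of_rat c)"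
      using assms(1) unfolding approximable_def by blast
    have cQ: "of_rat c \<in> Q_cyc" using v.closed by auto
    obtain L :: nat where L: "- ereal (real L) \<le> v (of_rat c)" "- ereal (real L) \<le> w (of_rat c)" using bound[OF cQ] by blast
    obtain d where d: "ereal (real (k + L)) \<le> v (y - of_rat d)" "ereal (real (k + L)) \<le> w (y - of_rat d)"
      using assms(2) unfolding approximable_def by blast
    have cl: "x - of_rat c \<in> Q_cyc" "y - of_rat d \<in> Q_cyc" using Q v.closed by auto
    have cl2: "(x - of_rat c) * y \<in> Q_cyc" "of_rat c * (y - of_rat d) \<in> Q_cyc" using cl Q cQ v.closed(3) by auto
    have eq: "x * y - of_rat (c * d) = (x - of_rat c) * y + of_rat c * (y - of_rat d)"
      by (simp add: of_rat_mult algebra_simps)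
    have sum: "ereal (real k) \<le> a + b" if "ereal (real (k + M)) \<le> a" "- ereal (real M) \<le> b" for a b and M :: nat
      using add_mono[OF that] by simp
    have "ereal (real k) \<le> v ((x - of_rat c) * y)" "ereal (real k) \<le> w ((x - of_rat c) * y)"
      unfolding v.v_mult[OF cl(1) Q(2)] w.v_mult[OF cl(1) Q(2)] by (rule sum[OF c(1) M(1)], rule sum[OF c(2) M(2)])
    moreover have "ereal (real k) \<le> v (of_rat c * (y - of_rat d))" "ereal (real k) \<le> w (of_rat c * (y - of_rat d))"
      unfolding v.v_mult[OF cQ cl(2)] w.v_mult[OF cQ cl(2)] using sum[OF d(1) L(1)] sum[OF d(2) L(2)] by (simp_all add: add.commute)
    ultimately have "ereal (real k) \<le> v (x * y - of_rat (c * d))" "ereal (real k) \<le> w (x * y - of_rat (c * d))"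
      unfolding eq using v.v_nonneg_add[OF cl2] w.v_nonneg_add[OF cl2] by auto
    then show ?thesis by blast
  qed
  then show ?thesis using Q v.closed(3) by (simp add: approximable_def)
qed

lemma subspace_approximable: "QV.subspace (approximable v w)"
  using approximable_rat[of 0] approximable_add approximable_mult[OF approximable_rat]
  by (auto simp: QV.subspace_def rat_scale_def)

lemma eq_on_approximable:
  assumes "x \<in> approximable v w"
  shows "v x = w x"
proof (cases "x = 0")
  case False
  have x: "x \<in> Q_cyc" using assms by (simp add: approximable_def)
  obtain r s where rs: "v x = ereal r" "w x = ereal s" using v.v_real[OF x False] w.v_real[OF x False] by metis
  obtain k where k: "max r s < real k" using reals_Archimedean2 by blast
  obtain c where c: "ereal (real k) \<le> v (x - of_rat c)" "ereal (real k) \<le> w (x - of_rat c)"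
    using assms unfolding approximable_def by blast
  have "v x < ereal (real k)" "w x < ereal (real k)" using k rs by auto
  then have "v (of_rat c) = v x" "w (of_rat c) = w x"
    using v.v_eq_if_close[OF x v.closed(12)] w.v_eq_if_close[OF x v.closed(12)] c by (meson order_less_le_trans)+
  then show ?thesis using v.v_of_rat w.v_of_rat by metis
qed simp

text \<open>The prime \<open>p\<close> splits completely in this field: its Frobenius automorphism
  is torsion and so acts trivially, hence the residue field is the prime field. As
  \<open>p\<close> is a uniformizer, an element has an expansion in powers of \<open>p\<close>
  with integral digits. Its partial sums approximate it at both valuations, because they agree on
  the field.\<close>

lemma layer_approximable:
  assumes l: "Factorial_Ring.prime l" and pl: "p \<noteq> l"
    and eq: "\<And>x. x \<in> B_inf l \<Longrightarrow> v x = w x" and x: "x \<in> layer l (split_level p l)"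
  shows "x \<in> approximable v w"
proof -
  define L where "L = layer l (split_level p l)"
  define n where "n = l ^ split_level p l"
  have n: "n > 0" using l by (simp add: n_def prime_gt_0_nat)
  have cop: "coprime n p" using primes_coprime[OF l v.prime] pl by (simp add: n_def)
  interpret u: unramified_level p n "restrict v (qspan (mu n))" by (rule unramified_restrict[OF v.prime v.val n cop])
  note Lc = is_subfieldD[OF is_subfield_layer[OF l, of "split_level p l"], folded L_def]
  have Ln: "L \<subseteq> qspan (mu n)" by (auto simp: L_def layer_def n_def)
  have LQ: "L \<subseteq> Q_cyc" using Ln qspan_mu_Q_cyc[OF n] by auto
  have Lw: "v x = w x" if "x \<in> L" for x using eq that B_inf_eq[OF l] by (auto simp: L_def)
  have tor: "torsion l (split_level p l) p" using frobenius_generator[OF v.prime l pl] by metis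
  have copp: "coprime p n" using cop by (simp add: coprime_commute)
  have fixed: "gal n p x = x" if "x \<in> L" for x
    using layer_iff[OF l, of x "split_level p l"] that tor Ln by (auto simp: L_def n_def)
  have p0: "(of_nat p :: complex) \<noteq> 0" using v.p_pos by simp
  have main: "\<exists>c. ereal (real k) \<le> v (x - of_rat c)" if "x \<in> L" "v x \<ge> 0" for k x
    using that
  proof (induction k arbitrary: x)
    case 0
    then show ?case by (intro exI[of _ 0]) (simp add: zero_ereal_def[symmetric])
  next
    case (Suc k)
    have xn: "x \<in> qspan (mu n)" using Suc.prems(1) Ln by auto
    have "restrict v (qspan (mu n)) (gal n p x - x ^ (p ^ 1)) > 0"
      using Suc.prems(2) xn by (intro u.frobenius_residue[OF copp _ xn]) auto
    then have "v (x - x ^ p) > 0" using fixed[OF Suc.prems(1)] u.closed(7,9) xn by simp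
    moreover have xx: "x ^ p - x \<in> Q_cyc" "x \<in> Q_cyc" using Suc.prems(1) LQ v.closed by auto
    ultimately have "v (x ^ p - x) > 0" using v.v_minus[OF xx(1)] by simp
    then obtain c where c: "v (x - of_nat c) > 0" using v.residue_in_prime_field[OF xx(2) Suc.prems(2)] by blast
    define y where "y = (x - of_nat c) / of_nat p"
    have yL: "y \<in> L" using Suc.prems(1) Lc by (auto simp: y_def)
    have xc: "x - of_nat c = of_nat p * y" using p0 by (simp add: y_def)
    have "v y \<ge> 0"
    proof (cases "y = 0")
      case False
      then obtain j :: int where j: "restrict v (qspan (mu n)) y = ereal (of_int j)" using u.integral_value yL Ln by blast
      then have vy: "v y = ereal (of_int j)" using yL Ln by auto
      have "v (x - of_nat c) = 1 + v y"
        unfolding xc using v.v_mult[OF v.closed(10)] yL LQ v.v_prime by auto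
      then have "0 < 1 + real_of_int j" using c vy by (simp add: one_ereal_def)
      then show ?thesis using vy by simp
    qed simp
    then obtain d where d: "ereal (real k) \<le> v (y - of_rat d)" using Suc.IH[OF yL] by blast
    have "x - of_rat (of_nat c + of_nat p * d) = of_nat p * (y - of_rat d)"
      using xc by (simp add: of_rat_add of_rat_mult algebra_simps)
    moreover have "y - of_rat d \<in> Q_cyc" using yL LQ v.closed by auto
    ultimately have "v (x - of_rat (of_nat c + of_nat p * d)) = 1 + v (y - of_rat d)"
      using v.v_mult[OF v.closed(10)] v.v_prime by simp
    moreover have "ereal (real (Suc k)) \<le> 1 + v (y - of_rat d)"
      using add_left_mono[OF d, of 1] by (simp add: one_ereal_def add.commute)
    ultimately show ?case by metis
  qed
  have xL: "x \<in> L" using x by (simp add: L_def)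
  have xQ: "x \<in> Q_cyc" using xL LQ by auto
  obtain t :: nat where t: "- ereal (real t) \<le> v x" using v.v_lower_bound[OF xQ] .
  have ptQ: "of_nat p ^ t \<in> Q_cyc" using v.closed by auto
  have vpt: "v (of_nat p ^ t) = ereal (real t)" using v.v_prime_powi[of "int t"] by simp
  have pt0: "(of_nat p :: complex) ^ t \<noteq> 0" using p0 by simp
  have "v (of_nat p ^ t * x) \<ge> 0"
    using v.v_mult[OF ptQ xQ] vpt add_left_mono[OF t, of "ereal (real t)"] by (simp add: zero_ereal_def[symmetric])
  moreover have "of_nat p ^ t * x \<in> L" using xL Lc by auto
  ultimately have app: "\<exists>c. ereal (real k) \<le> v (of_nat p ^ t * x - of_rat c)" for k using main by blast
  have "\<exists>c. ereal (real k) \<le> v (x - of_rat c) \<and> ereal (real k) \<le> w (x - of_rat c)" for k :: nat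
  proof -
    obtain c where c: "ereal (real (k + t)) \<le> v (of_nat p ^ t * x - of_rat c)" using app by blast
    define d where "d = c / of_nat p ^ t"
    have "of_nat p ^ t * x - of_rat c = of_nat p ^ t * (x - of_rat d)"
      using pt0 by (simp add: d_def of_rat_divide of_rat_power right_diff_distrib)
    moreover have xd: "x - of_rat d \<in> L" using xL Lc by auto
    ultimately have "ereal (real (k + t)) \<le> ereal (real t) + v (x - of_rat d)"
      using c v.v_mult[OF ptQ, of "x - of_rat d"] vpt LQ by auto
    then have "ereal (real k) \<le> v (x - of_rat d)" by (cases "v (x - of_rat d)") auto
    then show ?thesis using Lw[OF xd] by (intro exI[of _ d]) simp
  qed
  then show ?thesis using xQ by (simp add: approximable_def)
qed

end

section \<open>The decomposition group\<close>

text \<open>The decomposition group modulo torsion. For \<open>l \<noteq> p\<close> it is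
  generated by the Frobenius automorphism \<open>p\<close>; at \<open>p\<close>, where the
  extension is totally ramified, it is everything.\<close>

definition local_decomposition :: "nat \<Rightarrow> nat \<Rightarrow> nat \<Rightarrow> nat \<Rightarrow> bool" where
  "local_decomposition p l k A \<longleftrightarrow> l = p \<or> (\<exists>i B. torsion l k B \<and> [A = p ^ i * B] (mod l ^ k))"

definition decomposition :: "nat \<Rightarrow> nat \<Rightarrow> nat \<Rightarrow> bool" where
  "decomposition p n A \<longleftrightarrow> coprime A n \<and>
    (\<forall>l. Factorial_Ring.prime l \<and> l dvd n \<longrightarrow> local_decomposition p l (multiplicity l n) A)"

definition decomposition_group :: "nat \<Rightarrow> nat \<Rightarrow> nat set" where
  "decomposition_group p n = {A. A < n \<and> decomposition p n A}"

lemma local_decomposition_cong: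
  assumes "[A = B] (mod l ^ k)" "local_decomposition p l k A"
  shows "local_decomposition p l k B"
  using assms cong_trans[OF cong_sym[OF assms(1)]] unfolding local_decomposition_def by blast

lemma local_decomposition_mult:
  assumes "local_decomposition p l k A" "local_decomposition p l k B"
  shows "local_decomposition p l k (A * B)"
proof (cases "l = p")
  case False
  obtain i C where C: "torsion l k C" "[A = p ^ i * C] (mod l ^ k)" using assms(1) False by (auto simp: local_decomposition_def)
  obtain j D where D: "torsion l k D" "[B = p ^ j * D] (mod l ^ k)" using assms(2) False by (auto simp: local_decomposition_def)
  have "[A * B = p ^ (i + j) * (C * D)] (mod l ^ k)"
    using cong_mult[OF C(2) D(2)] by (simp add: power_add mult_ac)
  then show ?thesis using torsion_mult[OF C(1) D(1)] unfolding local_decomposition_def by blast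
qed (simp add: local_decomposition_def)

lemma local_decomposition_torsion: "torsion l k A \<Longrightarrow> local_decomposition p l k A"
  unfolding local_decomposition_def by (intro disjI2 exI[of _ 0] exI[of _ A]) simp

lemma local_decomposition_prime: "local_decomposition p l k p"
  unfolding local_decomposition_def by (intro disjI2 exI[of _ 1] exI[of _ "Suc 0"]) simp

lemma decomposition_cong:
  assumes "n > 0" "[A = B] (mod n)" "decomposition p n A"
  shows "decomposition p n B"
proof -
  have "coprime B n" using cong_imp_coprime[OF assms(2)] assms(3) by (simp add: decomposition_def)
  moreover have "local_decomposition p l (multiplicity l n) B" if "Factorial_Ring.prime l" "l dvd n" for l
    using local_decomposition_cong[OF cong_dvd_modulus_nat[OF assms(2) multiplicity_dvd]] assms(3) that
    by (simp add: decomposition_def)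
  ultimately show ?thesis by (simp add: decomposition_def)
qed

lemma decomposition_mod: "n > 0 \<Longrightarrow> decomposition p n (A mod n) \<longleftrightarrow> decomposition p n A"
  using decomposition_cong[of n A "A mod n"] decomposition_cong[of n "A mod n" A] by (auto simp: cong_def)

lemma decomposition_mult: "decomposition p n A \<Longrightarrow> decomposition p n B \<Longrightarrow> decomposition p n (A * B)"
  by (auto simp: decomposition_def local_decomposition_mult)

lemma residue_group_decomposition:
  assumes "n > 0"
  shows "residue_group n (decomposition_group p n)"
proof -
  have "decomposition p n 1"
    by (simp add: decomposition_def local_decomposition_torsion)
  then show ?thesis
    using assms decomposition_mod[OF assms] decomposition_mult
    by (auto simp: residue_group_def decomposition_group_def) (auto simp: decomposition_def)
qed

lemma decomposition_split:
  assumes "coprime q m" "q > 0" "m > 0"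
  shows "decomposition p (q * m) A \<longleftrightarrow> decomposition p q A \<and> decomposition p m A"
proof -
  have m1: "multiplicity l (q * m) = multiplicity l q" if l: "Factorial_Ring.prime l" "l dvd q" for l
  proof -
    have "\<not> l dvd m" using l assms(1) by (metis coprime_common_divisor not_prime_unit)
    then show ?thesis using l(1) assms(2,3)
      by (subst prime_elem_multiplicity_mult_distrib) (auto simp: prime_imp_prime_elem not_dvd_imp_multiplicity_0)
  qed
  have m2: "multiplicity l (q * m) = multiplicity l m" if l: "Factorial_Ring.prime l" "l dvd m" for l
  proof -
    have "\<not> l dvd q" using l assms(1) by (metis coprime_common_divisor not_prime_unit)
    then show ?thesis using l(1) assms(2,3)
      by (subst prime_elem_multiplicity_mult_distrib) (auto simp: prime_imp_prime_elem not_dvd_imp_multiplicity_0)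
  qed
  show ?thesis
    unfolding decomposition_def using m1 m2 by (auto simp: prime_dvd_mult_iff)
qed

lemma decomposition_group_bij:
  assumes "coprime q m" "q > 0" "m > 0"
  shows "bij_betw (\<lambda>A. (A mod q, A mod m)) (decomposition_group p (q * m))
    (decomposition_group p q \<times> decomposition_group p m)"
  unfolding bij_betw_def
proof
  show "inj_on (\<lambda>A. (A mod q, A mod m)) (decomposition_group p (q * m))"
  proof (rule inj_onI)
    fix A B assume AB: "A \<in> decomposition_group p (q * m)" "B \<in> decomposition_group p (q * m)"
      and eq: "(A mod q, A mod m) = (B mod q, B mod m)"
    then have "[A = B] (mod q * m)" by (intro coprime_cong_mult_nat assms(1)) (auto simp: cong_def)
    then show "A = B" using AB by (simp add: decomposition_group_def cong_def)
  qed
  show "(\<lambda>A. (A mod q, A mod m)) ` decomposition_group p (q * m) = decomposition_group p q \<times> decomposition_group p m"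
  proof (intro equalityI subsetI)
    fix P assume "P \<in> (\<lambda>A. (A mod q, A mod m)) ` decomposition_group p (q * m)"
    then show "P \<in> decomposition_group p q \<times> decomposition_group p m"
      using assms decomposition_split[OF assms] decomposition_mod[OF assms(2)] decomposition_mod[OF assms(3)]
      by (auto simp: decomposition_group_def)
  next
    fix P assume P: "P \<in> decomposition_group p q \<times> decomposition_group p m"
    then obtain B C where BC: "P = (B, C)" "B < q" "C < m" "decomposition p q B" "decomposition p m C"
      by (auto simp: decomposition_group_def)
    obtain A where A: "[A = B] (mod q)" "[A = C] (mod m)" using binary_chinese_remainder_nat[OF assms(1)] by blast
    have "decomposition p (q * m) A"
      using decomposition_split[OF assms] decomposition_cong[OF assms(2) cong_sym[OF A(1)] BC(4)]
        decomposition_cong[OF assms(3) cong_sym[OF A(2)] BC(5)] by blast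
    then have "A mod (q * m) \<in> decomposition_group p (q * m)"
      using assms decomposition_mod[of "q * m"] by (simp add: decomposition_group_def)
    moreover have "P = ((A mod (q * m)) mod q, (A mod (q * m)) mod m)"
      using A BC by (simp add: cong_def mod_mod_cancel)
    ultimately show "P \<in> (\<lambda>A. (A mod q, A mod m)) ` decomposition_group p (q * m)" by blast
  qed
qed

context two_valuations
begin

text \<open>At \<open>p\<close> the trace of a root of unity is rational. At another prime the
  trace is fixed by torsion and by the Frobenius automorphism, so it lies in the field in which
  \<open>p\<close> splits.\<close>

lemma local_trace_approximable:
  assumes l: "Factorial_Ring.prime l" and z: "z \<in> mu (l ^ k)"
    and eq: "\<And>l x. Factorial_Ring.prime l \<Longrightarrow> l \<noteq> p \<Longrightarrow> x \<in> B_inf l \<Longrightarrow> v x = w x"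
  shows "(\<Sum>A\<in>decomposition_group p (l ^ k). z ^ A) \<in> approximable v w"
proof (cases "l = p")
  case True
  have pr: "q = l" if "Factorial_Ring.prime q" "q dvd l ^ k" for q
    using that l by (meson prime_dvd_power primes_dvd_imp_eq)
  have "decomposition_group p (l ^ k) = {A. A < l ^ k \<and> coprime A (l ^ k)}"
    using pr True by (auto simp: decomposition_group_def decomposition_def local_decomposition_def)
  then show ?thesis using trace_prime_power_rational[OF l z] approximable_rat by (auto elim: Rats_cases)
next
  case False
  define N where "N = l ^ k"
  have N: "N > 0" using l by (simp add: N_def prime_gt_0_nat)
  have zN: "z \<in> mu N" and zq: "z \<in> qspan (mu N)" using z by (auto simp: N_def QV.span_base)
  note H = residue_group_decomposition[OF N, of p]
  have cop: "coprime A N" if "A \<in> decomposition_group p N" for A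
    using that by (simp add: decomposition_group_def decomposition_def)
  define e where "e = (\<Sum>A\<in>decomposition_group p N. gal N A z)"
  have e: "(\<Sum>A\<in>decomposition_group p N. z ^ A) = e"
    unfolding e_def using gal_root[OF N cop zN] by (intro sum.cong) auto
  have eN: "e \<in> qspan (mu N)" unfolding e_def
    by (intro is_subfield_sum[OF is_subfield_qspan_mu[OF N]] gal_closed[OF N cop zq])
  have fixed: "gal N B e = e" if "decomposition p N B" for B
    unfolding e_def using that decomposition_mod[OF N] N by (intro gal_trace[OF N H _ zq]) (simp add: decomposition_group_def)
  have pr: "q = l" if "Factorial_Ring.prime q" "q dvd N" for q
    using that l unfolding N_def by (meson prime_dvd_power primes_dvd_imp_eq)
  have mult: "multiplicity l N = k" using l by (simp add: N_def multiplicity_prime_power)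
  have dec: "decomposition p N B" if "coprime B N" "local_decomposition p l k B" for B
    using that pr mult by (auto simp: decomposition_def)
  have "gal N B e = e" if B: "torsion l k B" for B
    using torsion_coprime[OF l B] local_decomposition_torsion[OF B] by (intro fixed dec) (auto simp: N_def)
  then have "e \<in> layer l k" using layer_iff[OF l, of e k] eN by (simp add: N_def)
  moreover have "gal N p e = e"
    using primes_coprime[OF v.prime l] False by (intro fixed dec local_decomposition_prime) (auto simp: N_def)
  ultimately have "e \<in> layer l (split_level p l)"
    using frobenius_fixed_in_split_layer[OF v.prime l] False by (auto simp: N_def)
  then have "e \<in> approximable v w" using layer_approximable[OF l _ eq[OF l False]] False by auto
  then show ?thesis using e by (simp add: N_def)
qed

text \<open>The decomposition group is the product of its components at the primes dividing
  \<open>n\<close>, and the trace of a root of unity factors accordingly.\<close>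

lemma trace_approximable:
  assumes "n > 0" "z \<in> mu n"
    and eq: "\<And>l x. Factorial_Ring.prime l \<Longrightarrow> l \<noteq> p \<Longrightarrow> x \<in> B_inf l \<Longrightarrow> v x = w x"
  shows "(\<Sum>A\<in>decomposition_group p n. z ^ A) \<in> approximable v w"
  using assms(1,2)
proof (induction n arbitrary: z rule: less_induct)
  case (less n)
  show ?case
  proof (cases "n = 1")
    case True
    have "decomposition_group p 1 = {0}" by (auto simp: decomposition_group_def decomposition_def)
    then show ?thesis using True approximable_rat[of 1] by simp
  next
    case False
    then obtain l where l: "Factorial_Ring.prime l" "l dvd n" using prime_factor_nat by blast
    obtain m where m: "n = l ^ multiplicity l n * m" "\<not> l dvd m"
      using multiplicity_decompose'[of n l] less.prems(1) l(1) not_prime_unit by blast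
    define k q where "k = multiplicity l n" and "q = l ^ k"
    have n: "n = q * m" using m(1) by (simp add: q_def k_def)
    have k: "k > 0" using multiplicity_prime_pos[OF l(1) less.prems(1) l(2)] by (simp add: k_def)
    have q: "q > 1" using one_less_power[OF prime_gt_1_nat[OF l(1)] k] by (simp add: q_def)
    have m0: "m > 0" using n less.prems(1) by (cases "m = 0") auto
    have cop: "coprime q m" using prime_imp_coprime[OF l(1) m(2)] by (simp add: q_def)
    have q0: "q > 0" using q by simp
    obtain x y where xy: "x \<in> mu q" "y \<in> mu m" "z = x * y" using mu_split[OF cop] less.prems(2) n by blast
    have "x ^ A = x ^ (A mod q)" "y ^ A = y ^ (A mod m)" for A
      using mu_power_cong[OF xy(1), of A "A mod q"] mu_power_cong[OF xy(2), of A "A mod m"] by (simp_all add: cong_def)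
    then have zA: "z ^ A = x ^ (A mod q) * y ^ (A mod m)" for A unfolding xy(3) power_mult_distrib by metis
    have "(\<Sum>A\<in>decomposition_group p n. z ^ A)
        = (\<Sum>A\<in>decomposition_group p n. (\<lambda>(B, C). x ^ B * y ^ C) (A mod q, A mod m))"
      unfolding zA by simp
    also have "\<dots> = (\<Sum>P\<in>decomposition_group p q \<times> decomposition_group p m. (\<lambda>(B, C). x ^ B * y ^ C) P)"
      unfolding n by (rule sum.reindex_bij_betw[OF decomposition_group_bij[OF cop q0 m0]])
    also have "\<dots> = (\<Sum>B\<in>decomposition_group p q. x ^ B) * (\<Sum>C\<in>decomposition_group p m. y ^ C)"
      by (simp only: sum_product sum.cartesian_product)
    also have "\<dots> \<in> approximable v w"
    proof (rule approximable_mult)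
      show "(\<Sum>B\<in>decomposition_group p q. x ^ B) \<in> approximable v w"
      proof -
        have "x \<in> mu (l ^ k)" using xy(1) by (simp add: q_def)
        then show ?thesis unfolding q_def by (rule local_trace_approximable[OF l(1)]) (rule eq)
      qed
      show "(\<Sum>C\<in>decomposition_group p m. y ^ C) \<in> approximable v w"
        using q m0 n by (intro less.IH xy(2)) auto
    qed
    finally show ?thesis .
  qed
qed

end

lemma torsion_power: "torsion l k A \<Longrightarrow> torsion l k (A ^ i)"
  by (induction i) (auto intro: torsion_mult)

lemma torsion_inverse:
  assumes "Factorial_Ring.prime l" "torsion l k A"
  obtains B where "torsion l k B" "[A * B = 1] (mod l ^ k)"
proof (rule that[of "A ^ (totient (l ^ k) - 1)"])
  show "torsion l k (A ^ (totient (l ^ k) - 1))" by (rule torsion_power[OF assms(2)])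
  have "totient (l ^ k) > 0" using assms(1) by (simp add: prime_gt_0_nat)
  then have "A * A ^ (totient (l ^ k) - 1) = A ^ totient (l ^ k)" by (cases "totient (l ^ k)") auto
  then show "[A * A ^ (totient (l ^ k) - 1) = 1] (mod l ^ k)"
    using euler_theorem[OF torsion_coprime[OF assms]] by simp
qed

text \<open>By Euler's theorem, since the order of the unit group modulo \<open>l ^ k\<close>
  divides \<open>l ^ k (l - 1)\<close>.\<close>

lemma torsion_prime_power:
  assumes p: "Factorial_Ring.prime p" and l: "Factorial_Ring.prime l" and pl: "p \<noteq> l"
  shows "torsion l k (p ^ (l ^ k))"
proof -
  have l1: "l > 1" using prime_gt_1_nat[OF l] .
  have "[(p ^ (l ^ k)) ^ (l - 1) = 1] (mod l ^ k)"
  proof (cases k)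
    case (Suc j)
    have "totient (l ^ k) = l ^ j * (l - 1)" using totient_prime_power[OF l, of k] Suc by simp
    then have "(p ^ (l ^ k)) ^ (l - 1) = (p ^ totient (l ^ k)) ^ l" using Suc by (simp add: mult_ac flip: power_mult)
    moreover have "coprime p (l ^ k)" using primes_coprime[OF p l pl] by simp
    ultimately show ?thesis using cong_pow[OF euler_theorem, of p "l ^ k" l] by simp
  qed simp
  then show ?thesis by (auto simp: torsion_def)
qed

text \<open>Only the exponents of \<open>p\<close> modulo powers of the various primes
  \<open>l\<close> matter, since \<open>p ^ (l ^ k)\<close> is torsion modulo \<open>l ^
  k\<close>. By the Chinese remainder theorem they can be taken to be equal.\<close>

lemma decomposition_factor:
  assumes p: "Factorial_Ring.prime p" and n: "n > 0" "n = p ^ a * m" "coprime m p" and A: "decomposition p n A"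
  obtains B C i where "torsion_residue n C" "coprime B n" "[B = p ^ i] (mod m)" "[A = B * C] (mod n)"
proof -
  define e where "e l = multiplicity l n" for l
  define L where "L = {l \<in> prime_factors n. l \<noteq> p}"
  have Lfin: "finite L" by (simp add: L_def)
  have L: "Factorial_Ring.prime l" "l dvd n" "l \<noteq> p" if "l \<in> L" for l
    using that by (auto simp: L_def prime_factors_dvd)
  have "\<exists>i B. torsion l (e l) B \<and> [A = p ^ i * B] (mod l ^ e l)" if "l \<in> L" for l
    using A L[OF that] by (auto simp: decomposition_def local_decomposition_def e_def)
  then obtain j B where jB: "\<And>l. l \<in> L \<Longrightarrow> torsion l (e l) (B l)" "\<And>l. l \<in> L \<Longrightarrow> [A = p ^ j l * B l] (mod l ^ e l)"
    by metis
  have "\<exists>i. \<forall>l\<in>L. [i = j l] (mod l ^ e l)"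
    by (rule chinese_remainder_nat[OF Lfin]) (auto intro!: primes_coprime dest: L)
  then obtain i0 where i0: "\<And>l. l \<in> L \<Longrightarrow> [i0 = j l] (mod l ^ e l)" by blast
  \<comment> \<open>The multiple of \<open>n\<close> makes \<open>i\<close> at least as large as
    all \<open>j l\<close>.\<close>
  define i where "i = i0 + n * (\<Sum>l\<in>L. j l)"
  have ex: "\<exists>C. torsion l (e l) C \<and> [A = p ^ i * C] (mod l ^ e l)" if l: "l \<in> L" for l
  proof -
    have "l ^ e l dvd n" by (simp add: e_def multiplicity_dvd)
    then have "[n * (\<Sum>l\<in>L. j l) = 0] (mod l ^ e l)" by (simp add: cong_0_iff)
    from cong_add[OF i0[OF l] this] have ij: "[i = j l] (mod l ^ e l)" by (simp add: i_def)
    have "j l \<le> (\<Sum>l\<in>L. j l)" using member_le_sum[OF l, of j] Lfin by simp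
    also have "\<dots> \<le> n * (\<Sum>l\<in>L. j l)" using n(1) by simp
    finally have "j l \<le> i" by (simp add: i_def)
    then obtain t where t: "i = j l + l ^ e l * t"
      using ij by (metis cong_altdef_nat cong_sym dvd_def le_add_diff_inverse)
    define T where "T = (p ^ (l ^ e l)) ^ t"
    have "torsion l (e l) T" unfolding T_def
      using L[OF l] by (intro torsion_power torsion_prime_power[OF p]) auto
    then obtain U where U: "torsion l (e l) U" "[T * U = 1] (mod l ^ e l)" using torsion_inverse L(1)[OF l] by blast
    have "[p ^ j l * B l * (T * U) = p ^ j l * B l * 1] (mod l ^ e l)" using U(2) by (rule cong_scalar_left)
    moreover have "p ^ j l * B l * (T * U) = p ^ i * (U * B l)" by (simp add: t T_def power_add power_mult)
    ultimately have "[A = p ^ i * (U * B l)] (mod l ^ e l)" using jB(2)[OF l] cong_trans cong_sym by (metis mult_1_right)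
    then show ?thesis using torsion_mult[OF U(1) jB(1)[OF l]] by blast
  qed
  then obtain D where D: "\<And>l. l \<in> L \<Longrightarrow> torsion l (e l) (D l)" "\<And>l. l \<in> L \<Longrightarrow> [A = p ^ i * D l] (mod l ^ e l)" by metis
  have "\<exists>C. \<forall>l\<in>prime_factors n. [C = (if l = p then 1 else D l)] (mod l ^ e l)"
    by (rule chinese_remainder_nat) (auto intro!: primes_coprime)
  then obtain C where C: "\<And>l. l \<in> prime_factors n \<Longrightarrow> [C = (if l = p then 1 else D l)] (mod l ^ e l)" by blast
  have "torsion l (e l) C" if "Factorial_Ring.prime l" "l dvd n" for l
  proof -
    have lp: "l \<in> prime_factors n" using that n(1) by (simp add: prime_factors_dvd)
    have "torsion l (e l) (if l = p then 1 else D l)" using D(1)[of l] lp by (simp add: L_def)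
    then show ?thesis by (rule torsion_cong[OF cong_sym[OF C[OF lp]]])
  qed
  then have tor: "torsion_residue n C" by (simp add: torsion_residue_def e_def)
  have copC: "coprime C n" by (rule torsion_residue_coprime[OF n(1) tor])
  obtain C' where C': "[C * C' = 1] (mod n)" using cong_solve_coprime_nat[OF copC] by auto
  have copA: "coprime A n" using A by (simp add: decomposition_def)
  have "coprime C' n"
    by (metis C' cong_imp_coprime cong_sym coprime_1_left coprime_mult_left_iff)
  then have copAC: "coprime (A * C') n" using copA by simp
  have "[A * C' = p ^ i] (mod m)"
  proof (rule cong_of_prime_powers)
    show "m > 0" using n by (cases "m = 0") auto
    fix l assume l: "Factorial_Ring.prime l" "l dvd m"
    have "l \<noteq> p" using l n(3) by (metis coprime_common_divisor dvd_refl not_prime_unit)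
    moreover have "l dvd n" using l n(2) by simp
    ultimately have lL: "l \<in> L" "l \<in> prime_factors n" using l n(1) by (auto simp: L_def prime_factors_dvd)
    have "[C = D l] (mod l ^ e l)" using C[OF lL(2)] \<open>l \<noteq> p\<close> by simp
    then have "[p ^ i * C = p ^ i * D l] (mod l ^ e l)" by (rule cong_scalar_left)
    then have "[A = p ^ i * C] (mod l ^ e l)" using D(2)[OF lL(1)] cong_trans cong_sym by blast
    then have "[A * C' = p ^ i * C * C'] (mod l ^ e l)" by (rule cong_scalar_right)
    moreover have "[p ^ i * (C * C') = p ^ i * 1] (mod l ^ e l)"
      using cong_dvd_modulus_nat[OF C', of "l ^ e l"] by (intro cong_scalar_left) (simp add: e_def multiplicity_dvd)
    ultimately have "[A * C' = p ^ i] (mod l ^ e l)" using cong_trans by (metis mult.assoc mult_1_right)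
    moreover have "l ^ multiplicity l m dvd l ^ e l"
      unfolding e_def using n by (intro le_imp_power_dvd dvd_imp_multiplicity_le) auto
    ultimately show "[A * C' = p ^ i] (mod l ^ multiplicity l m)" by (rule cong_dvd_modulus_nat)
  qed
  moreover have "[A = A * C' * C] (mod n)"
    using cong_sym[OF cong_scalar_left[OF C', of A]] by (simp add: mult_ac)
  ultimately show ?thesis using that[OF tor copAC] by blast
qed

context two_valuations
begin

lemma decomposition_invariant:
  assumes u: "u \<in> Val p Q_cyc" and n: "n > 0" and A: "decomposition p n A"
    and x: "x \<in> qspan (mu n)" "x \<in> Q_cyc_Delta"
  shows "u (gal n A x) = u x"
proof -
  interpret u: level_val p n "restrict u (qspan (mu n))" by (rule level_restrict[OF v.prime u n])
  obtain a m where nm: "n = p ^ a * m" "coprime m p" using u.decompose_level by blast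
  obtain B C i where BC: "torsion_residue n C" "coprime B n" "[B = p ^ i] (mod m)" "[A = B * C] (mod n)"
    using decomposition_factor[OF v.prime n nm A] .
  have copC: "coprime C n" by (rule torsion_residue_coprime[OF n BC(1)])
  have "gal n A x = gal n (B * C) x"
    using A by (intro gal_cong[OF n _ BC(4) x(1)]) (simp add: decomposition_def)
  also have "\<dots> = gal n B (gal n C x)" by (rule gal_compose[OF n BC(2) copC x(1), symmetric])
  also have "gal n C x = x" using Q_cyc_Delta_iff[OF n x(1)] x(2) BC(1) by blast
  finally show ?thesis using Val_gal_invariant[OF v.prime u n nm BC(2,3) x(1)] by simp
qed

text \<open>The norm of \<open>x\<close> for the decomposition group is a combination of traces of
  roots of unity and hence approximable. Each conjugate that enters into it has the value of
  \<open>x\<close>.\<close>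

theorem eq_on_Q_cyc_Delta:
  assumes eq: "\<And>l x. Factorial_Ring.prime l \<Longrightarrow> l \<noteq> p \<Longrightarrow> x \<in> B_inf l \<Longrightarrow> v x = w x" and x: "x \<in> Q_cyc_Delta"
  shows "v x = w x"
proof (cases "x = 0")
  case False
  have xQ: "x \<in> Q_cyc" using x Q_cyc_Delta_subset by auto
  obtain n where n: "n > 0" "x \<in> qspan (mu n)" using Q_cyc_level[OF xQ] .
  define H where "H = decomposition_group p n"
  have H: "residue_group n H" unfolding H_def by (rule residue_group_decomposition[OF n(1)])
  have Hfin: "finite H" "H \<noteq> {}" using residue_group_finite[OF H] by auto
  have dec: "decomposition p n A" "coprime A n" if "A \<in> H" for A
    using that by (auto simp: H_def decomposition_group_def decomposition_def)
  define y where "y = (\<Prod>A\<in>H. gal n A x)"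
  have cl: "gal n A x \<in> qspan (mu n)" if "A \<in> H" for A by (rule gal_closed[OF n(1) dec(2)[OF that] n(2)])
  have yn: "y \<in> qspan (mu n)" unfolding y_def by (rule is_subfield_prod[OF is_subfield_qspan_mu[OF n(1)] cl])
  have "y \<in> approximable v w"
  proof (rule average_subspace[OF n(1) Hfin dec(2) subspace_approximable _ yn])
    show "(\<Sum>A\<in>H. z ^ A) \<in> approximable v w" if "z \<in> mu n" for z
      unfolding H_def by (rule trace_approximable[OF n(1) that eq])
    show "gal n A y = y" if "A \<in> H" for A
      unfolding y_def using that n(1) by (intro gal_norm[OF n(1) H _ n(2)]) (simp add: H_def decomposition_group_def)
  qed
  then have vw: "v y = w y" by (rule eq_on_approximable)
  have norm_value: "u y = ereal (real (card H) * t)" if u: "u \<in> Val p Q_cyc" and t: "u x = ereal t" for u t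
  proof -
    interpret u: padic_val p Q_cyc u using v.prime u is_subfield_Q_cyc by unfold_locales
    have "u y = (\<Sum>A\<in>H. u (gal n A x))"
      unfolding y_def using cl qspan_mu_Q_cyc[OF n(1)] by (intro u.v_prod[OF Hfin(1)]) auto
    also have "\<dots> = (\<Sum>A\<in>H. ereal t)"
      using decomposition_invariant[OF u n(1) dec(1) n(2) x] t by (intro sum.cong) auto
    finally show ?thesis by simp
  qed
  obtain r s where rs: "v x = ereal r" "w x = ereal s" using v.v_real[OF xQ False] w.v_real[OF xQ False] by metis
  have "card H \<noteq> 0" using Hfin by simp
  then show ?thesis using norm_value[OF v.val rs(1)] norm_value[OF w.val rs(2)] vw rs by simp
qed simp

end

theorem bij_restrict_product:
  assumes p: "Factorial_Ring.prime p"
  shows "bij_betw (\<lambda>v. \<lambda>l\<in>primes - {p}. restrict v (B_inf l)) (Val p Q_cyc_Delta) (\<Pi>\<^sub>E l\<in>primes - {p}. Val p (B_inf l))"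
  unfolding bij_betw_def
proof
  note D = is_subfield_Q_cyc_Delta Q_cyc_Delta_subset
  show "inj_on (\<lambda>v. \<lambda>l\<in>primes - {p}. restrict v (B_inf l)) (Val p Q_cyc_Delta)"
  proof (rule inj_onI)
    fix v v' assume v: "v \<in> Val p Q_cyc_Delta" "v' \<in> Val p Q_cyc_Delta"
      and eq: "(\<lambda>l\<in>primes - {p}. restrict v (B_inf l)) = (\<lambda>l\<in>primes - {p}. restrict v' (B_inf l))"
    obtain u where u: "u \<in> Val p Q_cyc" "restrict u Q_cyc_Delta = v" using Val_extends_to_Q_cyc[OF p D v(1)] .
    obtain u' where u': "u' \<in> Val p Q_cyc" "restrict u' Q_cyc_Delta = v'" using Val_extends_to_Q_cyc[OF p D v(2)] .
    interpret two_valuations p u u'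
      using p u(1) u'(1) is_subfield_Q_cyc by (simp add: two_valuations_def padic_val_def)
    have "u x = u' x" if l: "Factorial_Ring.prime l" "l \<noteq> p" and x: "x \<in> B_inf l" for l x
    proof -
      have "l \<in> primes - {p}" using l by (simp add: primes_def)
      then have "restrict v (B_inf l) = restrict v' (B_inf l)" using fun_cong[OF eq, of l] by simp
      then have "v x = v' x" using x by (metis restrict_apply')
      moreover have "x \<in> Q_cyc_Delta" using x B_inf_subset[OF l(1)] by auto
      ultimately show ?thesis using u(2) u'(2) by (metis restrict_apply')
    qed
    then have "u x = u' x" if "x \<in> Q_cyc_Delta" for x using eq_on_Q_cyc_Delta that by blast
    then show "v = v'" unfolding u(2)[symmetric] u'(2)[symmetric] by (intro restrict_ext)
  qed
  show "(\<lambda>v. \<lambda>l\<in>primes - {p}. restrict v (B_inf l)) ` Val p Q_cyc_Delta = (\<Pi>\<^sub>E l\<in>primes - {p}. Val p (B_inf l))"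
  proof (intro equalityI subsetI)
    fix f assume "f \<in> (\<lambda>v. \<lambda>l\<in>primes - {p}. restrict v (B_inf l)) ` Val p Q_cyc_Delta"
    then obtain v where v: "v \<in> Val p Q_cyc_Delta" "f = (\<lambda>l\<in>primes - {p}. restrict v (B_inf l))" by blast
    interpret v: padic_val p Q_cyc_Delta v using p v(1) D(1) by unfold_locales
    show "f \<in> (\<Pi>\<^sub>E l\<in>primes - {p}. Val p (B_inf l))"
      unfolding v(2) using v.restrict_Val[OF is_subfield_B_inf B_inf_subset] by (auto simp: primes_def)
  next
    fix f assume f: "f \<in> (\<Pi>\<^sub>E l\<in>primes - {p}. Val p (B_inf l))"
    obtain v where v: "v \<in> Val p Q_cyc_Delta" "\<And>l. l \<in> primes - {p} \<Longrightarrow> restrict v (B_inf l) = f l"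
      using Val_product_surj[OF p f] by blast
    have "f = (\<lambda>l\<in>primes - {p}. restrict v (B_inf l))"
      using f v(2) by (intro extensionalityI[of _ "primes - {p}"]) (auto simp: PiE_def)
    then show "f \<in> (\<lambda>v. \<lambda>l\<in>primes - {p}. restrict v (B_inf l)) ` Val p Q_cyc_Delta" using v(1) by blast
  qed
qed

section \<open>Finite subfields of a field of prime characteristic\<close>

lemma degree_power_minus_self:
  assumes "n > (1::nat)"
  shows "Polynomial.degree (Polynomial.monom 1 n - Polynomial.monom 1 1 :: int poly) = n"
  using assms degree_add_eq_left[of "- Polynomial.monom 1 1" "Polynomial.monom (1::int) n"]
  by (simp add: degree_monom_eq)

text \<open>The characteristic is expressed by the integral multiple \<open>p \<cdot>
  \<one>\<close>, so that polynomials with integral coefficients can be evaluated in all fields of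
  characteristic \<open>p\<close> alike.\<close>

locale char_field = field R for R (structure) +
  fixes p :: nat
  assumes prime_p: "Factorial_Ring.prime p" and char_p: "add_pow R (int p) \<one> = \<zero>"
begin

definition of_integer :: "int \<Rightarrow> 'a" where
  "of_integer k = add_pow R k \<one>"

lemma of_integer_closed [simp]: "of_integer k \<in> carrier R"
  by (simp add: of_integer_def)

lemma of_integer_0 [simp]: "of_integer 0 = \<zero>" and of_integer_1 [simp]: "of_integer 1 = \<one>"
  by (simp_all add: of_integer_def add_pow_def int_pow_def2 nat_pow_def)

lemma of_integer_add: "of_integer (i + j) = of_integer i \<oplus> of_integer j"
  by (simp add: of_integer_def add.int_pow_mult)

lemma of_integer_mult: "of_integer (i * j) = of_integer i \<otimes> of_integer j"
proof -
  have "of_integer i \<otimes> of_integer j = add_pow R i (\<one> \<otimes> of_integer j)"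
    unfolding of_integer_def by (rule add_pow_ldistr_int) auto
  also have "\<dots> = add_pow R i (add_pow R j \<one>)" by (simp add: of_integer_def)
  also have "\<dots> = add_pow R (j * i) \<one>" by (simp add: add.int_pow_pow)
  finally show ?thesis by (simp add: of_integer_def mult.commute)
qed

lemma of_integer_p: "of_integer (int p) = \<zero>"
  using char_p by (simp add: of_integer_def)

lemma of_integer_dvd: "int p dvd k \<Longrightarrow> of_integer k = \<zero>"
  by (auto simp: dvd_def of_integer_mult of_integer_p)

text \<open>The value at \<open>x\<close> of a polynomial with integral coefficients, by Horner's
  scheme.\<close>

definition ev :: "'a \<Rightarrow> int poly \<Rightarrow> 'a" where
  "ev x f = fold_coeffs (\<lambda>a y. of_integer a \<oplus> x \<otimes> y) f \<zero>"

context
  fixes x assumes x: "x \<in> carrier R"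
begin

lemma ev_0 [simp]: "ev x 0 = \<zero>"
  by (simp add: ev_def)

lemma ev_pCons [simp]: "ev x (pCons a f) = of_integer a \<oplus> x \<otimes> ev x f"
  using x by (cases "a = 0 \<and> f = 0") (auto simp: ev_def)

lemma ev_closed [simp]: "ev x f \<in> carrier R"
  by (induction f) (use x in auto)

lemma ev_add: "ev x (f + g) = ev x f \<oplus> ev x g"
proof (induction f g rule: poly_induct2)
  case (pCons a f b g)
  have "x \<otimes> (ev x f \<oplus> ev x g) = x \<otimes> ev x f \<oplus> x \<otimes> ev x g" using x by (simp add: r_distr)
  then show ?case using pCons x by (simp add: of_integer_add a_ac)
qed simp

lemma ev_smult: "ev x (Polynomial.smult a f) = of_integer a \<otimes> ev x f"
proof (induction f)
  case (pCons b f)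
  have "of_integer a \<otimes> (of_integer b \<oplus> x \<otimes> ev x f) = of_integer a \<otimes> of_integer b \<oplus> x \<otimes> (of_integer a \<otimes> ev x f)"
    using x by (simp add: r_distr m_ac)
  then show ?case using pCons by (simp add: of_integer_mult)
qed simp

lemma ev_mult: "ev x (f * g) = ev x f \<otimes> ev x g"
proof (induction f)
  case (pCons a f)
  have "(of_integer a \<oplus> x \<otimes> ev x f) \<otimes> ev x g = of_integer a \<otimes> ev x g \<oplus> x \<otimes> (ev x f \<otimes> ev x g)"
    using x by (simp add: l_distr m_assoc)
  then show ?case using pCons x by (simp add: ev_add ev_smult)
qed simp

lemma ev_one [simp]: "ev x 1 = \<one>"
  using x by (simp add: one_pCons)

lemma ev_minus: "ev x (- f) = \<ominus> ev x f"
  using ev_add[of "- f" f] by (intro sym[OF minus_equality]) auto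

lemma ev_diff: "ev x (f - g) = ev x f \<ominus> ev x g"
  using ev_add[of f "- g"] ev_minus by (simp add: a_minus_def)

lemma ev_monom: "ev x (Polynomial.monom 1 n) = x [^] n"
  by (induction n) (use x in \<open>auto simp: monom_Suc m_comm monom_0\<close>)

lemma ev_power: "ev x (f ^ n) = ev x f [^] n"
  by (induction n) (auto simp: ev_mult m_comm)

lemma ev_coeffs_dvd:
  assumes "\<And>i. int p dvd Polynomial.coeff f i"
  shows "ev x f = \<zero>"
  using assms
proof (induction f)
  case (pCons a f)
  have "int p dvd Polynomial.coeff f i" for i using pCons.prems[of "Suc i"] by simp
  moreover have "int p dvd a" using pCons.prems[of 0] by simp
  ultimately show ?case using pCons x by (simp add: of_integer_dvd)
qed simp

text \<open>The list of coefficients in decreasing order is the representation of polynomials in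
  which the roots in a ring are counted.\<close>

lemma eval_list: "eval (map of_integer (rev (coeffs f))) x = ev x f"
proof (induction f)
  case (pCons a f)
  have "eval (map of_integer (rev (coeffs (pCons a f)))) x = eval (map of_integer (rev (coeffs f)) @ [of_integer a]) x"
    using pCons(1) by auto
  also have "\<dots> = eval (map of_integer (rev (coeffs f))) x \<otimes> x \<oplus> of_integer a"
    using x by (intro eval_append_aux) auto
  finally show ?case using pCons(2) x by (simp add: m_comm a_comm)
qed simp

end

lemma monic_list:
  assumes "Polynomial.lead_coeff f = 1"
  shows "map of_integer (rev (coeffs f)) \<in> carrier (poly_ring R)" "map of_integer (rev (coeffs f)) \<noteq> []"
    "degree (map of_integer (rev (coeffs f))) = Polynomial.degree f"
proof -
  have f0: "f \<noteq> 0" using assms by auto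
  then have ne: "coeffs f \<noteq> []" by simp
  have "hd (rev (coeffs f)) = 1" using assms f0 by (simp add: hd_rev last_coeffs_eq_coeff_degree)
  then have "hd (map of_integer (rev (coeffs f))) = \<one>" using ne by (simp add: hd_map)
  then have "polynomial (carrier R) (map of_integer (rev (coeffs f)))"
    using ne by (auto simp: polynomial_def)
  then show "map of_integer (rev (coeffs f)) \<in> carrier (poly_ring R)" by (simp add: univ_poly_carrier)
  show "map of_integer (rev (coeffs f)) \<noteq> []" using ne by simp
  show "degree (map of_integer (rev (coeffs f))) = Polynomial.degree f"
    using f0 by (simp add: length_coeffs)
qed

lemma monic_roots:
  assumes "Polynomial.lead_coeff f = 1"
  shows "finite {x \<in> carrier R. ev x f = \<zero>}" "card {x \<in> carrier R. ev x f = \<zero>} \<le> Polynomial.degree f"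
proof -
  define P where "P = map of_integer (rev (coeffs f))"
  note P = monic_list[OF assms, folded P_def]
  have eq: "{x \<in> carrier R. ev x f = \<zero>} = set_mset (roots P)"
    using roots_mem_iff_is_root[OF P(1)] P(2) eval_list[of _ f] by (auto simp: is_root_def P_def)
  show "finite {x \<in> carrier R. ev x f = \<zero>}" unfolding eq by simp
  have "card (set_mset (roots P)) \<le> size (roots P)" by (simp add: size_multiset_overloaded_eq sum_mono card_eq_sum del: sum_constant)
  also have "\<dots> \<le> Polynomial.degree f" using size_roots_le_degree[OF P(1)] P(3) by simp
  finally show "card {x \<in> carrier R. ev x f = \<zero>} \<le> Polynomial.degree f" unfolding eq .
qed

lemma frobenius_add_one:
  assumes "z \<in> carrier R"
  shows "(\<one> \<oplus> z) [^] p = z [^] p \<oplus> \<one>"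
proof -
  define y :: "int poly" where "y = Polynomial.monom 1 1"
  have p0: "p > 0" using prime_p by (simp add: prime_gt_0_nat)
  have "\<exists>c. p choose k = p * c" if "k \<in> {1..<p}" for k
    using dvd_choose_prime[of k p] that prime_p by (auto simp: dvd_def)
  then obtain c where c: "\<And>k. k \<in> {1..<p} \<Longrightarrow> p choose k = p * c k" by metis
  define h where "h = (\<Sum>k\<in>{1..<p}. of_nat (c k) * y ^ k)"
  have "(y + 1) ^ p = (\<Sum>k\<le>p. of_nat (p choose k) * y ^ k)"
    using binomial_ring[of y 1 p] by simp
  also have "{..p} = insert 0 (insert p {1..<p})" using p0 by auto
  also have "(\<Sum>k\<in>insert 0 (insert p {1..<p}). of_nat (p choose k) * y ^ k)
      = 1 + y ^ p + (\<Sum>k\<in>{1..<p}. of_nat (p choose k) * y ^ k)"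
    using p0 by (simp add: add.assoc)
  also have "(\<Sum>k\<in>{1..<p}. of_nat (p choose k) * y ^ k) = of_nat p * h"
    unfolding h_def sum_distrib_left by (rule sum.cong) (auto simp: c mult.assoc)
  also have "of_nat p * h = Polynomial.smult (int p) h" by (simp add: of_nat_poly)
  finally have eq: "(y + 1) ^ p = 1 + y ^ p + Polynomial.smult (int p) h" .
  have "ev z y = z" using ev_monom[OF assms, of 1] assms by (simp add: y_def)
  then show ?thesis
    using arg_cong[OF eq, of "ev z"] assms
    by (simp add: ev_add ev_power ev_smult of_integer_p a_comm)
qed

text \<open>This is the case \<open>\<one> \<oplus> z\<close> made homogeneous.\<close>

lemma frobenius_add_p:
  assumes "x \<in> carrier R" "y \<in> carrier R"
  shows "(x \<oplus> y) [^] p = x [^] p \<oplus> y [^] p"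
proof (cases "y = \<zero>")
  case True
  then show ?thesis using assms prime_p by (simp add: nat_pow_zero prime_gt_0_nat)
next
  case False
  then have u: "y \<in> Units R" using assms field_Units by auto
  define z where "z = x \<otimes> inv y"
  have z: "z \<in> carrier R" using assms u by (simp add: z_def)
  have x: "x = z \<otimes> y" using assms u by (simp add: z_def m_assoc)
  have "(x \<oplus> y) [^] p = ((\<one> \<oplus> z) \<otimes> y) [^] p" using assms z by (simp add: x l_distr a_comm)
  also have "\<dots> = (z [^] p \<oplus> \<one>) \<otimes> y [^] p" using assms z by (simp add: nat_pow_distrib frobenius_add_one)
  also have "\<dots> = x [^] p \<oplus> y [^] p" using assms z by (simp add: x l_distr nat_pow_distrib)
  finally show ?thesis .
qed

text \<open>The field with \<open>p ^ n\<close> elements, as far as it is contained in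
  \<open>R\<close>.\<close>

definition fix_field :: "nat \<Rightarrow> 'a set" where
  "fix_field n = {x \<in> carrier R. x [^] (p ^ n) = x}"

lemma p_power_pos: "p ^ n > 0"
  using prime_p by (simp add: prime_gt_0_nat)

lemma frobenius_add:
  assumes "x \<in> carrier R" "y \<in> carrier R"
  shows "(x \<oplus> y) [^] (p ^ n) = x [^] (p ^ n) \<oplus> y [^] (p ^ n)"
proof (induction n)
  case (Suc n)
  have "(x \<oplus> y) [^] (p ^ Suc n) = ((x \<oplus> y) [^] (p ^ n)) [^] p"
    using assms by (simp add: nat_pow_pow mult.commute)
  also have "\<dots> = (x [^] (p ^ n)) [^] p \<oplus> (y [^] (p ^ n)) [^] p"
    unfolding Suc using assms by (intro frobenius_add_p) auto
  also have "\<dots> = x [^] (p ^ Suc n) \<oplus> y [^] (p ^ Suc n)"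
    using assms by (simp add: nat_pow_pow mult.commute)
  finally show ?case .
qed (use assms in simp)

lemma subfield_fix_field: "subfield (fix_field n) R"
proof (rule subfieldI')
  show "subring (fix_field n) R"
  proof (rule subringI)
    fix x assume x: "x \<in> fix_field n"
    then have xc: "x \<in> carrier R" "x [^] (p ^ n) = x" by (auto simp: fix_field_def)
    have "\<zero> = x [^] (p ^ n) \<oplus> (\<ominus> x) [^] (p ^ n)"
      using frobenius_add[OF xc(1), of "\<ominus> x" n] xc(1) p_power_pos by (simp add: r_neg nat_pow_zero)
    then have "(\<ominus> x) [^] (p ^ n) = \<ominus> x"
      using xc by (metis a_comm a_inv_closed minus_equality nat_pow_closed minus_minus)
    then show "\<ominus> x \<in> fix_field n" using xc by (simp add: fix_field_def)
    fix y assume "y \<in> fix_field n"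
    then show "x \<oplus> y \<in> fix_field n" "x \<otimes> y \<in> fix_field n"
      using xc frobenius_add by (auto simp: fix_field_def nat_pow_distrib)
  qed (auto simp: fix_field_def)
  fix x assume x: "x \<in> fix_field n - {\<zero>}"
  then have xc: "x \<in> carrier R" "x [^] (p ^ n) = x" "x \<in> Units R" using field_Units by (auto simp: fix_field_def)
  have "x \<otimes> (inv x) [^] (p ^ n) = (x \<otimes> inv x) [^] (p ^ n)"
    using xc by (simp only: nat_pow_distrib[OF xc(1) Units_inv_closed[OF xc(3)]])
  then have "x \<otimes> (inv x) [^] (p ^ n) = \<one>" using xc by simp
  then have "(inv x) [^] (p ^ n) = inv x" using xc by (metis Units_inv_closed comm_inv_char nat_pow_closed)
  then show "inv x \<in> fix_field n" using xc by (simp add: fix_field_def)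
qed

lemma fix_field_card:
  assumes "n > 0"
  shows "finite (fix_field n)" "card (fix_field n) \<le> p ^ n"
proof -
  define f :: "int poly" where "f = Polynomial.monom 1 (p ^ n) - Polynomial.monom 1 1"
  have q: "p ^ n > 1" using one_less_power[OF prime_gt_1_nat[OF prime_p] assms] .
  have "Polynomial.degree f = p ^ n"
    unfolding f_def by (rule degree_power_minus_self[OF q])
  then have lc: "Polynomial.lead_coeff f = 1" using q by (simp add: f_def)
  have eq: "fix_field n = {x \<in> carrier R. ev x f = \<zero>}"
    by (auto simp: fix_field_def f_def ev_diff ev_monom simp del: One_nat_def)
  show "finite (fix_field n)" "card (fix_field n) \<le> p ^ n"
    using monic_roots[OF lc] \<open>Polynomial.degree f = p ^ n\<close> unfolding eq by auto
qed

lemma fix_field_mult: "x \<in> fix_field n \<Longrightarrow> x \<in> fix_field (n * m)"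
proof (induction m)
  case (Suc m)
  then have x: "x \<in> carrier R" "x [^] (p ^ n) = x" "x [^] (p ^ (n * m)) = x" by (auto simp: fix_field_def)
  have "x [^] (p ^ (n * Suc m)) = (x [^] (p ^ n)) [^] (p ^ (n * m))"
    using x(1) by (simp add: nat_pow_pow power_add)
  then show ?case using x by (simp add: fix_field_def)
qed (simp add: fix_field_def)

lemma fix_field_dvd: "n dvd m \<Longrightarrow> fix_field n \<subseteq> fix_field m"
  using fix_field_mult by auto

text \<open>The powers of the Frobenius map fixing \<open>x\<close> are closed under subtraction
  of exponents.\<close>

lemma fix_field_mod:
  assumes "x \<in> fix_field m" "x \<in> fix_field n"
  shows "x \<in> fix_field (m mod n)"
proof -
  have x: "x \<in> carrier R" "x [^] (p ^ m) = x" "x [^] (p ^ (n * (m div n))) = x"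
    using assms fix_field_mult by (auto simp: fix_field_def)
  have "m = n * (m div n) + m mod n" by simp
  then have "x = x [^] (p ^ (n * (m div n)) * p ^ (m mod n))" using x(2) by (metis power_add)
  also have "\<dots> = (x [^] (p ^ (n * (m div n)))) [^] (p ^ (m mod n))" using x(1) by (simp add: nat_pow_pow)
  finally show ?thesis using x by (simp add: fix_field_def)
qed

lemma fix_field_gcd:
  assumes "x \<in> fix_field m" "x \<in> fix_field n"
  shows "x \<in> fix_field (gcd m n)"
  using assms
proof (induction m n rule: gcd_nat_induct)
  case (step m n)
  then show ?case using fix_field_mod[of x m n] by (simp add: gcd_red_nat[of m n])
qed simp

text \<open>The additive group is annihilated by \<open>p\<close>, so that by Sylow's theorem no
  other prime divides the order. If the order is \<open>p ^ d\<close>, all elements are roots of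
  \<open>x ^ (p ^ d) - x\<close>, and there are not more roots than that.\<close>

lemma finite_subfield:
  assumes F: "subfield F R" "finite F"
  obtains d where "d > 0" "card F = p ^ d" "F = fix_field d"
proof -
  define K where "K = R\<lparr>carrier := F\<rparr>"
  have K: "field K" unfolding K_def by (rule subfield_iff(2)[OF F(1)])
  interpret K: field K by (rule K)
  have Fc: "F \<subseteq> carrier R" using F(1) by (simp add: subfieldE)
  have K_simps: "carrier K = F" "\<zero>\<^bsub>K\<^esub> = \<zero>" "\<one>\<^bsub>K\<^esub> = \<one>" "mult K = mult R" "add K = add R" by (auto simp: K_def)
  have pow: "x [^]\<^bsub>K\<^esub> (n::nat) = x [^] n" for x n by (simp add: K_def nat_pow_def)
  have in01: "\<zero> \<in> F" "\<one> \<in> F" using K.zero_closed K.one_closed K_simps by auto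
  then have card2: "card F \<ge> 2"
    using card_mono[OF F(2), of "{\<zero>, \<one>}"] zero_not_one by auto
  have grp: "group (add_monoid K)" by (rule K.add.is_group)
  have nprime: "\<not> r dvd card F" if r: "Factorial_Ring.prime r" "r \<noteq> p" for r
  proof
    assume dv: "r dvd card F"
    define a where "a = multiplicity r (card F)"
    have c0: "card F > 0" using card2 by simp
    have a: "a > 0" unfolding a_def by (rule multiplicity_prime_pos[OF r(1) c0 dv])
    have "card F = r ^ a * (card F div r ^ a)" by (simp add: a_def multiplicity_dvd)
    then have ord: "order (add_monoid K) = r ^ a * (card F div r ^ a)" by (simp add: order_def K_simps)
    obtain H where H: "subgroup H (add_monoid K)" "card H = r ^ a"
      using sylow_thm[OF r(1) grp ord] F(2) by (auto simp: K_simps)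
    have "card H > 1" using H(2) one_less_power[OF prime_gt_1_nat[OF r(1)] a] by simp
    then obtain h where h: "h \<in> H" "h \<noteq> \<zero>"
      by (metis card_1_singleton_iff card.empty is_singletonI' is_singleton_altdef less_irrefl_nat less_one not_one_less_zero empty_iff One_nat_def equals0I)
    have HF: "H \<subseteq> F" using H(1) by (auto simp: subgroup_def K_simps)
    have hR: "h \<in> carrier R" using h HF Fc by auto
    have "group ((add_monoid K)\<lparr>carrier := H\<rparr>)" using H(1) grp by (rule subgroup.subgroup_is_group)
    then have "h [^]\<^bsub>(add_monoid K)\<lparr>carrier := H\<rparr>\<^esub> order ((add_monoid K)\<lparr>carrier := H\<rparr>) = \<one>\<^bsub>(add_monoid K)\<lparr>carrier := H\<rparr>\<^esub>"
      by (rule group.pow_order_eq_1) (use h in simp)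
    then have rh: "add_pow R (r ^ a) h = \<zero>"
      by (simp add: order_def H(2) add_pow_def nat_pow_def K_def)
    have "of_integer (int (r ^ a)) \<otimes> h = \<zero>"
    proof -
      have "of_integer (int (r ^ a)) \<otimes> h = add_pow R (int (r ^ a)) (\<one> \<otimes> h)"
        unfolding of_integer_def using hR by (intro add_pow_ldistr_int) auto
      also have "\<dots> = add_pow R (r ^ a) h" using hR by (simp add: add_pow_def int_pow_int del: of_nat_power)
      finally show ?thesis using rh by simp
    qed
    moreover have "coprime (int (r ^ a)) (int p)" using primes_coprime[OF r(1) prime_p r(2)] by simp
    then obtain u w where uw: "u * int (r ^ a) + w * int p = 1" using bezout_int[of "int (r ^ a)" "int p"] by auto
    have "\<one> = of_integer u \<otimes> of_integer (int (r ^ a))"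
      using arg_cong[OF uw, of of_integer] by (simp only: of_integer_add of_integer_mult of_integer_p) simp
    ultimately have "h = \<zero>" using hR by (metis l_one m_assoc of_integer_closed r_null)
    then show False using h(2) by simp
  qed
  define d where "d = multiplicity p (card F)"
  have c0: "card F \<noteq> 0" using card2 by simp
  obtain m where m: "card F = p ^ d * m" "\<not> p dvd m"
    using multiplicity_decompose'[of "card F" p] c0 prime_p not_prime_unit unfolding d_def by blast
  have "m = 1"
  proof (rule ccontr)
    assume "m \<noteq> 1"
    then obtain r where "Factorial_Ring.prime r" "r dvd m" using prime_factor_nat by blast
    then show False using nprime[of r] m by auto
  qed
  then have card: "card F = p ^ d" using m by simp
  have d: "d > 0" using card card2 by (cases d) auto
  have "F \<subseteq> fix_field d"
  proof
    fix x assume x: "x \<in> F"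
    then have xc: "x \<in> carrier R" using Fc by auto
    show "x \<in> fix_field d"
    proof (cases "x = \<zero>")
      case True
      then show ?thesis using p_power_pos by (simp add: fix_field_def nat_pow_zero)
    next
      case False
      interpret G: group "Multiplicative_Group.mult_of K" by (rule K.field_mult_group)
      have "x [^]\<^bsub>Multiplicative_Group.mult_of K\<^esub> order (Multiplicative_Group.mult_of K) = \<one>\<^bsub>Multiplicative_Group.mult_of K\<^esub>"
        using x False by (intro G.pow_order_eq_1) (simp add: K_simps)
      moreover have "order (Multiplicative_Group.mult_of K) = p ^ d - 1" using K.order_mult_of F(2) card by (simp add: K_simps order_def)
      ultimately have "x [^] (p ^ d - 1) = \<one>" by (simp add: Multiplicative_Group.nat_pow_mult_of pow K_simps)
      then have "x [^] Suc (p ^ d - 1) = x" using xc by simp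
      moreover have "Suc (p ^ d - 1) = p ^ d" using p_power_pos[of d] by simp
      ultimately show ?thesis using xc by (simp only: fix_field_def mem_Collect_eq)
    qed
  qed
  moreover have "card (fix_field d) \<le> card F" using fix_field_card(2)[OF d] card by simp
  ultimately have "F = fix_field d" using card_seteq[OF fix_field_card(1)[OF d]] by blast
  then show ?thesis using that d card by blast
qed

lemma fix_field_subset_dvd:
  assumes d: "d > 0" "card (fix_field d) = p ^ d" and sub: "fix_field d \<subseteq> fix_field n" and n: "n > 0"
  shows "d dvd n"
proof (rule ccontr)
  assume "\<not> d dvd n"
  then have r: "n mod d > 0" "n mod d < d" using d by (auto simp: mod_greater_zero_iff_not_dvd)
  have "fix_field d \<subseteq> fix_field (n mod d)" using sub fix_field_mod by auto
  then have "card (fix_field d) \<le> card (fix_field (n mod d))" by (intro card_mono fix_field_card(1) r(1))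
  also have "\<dots> \<le> p ^ (n mod d)" by (rule fix_field_card(2)[OF r(1)])
  also have "\<dots> < p ^ d" using r(2) prime_gt_1_nat[OF prime_p] by simp
  finally show False using d(2) by simp
qed

text \<open>A monic integral equation of least degree is, modulo \<open>p\<close>, a minimal
  polynomial: a remainder that does not vanish modulo \<open>p\<close> could be changed by
  multiples of \<open>p\<close> and a scalar to a monic equation of smaller degree.\<close>

lemma minimal_equation:
  assumes x: "x \<in> carrier R" and f: "Polynomial.lead_coeff f = 1" "ev x f = \<zero>"
    and least: "\<And>g. Polynomial.lead_coeff g = 1 \<Longrightarrow> ev x g = \<zero> \<Longrightarrow> Polynomial.degree f \<le> Polynomial.degree g"
    and g: "ev x g = \<zero>"
  obtains q r where "g = f * q + r" "\<And>i. int p dvd Polynomial.coeff r i"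
proof -
  have f0: "f \<noteq> 0" using f(1) by auto
  obtain q r where qr: "pseudo_divmod g f = (q, r)" by force
  have eq: "g = f * q + r" using pseudo_divmod(1)[OF f0 qr] f(1) by simp
  have deg: "r = 0 \<or> Polynomial.degree r < Polynomial.degree f" using pseudo_divmod(2)[OF f0 qr] .
  have "ev x r = \<zero>"
    using arg_cong[OF eq, of "ev x"] g f(2) x by (simp add: ev_add ev_mult)
  have main: "\<forall>i. int p dvd Polynomial.coeff h i"
    if "\<And>i. i \<ge> n \<Longrightarrow> Polynomial.coeff h i = 0" "n \<le> Polynomial.degree f" "ev x h = \<zero>" for n h
    using that
  proof (induction n arbitrary: h)
    case (Suc n)
    define c where "c = Polynomial.coeff h n"
    have "int p dvd c"
    proof (rule ccontr)
      assume nd: "\<not> int p dvd c"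
      then have "coprime c (int p)" using prime_imp_coprime[of "int p" c] prime_p by (simp add: coprime_commute)
      then obtain u where u: "[c * u = 1] (mod int p)" using cong_solve_coprime_int by blast
      \<comment> \<open>The leading coefficient \<open>c * u\<close> is corrected to 1 by a
        multiple of \<open>p\<close>.\<close>
      define h' where "h' = Polynomial.smult u h + Polynomial.monom (1 - c * u) n"
      have cn: "Polynomial.coeff h' n = 1" by (simp add: h'_def c_def)
      have "Polynomial.coeff h' i = 0" if "i > n" for i using Suc.prems(1)[of i] that by (simp add: h'_def)
      then have dn: "Polynomial.degree h' = n"
        using cn by (intro antisym degree_le le_degree) auto
      have "int p dvd 1 - c * u" using u by (metis cong_iff_dvd_diff cong_sym)
      then have "ev x (Polynomial.monom (1 - c * u) n) = \<zero>"
        by (intro ev_coeffs_dvd[OF x]) auto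
      then have "ev x h' = \<zero>" unfolding h'_def using Suc.prems(3) x by (simp add: ev_add ev_smult)
      then have "Polynomial.degree f \<le> n" using least[of h'] cn dn by simp
      then show False using Suc.prems(2) by simp
    qed
    define h' where "h' = h + Polynomial.monom (- c) n"
    have "\<forall>i. int p dvd Polynomial.coeff h' i"
    proof (rule Suc.IH)
      show "Polynomial.coeff h' i = 0" if "i \<ge> n" for i
        using Suc.prems(1)[of i] that by (cases "i = n") (auto simp: h'_def c_def)
      have "ev x (Polynomial.monom (- c) n) = \<zero>" using \<open>int p dvd c\<close> by (intro ev_coeffs_dvd[OF x]) auto
      then show "ev x h' = \<zero>" unfolding h'_def using Suc.prems(3) x by (simp add: ev_add)
    qed (use Suc.prems in simp)
    moreover have "Polynomial.coeff h i = Polynomial.coeff h' i + (if i = n then c else 0)" for i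
      by (simp add: h'_def)
    ultimately show ?case using \<open>int p dvd c\<close> by simp
  qed simp
  have "\<forall>i. int p dvd Polynomial.coeff r i"
  proof (rule main[of "Polynomial.degree f"])
    show "Polynomial.coeff r i = 0" if "i \<ge> Polynomial.degree f" for i
      using deg that by (auto intro: coeff_eq_0)
  qed (use \<open>ev x r = \<zero>\<close> in auto)
  then show ?thesis using that eq by blast
qed

end

section \<open>Embedding into an algebraically closed field\<close>

locale closed_extension = k: char_field R p + M: char_field S p for R (structure) and S (structure) and p +
  assumes closed: "\<And>f :: int poly. Polynomial.lead_coeff f = 1 \<Longrightarrow> Polynomial.degree f > 0 \<Longrightarrow> \<exists>x\<in>carrier S. M.ev x f = \<zero>\<^bsub>S\<^esub>"
begin

text \<open>A finite field is generated by a single element \<open>g\<close>, which is sent to a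
  root \<open>m\<close> of its minimal equation. Modulo \<open>p\<close>, all relations of
  \<open>g\<close> are multiples of this equation and so are satisfied by
  \<open>m\<close>.\<close>

lemma embed_finite:
  assumes F: "subfield F R" "finite F"
  shows "\<exists>h. h \<in> ring_hom (R\<lparr>carrier := F\<rparr>) S"
proof -
  define K where "K = R\<lparr>carrier := F\<rparr>"
  have K: "field K" unfolding K_def by (rule k.subfield_iff(2)[OF F(1)])
  interpret K: field K by (rule K)
  have Fc: "F \<subseteq> carrier R" using F(1) by (simp add: subfieldE)
  have pow: "x [^]\<^bsub>K\<^esub> (n::nat) = x [^]\<^bsub>R\<^esub> n" for x n by (simp add: K_def nat_pow_def)
  obtain g where g: "g \<in> carrier (Multiplicative_Group.mult_of K)" "carrier (Multiplicative_Group.mult_of K) = {g [^]\<^bsub>K\<^esub> i | i::nat. i \<in> UNIV}"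
    using K.finite_field_mult_group_has_gen F(2) by (auto simp: K_def)
  have gR: "g \<in> carrier R" using g(1) Fc by (auto simp: K_def)
  obtain d where d: "d > 0" "card F = p ^ d" "F = k.fix_field d" using k.finite_subfield[OF F] .
  define f0 :: "int poly" where "f0 = Polynomial.monom 1 (p ^ d) - Polynomial.monom 1 1"
  have q: "p ^ d > 1" using one_less_power[OF prime_gt_1_nat[OF k.prime_p] d(1)] .
  have "Polynomial.degree f0 = p ^ d"
    unfolding f0_def by (rule degree_power_minus_self[OF q])
  then have lc0: "Polynomial.lead_coeff f0 = 1" using q by (simp add: f0_def)
  have "g \<in> k.fix_field d" using g(1) d(3) by (simp add: K_def)
  then have ev0: "k.ev g f0 = \<zero>\<^bsub>R\<^esub>"
    using gR by (simp add: f0_def k.ev_diff k.ev_monom k.fix_field_def del: One_nat_def)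
  define P where "P n \<longleftrightarrow> (\<exists>f. Polynomial.lead_coeff f = 1 \<and> k.ev g f = \<zero>\<^bsub>R\<^esub> \<and> Polynomial.degree f = n)" for n
  have "P (Polynomial.degree f0)" using lc0 ev0 by (auto simp: P_def)
  then have "P (LEAST n. P n)" by (rule LeastI)
  then obtain f where f: "Polynomial.lead_coeff f = 1" "k.ev g f = \<zero>\<^bsub>R\<^esub>" "Polynomial.degree f = (LEAST n. P n)"
    by (auto simp: P_def)
  have least: "Polynomial.degree f \<le> Polynomial.degree h" if "Polynomial.lead_coeff h = 1" "k.ev g h = \<zero>\<^bsub>R\<^esub>" for h
    unfolding f(3) using that by (intro Least_le) (auto simp: P_def)
  have "Polynomial.degree f > 0"
  proof (rule ccontr)
    assume "\<not> Polynomial.degree f > 0"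
    then have "f = 1" using f(1) by (metis degree_eq_zeroE coeff_pCons_0 gr0I one_pCons)
    then show False using f(2) gR by simp
  qed
  then obtain m where m: "m \<in> carrier S" "M.ev m f = \<zero>\<^bsub>S\<^esub>" using closed[OF f(1)] by blast
  have kill: "M.ev m h = \<zero>\<^bsub>S\<^esub>" if h: "k.ev g h = \<zero>\<^bsub>R\<^esub>" for h
  proof -
    obtain q r where qr: "h = f * q + r" "\<And>i. int p dvd Polynomial.coeff r i"
      using k.minimal_equation[OF gR f(1,2) least h] by blast
    then show ?thesis using m M.ev_coeffs_dvd[OF m(1) qr(2)] by (simp add: M.ev_add M.ev_mult)
  qed
  have same: "M.ev m h = M.ev m h'" if "k.ev g h = k.ev g h'" for h h'
  proof -
    have "k.ev g (h - h') = \<zero>\<^bsub>R\<^esub>" using that gR by (simp add: k.ev_diff)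
    then have "M.ev m h \<ominus>\<^bsub>S\<^esub> M.ev m h' = \<zero>\<^bsub>S\<^esub>" using kill[of "h - h'"] m(1) by (simp add: M.ev_diff)
    then show ?thesis using m(1) by simp
  qed
  have surj: "\<exists>h. k.ev g h = y" if y: "y \<in> F" for y
  proof (cases "y = \<zero>\<^bsub>R\<^esub>")
    case True
    then show ?thesis using gR by (intro exI[of _ 0]) simp
  next
    case False
    then have "y \<in> carrier (Multiplicative_Group.mult_of K)" using y by (simp add: K_def)
    then obtain i :: nat where "y = g [^]\<^bsub>K\<^esub> i" using g(2) by blast
    then have "y = g [^]\<^bsub>R\<^esub> i" by (simp only: pow)
    then show ?thesis using k.ev_monom[OF gR, of i] by (intro exI[of _ "Polynomial.monom 1 i"]) simp
  qed
  define h where "h y = M.ev m (SOME f. k.ev g f = y)" for y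
  have h: "h (k.ev g f) = M.ev m f" for f
    unfolding h_def by (rule same) (rule someI[of _ f], simp)
  have "h \<in> ring_hom (R\<lparr>carrier := F\<rparr>) S"
  proof (rule ring_hom_memI)
    fix y assume y: "y \<in> carrier (R\<lparr>carrier := F\<rparr>)"
    then obtain fy where fy: "k.ev g fy = y" using surj by auto
    show "h y \<in> carrier S" using h[of fy] fy m(1) by simp
    fix z assume z: "z \<in> carrier (R\<lparr>carrier := F\<rparr>)"
    then obtain fz where fz: "k.ev g fz = z" using surj by auto
    show "h (y \<otimes>\<^bsub>R\<lparr>carrier := F\<rparr>\<^esub> z) = h y \<otimes>\<^bsub>S\<^esub> h z"
      using h[of "fy * fz"] h[of fy] h[of fz] fy fz gR m(1) by (simp add: k.ev_mult M.ev_mult)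
    show "h (y \<oplus>\<^bsub>R\<lparr>carrier := F\<rparr>\<^esub> z) = h y \<oplus>\<^bsub>S\<^esub> h z"
      using h[of "fy + fz"] h[of fy] h[of fz] fy fz gR m(1) by (simp add: k.ev_add M.ev_add)
  next
    show "h \<one>\<^bsub>R\<lparr>carrier := F\<rparr>\<^esub> = \<one>\<^bsub>S\<^esub>" using h[of 1] gR m(1) by simp
  qed
  then show ?thesis by blast
qed

text \<open>Embeddings of an increasing sequence of finite subfields need not be compatible, but
  since each subfield has finitely many of them, a diagonal subsequence becomes constant on every
  one.\<close>

lemma embed_union:
  assumes N: "\<And>i. N i > 0" "\<And>i. N i dvd N (Suc i)" and union: "carrier R = (\<Union>i. k.fix_field (N i))"
  shows "\<exists>h. h \<in> ring_hom R S"
proof -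
  define F where "F i = k.fix_field (N i)" for i
  have F: "subfield (F i) R" "finite (F i)" for i
    using k.subfield_fix_field k.fix_field_card(1)[OF N(1)] by (auto simp: F_def)
  have "N i dvd N j" if "i \<le> j" for i j
    using that by (induction rule: dec_induct) (auto intro: dvd_trans N(2))
  then have mono: "F i \<subseteq> F j" if "i \<le> j" for i j using that k.fix_field_dvd by (auto simp: F_def)
  obtain h where h: "\<And>i. h i \<in> ring_hom (R\<lparr>carrier := F i\<rparr>) S" using embed_finite[OF F] by metis
  have one: "h i \<one>\<^bsub>R\<^esub> = \<one>\<^bsub>S\<^esub>" for i using ring_hom_one[OF h[of i]] by simp
  have add: "h i (x \<oplus>\<^bsub>R\<^esub> y) = h i x \<oplus>\<^bsub>S\<^esub> h i y" and mult: "h i (x \<otimes>\<^bsub>R\<^esub> y) = h i x \<otimes>\<^bsub>S\<^esub> h i y"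
    if "x \<in> F i" "y \<in> F i" for i x y
    using ring_hom_add[OF h[of i]] ring_hom_mult[OF h[of i]] that by auto
  have cl: "h i x \<in> carrier S" if "x \<in> F i" for i x using ring_hom_closed[OF h[of i]] that by simp
  have hpow: "h i (x [^]\<^bsub>R\<^esub> (n::nat)) = h i x [^]\<^bsub>S\<^esub> n \<and> x [^]\<^bsub>R\<^esub> n \<in> F i" if x: "x \<in> F i" for i x n
  proof (induction n)
    case 0
    show ?case using one subringE(3)[OF subfieldE(1)[OF F(1)[of i]]] by simp
  next
    case (Suc n)
    then show ?case using mult x subringE(6)[OF subfieldE(1)[OF F(1)[of i]]] by auto
  qed
  have fin: "h j x \<in> M.fix_field (N i)" if x: "x \<in> F i" "i \<le> j" for i j x
  proof -
    have xj: "x \<in> F j" using x mono by auto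
    have "x [^]\<^bsub>R\<^esub> (p ^ N i) = x" using x(1) by (simp add: F_def k.fix_field_def)
    then show ?thesis using hpow[OF xj, of "p ^ N i"] cl[OF xj] by (simp add: M.fix_field_def)
  qed
  interpret seqs: subseqs "\<lambda>n s. \<forall>x\<in>F n. \<forall>a b. n \<le> s a \<and> n \<le> s b \<longrightarrow> h (s a) x = h (s b) x"
  proof
    fix n :: nat and s :: "nat \<Rightarrow> nat" assume s: "strict_mono s"
    define T where "T = {j. n \<le> j}"
    define c where "c j = restrict (h (s j)) (F n)" for j
    \<comment> \<open>There are finitely many possible restrictions to \<open>F n\<close>, so one
      of them occurs infinitely often.\<close>
    have "c j \<in> (\<Pi>\<^sub>E x\<in>F n. M.fix_field (N n))" if "j \<in> T" for j
      using that seq_suble[OF s, of j] fin[of _ n "s j"] by (auto simp: T_def c_def)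
    then have "c ` T \<subseteq> (\<Pi>\<^sub>E x\<in>F n. M.fix_field (N n))" by blast
    moreover have "finite (\<Pi>\<^sub>E x\<in>F n. M.fix_field (N n))"
      by (rule finite_PiE[OF F(2)]) (rule M.fix_field_card(1)[OF N(1)])
    ultimately have "finite (c ` T)" by (rule finite_subset)
    moreover have "infinite T" unfolding T_def using infinite_Ici[of n] by (simp add: atLeast_def)
    ultimately obtain j0 where j0: "infinite {j\<in>T. c j = c j0}" using pigeonhole_infinite[of T c] by auto
    obtain r :: "nat \<Rightarrow> nat" where r: "strict_mono r" "\<And>n. r n \<in> {j\<in>T. c j = c j0}"
      using infinite_enumerate[OF j0] by blast
    have "h (s (r a)) x = h (s (r b)) x" if "x \<in> F n" for x a b
    proof -
      have "c (r a) = c (r b)" using r(2)[of a] r(2)[of b] by simp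
      from fun_cong[OF this, of x] show ?thesis using that by (simp add: c_def)
    qed
    then show "\<exists>r' :: nat \<Rightarrow> nat. strict_mono r' \<and> (\<forall>x\<in>F n. \<forall>a b. n \<le> (s \<circ> r') a \<and> n \<le> (s \<circ> r') b \<longrightarrow> h ((s \<circ> r') a) x = h ((s \<circ> r') b) x)"
      using r(1) by - (rule exI[of _ r], auto)
  qed
  define t where "t = seqs.diagseq"
  have t: "strict_mono t" unfolding t_def by (rule seqs.subseq_diagseq)
  have tge: "j \<le> t j" for j by (rule seq_suble[OF t])
  have stable: "h (t a) x = h (t b) x" if x: "x \<in> F n" and ab: "n < a" "n < b" for n x a b
  proof -
    have H: "\<forall>x\<in>F n. \<forall>a b. n \<le> (t \<circ> (+) (Suc n)) a \<and> n \<le> (t \<circ> (+) (Suc n)) b \<longrightarrow> h ((t \<circ> (+) (Suc n)) a) x = h ((t \<circ> (+) (Suc n)) b) x"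
      unfolding t_def by (rule seqs.diagseq_holds) simp
    have e: "(t \<circ> (+) (Suc n)) (a - Suc n) = t a" "(t \<circ> (+) (Suc n)) (b - Suc n) = t b" using ab by auto
    have "n \<le> t a \<and> n \<le> t b" using tge[of a] tge[of b] ab by simp
    then show ?thesis using H[rule_format, OF x, of "a - Suc n" "b - Suc n"] unfolding e by blast
  qed
  define lev where "lev x = (LEAST n. x \<in> F n)" for x
  have lev: "x \<in> F (lev x)" if "x \<in> carrier R" for x
  proof -
    have "\<exists>n. x \<in> F n" using that unfolding union F_def by blast
    then show ?thesis unfolding lev_def by (rule LeastI_ex)
  qed
  define \<psi> where "\<psi> x = h (t (Suc (lev x))) x" for x
  have \<psi>: "\<psi> x = h (t a) x" if x: "x \<in> F n" and a: "n < a" for x n a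
  proof -
    have "lev x \<le> n" unfolding lev_def using x by (rule Least_le)
    moreover have "x \<in> carrier R" using x union by (auto simp: F_def)
    ultimately show ?thesis unfolding \<psi>_def using stable[OF lev, of x "Suc (lev x)" a] a by auto
  qed
  have ex: "\<exists>n. x \<in> F n \<and> y \<in> F n" if "x \<in> carrier R" "y \<in> carrier R" for x y
  proof -
    have "x \<in> F (max (lev x) (lev y))" "y \<in> F (max (lev x) (lev y))"
      using lev that mono[of "lev x" "max (lev x) (lev y)"] mono[of "lev y" "max (lev x) (lev y)"] by auto
    then show ?thesis by blast
  qed
  have "\<psi> \<in> ring_hom R S"
  proof (rule ring_hom_memI)
    fix x assume x: "x \<in> carrier R"
    have big: "y \<in> F (t (Suc n))" if "y \<in> F n" for y n
      using that mono[of n "t (Suc n)"] tge[of "Suc n"] by auto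
    show "\<psi> x \<in> carrier S" unfolding \<psi>_def by (rule cl[OF big[OF lev[OF x]]])
    fix y assume y: "y \<in> carrier R"
    obtain n where n: "x \<in> F n" "y \<in> F n" using ex[OF x y] by blast
    have sub: "x \<otimes>\<^bsub>R\<^esub> y \<in> F n" "x \<oplus>\<^bsub>R\<^esub> y \<in> F n"
      using n subringE(6,7)[OF subfieldE(1)[OF F(1)[of n]]] by auto
    show "\<psi> (x \<otimes>\<^bsub>R\<^esub> y) = \<psi> x \<otimes>\<^bsub>S\<^esub> \<psi> y"
      using \<psi>[OF n(1), of "Suc n"] \<psi>[OF n(2), of "Suc n"] \<psi>[OF sub(1), of "Suc n"] mult[OF big[OF n(1)] big[OF n(2)]] by simp
    show "\<psi> (x \<oplus>\<^bsub>R\<^esub> y) = \<psi> x \<oplus>\<^bsub>S\<^esub> \<psi> y"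
      using \<psi>[OF n(1), of "Suc n"] \<psi>[OF n(2), of "Suc n"] \<psi>[OF sub(2), of "Suc n"] add[OF big[OF n(1)] big[OF n(2)]] by simp
  next
    show "\<psi> \<one>\<^bsub>R\<^esub> = \<one>\<^bsub>S\<^esub>" by (simp add: \<psi>_def one)
  qed
  then show ?thesis by blast
qed

text \<open>The image of a subfield with \<open>p ^ d\<close> elements is the only subfield of
  \<open>S\<close> of this order. So the image of \<open>R\<close> consists of subfields with
  \<open>p ^ n\<close> elements for \<open>n\<close> prime to \<open>p\<close>. All such
  \<open>n\<close> occur, because for each prime power dividing \<open>n\<close> there is an
  element in \<open>R\<close> whose degree over the prime field is divisible by it.\<close>

theorem iso_union_of_finite_subfields:
  assumes degrees: "\<And>x. x \<in> carrier R \<Longrightarrow> \<exists>n\<in>I_set p. x \<in> k.fix_field n"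
    and unbounded: "\<And>l j. Factorial_Ring.prime l \<Longrightarrow> l \<noteq> p \<Longrightarrow>
      \<exists>i. \<exists>y\<in>k.fix_field (l ^ i). y \<notin> k.fix_field (l ^ j)"
  shows "R \<simeq> S\<lparr>carrier := \<Union>n\<in>I_set p. \<Union>{F. subfield F S \<and> card F = p ^ n}\<rparr>"
proof -
  have I1: "1 \<in> I_set p" by (simp add: I_set_def)
  have Im: "a * b \<in> I_set p" if "a \<in> I_set p" "b \<in> I_set p" for a b
    using that by (auto simp: I_set_def)
  \<comment> \<open>A sequence that is cofinal among the exponents with respect to
    divisibility.\<close>
  define N where "N i = \<Prod>{j \<in> I_set p. j \<le> i}" for i
  have NI: "N i \<in> I_set p" for i
  proof -
    have "finite J \<Longrightarrow> J \<subseteq> I_set p \<Longrightarrow> \<Prod>J \<in> I_set p" for J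
      by (induction J rule: finite_induct) (use I1 Im in auto)
    then show ?thesis unfolding N_def by auto
  qed
  have Npos: "N i > 0" for i using NI by (simp add: I_set_def)
  have Nd: "N i dvd N (Suc i)" for i unfolding N_def by (rule prod_dvd_prod_subset) auto
  have nd: "n dvd N n" if "n \<in> I_set p" for n unfolding N_def using that by (intro dvd_prodI[of _ n "\<lambda>x. x"]) auto
  have union: "carrier R = (\<Union>i. k.fix_field (N i))"
  proof (intro equalityI subsetI)
    fix x assume "x \<in> carrier R"
    then obtain n where "n \<in> I_set p" "x \<in> k.fix_field n" using degrees by blast
    then show "x \<in> (\<Union>i. k.fix_field (N i))" using k.fix_field_dvd[OF nd] by blast
  qed (auto simp: k.fix_field_def)
  obtain \<psi> where \<psi>: "\<psi> \<in> ring_hom R S" using embed_union[OF Npos Nd union] by blast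
  interpret hom: ring_hom_ring R S \<psi> by (rule ring_hom_ringI2[OF k.is_ring M.is_ring \<psi>])
  have inj: "inj_on \<psi> (carrier R)"
  proof (rule inj_onI)
    fix x y assume xy: "x \<in> carrier R" "y \<in> carrier R" "\<psi> x = \<psi> y"
    show "x = y"
    proof (rule ccontr)
      assume "x \<noteq> y"
      define z where "z = x \<ominus>\<^bsub>R\<^esub> y"
      have z: "z \<in> carrier R" "z \<noteq> \<zero>\<^bsub>R\<^esub>" using xy \<open>x \<noteq> y\<close> by (auto simp: z_def)
      have zu: "z \<in> Units R" using z k.field_Units by auto
      have "\<psi> z = \<zero>\<^bsub>S\<^esub>" using xy by (simp add: z_def a_minus_def M.r_neg)
      moreover have "\<psi> (z \<otimes>\<^bsub>R\<^esub> inv\<^bsub>R\<^esub> z) = \<psi> z \<otimes>\<^bsub>S\<^esub> \<psi> (inv\<^bsub>R\<^esub> z)"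
        by (rule hom.hom_mult) (use z zu in auto)
      ultimately show False using z zu by simp
    qed
  qed
  have fixpt: "\<psi> x \<in> M.fix_field n \<longleftrightarrow> x \<in> k.fix_field n" if x: "x \<in> carrier R" for x n
  proof -
    have "\<psi> (x [^]\<^bsub>R\<^esub> (p ^ n)) = \<psi> x [^]\<^bsub>S\<^esub> (p ^ n)" using x by (rule hom.hom_nat_pow)
    then show ?thesis using x inj_on_eq_iff[OF inj, of "x [^]\<^bsub>R\<^esub> (p ^ n)" x] by (simp add: M.fix_field_def k.fix_field_def)
  qed
  have image_field: "\<exists>d. d > 0 \<and> d dvd n \<and> card (\<psi> ` k.fix_field n) = p ^ d \<and> \<psi> ` k.fix_field n = M.fix_field d \<and> subfield (\<psi> ` k.fix_field n) S"
    if n: "n > 0" for n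
  proof -
    have sf: "subfield (\<psi> ` k.fix_field n) S" by (rule hom.img_is_subfield(2)[OF k.subfield_fix_field M.one_not_zero])
    have "finite (\<psi> ` k.fix_field n)" using k.fix_field_card(1)[OF n] by simp
    then obtain d where d: "d > 0" "card (\<psi> ` k.fix_field n) = p ^ d" "\<psi> ` k.fix_field n = M.fix_field d"
      using M.finite_subfield[OF sf] by blast
    have "M.fix_field d \<subseteq> M.fix_field n" unfolding d(3)[symmetric] using fixpt by (auto simp: k.fix_field_def)
    then have "d dvd n" using M.fix_field_subset_dvd[OF d(1) _ _ n] d(2,3) by simp
    then show ?thesis using d sf by blast
  qed
  have "\<psi> ` carrier R = (\<Union>n\<in>I_set p. \<Union>{F. subfield F S \<and> card F = p ^ n})"
  proof (intro equalityI subsetI)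
    fix y assume "y \<in> \<psi> ` carrier R"
    then obtain x where x: "x \<in> carrier R" "y = \<psi> x" by blast
    obtain n where n: "n \<in> I_set p" "x \<in> k.fix_field n" using degrees[OF x(1)] by blast
    then obtain d where d: "d > 0" "d dvd n" "card (\<psi> ` k.fix_field n) = p ^ d" "subfield (\<psi> ` k.fix_field n) S"
      using image_field[of n] by (auto simp: I_set_def)
    have "coprime d p" by (rule coprime_divisors[OF d(2) dvd_refl]) (use n(1) in \<open>simp add: I_set_def\<close>)
    then have "d \<in> I_set p" using d(1) by (simp add: I_set_def)
    then show "y \<in> (\<Union>n\<in>I_set p. \<Union>{F. subfield F S \<and> card F = p ^ n})" using d n(2) x(2) by blast
  next
    fix y assume "y \<in> (\<Union>n\<in>I_set p. \<Union>{F. subfield F S \<and> card F = p ^ n})"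
    then obtain n F where nF: "n \<in> I_set p" "subfield F S" "card F = p ^ n" "y \<in> F" by blast
    have n: "n > 0" "coprime n p" using nF(1) by (auto simp: I_set_def)
    have "finite F" using nF(3) M.p_power_pos[of n] card_gt_0_iff by metis
    then obtain e where e: "card F = p ^ e" "F = M.fix_field e" using M.finite_subfield[OF nF(2)] by blast
    have "e = n" using e(1) nF(3) prime_gt_1_nat[OF k.prime_p] by (metis power_inject_exp)
    have lp: "Factorial_Ring.prime l \<and> l \<noteq> p \<and> l dvd n" if "l \<in> prime_factors n" for l
    proof -
      have "Factorial_Ring.prime l" "l dvd n" using that by (auto simp: prime_factors_dvd)
      moreover from this have "l \<noteq> p" using n(2) by (metis coprime_common_divisor dvd_refl not_prime_unit)
      ultimately show ?thesis by blast
    qed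
    have "\<exists>i y. y \<in> k.fix_field (l ^ i) \<and> y \<notin> k.fix_field (l ^ (multiplicity l n - 1))" if "l \<in> prime_factors n" for l
      using unbounded[of l "multiplicity l n - 1"] lp[OF that] by blast
    then obtain i z where iz: "\<And>l. l \<in> prime_factors n \<Longrightarrow> z l \<in> k.fix_field (l ^ i l)"
      "\<And>l. l \<in> prime_factors n \<Longrightarrow> z l \<notin> k.fix_field (l ^ (multiplicity l n - 1))" by metis
    define m where "m = n * (\<Prod>l\<in>prime_factors n. l ^ i l)"
    have "coprime (\<Prod>l\<in>prime_factors n. l ^ i l) p"
      using lp k.prime_p by (intro prod_coprime_left) (auto intro!: primes_coprime)
    then have m: "m \<in> I_set p" using n lp by (auto simp: m_def I_set_def intro!: prod_pos simp: prime_gt_0_nat)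
    obtain d where d: "d > 0" "d dvd m" "\<psi> ` k.fix_field m = M.fix_field d"
      using image_field[of m] m by (auto simp: I_set_def)
    have "n dvd d"
    proof (rule multiplicity_le_imp_dvd)
      fix l :: nat assume l: "Factorial_Ring.prime l"
      show "multiplicity l n \<le> multiplicity l d"
      proof (cases "l dvd n")
        case True
        then have lf: "l \<in> prime_factors n" using l n(1) by (simp add: prime_factors_dvd)
        have zc: "z l \<in> carrier R" using iz(1)[OF lf] by (simp add: k.fix_field_def)
        have "l ^ i l dvd (\<Prod>l\<in>prime_factors n. l ^ i l)" using lf by (intro dvd_prodI[of _ l "\<lambda>l. l ^ i l"]) auto
        then have "l ^ i l dvd m" by (simp add: m_def)
        then have "z l \<in> k.fix_field m" using iz(1)[OF lf] k.fix_field_dvd by blast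
        then have "\<psi> (z l) \<in> M.fix_field d" using d(3) by blast
        moreover have "\<psi> (z l) \<in> M.fix_field (l ^ i l)" using fixpt[OF zc] iz(1)[OF lf] by simp
        ultimately have g: "\<psi> (z l) \<in> M.fix_field (gcd d (l ^ i l))" by (rule M.fix_field_gcd)
        obtain c where c: "gcd d (l ^ i l) = l ^ c" using divides_primepow_nat[OF l, of "gcd d (l ^ i l)" "i l"] by auto
        have "c \<ge> multiplicity l n"
        proof (rule ccontr)
          assume "\<not> c \<ge> multiplicity l n"
          then have "l ^ c dvd l ^ (multiplicity l n - 1)" by (intro le_imp_power_dvd) simp
          then have "\<psi> (z l) \<in> M.fix_field (l ^ (multiplicity l n - 1))" using g c M.fix_field_dvd by auto
          then show False using fixpt[OF zc] iz(2)[OF lf] by simp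
        qed
        moreover have "l ^ c dvd d" using c by (metis gcd_dvd1)
        then have "c \<le> multiplicity l d" using nat_power_dvd_iff[OF l d(1)] by simp
        ultimately show ?thesis by simp
      qed (simp add: not_dvd_imp_multiplicity_0)
    qed (use n in simp)
    then have "y \<in> M.fix_field d" using M.fix_field_dvd nF(4) e(2) \<open>e = n\<close> by blast
    then have "y \<in> \<psi> ` k.fix_field m" using d(3) by simp
    then show "y \<in> \<psi> ` carrier R" by (auto simp: k.fix_field_def)
  qed
  then have "\<psi> \<in> ring_iso R (S\<lparr>carrier := \<Union>n\<in>I_set p. \<Union>{F. subfield F S \<and> card F = p ^ n}\<rparr>)"
    using inj \<psi> by (auto simp: ring_iso_def ring_hom_def bij_betw_def)
  then show ?thesis by (auto simp: is_ring_iso_def)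
qed

end

section \<open>Residue classes of high degree\<close>

text \<open>The residue \<open>c = p ^ (l ^ j)\<close> is larger than 1 and therefore not torsion
  at all levels, so it moves some element of a sufficiently high layer. Otherwise it would fix the
  traces \<open>e i\<close> of all roots of unity under the torsion, and the orthogonality of the
  characters would make it an inverse of a torsion residue.\<close>

lemma layer_moved:
  assumes p: "Factorial_Ring.prime p" and l: "Factorial_Ring.prime l" and pl: "p \<noteq> l"
  obtains K x where "j < K" "x \<in> layer l K" "gal (l ^ K) (p ^ (l ^ j)) x \<noteq> x"
proof -
  define c where "c = p ^ (l ^ j)"
  define r where "r = (if l = 2 then 2 else l - 1)"
  \<comment> \<open>At this level \<open>c ^ r\<close> is less than the modulus, so that it is not
    congruent to 1.\<close>
  define K where "K = max (Suc j) (c ^ r)"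
  define N where "N = l ^ K"
  have l1: "l > 1" and p1: "p > 1" using prime_gt_1_nat[OF l] prime_gt_1_nat[OF p] by blast+
  have N0: "N > 0" using l1 by (simp add: N_def)
  have "K < l ^ K" using l1 power_gt_expt[of l K] by simp
  then have cN: "c ^ r < N" by (simp add: N_def K_def)
  have c1: "c > 1" unfolding c_def using l1 by (intro one_less_power[OF p1]) simp
  have r0: "r > 0" using l1 by (simp add: r_def)
  have "c ^ r > 1" by (rule one_less_power[OF c1 r0])
  then have N1: "N > 1" using cN by simp
  have cop: "coprime c N" unfolding c_def N_def using primes_coprime[OF p l pl] by simp
  define T where "T = {A. A < N \<and> torsion l K A}"
  have T: "finite T" "1 \<in> T" using N1 by (auto simp: T_def)
  define e where "e i = (\<Sum>A\<in>T. (zeta N ^ i) ^ A)" for i :: nat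
  have zi: "zeta N ^ i \<in> mu N" for i by (rule mu_power[OF zeta_in_mu[OF N0]])
  have zq: "(zeta N ^ i) ^ A \<in> qspan (mu N)" for i A by (rule QV.span_base[OF mu_power[OF zi]])
  have eq: "e i \<in> qspan (mu N)" for i unfolding e_def by (rule QV.span_sum[OF zq])
  have gale: "gal N B (e i) = (\<Sum>A\<in>T. (zeta N ^ i) ^ (A * B))" if "coprime B N" for B i
    unfolding e_def using gal_sum[OF N0 that zq] gal_root[OF N0 that mu_power[OF zi]] by (simp add: power_mult)
  have grp: "residue_group N T"
    unfolding residue_group_def
  proof (intro conjI ballI)
    show "T \<subseteq> {..<N}" by (auto simp: T_def)
    show "1 mod N \<in> T" using T(2) N1 by simp
    show "coprime A N" if "A \<in> T" for A using torsion_coprime[OF l] that by (simp add: T_def N_def)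
    show "A * B mod N \<in> T" if "A \<in> T" "B \<in> T" for A B
      using torsion_cong[OF _ torsion_mult[of l K A B], of "A * B mod N"] that N0
      by (simp add: T_def N_def cong_def)
  qed
  have layer: "e i \<in> layer l K" for i
    unfolding layer_iff[OF l eq[unfolded N_def]]
  proof (intro allI impI)
    fix B assume B: "torsion l K B"
    have "B mod N \<in> T" using torsion_cong[OF _ B, of "B mod N"] N0 by (simp add: T_def N_def cong_def)
    moreover have "e i = (\<Sum>A\<in>T. gal N A (zeta N ^ i))"
      unfolding e_def using grp by (intro sum.cong refl gal_root[OF N0 _ zi, symmetric]) (auto simp: residue_group_def)
    ultimately show "gal (l ^ K) B (e i) = e i"
      using gal_trace[OF N0 grp _ QV.span_base[OF zi], of B i] by (simp add: N_def)
  qed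
  have inner: "(\<Sum>i<N. (zeta N ^ i) ^ m) = of_nat (if N dvd m then N else 0)" for m
  proof (cases "N dvd m")
    case True
    then have "[i * m = 0] (mod N)" for i by (simp add: cong_0_iff)
    then have "(zeta N ^ i) ^ m = 1" for i
      using zeta_power_eq_iff[OF N0, of "i * m" 0] by (simp add: power_mult)
    then show ?thesis using True by simp
  next
    case False
    then have ne: "zeta N ^ m \<noteq> 1" using zeta_power_eq_iff[OF N0, of m 0] by (simp add: cong_0_iff)
    have "(\<Sum>i<N. (zeta N ^ m) ^ i) = 0"
      by (rule sum_powers_root_of_unity[OF _ ne]) (use zi[of m] in \<open>simp add: mu_def\<close>)
    moreover have "(zeta N ^ i) ^ m = (zeta N ^ m) ^ i" for i by (simp add: mult.commute flip: power_mult)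
    ultimately show ?thesis using False by simp
  qed
  have "\<exists>i. gal N c (e i) \<noteq> e i"
  proof (rule ccontr)
    assume "\<not> ?thesis"
    then have fixed: "(\<Sum>A\<in>T. (zeta N ^ i) ^ (A * c)) = e i" for i using gale[OF cop] by simp
    define cnt where "cnt d = (\<Sum>A\<in>T. if N dvd N - 1 + A * d then N else 0)" for d
    have orth: "(\<Sum>i<N. (zeta N ^ i) ^ (N - 1) * (\<Sum>A\<in>T. (zeta N ^ i) ^ (A * d))) = of_nat (cnt d)" for d
    proof -
      have "(\<Sum>i<N. (zeta N ^ i) ^ (N - 1) * (\<Sum>A\<in>T. (zeta N ^ i) ^ (A * d)))
          = (\<Sum>i<N. \<Sum>A\<in>T. (zeta N ^ i) ^ (N - 1 + A * d))"
        by (simp only: sum_distrib_left power_add)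
      also have "\<dots> = (\<Sum>A\<in>T. \<Sum>i<N. (zeta N ^ i) ^ (N - 1 + A * d))" by (rule sum.swap)
      also have "\<dots> = of_nat (cnt d)" by (simp only: inner cnt_def of_nat_sum)
      finally show ?thesis .
    qed
    have "complex_of_nat (cnt c) = of_nat (cnt 1)"
      unfolding orth[symmetric] fixed by (simp add: e_def)
    then have "cnt c = cnt 1" by (simp only: of_nat_eq_iff)
    moreover have "N \<le> cnt 1" unfolding cnt_def
      using member_le_sum[OF T(2), of "\<lambda>A. if N dvd N - 1 + A * 1 then N else 0"] T(1) N0 by simp
    ultimately have "cnt c \<noteq> 0" using N0 by simp
    have "\<exists>A\<in>T. N dvd N - 1 + A * c"
    proof (rule ccontr)
      assume "\<not> ?thesis"
      then have "cnt c = 0" unfolding cnt_def by (intro sum.neutral) simp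
      then show False using \<open>cnt c \<noteq> 0\<close> by contradiction
    qed
    then obtain A where A: "A \<in> T" "N dvd N - 1 + A * c" by blast
    have "[N - 1 + A * c + 1 = 0 + 1] (mod N)"
      by (rule cong_add) (use A(2) in \<open>auto simp: cong_0_iff\<close>)
    moreover have "N - 1 + A * c + 1 = N + A * c" using N0 by simp
    ultimately have Ac: "[A * c = 1] (mod N)" by (simp add: cong_def)
    have Ar: "[A ^ r = 1] (mod N)"
    proof (cases "l = 2")
      case True
      then have "[A = 1] (mod N) \<or> [A + 1 = 0] (mod N)" using A(1) by (auto simp: T_def torsion_def N_def)
      then show ?thesis
      proof
        assume "[A = 1] (mod N)"
        from cong_pow[OF this, of r] show ?thesis by simp
      next
        assume "[A + 1 = 0] (mod N)"
        then have "N dvd A + 1" by (simp add: cong_0_iff)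
        then have "int N dvd int A + 1" by (metis int_dvd_int_iff of_nat_1 of_nat_add)
        then have "int N dvd (int A + 1) * (int A - 1)" by simp
        also have "(int A + 1) * (int A - 1) = int A ^ 2 - 1" by (simp add: power2_eq_square algebra_simps)
        finally have "[int (A ^ 2) = int 1] (mod int N)" by (simp add: cong_iff_dvd_diff)
        then show ?thesis unfolding r_def if_P[OF True] cong_int_iff .
      qed
    qed (use A(1) in \<open>simp add: T_def torsion_def N_def r_def\<close>)
    have "[c ^ r = c ^ r * A ^ r] (mod N)" using cong_mult[OF cong_refl[of "c ^ r"] Ar] by (simp add: cong_sym)
    also have "c ^ r * A ^ r = (A * c) ^ r" by (simp add: power_mult_distrib mult.commute)
    also have "[(A * c) ^ r = 1] (mod N)" using cong_pow[OF Ac, of r] by simp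
    finally have "c ^ r = 1" using cN N1 by (simp add: cong_def)
    then show False using \<open>c ^ r > 1\<close> by linarith
  qed
  then obtain i where i: "gal N c (e i) \<noteq> e i" by blast
  show thesis by (rule that[of K "e i"]) (use i layer in \<open>auto simp: K_def N_def c_def\<close>)
qed

text \<open>If \<open>y\<close> were fixed by a power of the Frobenius map in the residue field,
  then all of its conjugates under this power would be congruent to \<open>y\<close>. Their sum
  would be congruent to \<open>r * y\<close>, which is a unit.\<close>

lemma (in unramified_level) trace_zero_not_fixed:
  assumes y: "y \<in> qspan (mu n)" "v y = 0" and r: "\<not> p dvd r"
    and trace: "(\<Sum>t<r. gal n ((p ^ i) ^ t) y) = 0"
  shows "\<not> v (y ^ (p ^ i) - y) > 0"
proof
  assume pos: "v (y ^ (p ^ i) - y) > 0"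
  define c where "c = p ^ i"
  have cop: "coprime (c ^ t) n" for t using coprime_level by (simp add: c_def coprime_commute)
  have cop1: "coprime c n" using cop[of 1] by simp
  note g = gal_closed[OF n cop]
  have yp: "y ^ k \<in> qspan (mu n)" for k using closed(9) y(1) by blast
  have "v ((gal n c y - y ^ c) + (y ^ c - y)) > 0"
    using frobenius_residue[OF cop1 _ y(1), of i] pos y(2)
    by (intro v_pos_add closed(7) yp gal_closed[OF n cop1] y) (auto simp: c_def)
  then have step: "v (gal n c y - y) > 0" by simp
  have all: "v (gal n (c ^ t) y - y) > 0" for t
  proof (induction t)
    case 0
    then show ?case using gal_1[OF n y(1)] by (simp add: v_zero)
  next
    case (Suc t)
    have "gal n (c ^ t) (gal n c y - y) = gal n (c ^ Suc t) y - gal n (c ^ t) y"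
      using gal_diff[OF n cop, of "gal n c y" y] gal_compose[OF n cop cop1 y(1)] gal_closed[OF n cop1 y(1)] y(1)
      by (simp add: mult.commute)
    moreover have "[c ^ t = p ^ (i * t)] (mod n)" by (simp add: c_def power_mult)
    then have "v (gal n (c ^ t) (gal n c y - y)) = v (gal n c y - y)"
      by (intro gal_frobenius_invariant[OF cop] closed(7) gal_closed[OF n cop1] y(1))
    ultimately have "v (gal n (c ^ Suc t) y - gal n (c ^ t) y) > 0" using step by simp
    then have "v ((gal n (c ^ Suc t) y - gal n (c ^ t) y) + (gal n (c ^ t) y - y)) > 0"
      using Suc.IH by (intro v_pos_add closed(7) g y(1))
    then show ?case by simp
  qed
  have "v (\<Sum>t<r. gal n (c ^ t) y - y) > 0"
  proof (induction r)
    case (Suc r)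
    have "v ((\<Sum>t<r. gal n (c ^ t) y - y) + (gal n (c ^ r) y - y)) > 0"
      using Suc all by (intro v_pos_add is_subfield_sum[OF subfield] closed(7) g y(1)) auto
    then show ?case by simp
  qed (simp add: v_zero)
  moreover have "(\<Sum>t<r. gal n (c ^ t) y - y) = - (of_nat r * y)"
    using trace by (simp add: sum_subtractf c_def)
  moreover have "v (- (of_nat r * y)) = 0"
    using v_minus[of "of_nat r * y"] v_mult[of "of_nat r" y] v_of_nat_coprime[OF r] closed(3,10) y by simp
  ultimately show False by simp
qed

text \<open>An element \<open>x\<close> that is moved by \<open>p ^ (l ^ j)\<close> differs from
  the average of its conjugates under this power. The difference has trace zero and can be
  multiplied by a power of \<open>p\<close> so as to become a unit. Its residue class has degree
  dividing \<open>l ^ K\<close>, since \<open>p ^ (l ^ K)\<close> is torsion.\<close>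

lemma residue_degree_unbounded:
  assumes p: "Factorial_Ring.prime p" and l: "Factorial_Ring.prime l" and pl: "p \<noteq> l" and u: "u \<in> Val p Q_cyc"
  obtains K y where "y \<in> layer l K" "u y = 0" "u (y ^ (p ^ (l ^ K)) - y) > 0" "\<not> u (y ^ (p ^ (l ^ j)) - y) > 0"
proof -
  obtain K x where K: "j < K" and x: "x \<in> layer l K" and move: "gal (l ^ K) (p ^ (l ^ j)) x \<noteq> x"
    using layer_moved[OF p l pl] .
  define N where "N = l ^ K"
  define c where "c = p ^ (l ^ j)"
  define r where "r = l ^ (K - j)"
  have N0: "N > 0" using l by (simp add: N_def prime_gt_0_nat)
  have copN: "coprime N p" unfolding N_def using primes_coprime[OF l p] pl by simp
  interpret L: unramified_level p N "restrict u (qspan (mu N))"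
    by (rule unramified_restrict[OF p u N0 copN])
  have Q: "z \<in> qspan (mu N)" if "z \<in> layer l K" for z using that by (simp add: layer_def N_def)
  have cop: "coprime (c ^ t) N" for t using copN by (simp add: c_def coprime_commute)
  have cop1: "coprime c N" using cop[of 1] by simp
  have tors: "torsion l K (p ^ (l ^ K))" by (rule torsion_prime_power[OF p l pl])
  have fixl: "gal N (p ^ (l ^ K)) z = z" if "z \<in> layer l K" for z
    using layer_iff[OF l, of z K] that tors Q[OF that] by (simp add: N_def)
  have cr: "c ^ r = p ^ (l ^ K)" using K by (simp add: c_def r_def flip: power_mult power_add)
  have gx: "gal N (c ^ t) x \<in> qspan (mu N)" for t by (rule gal_closed[OF N0 cop Q[OF x]])
  have glayer: "gal N (c ^ t) z \<in> layer l K" if "z \<in> layer l K" for t z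
    using gal_Q_cyc_Delta[OF N0 cop Q[OF that]] gal_closed[OF N0 cop Q[OF that]] that by (simp add: layer_def N_def)
  define tr where "tr = (\<Sum>t<r. gal N (c ^ t) x)"
  note LF = is_subfieldD[OF is_subfield_layer[OF l]]
  have trl: "tr \<in> layer l K" unfolding tr_def by (intro is_subfield_sum[OF is_subfield_layer[OF l]] glayer x)
  have shift: "gal N c tr = tr"
  proof -
    have "gal N c tr = (\<Sum>t<r. gal N (c ^ Suc t) x)"
      unfolding tr_def using gal_sum[OF N0 cop1 gx] gal_compose[OF N0 cop1 cop Q[OF x]] by simp
    moreover have "(\<Sum>t<r. gal N (c ^ Suc t) x - gal N (c ^ t) x) = gal N (c ^ r) x - gal N (c ^ 0) x"
      by (rule sum_lessThan_telescope)
    then have "(\<Sum>t<r. gal N (c ^ Suc t) x - gal N (c ^ t) x) = 0"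
      using fixl[OF x] gal_1[OF N0 Q[OF x]] by (simp add: cr)
    ultimately show ?thesis by (simp add: sum_subtractf tr_def)
  qed
  have shift_t: "gal N (c ^ t) tr = tr" for t
  proof (induction t)
    case (Suc t)
    then show ?case using gal_compose[OF N0 cop1 cop Q[OF trl], of t] shift by simp
  qed (use gal_1[OF N0 Q[OF trl]] in simp)
  define y0 where "y0 = of_nat r * x - tr"
  have y0l: "y0 \<in> layer l K" unfolding y0_def by (intro LF(3,7,10) trl x)
  have galr: "gal N A (of_nat r * x) = of_nat r * gal N A x" if "coprime A N" for A
    using gal_rat_scale[OF N0 that Q[OF x], of "of_nat r"] by simp
  have rx: "of_nat r * x \<in> qspan (mu N)" by (intro L.closed(3,10) Q x)
  have "y0 \<noteq> 0"
  proof
    assume "y0 = 0"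
    then have "of_nat r * gal N c x = of_nat r * x" using galr[OF cop1] shift by (auto simp: y0_def)
    moreover have "r > 0" using l by (simp add: r_def prime_gt_0_nat)
    ultimately show False using move by (simp add: N_def c_def)
  qed
  have tr0: "(\<Sum>t<r. gal N (c ^ t) y0) = 0"
  proof -
    have "gal N (c ^ t) y0 = of_nat r * gal N (c ^ t) x - tr" for t
      unfolding y0_def using gal_diff[OF N0 cop rx Q[OF trl]] galr[OF cop] shift_t by simp
    then have "(\<Sum>t<r. gal N (c ^ t) y0) = of_nat r * tr - of_nat r * tr"
      by (simp add: sum_subtractf tr_def sum_distrib_left)
    then show ?thesis by simp
  qed
  obtain k :: int where k: "restrict u (qspan (mu N)) y0 = ereal (of_int k)"
    using L.integral_value[OF Q[OF y0l] \<open>y0 \<noteq> 0\<close>] .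
  define q :: rat where "q = of_nat p powi (- k)"
  have q: "of_rat q = (of_nat p powi (- k) :: complex)"
    by (simp add: q_def power_int_def of_rat_power of_rat_inverse)
  define y where "y = of_rat q * y0"
  have yl: "y \<in> layer l K" unfolding y_def by (intro LF(3,12) y0l)
  have "restrict u (qspan (mu N)) y = ereal (of_int (- k)) + ereal (of_int k)"
    unfolding y_def q using L.v_mult[OF L.prime_powi_closed Q[OF y0l]] L.v_prime_powi k by simp
  then have vy: "restrict u (qspan (mu N)) y = 0" by simp
  have "(\<Sum>t<r. gal N (c ^ t) y) = of_rat q * (\<Sum>t<r. gal N (c ^ t) y0)"
    unfolding y_def using gal_rat_scale[OF N0 cop Q[OF y0l]] by (simp add: sum_distrib_left)
  then have tr0': "(\<Sum>t<r. gal N ((p ^ (l ^ j)) ^ t) y) = 0" using tr0 by (simp add: c_def)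
  have "\<not> p dvd r"
    using pl p l by (metis prime_dvd_power primes_dvd_imp_eq r_def)
  from L.trace_zero_not_fixed[OF Q[OF yl] vy this tr0']
  have "\<not> restrict u (qspan (mu N)) (y ^ (p ^ (l ^ j)) - y) > 0" .
  moreover have "restrict u (qspan (mu N)) (gal N (p ^ (l ^ K)) y - y ^ (p ^ (l ^ K))) > 0"
    using cop[of r] vy by (intro L.frobenius_residue Q yl) (auto simp: cr)
  then have "restrict u (qspan (mu N)) (y - y ^ (p ^ (l ^ K))) > 0" using fixl[OF yl] by simp
  moreover have ypow: "y ^ m - y \<in> qspan (mu N)" for m using Q[OF yl] L.closed(7,9) by blast
  moreover have "restrict u (qspan (mu N)) (- (y ^ (p ^ (l ^ K)) - y)) = restrict u (qspan (mu N)) (y ^ (p ^ (l ^ K)) - y)"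
    by (rule L.v_minus[OF ypow])
  ultimately show thesis using that[OF yl] vy Q[OF yl] by simp
qed


section \<open>Valuation rings and their residue fields\<close>

lemma hom_multiple_of_one:
  assumes "ring R" "ring S" "h \<in> ring_hom R S"
  shows "h (add_pow R (n :: nat) \<one>\<^bsub>R\<^esub>) = add_pow S n \<one>\<^bsub>S\<^esub>"
proof -
  interpret R: ring R by (rule assms(1))
  interpret S: ring S by (rule assms(2))
  interpret h: ring_hom_ring R S h by (rule ring_hom_ringI2[OF assms])
  show ?thesis by (induction n) (simp_all add: R.add.nat_pow_Suc S.add.nat_pow_Suc)
qed

context padic_val
begin

lemma cring_valuation_ring: "cring (valuation_ring E v)"
proof -
  interpret C: cring Cring by (rule cring_Cring)
  have "subring {x \<in> E. v x \<ge> 0} Cring"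
    by (rule C.subringI) (use closed v_minus v_mult_nonneg v_nonneg_add in auto)
  then show ?thesis
    using C.subcring_iff[of "{x \<in> E. v x \<ge> 0}"] C.subcringI' by (simp add: valuation_ring_def)
qed

lemma valuation_ring_simps [simp]:
  "carrier (valuation_ring E v) = {x \<in> E. v x \<ge> 0}" "x \<otimes>\<^bsub>valuation_ring E v\<^esub> y = x * y"
  "\<one>\<^bsub>valuation_ring E v\<^esub> = 1" "\<zero>\<^bsub>valuation_ring E v\<^esub> = 0" "x \<oplus>\<^bsub>valuation_ring E v\<^esub> y = x + y"
  by (auto simp: valuation_ring_def)

lemma valuation_ring_uminus:
  assumes "x \<in> E" "v x \<ge> 0"
  shows "\<ominus>\<^bsub>valuation_ring E v\<^esub> x = - x"
proof -
  interpret cring "valuation_ring E v" by (rule cring_valuation_ring)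
  show ?thesis by (rule minus_equality) (use assms closed v_minus in auto)
qed

lemma valuation_ring_power: "x [^]\<^bsub>valuation_ring E v\<^esub> (n :: nat) = x ^ n"
  by (induction n) (simp_all add: nat_pow_def mult.commute)

text \<open>An element of value 0 is a unit of the valuation ring.\<close>

lemma maximalideal_positive: "maximalideal {x \<in> E. v x > 0} (valuation_ring E v)"
proof -
  interpret V: cring "valuation_ring E v" by (rule cring_valuation_ring)
  show ?thesis
  proof (rule maximalidealI)
    show "ideal {x \<in> E. v x > 0} (valuation_ring E v)"
    proof (rule idealI[OF V.ring_axioms])
      show "subgroup {x \<in> E. v x > 0} (add_monoid (valuation_ring E v))"
      proof (rule V.add.subgroupI)
        show "{x \<in> E. v x > 0} \<noteq> {}" using closed(6) v_zero by auto
        fix a assume a: "a \<in> {x \<in> E. v x > 0}"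
        then show "\<ominus>\<^bsub>valuation_ring E v\<^esub> a \<in> {x \<in> E. v x > 0}"
          using valuation_ring_uminus[of a] closed(4) v_minus by auto
      qed (use v_pos_add closed(2) in auto)
    qed (use v_mult_pos closed(3) in \<open>auto simp: mult.commute\<close>)
    have "1 \<in> carrier (valuation_ring E v) - {x \<in> E. v x > 0}" using closed(1) by simp
    then show "carrier (valuation_ring E v) \<noteq> {x \<in> E. v x > 0}" by blast
    fix J assume J: "ideal J (valuation_ring E v)" "{x \<in> E. v x > 0} \<subseteq> J" "J \<subseteq> carrier (valuation_ring E v)"
    show "J = {x \<in> E. v x > 0} \<or> J = carrier (valuation_ring E v)"
    proof (rule disjCI)
      assume "J \<noteq> carrier (valuation_ring E v)"
      then have one: "1 \<notin> J" using ideal.one_imp_carrier[OF J(1)] by auto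
      have "v a > 0" if a: "a \<in> J" for a
      proof (rule ccontr)
        assume "\<not> v a > 0"
        then have va: "a \<in> E" "v a = 0" using a J(3) by auto
        have a0: "a \<noteq> 0" using va v_zero by auto
        have "inverse a \<in> carrier (valuation_ring E v)" using v_inverse[OF va(1) a0] va closed(5) by simp
        from ideal.I_r_closed[OF J(1) a this] show False using one a0 by simp
      qed
      then show "J = {x \<in> E. v x > 0}" using J(2,3) by auto
    qed
  qed
qed

lemma field_residue_field: "field (residue_field E v)"
  unfolding residue_field_def by (rule maximalideal.quotient_is_field[OF maximalideal_positive cring_valuation_ring])

definition residue :: "complex \<Rightarrow> complex set" where
  "residue x = {x \<in> E. v x > 0} +>\<^bsub>valuation_ring E v\<^esub> x"

lemma carrier_residue_field: "carrier (residue_field E v) = residue ` {x \<in> E. v x \<ge> 0}"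
  by (auto simp: residue_field_def residue_def FactRing_def A_RCOSETS_def')

lemma residue_hom: "residue \<in> ring_hom (valuation_ring E v) (residue_field E v)"
  unfolding residue_field_def residue_def[abs_def]
  by (rule ideal.rcos_ring_hom[OF maximalideal.axioms(1)[OF maximalideal_positive]])

lemma residue_eq_iff:
  assumes "x \<in> E" "v x \<ge> 0" "y \<in> E" "v y \<ge> 0"
  shows "residue x = residue y \<longleftrightarrow> v (x - y) > 0"
proof -
  interpret V: cring "valuation_ring E v" by (rule cring_valuation_ring)
  have "x \<ominus>\<^bsub>valuation_ring E v\<^esub> y = x - y"
    using assms valuation_ring_uminus[of y] by (simp add: a_minus_def)
  then show ?thesis
    using V.quotient_eq_iff_same_a_r_cos[OF maximalideal.axioms(1)[OF maximalideal_positive], of x y] assms closed(7)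
    by (auto simp: residue_def)
qed

lemma char_field_residue_field: "char_field (residue_field E v) p"
proof -
  interpret V: cring "valuation_ring E v" by (rule cring_valuation_ring)
  interpret F: field "residue_field E v" by (rule field_residue_field)
  have "add_pow (valuation_ring E v) n 1 = of_nat n" for n :: nat
    by (induction n) (use V.add.nat_pow_0 V.add.nat_pow_Suc in simp_all)
  then have "add_pow (residue_field E v) p \<one>\<^bsub>residue_field E v\<^esub> = residue (of_nat p)"
    using hom_multiple_of_one[OF V.ring_axioms F.ring_axioms residue_hom, of p] by simp
  also have "\<dots> = residue 0"
    using residue_eq_iff[of "of_nat p" 0] closed(6,10) v_of_nat_nonneg v_prime by simp
  also have "\<dots> = \<zero>\<^bsub>residue_field E v\<^esub>"
    using ring_hom_zero[OF residue_hom V.ring_axioms F.ring_axioms] by simp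
  finally show ?thesis
    using prime F.field_axioms by (simp add: char_field_def char_field_axioms_def add_pow_def int_pow_int)
qed

lemma residue_fix_field:
  assumes "x \<in> E" "v x \<ge> 0"
  shows "residue x \<in> char_field.fix_field (residue_field E v) p n \<longleftrightarrow> v (x ^ (p ^ n) - x) > 0"
proof -
  interpret F: char_field "residue_field E v" p by (rule char_field_residue_field)
  interpret h: ring_hom_ring "valuation_ring E v" "residue_field E v" residue
    using ring_hom_ringI2[OF cring.axioms(1)[OF cring_valuation_ring] F.ring_axioms residue_hom] .
  have "residue x [^]\<^bsub>residue_field E v\<^esub> (p ^ n) = residue (x ^ (p ^ n))"
    using h.hom_nat_pow[of x "p ^ n"] assms by (simp add: valuation_ring_power)
  moreover have "v (x ^ (p ^ n)) \<ge> 0" using assms v_power by simp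
  ultimately show ?thesis
    using residue_eq_iff[of "x ^ (p ^ n)" x] assms closed(9) carrier_residue_field by (auto simp: F.fix_field_def)
qed

end

section \<open>The algebraic closure of the prime field\<close>

lemma (in char_field) root_of_monic:
  assumes splits: "\<And>P. P \<in> carrier (poly_ring R) \<Longrightarrow> splitted P"
    and f: "Polynomial.lead_coeff f = 1" "Polynomial.degree f > 0"
  shows "\<exists>x\<in>carrier R. ev x f = \<zero>"
proof -
  define P where "P = map of_integer (rev (coeffs f))"
  note P = monic_list[OF f(1), folded P_def]
  have "size (roots P) > 0" using splits[OF P(1)] P(3) f(2) by (simp add: splitted_def)
  then obtain x where "x \<in># roots P" by (metis size_eq_0_iff_empty less_irrefl multiset_nonemptyE)
  then have "is_root P x" using roots_mem_iff_is_root[OF P(1)] by simp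
  then show ?thesis using eval_list[of x f] by (auto simp: is_root_def P_def)
qed

lemma closed_extension_Fp_bar:
  assumes "char_field R p"
  shows "closed_extension R (Fp_bar p) p"
proof -
  interpret R: char_field R p by (rule assms)
  have "residues_prime p" using R.prime_p by (simp add: residues_prime_def)
  then interpret F: field "residue_ring (int p)" by (rule residues_prime.is_field)
  interpret L: algebraic_closure "Fp_bar p" "F.indexed_const ` carrier (residue_ring (int p))"
    by (rule F.alg_closureE(1))
  have "1 < p" by (rule prime_gt_1_nat[OF R.prime_p])
  then have "add_pow (residue_ring (int p)) n \<one>\<^bsub>residue_ring (int p)\<^esub> = int n mod int p" for n :: nat
    by (induction n)
       (use F.add.nat_pow_0 F.add.nat_pow_Suc in
        \<open>simp_all add: residue_ring_def mod_add_right_eq add.commute\<close>)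
  then have "add_pow (Fp_bar p) p \<one>\<^bsub>Fp_bar p\<^esub> = F.indexed_const \<zero>\<^bsub>residue_ring (int p)\<^esub>"
    using hom_multiple_of_one[OF F.ring_axioms L.ring_axioms F.alg_closureE(2), of p] by (simp add: residue_ring_def)
  also have "\<dots> = \<zero>\<^bsub>Fp_bar p\<^esub>" by (rule ring_hom_zero[OF F.alg_closureE(2) F.ring_axioms L.ring_axioms])
  finally have "char_field (Fp_bar p) p"
    using R.prime_p L.field_axioms by (simp add: char_field_def char_field_axioms_def add_pow_def int_pow_int)
  then interpret L': char_field "Fp_bar p" p .
  show ?thesis
    by unfold_locales (rule L'.root_of_monic[OF L.roots_over_carrier])
qed

section \<open>The part prime to \<open>p\<close> is unramified\<close>

lemma Q_cyc_prime_to_Delta_eq: "Q_cyc_prime_to_Delta p = qspan (unity_roots (\<lambda>n. coprime n p)) \<inter> Q_cyc_Delta"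
proof -
  have "unity_roots (\<lambda>n. coprime n p) \<subseteq> unity_roots (\<lambda>n. True)" by (auto simp: unity_roots_def)
  then have "qspan (unity_roots (\<lambda>n. coprime n p)) \<subseteq> Q_cyc" unfolding Q_cyc_eq by (rule QV.span_mono)
  then show ?thesis
    by (auto simp: Q_cyc_prime_to_Delta_def Q_cyc_Delta_def fixed_subfield_def Q_cyc_prime_to_eq)
qed

lemma is_subfield_Q_cyc_prime_to_Delta: "is_subfield (Q_cyc_prime_to_Delta p)"
  unfolding Q_cyc_prime_to_Delta_eq
  by (intro is_subfield_Int is_subfield_qspan_unity_roots is_subfield_Q_cyc_Delta) auto

lemma Q_cyc_prime_to_Delta_level:
  assumes "x \<in> Q_cyc_prime_to_Delta p"
  obtains n where "n > 0" "coprime n p" "x \<in> qspan (mu n)"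
proof -
  have "x \<in> qspan (unity_roots (\<lambda>n. coprime n p))" using assms by (simp add: Q_cyc_prime_to_Delta_eq)
  then show thesis using that qspan_unity_roots_level[of "\<lambda>n. coprime n p" x] by auto
qed

lemma layer_subset_prime_to:
  assumes "Factorial_Ring.prime p" "Factorial_Ring.prime l" "p \<noteq> l"
  shows "layer l k \<subseteq> Q_cyc_prime_to_Delta p"
proof -
  have "coprime (l ^ k) p" using primes_coprime[OF assms(2,1)] assms(3) by simp
  then have "mu (l ^ k) \<subseteq> unity_roots (\<lambda>n. coprime n p)"
    using assms(2) by (auto simp: unity_roots_def mu_def prime_gt_0_nat intro!: exI[of _ "l ^ k"])
  then show ?thesis unfolding layer_def Q_cyc_prime_to_Delta_eq using QV.span_mono by blast
qed

text \<open>A power of \<open>p\<close> with exponent divisible by \<open>n\<close> is a torsion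
  residue modulo \<open>n\<close>. So the Frobenius automorphism of the level \<open>n\<close> has
  order dividing \<open>n\<close> on the field fixed by \<open>\<Delta>\<close>.\<close>

lemma residue_degree:
  assumes p: "Factorial_Ring.prime p" and u: "u \<in> Val p Q_cyc" and n: "n > 0" "coprime n p"
    and x: "x \<in> qspan (mu n)" "x \<in> Q_cyc_Delta" "u x \<ge> 0"
  shows "u (x ^ (p ^ n) - x) > 0"
proof -
  interpret L: unramified_level p n "restrict u (qspan (mu n))" by (rule unramified_restrict[OF p u n])
  have "torsion l (multiplicity l n) (p ^ n)" if l: "Factorial_Ring.prime l" "l dvd n" for l
  proof -
    have "p \<noteq> l" using l n p by (metis coprime_common_divisor dvd_refl not_prime_unit)
    moreover obtain d where "n = l ^ multiplicity l n * d" using multiplicity_dvd[of l n] by (auto elim: dvdE)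
    ultimately show ?thesis
      using torsion_power[OF torsion_prime_power[OF p l(1)], of "multiplicity l n" d] by (metis power_mult)
  qed
  then have "torsion_residue n (p ^ n)" by (simp add: torsion_residue_def)
  then have fixed: "gal n (p ^ n) x = x" using Q_cyc_Delta_iff[OF n(1) x(1)] x(2) by blast
  have "coprime (p ^ n) n" using n(2) by (simp add: coprime_commute)
  then have "restrict u (qspan (mu n)) (gal n (p ^ n) x - x ^ (p ^ n)) > 0"
    by (rule L.frobenius_residue) (use x in auto)
  moreover have d: "x ^ (p ^ n) - x \<in> qspan (mu n)" by (intro L.closed(7,9) x)
  ultimately show ?thesis using L.v_minus[OF d] L.closed(4)[OF d] fixed by simp
qed

text \<open>The levels that occur here are prime to \<open>p\<close>, where \<open>p\<close> is a
  uniformizer. A residue class at the level \<open>n\<close> is fixed by the power \<open>p ^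
  n\<close> of the Frobenius map, so its degree is prime to \<open>p\<close>; and the layers
  belonging to a prime \<open>l \<noteq> p\<close> contribute residue classes whose degrees are
  arbitrarily high powers of \<open>l\<close>.\<close>

theorem prime_to_part:
  assumes p: "Factorial_Ring.prime p" and v: "v \<in> Val p Q_cyc_Delta"
  defines "w \<equiv> restrict v (Q_cyc_prime_to_Delta p)"
  shows "unramified p (Q_cyc_prime_to_Delta p) w"
    and "residue_field (Q_cyc_prime_to_Delta p) w \<simeq> Fp_union p"
proof -
  define E where "E = Q_cyc_prime_to_Delta p"
  have E: "is_subfield E" unfolding E_def by (rule is_subfield_Q_cyc_prime_to_Delta)
  have ED: "E \<subseteq> Q_cyc_Delta" by (auto simp: E_def Q_cyc_prime_to_Delta_eq)
  obtain u where u: "u \<in> Val p Q_cyc" "restrict u Q_cyc_Delta = v"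
    using Val_extends_to_Q_cyc[OF p is_subfield_Q_cyc_Delta Q_cyc_Delta_subset v] .
  have wu: "w x = u x" if "x \<in> E" for x using that ED u(2) by (auto simp: w_def E_def)
  interpret D: padic_val p Q_cyc_Delta v
    by unfold_locales (use p v is_subfield_Q_cyc_Delta in auto)
  interpret W: padic_val p E w
    by unfold_locales (use p E D.restrict_Val[OF E ED] in \<open>auto simp: w_def E_def\<close>)
  have integral: "\<exists>j :: int. w x = ereal (of_int j)" if x: "x \<in> E" "x \<noteq> 0" for x
  proof -
    obtain n where n: "n > 0" "coprime n p" "x \<in> qspan (mu n)"
      using Q_cyc_prime_to_Delta_level x(1) unfolding E_def by blast
    interpret L: unramified_level p n "restrict u (qspan (mu n))" by (rule unramified_restrict[OF p u(1) n(1,2)])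
    show ?thesis using L.integral_value[OF n(3) x(2)] n(3) wu[OF x(1)] by (metis restrict_apply')
  qed
  have "w ` (E - {0}) = {ereal (of_int j) | j :: int. True}"
  proof (intro equalityI subsetI)
    fix a assume "a \<in> {ereal (of_int j) | j :: int. True}"
    then obtain j :: int where j: "a = ereal (of_int j)" by blast
    have "of_nat p powi j \<in> E - {0}" using W.prime_powi_closed W.p_pos by simp
    then show "a \<in> w ` (E - {0})" using W.v_prime_powi[of j] j by (metis image_eqI)
  qed (use integral in auto)
  moreover have "padic_valuation p ` (UNIV - {0}) = {ereal (of_int j) | j :: int. True}"
  proof (intro equalityI subsetI)
    fix a assume "a \<in> padic_valuation p ` (UNIV - {0})"
    then obtain q where q: "q \<noteq> 0" "a = padic_valuation p q" by auto
    then have "a = w (of_rat q)" using W.v_of_rat by simp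
    moreover have "\<exists>j :: int. w (of_rat q) = ereal (of_int j)" using integral[OF W.closed(12)] q(1) by simp
    ultimately show "a \<in> {ereal (of_int j) | j :: int. True}" by auto
  next
    fix a assume "a \<in> {ereal (of_int j) | j :: int. True}"
    then obtain j :: int where j: "a = ereal (of_int j)" by blast
    define q :: rat where "q = of_nat p powi j"
    have "of_rat q = (of_nat p powi j :: complex)"
      by (simp add: q_def power_int_def of_rat_power of_rat_inverse)
    then have "padic_valuation p q = a" using W.v_of_rat[of q] W.v_prime_powi[of j] j by simp
    moreover have "q \<noteq> 0" using W.p_pos by (simp add: q_def)
    ultimately show "a \<in> padic_valuation p ` (UNIV - {0})" by blast
  qed
  ultimately show "unramified p (Q_cyc_prime_to_Delta p) w" by (simp add: unramified_def E_def)

  have cf: "char_field (residue_field E w) p" by (rule W.char_field_residue_field)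
  interpret C: closed_extension "residue_field E w" "Fp_bar p" p by (rule closed_extension_Fp_bar[OF cf])
  have "residue_field E w \<simeq> (Fp_bar p)\<lparr>carrier := \<Union>n\<in>I_set p. \<Union>{F. subfield F (Fp_bar p) \<and> card F = p ^ n}\<rparr>"
  proof (rule C.iso_union_of_finite_subfields)
    fix a assume "a \<in> carrier (residue_field E w)"
    then obtain x where x: "x \<in> E" "w x \<ge> 0" "a = W.residue x" by (auto simp: W.carrier_residue_field)
    obtain n where n: "n > 0" "coprime n p" "x \<in> qspan (mu n)"
      using Q_cyc_prime_to_Delta_level x(1) unfolding E_def by blast
    have "u (x ^ (p ^ n) - x) > 0"
      using residue_degree[OF p u(1) n(1,2,3)] x(1,2) wu ED by auto
    then have "w (x ^ (p ^ n) - x) > 0" using wu W.closed(7,9) x(1) by simp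
    then have "a \<in> C.k.fix_field n" unfolding x(3) using W.residue_fix_field[OF x(1,2)] by simp
    moreover have "n \<in> I_set p" using n by (simp add: I_set_def)
    ultimately show "\<exists>n\<in>I_set p. a \<in> C.k.fix_field n" by blast
  next
    fix l j :: nat assume l: "Factorial_Ring.prime l" "l \<noteq> p"
    obtain K y where y: "y \<in> layer l K" "u y = 0" "u (y ^ (p ^ (l ^ K)) - y) > 0" "\<not> u (y ^ (p ^ (l ^ j)) - y) > 0"
      using residue_degree_unbounded[OF p l(1) l(2)[symmetric] u(1)] .
    have yE: "y \<in> E" using layer_subset_prime_to[OF p l(1) l(2)[symmetric]] y(1) unfolding E_def by blast
    have "y ^ m - y \<in> E" for m using W.closed(7,9) yE by blast
    then have "W.residue y \<in> C.k.fix_field (l ^ K)" "W.residue y \<notin> C.k.fix_field (l ^ j)"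
      using W.residue_fix_field[OF yE] y wu yE by simp_all
    then show "\<exists>i. \<exists>y\<in>C.k.fix_field (l ^ i). y \<notin> C.k.fix_field (l ^ j)" by blast
  qed
  then show "residue_field (Q_cyc_prime_to_Delta p) w \<simeq> Fp_union p" by (simp add: E_def Fp_union_def)
qed

theorem theorem10p2:
  fixes p :: nat
  assumes "Factorial_Ring.prime p"
  shows
    "(\<forall>l. Factorial_Ring.prime l \<and> l \<noteq> p \<longrightarrow>
        bij_betw (\<lambda>v. restrict v (B_fin l p)) (Val p (B_inf l)) (Val p (B_fin l p)))
     \<and>
     bij_betw (\<lambda>v. \<lambda>l\<in>primes - {p}. restrict v (B_inf l))
       (Val p Q_cyc_Delta)
       (\<Pi>\<^sub>E l\<in>primes - {p}. Val p (B_inf l))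
     \<and>
     (\<forall>v\<in>Val p Q_cyc_Delta.
        let w = restrict v (Q_cyc_prime_to_Delta p) in
          unramified p (Q_cyc_prime_to_Delta p) w \<and>
          residue_field (Q_cyc_prime_to_Delta p) w \<simeq> Fp_union p)"
  using bij_restrict_B_fin[OF assms] bij_restrict_product[OF assms] prime_to_part[OF assms]
  unfolding Let_def by blast

end
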